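(* Let $\Omega\subset\mathbb{R}^N$ be a bounded domain with Lipschitz boundary, let $1<q<p<N$, let $T:W_0^{1,p}(\Omega)\to W^{1,p}(\Omega)$ be a continuous map, let $f:\Omega\times\mathbb{R}\times\mathbb{R}^N\to\mathbb{R}$ be a Carathéodory function, and let $u_0\in W^{1,p}(\Omega)$. Assume: (1) There exist constants $a_1\ge 0$, $a_2\ge 0$, $\alpha\in(0,p^*-1)$, $\beta\in\left(0,\frac{p}{(p^* )'}\right)$ and a function $\sigma\in L^{r'}(\Omega)$ with $r\in[1,p^* )$ such that $|f(x,s,\xi)|\le \sigma(x)+a_1|s|^\alpha+a_2|\xi|^\beta$ for almost all $x\in\Omega$, all $s\in\mathbb{R}$ and all $\xi\in\mathbb{R}^N$. (2) There exist constants $K_1,K_2,K_3\ge 0$ with $a_1K_1S_{\frac{p^*}{p^*-\alpha}}+a_2K_2S_{\frac{p}{p-\beta}}<1$ such that $\|T(u)\|_{p^*}^\alpha\le K_1\|\nabla u\|_p^{p-1}+K_3$ and $\|\nabla T(u)\|_p^\beta\le K_2\|\nabla u\|_p^{p-1}+K_3$ for all $u\in W_0^{1,p}(\Omega)$. Then the Dirichlet problem $-\operatorname{div}(|\nabla(w+u_0)|^{p-2}\nabla(w+u_0))+\operatorname{div}(|\nabla(w+u_0)|^{q-2}\nabla(w+u_0))=f(x,T(w),\nabla T(w))$ in $\Omega$, $w=0$ on $\partial\Omega$, admits a strong generalized solution $w\in W_0^{1,p}(\Omega)$ in the following sense: there exists a sequence $\{w_n\}_{n\in\mathbb{N}}$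 in $W_0^{1,p}(\Omega)$ such that (a) $w_n\rightharpoonup w$ weakly in $W_0^{1,p}(\Omega)$ as $n\to\infty$; (b) $-\operatorname{div}(|\nabla(w_n+u_0)|^{p-2}\nabla(w_n+u_0))+\operatorname{div}(|\nabla(w_n+u_0)|^{q-2}\nabla(w_n+u_0))-f(\cdot,T(w_n)(\cdot),\nabla T(w_n)(\cdot))\rightharpoonup 0$ weakly in $W^{-1,p'}(\Omega)$ as $n\to\infty$; (c) $\left\langle-\operatorname{div}\left(|\nabla(w_n+u_0)|^{p-2}\nabla(w_n+u_0)-|\nabla(w_n+u_0)|^{q-2}\nabla(w_n+u_0)\right),w_n-w\right\rangle\to 0$ as $n\to\infty$.
   Context: For $r\in(1,+\infty)$, $r'=r/(r-1)$ (and $r'=\infty$ if $r=1$). $p^*=\frac{Np}{N-p}$. $\|\cdot\|_r$ is the norm of $L^r(\Omega)$, and $W_0^{1,p}(\Omega)$ carries the norm $\|u\|=\|\nabla u\|_p$. For $1\le r\le p^*$, $S_r$ denotes a positive constant such that $\|u\|_r\le S_r\|\nabla u\|_p$ for all $u\in W_0^{1,p}(\Omega)$ (Sobolev embedding constant). A Carathéodory function $f(x,s,\xi)$ is measurable in $x$ and continuous in $(s,\xi)$. $W^{-1,p'}(\Omega)$ is the dual of $W_0^{1,p}(\Omega)$ with duality pairing $\langle\cdot,\cdot\rangle$. For a vector field $F\in L^{p'}(\Omega;\mathbb{R}^N)$, $-\operatorname{div}F\in W^{-1,p'}(\Omega)$ is given by $\langle-\operatorname{div}F,v\rangle=\int_\Omega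 F\cdot\nabla v\,dx$ for $v\in W_0^{1,p}(\Omega)$. The function $f(\cdot,T(w),\nabla T(w))$ is regarded as the element $v\mapsto\int_\Omega f(x,T(w),\nabla T(w))\,v\,dx$ of $W^{-1,p'}(\Omega)$. *)

theory Defs
  imports "HOL-Analysis.Analysis"
begin

section \<open>Bounded Lipschitz domains\<close>

text \<open>Near every boundary point the domain is, in suitable orthonormal coordinates with last
  axis e, the strict epigraph of a Lipschitz function \<gamma> on the hyperplane orthogonal to e.\<close>

definition lipschitz_boundary :: "'a::euclidean_space set \<Rightarrow> bool" where
  "lipschitz_boundary \<Omega> \<longleftrightarrow>
     (\<forall>z\<in>frontier \<Omega>. \<exists>\<rho>>0. \<exists>e \<gamma> L. norm e = 1 \<and> L-lipschitz_on {y. y \<bullet> e = 0} \<gamma> \<and>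
        \<Omega> \<inter> ball z \<rho> = {y \<in> ball z \<rho>. \<gamma> (y - (y \<bullet> e) *\<^sub>R e) < y \<bullet> e})"

definition bounded_lipschitz_domain :: "'a::euclidean_space set \<Rightarrow> bool" where
  "bounded_lipschitz_domain \<Omega> \<longleftrightarrow>
     open \<Omega> \<and> connected \<Omega> \<and> \<Omega> \<noteq> {} \<and> bounded \<Omega> \<and> lipschitz_boundary \<Omega>"


section \<open>Lebesgue spaces\<close>

text \<open>Throughout, elements of function spaces are represented by everywhere defined functions
  of which only the values on \<Omega>, up to null sets, matter. All the spaces below are thus
  seminormed; they become the usual Banach spaces after identifying elements at distance zero.\<close>

definition conj_exp :: "real \<Rightarrow> real" where
  "conj_exp r = r / (r - 1)"

definition enn_powr :: "ennreal \<Rightarrow> real \<Rightarrow> ennreal" where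
  "enn_powr x a = (if x = \<infinity> then \<infinity> else ennreal (enn2real x powr a))"

text \<open>The extended norm is infinite off the space, so that a bound on it by a finite quantity
  includes membership in the space (for measurable functions).\<close>

definition eLp_norm :: "'a::euclidean_space set \<Rightarrow> real \<Rightarrow> ('a \<Rightarrow> 'b::euclidean_space) \<Rightarrow> ennreal" where
  "eLp_norm \<Omega> r u = enn_powr (\<integral>\<^sup>+x. ennreal (norm (u x) powr r) \<partial>lebesgue_on \<Omega>) (1 / r)"

definition Lp :: "'a::euclidean_space set \<Rightarrow> real \<Rightarrow> ('a \<Rightarrow> 'b::euclidean_space) set" where
  "Lp \<Omega> r = {u \<in> borel_measurable (lebesgue_on \<Omega>). eLp_norm \<Omega> r u < \<infinity>}"

definition Lp_norm :: "'a::euclidean_space set \<Rightarrow> real \<Rightarrow> ('a \<Rightarrow> 'b::euclidean_space) \<Rightarrow> real" where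
  "Lp_norm \<Omega> r u = enn2real (eLp_norm \<Omega> r u)"

definition Linf :: "'a::euclidean_space set \<Rightarrow> ('a \<Rightarrow> 'b::euclidean_space) set" where
  "Linf \<Omega> = {u \<in> borel_measurable (lebesgue_on \<Omega>). \<exists>C. AE x in lebesgue_on \<Omega>. norm (u x) \<le> C}"


section \<open>Sobolev spaces\<close>

primrec C_k :: "nat \<Rightarrow> ('a::euclidean_space \<Rightarrow> real) \<Rightarrow> bool" where
  "C_k 0 \<phi> \<longleftrightarrow> continuous_on UNIV \<phi>"
| "C_k (Suc k) \<phi> \<longleftrightarrow>
     \<phi> differentiable_on UNIV \<and> (\<forall>b\<in>Basis. C_k k (\<lambda>x. frechet_derivative \<phi> (at x) b))"

definition test_functions :: "'a::euclidean_space set \<Rightarrow> ('a \<Rightarrow> real) set" where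
  "test_functions \<Omega> =
     {\<phi>. (\<forall>k. C_k k \<phi>) \<and> compact (closure {x. \<phi> x \<noteq> 0}) \<and> closure {x. \<phi> x \<noteq> 0} \<subseteq> \<Omega>}"

definition locally_integrable :: "'a::euclidean_space set \<Rightarrow> ('a \<Rightarrow> 'b::euclidean_space) \<Rightarrow> bool" where
  "locally_integrable \<Omega> u \<longleftrightarrow> (\<forall>K. compact K \<and> K \<subseteq> \<Omega> \<longrightarrow> integrable (lebesgue_on K) u)"

definition has_weak_gradient ::
  "'a::euclidean_space set \<Rightarrow> ('a \<Rightarrow> real) \<Rightarrow> ('a \<Rightarrow> 'a) \<Rightarrow> bool" where
  "has_weak_gradient \<Omega> u G \<longleftrightarrow>
     locally_integrable \<Omega> u \<and> locally_integrable \<Omega> G \<and>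
     (\<forall>\<phi>\<in>test_functions \<Omega>. \<forall>b\<in>Basis.
        (LINT x|lebesgue_on \<Omega>. u x * frechet_derivative \<phi> (at x) b) =
        - (LINT x|lebesgue_on \<Omega>. (G x \<bullet> b) * \<phi> x))"

text \<open>Weak gradients are unique up to null sets, so the choice is immaterial.\<close>

definition weak_grad :: "'a::euclidean_space set \<Rightarrow> ('a \<Rightarrow> real) \<Rightarrow> 'a \<Rightarrow> 'a" where
  "weak_grad \<Omega> u = (SOME G. has_weak_gradient \<Omega> u G)"

definition W1p :: "'a::euclidean_space set \<Rightarrow> real \<Rightarrow> ('a \<Rightarrow> real) set" where
  "W1p \<Omega> p = {u \<in> Lp \<Omega> p. \<exists>G\<in>Lp \<Omega> p. has_weak_gradient \<Omega> u G}"

definition W1p_norm :: "'a::euclidean_space set \<Rightarrow> real \<Rightarrow> ('a \<Rightarrow> real) \<Rightarrow> real" where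
  "W1p_norm \<Omega> p u = Lp_norm \<Omega> p u + Lp_norm \<Omega> p (weak_grad \<Omega> u)"

definition W01p :: "'a::euclidean_space set \<Rightarrow> real \<Rightarrow> ('a \<Rightarrow> real) set" where
  "W01p \<Omega> p = {u \<in> W1p \<Omega> p. \<exists>\<phi>::nat \<Rightarrow> 'a \<Rightarrow> real. (\<forall>k. \<phi> k \<in> test_functions \<Omega>) \<and>
                 (\<lambda>k. W1p_norm \<Omega> p (\<lambda>x. u x - \<phi> k x)) \<longlonglongrightarrow> 0}"

definition W01p_norm :: "'a::euclidean_space set \<Rightarrow> real \<Rightarrow> ('a \<Rightarrow> real) \<Rightarrow> real" where
  "W01p_norm \<Omega> p u = Lp_norm \<Omega> p (weak_grad \<Omega> u)"


section \<open>Continuity, duals and weak convergence in seminormed function spaces\<close>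

text \<open>A space is given by a carrier V, closed under the pointwise vector operations, and a seminorm
  nrm. The dual again consists of real-valued functions (on the functions in V), so the
  construction can be iterated. Values of functionals outside V are irrelevant.\<close>

definition dual_space ::
  "('i \<Rightarrow> real) set \<Rightarrow> (('i \<Rightarrow> real) \<Rightarrow> real) \<Rightarrow> (('i \<Rightarrow> real) \<Rightarrow> real) set" where
  "dual_space V nrm =
     {g. (\<forall>u\<in>V. \<forall>v\<in>V. g (\<lambda>x. u x + v x) = g u + g v) \<and>
         (\<forall>c. \<forall>u\<in>V. g (\<lambda>x. c * u x) = c * g u) \<and>
         (\<exists>C. \<forall>u\<in>V. \<bar>g u\<bar> \<le> C * nrm u)}"

definition dual_norm ::
  "('i \<Rightarrow> real) set \<Rightarrow> (('i \<Rightarrow> real) \<Rightarrow> real) \<Rightarrow> (('i \<Rightarrow> real) \<Rightarrow> real) \<Rightarrow> real" where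
  "dual_norm V nrm g = (SUP u\<in>{u \<in> V. nrm u \<le> 1}. \<bar>g u\<bar>)"

definition weakly_converges ::
  "('i \<Rightarrow> real) set \<Rightarrow> (('i \<Rightarrow> real) \<Rightarrow> real) \<Rightarrow> (nat \<Rightarrow> 'i \<Rightarrow> real) \<Rightarrow> ('i \<Rightarrow> real) \<Rightarrow> bool" where
  "weakly_converges V nrm us u \<longleftrightarrow>
     (\<forall>n. us n \<in> V) \<and> u \<in> V \<and> (\<forall>g\<in>dual_space V nrm. (\<lambda>n. g (us n)) \<longlonglongrightarrow> g u)"

text \<open>Continuity with respect to the seminorms forces a map to respect the identification of
  elements at distance zero.\<close>

definition continuous_map_nrm ::
  "('i \<Rightarrow> real) set \<Rightarrow> (('i \<Rightarrow> real) \<Rightarrow> real) \<Rightarrow> ('j \<Rightarrow> real) set \<Rightarrow> (('j \<Rightarrow> real) \<Rightarrow> real) \<Rightarrow>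
   (('i \<Rightarrow> real) \<Rightarrow> 'j \<Rightarrow> real) \<Rightarrow> bool" where
  "continuous_map_nrm V nrm V' nrm' T \<longleftrightarrow>
     (\<forall>u\<in>V. T u \<in> V') \<and>
     (\<forall>u\<in>V. \<forall>\<epsilon>>0. \<exists>\<delta>>0. \<forall>v\<in>V.
        nrm (\<lambda>x. v x - u x) < \<delta> \<longrightarrow> nrm' (\<lambda>x. T v x - T u x) < \<epsilon>)"

text \<open>The dual of W01p, i.e. the space with exponents -1 and p'.\<close>

abbreviation Wm1 :: "'a::euclidean_space set \<Rightarrow> real \<Rightarrow> (('a \<Rightarrow> real) \<Rightarrow> real) set" where
  "Wm1 \<Omega> p \<equiv> dual_space (W01p \<Omega> p) (W01p_norm \<Omega> p)"

abbreviation Wm1_norm :: "'a::euclidean_space set \<Rightarrow> real \<Rightarrow> (('a \<Rightarrow> real) \<Rightarrow> real) \<Rightarrow> real" where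
  "Wm1_norm \<Omega> p \<equiv> dual_norm (W01p \<Omega> p) (W01p_norm \<Omega> p)"


section \<open>The differential operator and the right-hand side\<close>

definition caratheodory ::
  "'a::euclidean_space set \<Rightarrow> ('a \<Rightarrow> real \<Rightarrow> 'a \<Rightarrow> real) \<Rightarrow> bool" where
  "caratheodory \<Omega> f \<longleftrightarrow>
     (\<forall>s \<xi>. (\<lambda>x. f x s \<xi>) \<in> borel_measurable (lebesgue_on \<Omega>)) \<and>
     (AE x in lebesgue_on \<Omega>. continuous_on UNIV (\<lambda>(s, \<xi>). f x s \<xi>))"

text \<open>For r < 2 the value at 0 is 0, as usual.\<close>

definition flux :: "real \<Rightarrow> 'a::euclidean_space \<Rightarrow> 'a" where
  "flux r \<xi> = (norm \<xi> powr (r - 2)) *\<^sub>R \<xi>"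

definition neg_div :: "'a::euclidean_space set \<Rightarrow> ('a \<Rightarrow> 'a) \<Rightarrow> ('a \<Rightarrow> real) \<Rightarrow> real" where
  "neg_div \<Omega> F = (\<lambda>v. LINT x|lebesgue_on \<Omega>. F x \<bullet> weak_grad \<Omega> v x)"

definition fun_functional :: "'a::euclidean_space set \<Rightarrow> ('a \<Rightarrow> real) \<Rightarrow> ('a \<Rightarrow> real) \<Rightarrow> real" where
  "fun_functional \<Omega> h = (\<lambda>v. LINT x|lebesgue_on \<Omega>. h x * v x)"

end

theory Submission
  imports Defs "HOL-Computational_Algebra.Polynomial" "HOL-Library.Diagonal_Subsequence"
begin

text \<open>Galerkin's method. The growth conditions make A w = - div (|\<nabla>(w + u0)|^(p-2) \<nabla>(w + u0))
  + div (|\<nabla>(w + u0)|^(q-2) \<nabla>(w + u0)) - f(x, T w, \<nabla>T w) a bounded map into the dual space. It is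
  demicontinuous, since a.e. convergence of bounded sequences in L^s with s > 1 implies weak
  convergence, and coercive, since q < p and the coefficient of |w|^p coming from f is less than one.
  On the span of the first n test functions of a dense sequence, a Brouwer-type argument therefore
  gives w n with (A (w n)) (w n) and (A (w n)) (e j), j < n, arbitrarily small. These w n are bounded,
  so by reflexivity a subsequence converges weakly to some w, and A (w n) converges weakly to zero by
  density. Finally, (A (w n)) (w n - w) tends to zero, and the contribution of f to it tends to zero by
  Hoelder's inequality and the compact embedding. No monotonicity of the operator is used, which is
  why w is a solution in the generalized sense only.

  Reflexivity comes from uniform convexity: minimizing |F|^r / r - G(F) over a closed subspace of L^r
  represents every functional G on it by |F|^(r-2) F. Compactness of the embedding comes from
  approximation by ball averages and interpolation between L^1 and the critical exponent.\<close>

section \<open>Pointwise inequalities\<close>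

text \<open>Elements of the spaces are functions with seminorms, and gradients are fixed only up to
  null sets. The Galerkin vectors may thus be dependent modulo null sets, and coefficients need not
  be controlled by the function they define. A small multiple of the coefficient vector is therefore
  added to the Galerkin equations: it produces a zero and keeps it orthogonal to the degenerate
  directions. The conditions on \<alpha> and \<beta> put the conjugates of
  \<open>pstar / \<alpha>\<close> and \<open>p / \<beta>\<close> strictly below
  \<open>pstar\<close>. One subcritical exponent t then serves \<sigma> and both growth terms: f
  stays bounded in the dual of L^t, and the embedding into L^t is compact. The bounds on T grow like
  the power p - 1, so pairing f with w gives the power p, with the coefficient of the smallness
  condition. Uniform convexity, continuity of the flux and coercivity under the shift u0 are
  pointwise one statement: a homogeneous expression is a small term plus a multiple of another one
  that controls it at its zeros. Compactness of a sphere proves it for all exponents above 1 at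
  once.\<close>

lemma flux_zero [simp]: "flux r 0 = 0"
  by (simp add: flux_def)

lemma norm_flux: "norm (flux r x) = norm x powr (r - 1)"
proof (cases "x = 0")
  case False
  then have "norm x powr (r - 2) * norm x = norm x powr (r - 1)"
    using powr_add[of "norm x" "r - 2" 1] by simp
  then show ?thesis by (simp add: flux_def)
qed (simp add: flux_def)

lemma flux_inner_self: "flux r x \<bullet> x = norm x powr r"
proof (cases "x = 0")
  case False
  then have "norm x powr (r - 2) * (norm x)\<^sup>2 = norm x powr r"
    using powr_add[of "norm x" "r - 2" 2] by (simp add: powr_numeral)
  then show ?thesis by (simp add: flux_def power2_norm_eq_inner)
qed (simp add: flux_def)

lemma flux_inner_le: "\<bar>flux r x \<bullet> y\<bar> \<le> norm x powr (r - 1) * norm y"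
  using Cauchy_Schwarz_ineq2[of "flux r x" y] by (simp add: norm_flux)

lemma flux_scaleR: "t > 0 \<Longrightarrow> flux r (t *\<^sub>R x) = t powr (r - 1) *\<^sub>R flux r x"
proof -
  assume "t > 0"
  then have "t powr (r - 2) * t = t powr (r - 1)"
    using powr_add[of t "r - 2" 1] by simp
  then show ?thesis using \<open>t > 0\<close>
    by (simp add: flux_def powr_mult mult.commute mult.left_commute)
qed

text \<open>For r < 2 the scalar factor is singular at 0. There \<open>norm_flux\<close> helps: the
  norm of the flux is a positive power of \<open>norm x\<close>, so it tends to 0 with x.\<close>

lemma continuous_flux:
  assumes "r > 1"
  shows "continuous_on UNIV (flux r :: 'a::euclidean_space \<Rightarrow> 'a)"
proof -
  have "isCont (flux r) x" for x :: 'a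
  proof (cases "x = 0")
    case True
    have "((\<lambda>y::'a. norm y powr (r - 1)) \<longlongrightarrow> 0) (at 0)"
      using assms by (auto intro!: tendsto_eq_intros)
    then have "((\<lambda>y::'a. norm (flux r y)) \<longlongrightarrow> 0) (at 0)"
      by (simp add: norm_flux)
    then show ?thesis unfolding True isCont_def
      by (simp add: tendsto_norm_zero_iff)
  next
    case False
    then show ?thesis unfolding flux_def by (intro continuous_intros) auto
  qed
  then show ?thesis by (simp add: continuous_at_imp_continuous_on)
qed

lemma borel_measurable_flux [measurable]:
  assumes "F \<in> borel_measurable M"
  shows "(\<lambda>x. flux r (F x)) \<in> borel_measurable M"
  unfolding flux_def using assms by measurable

text \<open>Equality holds at a = b, which is why this form yields the tangent inequality for
  \<open>flux\<close>.\<close>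

lemma young:
  fixes a b r :: real
  assumes "r > 1" "a \<ge> 0" "b \<ge> 0"
  shows "a powr (r - 1) * b \<le> (1 - 1/r) * a powr r + b powr r / r"
proof -
  have "1 / (r/(r-1)) + 1 / r = 1" using assms by (simp add: field_simps)
  then have "a powr (r-1) * b \<le> (a powr (r-1)) powr (r/(r-1)) / (r/(r-1)) + b powr r / r"
    using assms by (intro Youngs_inequality) (auto simp: field_simps)
  also have "(a powr (r-1)) powr (r/(r-1)) = a powr r"
    using assms by (simp add: powr_powr)
  finally show ?thesis using assms by (simp add: field_simps)
qed

text \<open>The vector \<open>flux r x\<close>, multiplied by r, is the gradient of the r-th power
  of the norm at x. This is the tangent inequality of that convex function, obtained from Young's
  inequality.\<close>

lemma flux_subgradient:
  assumes "r > 1"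
  shows "norm x powr r + r * (flux r x \<bullet> (y - x)) \<le> norm y powr r"
proof -
  have "flux r x \<bullet> y \<le> norm x powr (r - 1) * norm y"
    using flux_inner_le[of r x y] by linarith
  also have "\<dots> \<le> (1 - 1/r) * norm x powr r + norm y powr r / r"
    by (rule young) (use assms in auto)
  finally have "r * (flux r x \<bullet> y) \<le> r * ((1 - 1/r) * norm x powr r + norm y powr r / r)"
    using assms by simp
  also have "\<dots> = (r - 1) * norm x powr r + norm y powr r"
    using assms by (simp add: field_simps)
  finally show ?thesis
    by (simp add: inner_diff_right flux_inner_self algebra_simps)
qed

text \<open>Cauchy-Schwarz is applied to the two mixed terms only. What remains is the same
  expression for the norms, so monotonicity and its equality case reduce to the power function on
  the half line.\<close>

lemma flux_monotone_aux:
  assumes "r > 1"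
  shows "(norm x powr (r-1) - norm y powr (r-1)) * (norm x - norm y) \<le> (flux r x - flux r y) \<bullet> (x - y)"
proof -
  have 1: "norm x powr (r-1) * norm x = norm x powr r" for x :: 'a
    using powr_add[of "norm x" "r-1" 1] assms by (cases "x = 0") auto
  have "flux r x \<bullet> y \<le> norm x powr (r-1) * norm y" "flux r y \<bullet> x \<le> norm y powr (r-1) * norm x"
    using flux_inner_le[of r x y] flux_inner_le[of r y x] by auto
  then show ?thesis using 1[of x] 1[of y]
    by (simp add: inner_diff_left inner_diff_right flux_inner_self algebra_simps)
qed

lemma powr_diff_mult_nonneg:
  fixes a b s :: real
  assumes "s > 0" "a \<ge> 0" "b \<ge> 0"
  shows "(a powr s - b powr s) * (a - b) \<ge> 0"
    and "(a powr s - b powr s) * (a - b) = 0 \<Longrightarrow> a = b"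
proof -
  have "a < b \<or> a = b \<or> b < a" by linarith
  then show "(a powr s - b powr s) * (a - b) \<ge> 0"
    using powr_less_mono2[of s a b] powr_less_mono2[of s b a] assms
    by (auto intro: mult_nonpos_nonpos)
  show "a = b" if "(a powr s - b powr s) * (a - b) = 0"
    using that powr_less_mono2[of s a b] powr_less_mono2[of s b a] assms
    by (metis diff_eq_diff_eq diff_self less_irrefl linorder_neqE_linordered_idom mult_eq_0_iff)
qed

lemma flux_monotone:
  assumes "r > 1"
  shows "(flux r x - flux r y) \<bullet> (x - y) \<ge> 0"
  using flux_monotone_aux[OF assms, of x y] powr_diff_mult_nonneg(1)[of "r-1" "norm x" "norm y"] assms
  by simp

lemma flux_strictly_monotone:
  assumes "r > 1" "(flux r x - flux r y) \<bullet> (x - y) = 0"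
  shows "x = y"
proof -
  have "(norm x powr (r-1) - norm y powr (r-1)) * (norm x - norm y) = 0"
    using flux_monotone_aux[OF assms(1), of x y] powr_diff_mult_nonneg(1)[of "r-1" "norm x" "norm y"] assms
    by simp
  then have n: "norm x = norm y"
    using powr_diff_mult_nonneg(2)[of "r-1" "norm x" "norm y"] assms by simp
  \<comment> \<open>Equal norms give both fluxes the same scalar factor. It vanishes only for x = 0,
    and then y = 0 too.\<close>
  then have "norm x powr (r-2) * ((x - y) \<bullet> (x - y)) = 0"
    using assms(2) by (simp add: flux_def flip: scaleR_diff_right)
  then show ?thesis using n by auto
qed

text \<open>In the tangent inequalities from the midpoint m to both ends the linear terms cancel,
  which gives convexity. In the equality case the one towards a is an equality; the midpoint n of a
  and m then allows the fluxes at n and m to be compared, and strict monotonicity forces n =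
  m.\<close>

lemma midpoint_strict_convex:
  fixes a b :: "'a::euclidean_space"
  assumes "r > 1"
  shows "norm ((1/2) *\<^sub>R (a + b)) powr r \<le> (norm a powr r + norm b powr r) / 2" (is "?m \<le> ?h")
    and "norm ((1/2) *\<^sub>R (a + b)) powr r = (norm a powr r + norm b powr r) / 2 \<Longrightarrow> a = b"
proof -
  define m where "m = (1/2) *\<^sub>R (a + b)"
  have ab: "a - m = - (b - m)" by (simp add: m_def algebra_simps flip: scaleR_add_left)
  have b: "norm m powr r + r * (flux r m \<bullet> (b - m)) \<le> norm b powr r"
    by (rule flux_subgradient[OF assms])
  have "norm m powr r + r * (flux r m \<bullet> (a - m)) \<le> norm a powr r"
    by (rule flux_subgradient[OF assms])
  with b show "?m \<le> ?h" unfolding ab m_def[symmetric] inner_minus_right by simp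
  assume eq: "?m = ?h"
  define n where "n = (1/2) *\<^sub>R (a + m)"
  have d: "a - n = n - m" "a - m = 2 *\<^sub>R (n - m)"
    by (simp_all add: n_def algebra_simps scaleR_2 flip: scaleR_add_left)
  have 1: "norm n powr r + r * (flux r n \<bullet> (a - n)) \<le> norm a powr r"
    by (rule flux_subgradient[OF assms])
  have 2: "norm m powr r + r * (flux r m \<bullet> (n - m)) \<le> norm n powr r"
    by (rule flux_subgradient[OF assms])
  have "norm a powr r \<le> norm m powr r + r * (flux r m \<bullet> (a - m))"
    using eq b unfolding m_def[symmetric] ab inner_minus_right by simp
  then have "r * ((flux r n - flux r m) \<bullet> (n - m)) \<le> 0"
    using 1 2 unfolding d by (simp add: inner_diff_left algebra_simps)
  then have "(flux r n - flux r m) \<bullet> (n - m) = 0"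
    using flux_monotone[OF assms, of n m] assms by (simp add: mult_le_0_iff)
  then have "n = m" by (rule flux_strictly_monotone[OF assms])
  then have "a = m" using d by simp
  then show "a = b" using ab by simp
qed

section \<open>Absorption inequalities for homogeneous expressions\<close>

lemma continuous_on_norm_powr:
  fixes F :: "'a::topological_space \<Rightarrow> 'b::real_normed_vector"
  assumes "continuous_on S F" "r > 0"
  shows "continuous_on S (\<lambda>x. norm (F x) powr r)"
  by (rule continuous_on_powr') (use assms in \<open>auto intro!: continuous_intros\<close>)

text \<open>By homogeneity it suffices to treat the compact set where the two r-th powers sum to 1.
  Where \<Phi> is below \<epsilon> there is nothing to do; on the compact rest \<Psi> has a positive
  minimum, because \<Phi> is not positive at zeros of \<Psi>. The maximum of \<Phi> over this
  minimum is the constant C.\<close>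

lemma homogeneous_absorb:
  fixes \<Phi> \<Psi> :: "'a::euclidean_space \<Rightarrow> 'a \<Rightarrow> real"
  assumes r: "r > 0"
    and cont: "continuous_on UNIV (\<lambda>z. \<Phi> (fst z) (snd z))" "continuous_on UNIV (\<lambda>z. \<Psi> (fst z) (snd z))"
    and hom: "\<And>t a b. t > 0 \<Longrightarrow> \<Phi> (t *\<^sub>R a) (t *\<^sub>R b) = t powr r * \<Phi> a b"
             "\<And>t a b. t > 0 \<Longrightarrow> \<Psi> (t *\<^sub>R a) (t *\<^sub>R b) = t powr r * \<Psi> a b"
    and nonneg: "\<And>a b. \<Psi> a b \<ge> 0" and zero: "\<And>a b. \<Psi> a b = 0 \<Longrightarrow> \<Phi> a b \<le> 0"
    and \<epsilon>: "\<epsilon> > 0"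
  shows "\<exists>C\<ge>0. \<forall>a b. \<Phi> a b \<le> \<epsilon> * (norm a powr r + norm b powr r) + C * \<Psi> a b"
proof -
  define N where "N = (\<lambda>z::'a\<times>'a. norm (fst z) powr r + norm (snd z) powr r)"
  define K where "K = {z. N z = 1} \<inter> {z. \<Phi> (fst z) (snd z) \<ge> \<epsilon>}"
  have cN: "continuous_on UNIV N" unfolding N_def using r
    by (intro continuous_on_add continuous_on_norm_powr continuous_on_fst continuous_on_snd continuous_on_id)
  have "closed K" unfolding K_def
    by (intro closed_Int closed_Collect_eq closed_Collect_le continuous_intros cN cont)
  moreover have "bounded K"
  proof (rule boundedI)
    fix z assume "z \<in> K"
    then have "N z = 1" by (simp add: K_def)
    then have "norm (fst z) powr r \<le> 1" "norm (snd z) powr r \<le> 1" unfolding N_def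
      using powr_ge_zero[of "norm (fst z)" r] powr_ge_zero[of "norm (snd z)" r] by linarith+
    then have "norm (fst z) \<le> 1" "norm (snd z) \<le> 1"
      using powr_less_mono2[of r 1 "norm (fst z)"] powr_less_mono2[of r 1 "norm (snd z)"] r by fastforce+
    then show "norm z \<le> 2" using norm_Pair_le[of "fst z" "snd z"] by simp
  qed
  ultimately have cK: "compact K" using compact_eq_bounded_closed by blast
  obtain C where C: "C \<ge> 0" "\<And>z. N z = 1 \<Longrightarrow> \<Phi> (fst z) (snd z) \<le> \<epsilon> + C * \<Psi> (fst z) (snd z)"
  proof (cases "K = {}")
    case True
    then show ?thesis using that[of 0] unfolding K_def by fastforce
  next
    case False
    obtain zm where zm: "zm \<in> K" "\<And>z. z \<in> K \<Longrightarrow> \<Psi> (fst zm) (snd zm) \<le> \<Psi> (fst z) (snd z)"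
      using continuous_attains_inf[OF cK False continuous_on_subset[OF cont(2) subset_UNIV]] by blast
    obtain zM where zM: "zM \<in> K" "\<And>z. z \<in> K \<Longrightarrow> \<Phi> (fst z) (snd z) \<le> \<Phi> (fst zM) (snd zM)"
      using continuous_attains_sup[OF cK False continuous_on_subset[OF cont(1) subset_UNIV]] by blast
    define d where "d = \<Psi> (fst zm) (snd zm)"
    define B where "B = \<Phi> (fst zM) (snd zM)"
    have "d \<noteq> 0" using zero zm(1) \<epsilon> unfolding K_def d_def by fastforce
    then have d: "d > 0" using nonneg unfolding d_def by (metis less_eq_real_def)
    have B: "B > 0" using zM(1) \<epsilon> unfolding K_def B_def by auto
    show ?thesis
    proof (rule that[of "B/d"])
      fix z assume N: "N z = 1"
      show "\<Phi> (fst z) (snd z) \<le> \<epsilon> + B / d * \<Psi> (fst z) (snd z)"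
      proof (cases "z \<in> K")
        case True
        have "B = B / d * d" using d by simp
        also have "\<dots> \<le> B / d * \<Psi> (fst z) (snd z)"
          using zm(2)[OF True] d B unfolding d_def by (intro mult_left_mono) auto
        finally show ?thesis using zM(2)[OF True] \<epsilon> unfolding B_def by linarith
      next
        case False
        then have "\<Phi> (fst z) (snd z) \<le> \<epsilon>" using N unfolding K_def by auto
        then show ?thesis using nonneg[of "fst z" "snd z"] B d
          by (smt (verit) divide_nonneg_nonneg mult_nonneg_nonneg)
      qed
    qed (use B d in auto)
  qed
  have "\<Phi> a b \<le> \<epsilon> * (norm a powr r + norm b powr r) + C * \<Psi> a b" for a b
  proof (cases "a = 0 \<and> b = 0")
    case True
    \<comment> \<open>At the origin, homogeneity with t = 2 multiplies the value of \<Phi> by a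
      number above 1 and leaves it unchanged, so the value is 0.\<close>
    have "2 powr r > (1::real)" using r by simp
    then have "\<Phi> a b = 0" using hom(1)[of 2 0 0] True by auto
    then show ?thesis using nonneg C(1) True by simp
  next
    case False
    define s where "s = norm a powr r + norm b powr r"
    have s: "s > 0" unfolding s_def using False by (auto simp: add_pos_nonneg add_nonneg_pos)
    define t where "t = s powr (1/r)"
    have t: "t > 0" "t powr r = s" unfolding t_def using s r by (auto simp: powr_powr)
    define z where "z = ((1/t) *\<^sub>R a, (1/t) *\<^sub>R b)"
    have ab: "a = t *\<^sub>R fst z" "b = t *\<^sub>R snd z" using t by (auto simp: z_def)
    have "N z = 1" using t s unfolding N_def z_def
      by (simp add: powr_divide flip: add_divide_distrib) (simp add: s_def)
    then have "s * \<Phi> (fst z) (snd z) \<le> s * (\<epsilon> + C * \<Psi> (fst z) (snd z))"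
      using C(2) s by simp
    then show ?thesis using hom[OF t(1), of "fst z" "snd z"] ab t(2)
      unfolding s_def[symmetric] by (simp add: algebra_simps)
  qed
  then show ?thesis using C(1) by blast
qed

text \<open>Here \<Psi> is the midpoint convexity defect, which vanishes only for a = b. Integrated,
  the bound is uniform convexity of L^r, in one form for all r > 1.\<close>

lemma uniformly_convex_absorb:
  assumes "r > 1" "\<epsilon> > 0"
  shows "\<exists>C\<ge>0. \<forall>a b :: 'a::euclidean_space. norm (a - b) powr r \<le> \<epsilon> * (norm a powr r + norm b powr r)
           + C * ((norm a powr r + norm b powr r) / 2 - norm ((1/2) *\<^sub>R (a + b)) powr r)"
proof (rule homogeneous_absorb)
  fix t :: real and a b :: 'a assume t: "t > 0"
  show "norm (t *\<^sub>R a - t *\<^sub>R b) powr r = t powr r * norm (a - b) powr r"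
    using t by (simp add: powr_mult flip: scaleR_diff_right)
  have "norm ((1/2) *\<^sub>R (t *\<^sub>R a + t *\<^sub>R b)) = t * norm ((1/2) *\<^sub>R (a + b))"
    using t by (simp flip: scaleR_add_right)
  then show "(norm (t *\<^sub>R a) powr r + norm (t *\<^sub>R b) powr r) / 2 - norm ((1/2) *\<^sub>R (t *\<^sub>R a + t *\<^sub>R b)) powr r =
    t powr r * ((norm a powr r + norm b powr r) / 2 - norm ((1/2) *\<^sub>R (a + b)) powr r)"
    using t by (simp add: powr_mult algebra_simps)
next
  fix a b :: 'a
  show "0 \<le> (norm a powr r + norm b powr r) / 2 - norm ((1/2) *\<^sub>R (a + b)) powr r"
    using midpoint_strict_convex(1)[OF assms(1)] by simp
  show "norm (a - b) powr r \<le> 0" if "(norm a powr r + norm b powr r) / 2 - norm ((1/2) *\<^sub>R (a + b)) powr r = 0"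
  proof -
    have "a = b" by (rule midpoint_strict_convex(2)[OF assms(1)]) (use that in simp)
    then show ?thesis by simp
  qed
  show "continuous_on UNIV (\<lambda>z. norm (fst z - snd z :: 'a) powr r)"
    using assms by (intro continuous_on_norm_powr continuous_intros) auto
  have "continuous_on UNIV (\<lambda>z. norm (fst z :: 'a) powr r)" "continuous_on UNIV (\<lambda>z. norm (snd z :: 'a) powr r)"
    "continuous_on UNIV (\<lambda>z. norm ((1/2) *\<^sub>R (fst z + snd z :: 'a)) powr r)"
    using assms by (intro continuous_on_norm_powr continuous_intros; simp)+
  then show "continuous_on UNIV (\<lambda>z. (norm (fst z :: 'a) powr r + norm (snd z) powr r) / 2 - norm ((1/2) *\<^sub>R (fst z + snd z)) powr r)"
    by (intro continuous_on_diff continuous_on_divide continuous_on_add continuous_on_const) auto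
qed (use assms in auto)

text \<open>The flux is homogeneous of degree r - 1, so the conjugate exponent makes the left side
  homogeneous of degree r. Integrated, this is continuity of the flux from L^r to its dual.\<close>

lemma flux_continuity_absorb:
  assumes "r > 1" "\<epsilon> > 0"
  shows "\<exists>C\<ge>0. \<forall>a b :: 'a::euclidean_space. norm (flux r a - flux r b) powr (r/(r-1))
           \<le> \<epsilon> * (norm a powr r + norm b powr r) + C * norm (a - b) powr r"
proof (rule homogeneous_absorb)
  fix t :: real and a b :: 'a assume t: "t > 0"
  show "norm (flux r (t *\<^sub>R a) - flux r (t *\<^sub>R b)) powr (r/(r-1)) = t powr r * norm (flux r a - flux r b) powr (r/(r-1))"
    using t assms by (simp add: flux_scaleR powr_mult powr_powr flip: scaleR_diff_right)
  show "norm (t *\<^sub>R a - t *\<^sub>R b) powr r = t powr r * norm (a - b) powr r"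
    using t by (simp add: powr_mult flip: scaleR_diff_right)
next
  have "continuous_on UNIV (\<lambda>z. flux r (fst z) - flux r (snd z) :: 'a)"
    using assms by (intro continuous_intros continuous_on_compose2[OF continuous_flux]) auto
  then show "continuous_on UNIV (\<lambda>z. norm (flux r (fst z) - flux r (snd z) :: 'a) powr (r/(r-1)))"
    using assms by (intro continuous_on_norm_powr) auto
  show "continuous_on UNIV (\<lambda>z. norm (fst z - snd z :: 'a) powr r)"
    using assms by (intro continuous_on_norm_powr continuous_intros) auto
next
  fix a b :: 'a
  show "norm (flux r a - flux r b) powr (r/(r-1)) \<le> 0" if "norm (a - b) powr r = 0"
    using that by simp
qed (use assms in auto)

text \<open>For b = 0 the left side vanishes, so \<Psi> may depend on b alone. With b the gradient
  of \<open>u0\<close>, the shift costs an arbitrarily small part of the leading term and, after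
  integration, a constant.\<close>

lemma flux_coercive_absorb:
  assumes "r > 1" "\<epsilon> > 0"
  shows "\<exists>C\<ge>0. \<forall>a b :: 'a::euclidean_space. norm a powr r - flux r (a + b) \<bullet> a
           \<le> \<epsilon> * (norm a powr r + norm b powr r) + C * norm b powr r"
proof (rule homogeneous_absorb)
  fix t :: real and a b :: 'a assume t: "t > 0"
  have "t powr (r-1) * t = t powr r" using powr_add[of t "r-1" 1] t by simp
  then show "norm (t *\<^sub>R a) powr r - flux r (t *\<^sub>R a + t *\<^sub>R b) \<bullet> (t *\<^sub>R a) = t powr r * (norm a powr r - flux r (a + b) \<bullet> a)"
    using t by (simp add: flux_scaleR powr_mult algebra_simps flip: scaleR_add_right)
  show "norm (t *\<^sub>R b) powr r = t powr r * norm b powr r" using t by (simp add: powr_mult)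
next
  have "continuous_on UNIV (\<lambda>z. norm (fst z :: 'a) powr r)"
    using assms by (intro continuous_on_norm_powr continuous_intros; simp)+
  then show "continuous_on UNIV (\<lambda>z. norm (fst z :: 'a) powr r - flux r (fst z + snd z) \<bullet> fst z)"
    using assms by (intro continuous_on_diff continuous_on_inner continuous_on_compose2[OF continuous_flux]
      continuous_on_add continuous_on_fst continuous_on_snd continuous_on_id) auto
  show "continuous_on UNIV (\<lambda>z. norm (snd z :: 'a) powr r)"
    using assms by (intro continuous_on_norm_powr continuous_intros; simp)+
qed (use assms in \<open>auto simp: flux_inner_self\<close>)

lemma powr_add_le:
  fixes a b s :: real
  assumes "a \<ge> 0" "b \<ge> 0" "s > 0"
  shows "(a + b) powr s \<le> 2 powr s * (a powr s + b powr s)"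
proof -
  have "(a + b) powr s \<le> (2 * max a b) powr s" using assms by (intro powr_mono2) auto
  also have "\<dots> = 2 powr s * (max a b) powr s" using assms by (simp add: powr_mult)
  also have "\<dots> \<le> 2 powr s * (a powr s + b powr s)"
    using assms by (intro mult_left_mono) (auto simp: max_def)
  finally show ?thesis .
qed

section \<open>Functions with integrable powers\<close>

definition Lfun :: "'a measure \<Rightarrow> real \<Rightarrow> ('a \<Rightarrow> 'b::euclidean_space) set" where
  "Lfun M r = {F \<in> borel_measurable M. integrable M (\<lambda>x. norm (F x) powr r)}"

text \<open>The r-th power of the norm rather than the norm: pointwise inequalities between powers
  integrate directly. The price is a factor \<open>2 powr r\<close> where the triangle inequality
  would have none.\<close>

definition pint :: "'a measure \<Rightarrow> real \<Rightarrow> ('a \<Rightarrow> 'b::euclidean_space) \<Rightarrow> real" where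
  "pint M r F = (LINT x|M. norm (F x) powr r)"

lemma Lfun_measurable [measurable_dest]: "F \<in> Lfun M r \<Longrightarrow> F \<in> borel_measurable M"
  and Lfun_integrable: "F \<in> Lfun M r \<Longrightarrow> integrable M (\<lambda>x. norm (F x) powr r)"
  by (simp_all add: Lfun_def)

lemma pint_nonneg [simp]: "0 \<le> pint M r F"
  unfolding pint_def by (rule integral_nonneg_AE) simp

lemma pint_cong_AE:
  assumes "F \<in> borel_measurable M" "G \<in> borel_measurable M" "AE x in M. F x = G x"
  shows "pint M r F = pint M r G"
  unfolding pint_def using assms by (intro integral_cong_AE) auto

lemma pint_minus_commute: "pint M r (\<lambda>x. F x - G x) = pint M r (\<lambda>x. G x - F x)"
  by (simp add: pint_def norm_minus_commute)

lemma Lfun_bound: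
  assumes "F \<in> borel_measurable M" "integrable M g" "AE x in M. norm (F x) powr r \<le> g x"
  shows "F \<in> Lfun M r" "pint M r F \<le> (LINT x|M. g x)"
proof -
  have "integrable M (\<lambda>x. norm (F x) powr r)"
    by (rule Bochner_Integration.integrable_bound[OF assms(2)]) (use assms in auto)
  then show "F \<in> Lfun M r" "pint M r F \<le> (LINT x|M. g x)"
    using assms by (auto simp: Lfun_def pint_def intro!: integral_mono_AE)
qed

lemma Lfun_zero [simp]: "(\<lambda>x. 0) \<in> Lfun M r"
  by (simp add: Lfun_def)

lemma Lfun_scaleR:
  assumes "F \<in> Lfun M r"
  shows "(\<lambda>x. c *\<^sub>R F x) \<in> Lfun M r" "pint M r (\<lambda>x. c *\<^sub>R F x) = \<bar>c\<bar> powr r * pint M r F"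
  using assms by (auto simp: Lfun_def pint_def powr_mult)

lemma Lfun_add:
  assumes "F \<in> Lfun M r" "G \<in> Lfun M r" "r > 0"
  shows "(\<lambda>x. F x + G x) \<in> Lfun M r"
    "pint M r (\<lambda>x. F x + G x) \<le> 2 powr r * (pint M r F + pint M r G)"
proof -
  have i: "integrable M (\<lambda>x. 2 powr r * (norm (F x) powr r + norm (G x) powr r))"
    using assms by (simp add: Lfun_def)
  have b: "AE x in M. norm (F x + G x) powr r \<le> 2 powr r * (norm (F x) powr r + norm (G x) powr r)"
  proof (rule AE_I2)
    fix x
    have "norm (F x + G x) powr r \<le> (norm (F x) + norm (G x)) powr r"
      using assms by (intro powr_mono2 norm_triangle_ineq) auto
    also have "\<dots> \<le> 2 powr r * (norm (F x) powr r + norm (G x) powr r)"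
      using assms by (intro powr_add_le) auto
    finally show "norm (F x + G x) powr r \<le> 2 powr r * (norm (F x) powr r + norm (G x) powr r)" .
  qed
  have m: "(\<lambda>x. F x + G x) \<in> borel_measurable M" using assms by (auto simp: Lfun_def)
  show "(\<lambda>x. F x + G x) \<in> Lfun M r" by (rule Lfun_bound[OF m i b])
  have "pint M r (\<lambda>x. F x + G x) \<le> (LINT x|M. 2 powr r * (norm (F x) powr r + norm (G x) powr r))"
    by (rule Lfun_bound[OF m i b])
  also have "\<dots> = 2 powr r * (pint M r F + pint M r G)"
    using assms by (simp add: Lfun_def pint_def)
  finally show "pint M r (\<lambda>x. F x + G x) \<le> 2 powr r * (pint M r F + pint M r G)" .
qed

lemma Lfun_diff:
  assumes "F \<in> Lfun M r" "G \<in> Lfun M r" "r > 0"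
  shows "(\<lambda>x. F x - G x) \<in> Lfun M r"
    "pint M r (\<lambda>x. F x - G x) \<le> 2 powr r * (pint M r F + pint M r G)"
  using Lfun_add[OF assms(1) Lfun_scaleR(1)[OF assms(2), of "-1"] assms(3)]
    Lfun_scaleR(2)[OF assms(2), of "-1"] by simp_all

lemma Lfun_diff_tendsto_imp_bounded:
  fixes F :: "nat \<Rightarrow> 'a \<Rightarrow> 'b::euclidean_space"
  assumes r: "r > 0" and F: "\<And>k. F k \<in> Lfun M r" and F0: "F0 \<in> Lfun M r"
    and lim: "(\<lambda>k. pint M r (\<lambda>x. F k x - F0 x)) \<longlonglongrightarrow> 0"
  shows "\<exists>B. \<forall>k. pint M r (F k) \<le> B"
proof -
  have "Bseq (\<lambda>k. pint M r (\<lambda>x. F k x - F0 x))" using lim by (intro convergent_imp_Bseq convergentI)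
  then obtain B where B: "\<And>k. \<bar>pint M r (\<lambda>x. F k x - F0 x)\<bar> \<le> B" unfolding Bseq_def real_norm_def by blast
  have "pint M r (F k) \<le> 2 powr r * (B + pint M r F0)" for k
  proof -
    have "pint M r (\<lambda>x. (F k x - F0 x) + F0 x) \<le> 2 powr r * (pint M r (\<lambda>x. F k x - F0 x) + pint M r F0)"
      by (rule Lfun_add(2)[OF Lfun_diff(1)[OF F F0 r] F0 r])
    also have "\<dots> \<le> 2 powr r * (B + pint M r F0)"
      using B[of k] by (intro mult_left_mono add_right_mono) auto
    finally show ?thesis by simp
  qed
  then show ?thesis by blast
qed

lemma Lfun_sum:
  assumes "\<And>i. i \<in> I \<Longrightarrow> F i \<in> Lfun M r" "r > 0"
  shows "(\<lambda>x. \<Sum>i\<in>I. F i x) \<in> Lfun M r"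
  using assms by (induction I rule: infinite_finite_induct) (auto intro!: Lfun_add)

lemma Lfun_norm: "F \<in> Lfun M r \<Longrightarrow> (\<lambda>x. norm (F x)) \<in> Lfun M r"
  by (auto simp: Lfun_def)

lemma pint_norm: "pint M r (\<lambda>x. norm (F x)) = pint M r F"
  by (simp add: pint_def)

section \<open>Hoelder's inequality, completeness and weak convergence\<close>

lemma conjugate_exponents:
  fixes r s :: real
  assumes "1/r + 1/s = 1" "r > 1"
  shows "s = r / (r - 1)" "s > 1" "s - 1 = 1 / (r - 1)" "s * (r - 1) = r" "r * (s - 1) = s"
proof -
  have "s \<noteq> 0" using assms by auto
  then show 1: "s = r / (r - 1)" using assms by (simp add: field_simps)
  show "s > 1" "s - 1 = 1 / (r - 1)" "s * (r - 1) = r" "r * (s - 1) = s"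
    using assms(2) unfolding 1 by (simp_all add: field_simps)
qed

lemma pint_eq_0_AE:
  assumes "F \<in> Lfun M r" "pint M r F = 0"
  shows "AE x in M. F x = 0"
proof -
  have "AE x in M. norm (F x) powr r = 0"
    using assms integral_nonneg_eq_0_iff_AE[OF Lfun_integrable[OF assms(1)]] by (simp add: pint_def)
  then show ?thesis by simp
qed

text \<open>Young's inequality is integrated for F and G divided by their norms A and B; if one of
  these vanishes, so does the product a.e.\<close>

lemma holder:
  fixes F :: "'a \<Rightarrow> 'b::euclidean_space" and G :: "'a \<Rightarrow> 'c::euclidean_space"
  assumes rs: "1/r + 1/s = 1" "r > 1" and F: "F \<in> Lfun M r" and G: "G \<in> Lfun M s"
  shows "integrable M (\<lambda>x. norm (F x) * norm (G x))"
    "(LINT x|M. norm (F x) * norm (G x)) \<le> pint M r F powr (1/r) * pint M s G powr (1/s)"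
proof -
  note s = conjugate_exponents[OF rs]
  have [measurable]: "F \<in> borel_measurable M" "G \<in> borel_measurable M"
    using F G by (auto simp: Lfun_def)
  have Y: "norm (F x) * norm (G x) \<le> norm (F x) powr r / r + norm (G x) powr s / s" for x
    by (rule Youngs_inequality) (use rs s in auto)
  show "integrable M (\<lambda>x. norm (F x) * norm (G x))"
    by (rule Bochner_Integration.integrable_bound[of M "\<lambda>x. norm (F x) powr r / r + norm (G x) powr s / s"])
      (use F G Y rs s in \<open>auto simp: Lfun_def intro!: AE_I2 order_trans[OF Y]\<close>)
  show "(LINT x|M. norm (F x) * norm (G x)) \<le> pint M r F powr (1/r) * pint M s G powr (1/s)"
  proof (cases "pint M r F = 0 \<or> pint M s G = 0")
    case True
    then have "AE x in M. norm (F x) * norm (G x) = 0"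
      using pint_eq_0_AE[OF F] pint_eq_0_AE[OF G] by auto
    then have "(LINT x|M. norm (F x) * norm (G x)) = 0" by (simp add: integral_eq_zero_AE)
    then show ?thesis by simp
  next
    case False
    define A where "A = pint M r F powr (1/r)"
    define B where "B = pint M s G powr (1/s)"
    have p: "pint M r F > 0" "pint M s G > 0" using False pint_nonneg by (metis less_eq_real_def)+
    then have A: "A > 0" "A powr r = pint M r F" and B: "B > 0" "B powr s = pint M s G"
      unfolding A_def B_def using rs s by (auto simp: powr_powr)
    have "(LINT x|M. (norm (F x) / A) * (norm (G x) / B)) \<le>
       (LINT x|M. norm (F x) powr r / pint M r F / r + norm (G x) powr s / pint M s G / s)"
    proof (rule integral_mono')
      fix x
      have "(norm (F x) / A) * (norm (G x) / B) \<le> (norm (F x) / A) powr r / r + (norm (G x) / B) powr s / s"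
        by (rule Youngs_inequality) (use rs s A B in auto)
      then show "(norm (F x) / A) * (norm (G x) / B) \<le> norm (F x) powr r / pint M r F / r + norm (G x) powr s / pint M s G / s"
        using A B by (simp add: powr_divide)
    qed (use F G A B rs s p in \<open>auto simp: Lfun_def\<close>)
    also have "\<dots> = 1" using F G p rs by (simp add: Lfun_def flip: pint_def)
    finally have "(LINT x|M. norm (F x) * norm (G x)) / (A * B) \<le> 1" by simp
    then show ?thesis using A B unfolding A_def[symmetric] B_def[symmetric] by (simp add: divide_le_eq)
  qed
qed

lemma holder_inner:
  fixes F G :: "'a \<Rightarrow> 'b::euclidean_space"
  assumes rs: "1/r + 1/s = 1" "r > 1" and F: "F \<in> Lfun M r" and G: "G \<in> Lfun M s"
  shows "integrable M (\<lambda>x. F x \<bullet> G x)"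
    "\<bar>LINT x|M. F x \<bullet> G x\<bar> \<le> pint M r F powr (1/r) * pint M s G powr (1/s)"
proof -
  have [measurable]: "F \<in> borel_measurable M" "G \<in> borel_measurable M"
    using F G by (auto simp: Lfun_def)
  note h = holder[OF rs F G]
  show i: "integrable M (\<lambda>x. F x \<bullet> G x)"
    by (rule Bochner_Integration.integrable_bound[OF h(1)]) (auto simp: Cauchy_Schwarz_ineq2)
  have "\<bar>LINT x|M. F x \<bullet> G x\<bar> \<le> (LINT x|M. \<bar>F x \<bullet> G x\<bar>)" by (rule integral_abs_bound)
  also have "\<dots> \<le> (LINT x|M. norm (F x) * norm (G x))"
    using i h by (intro integral_mono) (auto simp: Cauchy_Schwarz_ineq2)
  finally show "\<bar>LINT x|M. F x \<bullet> G x\<bar> \<le> pint M r F powr (1/r) * pint M s G powr (1/s)"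
    using h by linarith
qed

lemma Lfun_conv_AE_subseq:
  assumes "\<And>k. (\<lambda>x. F k x - F0 x) \<in> Lfun M r" "(\<lambda>k. pint M r (\<lambda>x. F k x - F0 x)) \<longlonglongrightarrow> 0" "r > 0"
  shows "\<exists>\<rho>::nat\<Rightarrow>nat. strict_mono \<rho> \<and> (AE x in M. (\<lambda>k. F (\<rho> k) x) \<longlonglongrightarrow> F0 x)"
proof -
  have "\<exists>\<rho>::nat\<Rightarrow>nat. strict_mono \<rho> \<and> (AE x in M. (\<lambda>k. norm (F (\<rho> k) x - F0 x) powr r) \<longlonglongrightarrow> 0)"
    by (rule tendsto_L1_AE_subseq) (use assms in \<open>auto simp: Lfun_def pint_def\<close>)
  then obtain \<rho> :: "nat \<Rightarrow> nat" where \<rho>: "strict_mono \<rho>"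
    "AE x in M. (\<lambda>k. norm (F (\<rho> k) x - F0 x) powr r) \<longlonglongrightarrow> 0" by blast
  have "(\<lambda>k. F (\<rho> k) x) \<longlonglongrightarrow> F0 x" if "(\<lambda>k. norm (F (\<rho> k) x - F0 x) powr r) \<longlonglongrightarrow> 0" for x
  proof -
    have "(\<lambda>k. (norm (F (\<rho> k) x - F0 x) powr r) powr (1/r)) \<longlonglongrightarrow> 0 powr (1/r)"
      by (rule tendsto_powr2[OF that]) (use assms in auto)
    then have "(\<lambda>k. norm (F (\<rho> k) x - F0 x)) \<longlonglongrightarrow> 0" using assms by (simp add: powr_powr)
    then show ?thesis using LIM_zero_cancel tendsto_norm_zero_iff by blast
  qed
  then show ?thesis using \<rho> by (metis (mono_tags, lifting) eventually_mono)
qed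

text \<open>Serves throughout as lower semicontinuity of \<open>pint\<close> under a.e. convergence,
  with membership of the limit included.\<close>

lemma Lfun_fatou:
  assumes F: "\<And>k. F k \<in> Lfun M r" and b: "\<And>k. pint M r (F k) \<le> C"
    and conv: "AE x in M. (\<lambda>k. F k x) \<longlonglongrightarrow> F0 x" and m[measurable]: "F0 \<in> borel_measurable M" and r: "r > 0"
  shows "F0 \<in> Lfun M r" "pint M r F0 \<le> C"
proof -
  have [measurable]: "F k \<in> borel_measurable M" for k using F by (simp add: Lfun_def)
  have C: "C \<ge> 0" using b[of 0] pint_nonneg[of M r "F 0"] by linarith
  have *: "(\<integral>\<^sup>+x. ennreal (norm (F k x) powr r) \<partial>M) \<le> ennreal C" for k
    using b[of k] F[of k] by (simp add: Lfun_def pint_def nn_integral_eq_integral ennreal_leI)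
  have "(\<integral>\<^sup>+x. ennreal (norm (F0 x) powr r) \<partial>M) = (\<integral>\<^sup>+x. liminf (\<lambda>k. ennreal (norm (F k x) powr r)) \<partial>M)"
  proof (rule nn_integral_cong_AE, use conv in eventually_elim)
    case (elim x)
    then have "(\<lambda>k. ennreal (norm (F k x) powr r)) \<longlonglongrightarrow> ennreal (norm (F0 x) powr r)"
      by (intro tendsto_ennrealI tendsto_powr2 tendsto_norm) (use r in auto)
    then show ?case using lim_imp_Liminf[OF sequentially_bot] by metis
  qed
  also have "\<dots> \<le> liminf (\<lambda>k. (\<integral>\<^sup>+x. ennreal (norm (F k x) powr r) \<partial>M))"
    by (rule nn_integral_liminf) simp
  also have "\<dots> \<le> liminf (\<lambda>k::nat. ennreal C)" by (intro Liminf_mono always_eventually allI *)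
  also have "\<dots> = ennreal C" by (simp add: Liminf_const)
  finally have le: "(\<integral>\<^sup>+x. ennreal (norm (F0 x) powr r) \<partial>M) \<le> ennreal C" .
  then have i: "integrable M (\<lambda>x. norm (F0 x) powr r)"
    by (intro integrableI_bounded) (auto simp: order_le_less_trans)
  then show "F0 \<in> Lfun M r" by (simp add: Lfun_def)
  show "pint M r F0 \<le> C" using le C i by (simp add: pint_def nn_integral_eq_integral)
qed

text \<open>Riesz-Fischer in a form adapted to \<open>pint\<close>: the increments
  \<open>d k\<close> of a fast subsequence are weighted by powers of 2 before integration.
  Finiteness of the weighted sum at almost every point makes them decay geometrically there, so they
  are summable.\<close>

lemma Lfun_complete:
  fixes F :: "nat \<Rightarrow> 'a \<Rightarrow> 'b::euclidean_space"
  assumes F: "\<And>k. F k \<in> Lfun M r" and r: "r > 0"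
    and cauchy: "\<And>\<epsilon>. \<epsilon> > 0 \<Longrightarrow> \<exists>N. \<forall>m\<ge>N. \<forall>n\<ge>N. pint M r (\<lambda>x. F m x - F n x) < \<epsilon>"
  shows "\<exists>F0\<in>Lfun M r. (\<lambda>k. pint M r (\<lambda>x. F k x - F0 x)) \<longlonglongrightarrow> 0"
proof -
  have [measurable]: "F k \<in> borel_measurable M" for k using F by (simp add: Lfun_def)
  \<comment> \<open>Against the weights \<open>2^k\<close> the tolerance \<open>(1/4)^k\<close>
    leaves the convergent series of the integrals \<open>(1/2)^k\<close>.\<close>
  have "\<exists>N. \<forall>m\<ge>N. \<forall>n\<ge>N. pint M r (\<lambda>x. F m x - F n x) < (1/4)^k" for k :: nat
    by (rule cauchy) simp
  then obtain N where N: "\<And>k m n. m \<ge> N k \<Longrightarrow> n \<ge> N k \<Longrightarrow> pint M r (\<lambda>x. F m x - F n x) < (1/4)^k"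
    by metis
  \<comment> \<open>The partial sums dominate every N k and, thanks to the added 1, increase
    strictly.\<close>
  define \<rho> where "\<rho> k = (\<Sum>i\<le>k. N i + 1)" for k
  have \<rho>: "strict_mono \<rho>" by (rule strict_mono_Suc_iff[THEN iffD2]) (simp add: \<rho>_def)
  have \<rho>N: "\<rho> k \<ge> N k" for k
    unfolding \<rho>_def using member_le_sum[of k "{..k}" "\<lambda>i. N i + 1"] by simp
  define d where "d k x = F (\<rho> (Suc k)) x - F (\<rho> k) x" for k x
  have dL: "d k \<in> Lfun M r" for k unfolding d_def using F r by (intro Lfun_diff) auto
  have dp: "pint M r (d k) < (1/4)^k" for k
  proof -
    have "\<rho> (Suc k) \<ge> N k" using \<rho>N[of k] by (simp add: \<rho>_def)
    then show ?thesis unfolding d_def using N[of k "\<rho> (Suc k)" "\<rho> k"] \<rho>N[of k] by simp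
  qed
  have [measurable]: "d k \<in> borel_measurable M" for k using dL by (simp add: Lfun_def)
  have "(\<integral>\<^sup>+x. (\<Sum>k. ennreal (2^k * norm (d k x) powr r)) \<partial>M) = (\<Sum>k. \<integral>\<^sup>+x. ennreal (2^k * norm (d k x) powr r) \<partial>M)"
    by (rule nn_integral_suminf) simp
  also have "\<dots> \<le> (\<Sum>k. ennreal ((1/2)^k))"
  proof (rule suminf_le)
    fix k
    have "(\<integral>\<^sup>+x. ennreal (2^k * norm (d k x) powr r) \<partial>M) = ennreal (2^k * pint M r (d k))"
      using dL[of k] by (subst nn_integral_eq_integral) (auto simp: Lfun_def pint_def)
    also have "2^k * pint M r (d k) \<le> 2^k * (1/4)^k" using dp[of k] by simp
    also have "2^k * (1/4)^k = (1/2::real)^k" by (simp flip: power_mult_distrib)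
    finally show "(\<integral>\<^sup>+x. ennreal (2^k * norm (d k x) powr r) \<partial>M) \<le> ennreal ((1/2)^k)"
      by (simp add: ennreal_leI)
  qed auto
  also have "\<dots> < \<infinity>"
    by (simp add: suminf_ennreal2 ennreal_suminf_neq_top less_top summable_geometric)
  finally have "AE x in M. (\<Sum>k. ennreal (2^k * norm (d k x) powr r)) \<noteq> \<infinity>"
    by (intro nn_integral_PInf_AE) auto
  then have AEc: "AE x in M. convergent (\<lambda>k. F (\<rho> k) x)"
  proof eventually_elim
    case (elim x)
    then have "summable (\<lambda>k. 2^k * norm (d k x) powr r)"
      by (intro summable_suminf_not_top) auto
    then have "(\<lambda>k. 2^k * norm (d k x) powr r) \<longlonglongrightarrow> 0" by (rule summable_LIMSEQ_zero)
    then have "eventually (\<lambda>k. 2^k * norm (d k x) powr r < 1) sequentially"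
      by (rule order_tendstoD) simp
    then have "eventually (\<lambda>k. norm (norm (d k x)) \<le> ((1/2) powr (1/r))^k) sequentially"
    proof eventually_elim
      case (elim k)
      then have "norm (d k x) powr r \<le> (1/2)^k" by (simp add: field_simps power_one_over)
      then have "(norm (d k x) powr r) powr (1/r) \<le> ((1/2)^k) powr (1/r)"
        using r by (intro powr_mono2) auto
      also have "((1/2)^k) powr (1/r) = ((1/2) powr (1/r))^k"
        by (simp add: powr_powr powr_realpow[symmetric] mult.commute)
      finally show ?case using r by (simp add: powr_powr)
    qed
    moreover have "summable (\<lambda>k. ((1/2::real) powr (1/r))^k)"
      using r powr_less_mono2[of "1/r" "1/2" 1] by (intro summable_geometric) auto
    ultimately have "summable (\<lambda>k. norm (d k x))" by (rule summable_comparison_test_ev)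
    then have "summable (\<lambda>k. d k x)" by (rule summable_norm_cancel)
    then have "convergent (\<lambda>n. \<Sum>k<n. d k x)" by (simp add: summable_iff_convergent)
    moreover have "(\<Sum>k<n. d k x) = F (\<rho> n) x - F (\<rho> 0) x" for n
      unfolding d_def by (rule sum_lessThan_telescope)
    ultimately have "convergent (\<lambda>n. F (\<rho> n) x - F (\<rho> 0) x)" by simp
    then have "convergent (\<lambda>n. (F (\<rho> n) x - F (\<rho> 0) x) + F (\<rho> 0) x)"
      by (intro convergent_add convergent_const)
    then show ?case by simp
  qed
  define F0 where "F0 x = lim (\<lambda>k. F (\<rho> k) x)" for x
  have [measurable]: "F0 \<in> borel_measurable M"
    unfolding F0_def by (rule borel_measurable_lim_metric) simp
  have F0: "AE x in M. (\<lambda>k. F (\<rho> k) x) \<longlonglongrightarrow> F0 x"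
    using AEc by eventually_elim (simp add: F0_def convergent_LIMSEQ_iff)
  \<comment> \<open>Fatou's lemma with F m fixed, along the subsequence started beyond K, turns the
    Cauchy bound into a bound on the distance to F0.\<close>
  have key: "(\<lambda>x. F m x - F0 x) \<in> Lfun M r \<and> pint M r (\<lambda>x. F m x - F0 x) \<le> \<epsilon>"
    if K: "\<And>n. n \<ge> K \<Longrightarrow> pint M r (\<lambda>x. F m x - F n x) < \<epsilon>" for m K \<epsilon>
  proof -
    have "\<rho> (k + K) \<ge> K" for k using strict_mono_imp_increasing[OF \<rho>, of "k+K"] by linarith
    then have b: "pint M r (\<lambda>x. F m x - F (\<rho> (k + K)) x) \<le> \<epsilon>" for k
      using K[of "\<rho> (k+K)"] by (simp add: less_imp_le)
    have c: "AE x in M. (\<lambda>k. F m x - F (\<rho> (k + K)) x) \<longlonglongrightarrow> F m x - F0 x"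
      using F0 by eventually_elim (intro tendsto_intros LIMSEQ_ignore_initial_segment)
    have L: "(\<lambda>x. F m x - F (\<rho> (k + K)) x) \<in> Lfun M r" for k using F r by (intro Lfun_diff)
    show ?thesis using Lfun_fatou[OF L b c _ r] by simp
  qed
  obtain N1 where N1: "\<And>m n. m \<ge> N1 \<Longrightarrow> n \<ge> N1 \<Longrightarrow> pint M r (\<lambda>x. F m x - F n x) < 1"
    using cauchy[of 1] by auto
  have "(\<lambda>x. F N1 x - F0 x) \<in> Lfun M r" using key[of N1 N1 1] N1 by auto
  then have F0L: "F0 \<in> Lfun M r" using Lfun_diff(1)[OF F[of N1] _ r] by fastforce
  have "(\<lambda>k. pint M r (\<lambda>x. F k x - F0 x)) \<longlonglongrightarrow> 0"
  proof (rule LIMSEQ_I)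
    fix \<epsilon> :: real assume "\<epsilon> > 0"
    then obtain N where N: "\<And>m n. m \<ge> N \<Longrightarrow> n \<ge> N \<Longrightarrow> pint M r (\<lambda>x. F m x - F n x) < \<epsilon>/2"
      using cauchy[of "\<epsilon>/2"] by auto
    then have "pint M r (\<lambda>x. F m x - F0 x) \<le> \<epsilon>/2" if "m \<ge> N" for m
      using key[of N m "\<epsilon>/2"] that by auto
    then show "\<exists>no. \<forall>n\<ge>no. norm (pint M r (\<lambda>x. F n x - F0 x) - 0) < \<epsilon>"
      using \<open>\<epsilon> > 0\<close> by (intro exI[of _ N] allI impI) (fastforce intro: le_less_trans)
  qed
  then show ?thesis using F0L by blast
qed

text \<open>A threshold l splits the product of a = |h k - h0| and b = |e|. Where a \<le> l b^(r-1),
  it is dominated by l b^r and handled by dominated convergence; elsewhere it is at most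
  l^(-1/(r-1)) a^s, whose integral is small uniformly in k when l is large.\<close>

lemma Lfun_bounded_AE_conv_weak:
  fixes h :: "nat \<Rightarrow> 'a \<Rightarrow> 'b::euclidean_space"
  assumes rs: "1/r + 1/s = 1" "r > 1"
    and h: "\<And>k. h k \<in> Lfun M s" "\<And>k. pint M s (h k) \<le> C"
    and conv: "AE x in M. (\<lambda>k. h k x) \<longlonglongrightarrow> h0 x" and m: "h0 \<in> borel_measurable M"
    and e: "e \<in> Lfun M r"
  shows "(\<lambda>k. LINT x|M. h k x \<bullet> e x) \<longlonglongrightarrow> (LINT x|M. h0 x \<bullet> e x)"
proof -
  note s = conjugate_exponents[OF rs]
  have h0: "h0 \<in> Lfun M s" "pint M s h0 \<le> C"
    using Lfun_fatou[OF h conv m] s by auto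
  have [measurable]: "h k \<in> borel_measurable M" "h0 \<in> borel_measurable M" "e \<in> borel_measurable M" for k
    using h m e by (auto simp: Lfun_def)
  define a where "a k x = norm (h k x - h0 x)" for k x
  define b where "b x = norm (e x)" for x
  have [measurable]: "a k \<in> borel_measurable M" "b \<in> borel_measurable M" for k
    unfolding a_def b_def by auto
  define D where "D = 2 powr s * (C + C)"
  have hd: "(\<lambda>x. h k x - h0 x) \<in> Lfun M s" "pint M s (\<lambda>x. h k x - h0 x) \<le> D" for k
  proof -
    show "(\<lambda>x. h k x - h0 x) \<in> Lfun M s" using h h0 s by (intro Lfun_diff) auto
    have "2 powr s * (pint M s (h k) + pint M s h0) \<le> D"
      unfolding D_def using h(2)[of k] h0(2) by (intro mult_left_mono) auto
    then show "pint M s (\<lambda>x. h k x - h0 x) \<le> D"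
      using Lfun_diff(2)[OF h(1)[of k] h0(1)] s by linarith
  qed
  have D: "D \<ge> 0" using hd(2)[of 0] pint_nonneg[of M s "\<lambda>x. h 0 x - h0 x"] by linarith
  have split: "a k x * b x \<le> min (a k x * b x) (l * b x powr r) + l powr (- 1/(r-1)) * a k x powr s" if "l > 0" for l k x
  proof (cases "a k x \<le> l * b x powr (r-1)")
    case True
    then have "a k x * b x \<le> l * b x powr (r-1) * b x" by (intro mult_right_mono) (auto simp: b_def)
    also have "b x powr (r-1) * b x = b x powr r" using powr_add[of "b x" "r-1" 1]
      by (cases "b x = 0") (use rs in \<open>auto simp: b_def\<close>)
    then have "l * b x powr (r-1) * b x = l * b x powr r" by simp
    finally show ?thesis by (simp add: min_absorb1)
  next
    case False
    then have "b x powr (r-1) \<le> a k x / l" using that by (simp add: field_simps)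
    then have "(b x powr (r-1)) powr (1/(r-1)) \<le> (a k x / l) powr (1/(r-1))"
      using rs by (intro powr_mono2) auto
    then have "b x \<le> (a k x / l) powr (1/(r-1))" using rs by (simp add: powr_powr b_def)
    then have "a k x * b x \<le> a k x * (a k x / l) powr (1/(r-1))"
      by (intro mult_left_mono) (auto simp: a_def)
    also have "\<dots> = (a k x * a k x powr (1/(r-1))) * l powr (- 1/(r-1))"
      using that by (simp add: powr_divide a_def powr_minus_divide)
    also have "a k x * a k x powr (1/(r-1)) = a k x powr s"
    proof -
      have "s = 1 + 1/(r-1)" using s(3) by linarith
      then show ?thesis using powr_add[of "a k x" 1 "1/(r-1)"] by (cases "a k x = 0") (auto simp: a_def)
    qed
    finally have "a k x * b x \<le> l powr (- 1/(r-1)) * a k x powr s" by (simp add: mult.commute)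
    moreover have "min (a k x * b x) (l * b x powr r) \<ge> 0" using that by (auto simp: a_def b_def)
    ultimately show ?thesis by linarith
  qed
  have ib: "integrable M (\<lambda>x. b x powr r)" using e by (simp add: Lfun_def b_def)
  have ias: "integrable M (\<lambda>x. a k x powr s)" for k using hd(1)[of k] by (simp add: Lfun_def a_def)
  have iab: "integrable M (\<lambda>x. a k x * b x)" for k
    unfolding a_def b_def using holder(1)[OF rs e hd(1)[of k]] by (simp add: mult.commute)
  have lim0: "(\<lambda>k. LINT x|M. a k x * b x) \<longlonglongrightarrow> 0"
  proof (rule LIMSEQ_I)
    fix \<epsilon> :: real assume \<epsilon>: "\<epsilon> > 0"
    \<comment> \<open>Solves \<open>l powr (- 1/(r-1)) = \<epsilon> / (2 * (D + 1))\<close>, so that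
      the part above the threshold contributes less than \<epsilon> / 2 for every k.\<close>
    define l where "l = (\<epsilon> / (2 * (D + 1))) powr (-(r-1))"
    have l: "l > 0" unfolding l_def using \<epsilon> D by auto
    have "l powr (- 1/(r-1)) = \<epsilon> / (2 * (D + 1))" 
    proof -
      have "- (r-1) * (- 1/(r-1)) = 1" using rs by (simp add: field_simps)
      then show ?thesis unfolding l_def powr_powr using \<epsilon> D by simp
    qed
    then have lD: "l powr (- 1/(r-1)) * D < \<epsilon> / 2"

    proof -
      have "\<epsilon> / (2 * (D + 1)) * D = \<epsilon> / 2 * (D / (D + 1))" by simp
      also have "\<dots> < \<epsilon> / 2 * 1" using \<epsilon> D by (intro mult_strict_left_mono) auto
      finally show ?thesis using \<open>l powr (- 1/(r-1)) = \<epsilon> / (2 * (D + 1))\<close> by simp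
    qed
    have imin: "integrable M (\<lambda>x. min (a k x * b x) (l * b x powr r))" for k
      by (rule Bochner_Integration.integrable_bound[OF iab[of k]]) (use l in \<open>auto simp: a_def b_def\<close>)
    have "(\<lambda>k. LINT x|M. min (a k x * b x) (l * b x powr r)) \<longlonglongrightarrow> (LINT x|M. 0)"
    proof (rule integral_dominated_convergence)
      show "integrable M (\<lambda>x. l * b x powr r)" using ib by simp
      show "AE x in M. (\<lambda>k. min (a k x * b x) (l * b x powr r)) \<longlonglongrightarrow> 0"
        using conv
      proof eventually_elim
        case (elim x)
        then have "(\<lambda>k. a k x) \<longlonglongrightarrow> 0" unfolding a_def by (simp add: LIM_zero tendsto_norm_zero)
        then have "(\<lambda>k. min (a k x * b x) (l * b x powr r)) \<longlonglongrightarrow> min (0 * b x) (l * b x powr r)"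
          by (intro tendsto_intros)
        then show ?case using l by simp
      qed
      show "AE x in M. norm (min (a k x * b x) (l * b x powr r)) \<le> l * b x powr r" for k
        using l by (auto simp: a_def b_def)
    qed auto
    then have "eventually (\<lambda>k. (LINT x|M. min (a k x * b x) (l * b x powr r)) < \<epsilon>/2) sequentially"
      using \<epsilon> by (intro order_tendstoD(2)[of _ 0]) auto
    then obtain n0 where n0: "\<And>k. k \<ge> n0 \<Longrightarrow> (LINT x|M. min (a k x * b x) (l * b x powr r)) < \<epsilon>/2"
      by (auto simp: eventually_sequentially)
    have "norm ((LINT x|M. a k x * b x) - 0) < \<epsilon>" if "k \<ge> n0" for k
    proof -
      have "(LINT x|M. a k x * b x) \<le> (LINT x|M. min (a k x * b x) (l * b x powr r) + l powr (- 1/(r-1)) * a k x powr s)"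
        by (rule integral_mono) (use iab imin ias split[OF l] in auto)
      also have "\<dots> = (LINT x|M. min (a k x * b x) (l * b x powr r)) + l powr (- 1/(r-1)) * pint M s (\<lambda>x. h k x - h0 x)"
        using imin ias by (simp add: pint_def a_def)
      also have "\<dots> \<le> (LINT x|M. min (a k x * b x) (l * b x powr r)) + l powr (- 1/(r-1)) * D"
        using hd(2)[of k] by (intro add_left_mono mult_left_mono) auto
      also have "\<dots> < \<epsilon>" using n0[OF that] lD by linarith
      finally have "(LINT x|M. a k x * b x) < \<epsilon>" .
      moreover have "(LINT x|M. a k x * b x) \<ge> 0" by (rule integral_nonneg_AE) (auto simp: a_def b_def)
      ultimately show ?thesis by simp
    qed
    then show "\<exists>n0. \<forall>k\<ge>n0. norm ((LINT x|M. a k x * b x) - 0) < \<epsilon>" by blast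
  qed
  have ihe: "integrable M (\<lambda>x. h k x \<bullet> e x)" "integrable M (\<lambda>x. h0 x \<bullet> e x)" for k
    using holder_inner(1)[OF rs e h(1)[of k]] holder_inner(1)[OF rs e h0(1)] by (simp_all add: inner_commute)
  have "norm ((LINT x|M. h k x \<bullet> e x) - (LINT x|M. h0 x \<bullet> e x)) \<le> (LINT x|M. a k x * b x)" for k
  proof -
    have "(LINT x|M. h k x \<bullet> e x) - (LINT x|M. h0 x \<bullet> e x) = (LINT x|M. (h k x - h0 x) \<bullet> e x)"
      using ihe by (simp add: inner_diff_left)
    also have "norm \<dots> \<le> (LINT x|M. norm ((h k x - h0 x) \<bullet> e x))"
      by (rule integral_norm_bound)
    also have "\<dots> \<le> (LINT x|M. a k x * b x)"
    proof (rule integral_mono)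
      show "integrable M (\<lambda>x. norm ((h k x - h0 x) \<bullet> e x))" using ihe by (simp add: inner_diff_left)
    qed (use iab in \<open>auto simp: a_def b_def Cauchy_Schwarz_ineq2\<close>)
    finally show ?thesis .
  qed
  then have "(\<lambda>k. (LINT x|M. h k x \<bullet> e x) - (LINT x|M. h0 x \<bullet> e x)) \<longlonglongrightarrow> 0"
    by (intro Lim_null_comparison[OF _ lim0] always_eventually) simp
  then show ?thesis by (rule LIM_zero_cancel)
qed

section \<open>Duality on closed subspaces\<close>

text \<open>The last clause, applied to constant sequences, also closes Y under a.e. equality within
  L^r.\<close>

definition closed_subspace_Lfun :: "'a measure \<Rightarrow> real \<Rightarrow> ('a \<Rightarrow> 'b::euclidean_space) set \<Rightarrow> bool" where
  "closed_subspace_Lfun M r Y \<longleftrightarrow> Y \<subseteq> Lfun M r \<and> (\<lambda>x. 0) \<in> Y \<and>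
     (\<forall>F\<in>Y. \<forall>G\<in>Y. (\<lambda>x. F x + G x) \<in> Y) \<and> (\<forall>c. \<forall>F\<in>Y. (\<lambda>x. c *\<^sub>R F x) \<in> Y) \<and>
     (\<forall>Fk F. (\<forall>k. Fk k \<in> Y) \<longrightarrow> F \<in> Lfun M r \<longrightarrow> (\<lambda>k. pint M r (\<lambda>x. Fk k x - F x)) \<longlonglongrightarrow> 0 \<longrightarrow> F \<in> Y)"

lemma closed_subspace_Lfun_UNIV: "r > 0 \<Longrightarrow> closed_subspace_Lfun M r (Lfun M r)"
  unfolding closed_subspace_Lfun_def
  by (intro conjI ballI allI impI subset_refl Lfun_zero Lfun_add(1) Lfun_scaleR(1))

text \<open>From s (r - 1) = r: up to normalization, the flux is the duality map of L^r.\<close>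

lemma flux_Lfun:
  assumes "1/r + 1/s = 1" "r > 1" "F \<in> Lfun M r"
  shows "(\<lambda>x. flux r (F x)) \<in> Lfun M s" "pint M s (\<lambda>x. flux r (F x)) = pint M r F"
proof -
  have "norm (flux r y) powr s = norm y powr r" for y :: 'b
    using conjugate_exponents(4)[OF assms(1,2)] by (simp add: norm_flux powr_powr mult.commute)
  then show "(\<lambda>x. flux r (F x)) \<in> Lfun M s" "pint M s (\<lambda>x. flux r (F x)) = pint M r F"
    using assms(3) by (auto simp: Lfun_def pint_def)
qed

text \<open>Young's inequality with weights that spend only half of A / r; the other half is left
  for coercivity.\<close>

lemma powr_conj_shift:
  assumes "A \<ge> 0" "1/r + 1/s = 1" "r > (1::real)" and that: "C \<ge> 0"
  shows "C * A powr (1/r) \<le> A / (2 * r) + (C * 2 powr (1/r)) powr s / s"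
proof -
  note s = conjugate_exponents[OF assms(2,3)]
  have "(A/2) powr (1/r) * (C * 2 powr (1/r)) \<le> ((A/2) powr (1/r)) powr r / r + (C * 2 powr (1/r)) powr s / s"
    by (rule Youngs_inequality) (use assms s that in auto)
  also have "(A/2) powr (1/r) * (C * 2 powr (1/r)) = C * A powr (1/r)"
    using assms by (simp add: powr_divide)
  finally show ?thesis using assms by (simp add: powr_powr)
qed

text \<open>The direct method: by uniform convexity a minimizing sequence of F \<mapsto> \<integral>|F|^r / r - G(F) is
  Cauchy, and the equation is the Euler--Lagrange equation.\<close>

theorem flux_represents_functional:
  fixes Y :: "('a \<Rightarrow> 'b::euclidean_space) set" and G :: "('a \<Rightarrow> 'b) \<Rightarrow> real"
  assumes rs: "1/r + 1/s = 1" "r > 1" and Y: "closed_subspace_Lfun M r Y"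
    and G_add: "\<And>F H. F \<in> Y \<Longrightarrow> H \<in> Y \<Longrightarrow> G (\<lambda>x. F x + H x) = G F + G H"
    and G_scale: "\<And>c F. F \<in> Y \<Longrightarrow> G (\<lambda>x. c *\<^sub>R F x) = c * G F"
    and G_bound: "\<And>F. F \<in> Y \<Longrightarrow> \<bar>G F\<bar> \<le> C * pint M r F powr (1/r)"
  shows "\<exists>F\<in>Y. \<forall>H\<in>Y. (LINT x|M. flux r (F x) \<bullet> H x) = G H"
proof -
  note s = conjugate_exponents[OF rs]
  have r0: "r > 0" using rs by simp
  have YL: "F \<in> Lfun M r" if "F \<in> Y" for F using Y that by (auto simp: closed_subspace_Lfun_def)
  have Y0: "(\<lambda>x. 0) \<in> Y" and Yadd: "\<And>F H. F \<in> Y \<Longrightarrow> H \<in> Y \<Longrightarrow> (\<lambda>x. F x + H x) \<in> Y"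
    and Yscale: "\<And>c F. F \<in> Y \<Longrightarrow> (\<lambda>x. c *\<^sub>R F x) \<in> Y"
    and Yclosed: "\<And>Fk F. (\<And>k. Fk k \<in> Y) \<Longrightarrow> F \<in> Lfun M r \<Longrightarrow> (\<lambda>k. pint M r (\<lambda>x. Fk k x - F x)) \<longlonglongrightarrow> 0 \<Longrightarrow> F \<in> Y"
    using Y unfolding closed_subspace_Lfun_def by blast+
  define C' where "C' = max C 0"
  have GC': "\<bar>G F\<bar> \<le> C' * pint M r F powr (1/r)" if "F \<in> Y" for F
  proof -
    have "C * pint M r F powr (1/r) \<le> C' * pint M r F powr (1/r)"
      unfolding C'_def by (intro mult_right_mono) auto
    then show ?thesis using G_bound[OF that] by linarith
  qed
  have C'0: "C' \<ge> 0" by (simp add: C'_def)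
  define J where "J F = pint M r F / r - G F" for F
  define B where "B = (C' * 2 powr (1/r)) powr s / s"
  have coer: "pint M r F / (2 * r) - B \<le> J F" if "F \<in> Y" for F
  proof -
    have "C' * pint M r F powr (1/r) \<le> pint M r F / (2 * r) + B"
      unfolding B_def using powr_conj_shift[OF pint_nonneg rs C'0] .
    then have "G F \<le> pint M r F / (2 * r) + B" using GC'[OF that] by linarith
    moreover have "pint M r F / r = pint M r F / (2 * r) + pint M r F / (2 * r)" by (simp add: field_simps)
    ultimately show ?thesis unfolding J_def by linarith
  qed
  define m where "m = (INF F\<in>Y. J F)"
  have bdd: "bdd_below (J ` Y)"
  proof (rule bdd_belowI2)
    fix F assume "F \<in> Y"
    have "0 \<le> pint M r F / (2 * r)" using r0 by simp
    then show "- B \<le> J F" using coer[OF \<open>F \<in> Y\<close>] by linarith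
  qed
  have mJ: "m \<le> J F" if "F \<in> Y" for F unfolding m_def by (rule cINF_lower[OF bdd that])
  have "\<exists>F\<in>Y. J F < m + 1 / (real k + 1)" for k
    using cInf_lessD[of "J ` Y" "m + 1 / (real k + 1)"] Y0 unfolding m_def by auto
  then obtain Fk where Fk: "\<And>k. Fk k \<in> Y" "\<And>k. J (Fk k) < m + 1 / (real k + 1)" by metis
  note FkL = YL[OF Fk(1)]
  define A where "A = 2 * r * (m + 1 + B)"
  have FkA: "pint M r (Fk k) \<le> A" for k
  proof -
    have "1 / (real k + 1) \<le> 1" by simp
    then have "pint M r (Fk k) / (2 * r) \<le> m + 1 + B" using coer[OF Fk(1)[of k]] Fk(2)[of k] by linarith
    then show ?thesis using r0 by (simp add: A_def field_simps)
  qed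
  have A0: "A \<ge> 0" using FkA[of 0] pint_nonneg[of M r "Fk 0"] by linarith
  have "\<exists>F0\<in>Lfun M r. (\<lambda>k. pint M r (\<lambda>x. Fk k x - F0 x)) \<longlonglongrightarrow> 0"
  proof (rule Lfun_complete[OF FkL r0])
    fix \<epsilon> :: real assume \<epsilon>: "\<epsilon> > 0"
    \<comment> \<open>Both integrals are bounded by A, so the \<delta>-part of the convexity bound
      is at most \<epsilon> / 2; the other half is left for the midpoint defect.\<close>
    define \<delta> where "\<delta> = \<epsilon> / (4 * (A + 1))"
    have \<delta>: "\<delta> > 0" using \<epsilon> A0 by (simp add: \<delta>_def)
    obtain D where D: "D \<ge> 0" "\<And>a b :: 'b. norm (a - b) powr r \<le> \<delta> * (norm a powr r + norm b powr r)
           + D * ((norm a powr r + norm b powr r) / 2 - norm ((1/2) *\<^sub>R (a + b)) powr r)"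
      using uniformly_convex_absorb[OF rs(2) \<delta>, where 'a='b] by blast
    obtain N :: nat where N: "D * r / (real N + 1) < \<epsilon> / 2"
    proof -
      obtain N :: nat where "D * r / (\<epsilon> / 2) < real N" using reals_Archimedean2 by blast
      then have "D * r / (real N + 1) < \<epsilon> / 2" using \<epsilon> by (simp add: field_simps)
      then show ?thesis by (rule that)
    qed
    have "pint M r (\<lambda>x. Fk i x - Fk j x) < \<epsilon>" if ij: "i \<ge> N" "j \<ge> N" for i j
    proof -
      define H where "H x = (1/2) *\<^sub>R (Fk i x + Fk j x)" for x
      have HY: "H \<in> Y" unfolding H_def using Fk(1) by (intro Yscale Yadd)
      have GH: "G H = (G (Fk i) + G (Fk j)) / 2" unfolding H_def
        using G_scale[OF Yadd[OF Fk(1)[of i] Fk(1)[of j]], of "1/2"] G_add[OF Fk(1)[of i] Fk(1)[of j]] by simp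
      have "pint M r (\<lambda>x. Fk i x - Fk j x) \<le> (LINT x|M. \<delta> * (norm (Fk i x) powr r + norm (Fk j x) powr r)
           + D * ((norm (Fk i x) powr r + norm (Fk j x) powr r) / 2 - norm (H x) powr r))"
        unfolding pint_def
        by (rule integral_mono) (use Lfun_diff(1)[OF FkL[of i] FkL[of j] r0] FkL YL[OF HY] D(2) in \<open>auto simp: Lfun_def H_def\<close>)
      also have "\<dots> = \<delta> * (pint M r (Fk i) + pint M r (Fk j)) + D * ((pint M r (Fk i) + pint M r (Fk j)) / 2 - pint M r H)"
        unfolding pint_def using FkL YL[OF HY] by (auto simp: Lfun_def)
      \<comment> \<open>The linear G cancels in the midpoint defect, so the defect of the integral
        is r times that of J. The latter is at most 1 / (N + 1), because J H is not below the
        infimum.\<close>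
      also have "(pint M r (Fk i) + pint M r (Fk j)) / 2 - pint M r H = r * ((J (Fk i) + J (Fk j)) / 2 - J H)"
        unfolding J_def GH using r0 by (simp add: field_simps)
      also have "\<delta> * (pint M r (Fk i) + pint M r (Fk j)) + D * (r * ((J (Fk i) + J (Fk j)) / 2 - J H)) \<le>
          \<delta> * (A + A) + D * (r * (1 / (real N + 1)))"
      proof (intro add_mono mult_left_mono)
        have *: "1 / (real i + 1) \<le> 1 / (real N + 1)" "1 / (real j + 1) \<le> 1 / (real N + 1)"
          using ij by (auto intro!: divide_left_mono)
        show "(J (Fk i) + J (Fk j)) / 2 - J H \<le> 1 / (real N + 1)"
          using Fk(2)[of i] Fk(2)[of j] mJ[OF HY] * by argo
      qed (use FkA \<delta> D r0 in auto)
      also have "\<dots> = \<epsilon> * (A / (2 * (A + 1))) + D * r / (real N + 1)"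
      proof -
        have "\<delta> * (A + A) = \<epsilon> * (A / (2 * (A + 1)))" using A0 by (simp add: \<delta>_def field_simps)
        then show ?thesis by simp
      qed
      also have "\<dots> < \<epsilon>"
      proof -
        have "\<epsilon> * (A / (2 * (A + 1))) \<le> \<epsilon> * (1/2)" using \<epsilon> A0 by (intro mult_left_mono) (auto simp: field_simps)
        then show ?thesis using N by linarith
      qed
      finally show ?thesis .
    qed
    then show "\<exists>N. \<forall>m\<ge>N. \<forall>n\<ge>N. pint M r (\<lambda>x. Fk m x - Fk n x) < \<epsilon>" by blast
  qed
  then obtain F where FL: "F \<in> Lfun M r" and Flim: "(\<lambda>k. pint M r (\<lambda>x. Fk k x - F x)) \<longlonglongrightarrow> 0" by blast
  have FY: "F \<in> Y" by (rule Yclosed[OF Fk(1) FL Flim])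
  have Glim: "(\<lambda>k. G (Fk k)) \<longlonglongrightarrow> G F"
  proof -
    have "G (\<lambda>x. Fk k x - F x) = G (Fk k) - G F" for k
      using G_add[OF Fk(1)[of k] Yscale[OF FY, of "-1"]] G_scale[OF FY, of "-1"] by simp
    moreover have "\<bar>G (\<lambda>x. Fk k x - F x)\<bar> \<le> C' * pint M r (\<lambda>x. Fk k x - F x) powr (1/r)" for k
      using GC'[OF Yadd[OF Fk(1)[of k] Yscale[OF FY, of "-1"]]] by simp
    ultimately have b: "\<bar>G (Fk k) - G F\<bar> \<le> C' * pint M r (\<lambda>x. Fk k x - F x) powr (1/r)" for k by metis
    have "(\<lambda>k. C' * pint M r (\<lambda>x. Fk k x - F x) powr (1/r)) \<longlonglongrightarrow> C' * 0 powr (1/r)"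
      by (intro tendsto_mult_left tendsto_powr2 Flim) (use r0 in auto)
    then have c: "(\<lambda>k. C' * pint M r (\<lambda>x. Fk k x - F x) powr (1/r)) \<longlonglongrightarrow> 0" by simp
    have "(\<lambda>k. G (Fk k) - G F) \<longlonglongrightarrow> 0"
      by (rule Lim_null_comparison[OF always_eventually c]) (use b in simp)
    then show ?thesis by (rule LIM_zero_cancel)
  qed
  obtain \<rho> :: "nat \<Rightarrow> nat" where \<rho>: "strict_mono \<rho>" "AE x in M. (\<lambda>k. Fk (\<rho> k) x) \<longlonglongrightarrow> F x"
    using Lfun_conv_AE_subseq[OF Lfun_diff(1)[OF FkL FL r0] Flim r0] by blast
  \<comment> \<open>Lower semicontinuity of J: G converges along the minimizing sequence, and
    Fatou's lemma along an a.e. convergent subsequence bounds the integral.\<close>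
  have JF: "J F \<le> m"
  proof (rule field_le_epsilon)
    fix \<epsilon> :: real assume \<epsilon>: "\<epsilon> > 0"
    have "(\<lambda>k. G (Fk (\<rho> k))) \<longlonglongrightarrow> G F" using LIMSEQ_subseq_LIMSEQ[OF Glim \<rho>(1)] by (simp add: o_def)
    then obtain N1 where N1: "\<And>k. k \<ge> N1 \<Longrightarrow> \<bar>G (Fk (\<rho> k)) - G F\<bar> < \<epsilon>/2"
      using LIMSEQ_D[of _ _ "\<epsilon>/2"] \<epsilon> by (metis half_gt_zero real_norm_def)
    obtain N2 :: nat where N2: "1 / (real N2 + 1) < \<epsilon> / 2"
      using \<epsilon> reals_Archimedean[of "\<epsilon>/2"] by (auto simp: inverse_eq_divide add.commute)
    define K where "K = max N1 N2"
    have b: "pint M r (Fk (\<rho> (k + K))) \<le> r * (m + \<epsilon> + G F)" for k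
    proof -
      have "\<rho> (k + K) \<ge> N2" using strict_mono_imp_increasing[OF \<rho>(1), of "k + K"] unfolding K_def by linarith
      then have "1 / (real (\<rho> (k + K)) + 1) \<le> 1 / (real N2 + 1)" by (intro divide_left_mono) auto
      then have "J (Fk (\<rho> (k + K))) \<le> m + \<epsilon>/2" using Fk(2)[of "\<rho> (k+K)"] N2 by linarith
      moreover have "G (Fk (\<rho> (k + K))) \<le> G F + \<epsilon>/2" using N1[of "k + K"] unfolding K_def by linarith
      ultimately have "pint M r (Fk (\<rho> (k + K))) / r \<le> m + \<epsilon> + G F" unfolding J_def by linarith
      then show ?thesis using r0 by (simp add: field_simps)
    qed
    have c: "AE x in M. (\<lambda>k. Fk (\<rho> (k + K)) x) \<longlonglongrightarrow> F x"
      using \<rho>(2) by eventually_elim (rule LIMSEQ_ignore_initial_segment)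
    have "pint M r F \<le> r * (m + \<epsilon> + G F)"
      using Lfun_fatou(2)[OF FkL b c Lfun_measurable[OF FL] r0] .
    then show "J F \<le> m + \<epsilon>" unfolding J_def using r0 by (simp add: field_simps)
  qed
  have EL: "G H \<le> (LINT x|M. flux r (F x) \<bullet> H x)" if HY: "H \<in> Y" for H
  proof -
    note HL = YL[OF HY]
    have [measurable]: "F \<in> borel_measurable M" "H \<in> borel_measurable M" using FL HL by (auto simp: Lfun_def)
    \<comment> \<open>The tangent inequality is taken at the perturbed point \<open>Ft\<close> and
      not at F. Minimality then gives an inequality for each t > 0 in which t can tend to 0 by
      dominated convergence.\<close>
    have step: "G H \<le> (LINT x|M. flux r (F x + t *\<^sub>R H x) \<bullet> H x)" if t: "t > 0" for t
    proof -
      define Ft where "Ft x = F x + t *\<^sub>R H x" for x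
      have FtY: "Ft \<in> Y" unfolding Ft_def by (intro Yadd Yscale FY HY)
      note FtL = YL[OF FtY]
      have GFt: "G Ft = G F + t * G H" unfolding Ft_def using G_add[OF FY Yscale[OF HY]] G_scale[OF HY] by simp
      have iFt: "integrable M (\<lambda>x. flux r (Ft x) \<bullet> H x)"
        using holder_inner(1)[OF rs HL flux_Lfun(1)[OF rs FtL]] by (simp add: inner_commute)
      have "pint M r Ft - r * t * (LINT x|M. flux r (Ft x) \<bullet> H x) = (LINT x|M. norm (Ft x) powr r + r * (flux r (Ft x) \<bullet> (F x - Ft x)))"
        using FtL iFt by (simp add: pint_def Lfun_def Ft_def)
      also have "\<dots> \<le> pint M r F" unfolding pint_def
      proof (rule integral_mono)
        show "integrable M (\<lambda>x. norm (Ft x) powr r + r * (flux r (Ft x) \<bullet> (F x - Ft x)))"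
          using Lfun_integrable[OF FtL] iFt by (simp add: Ft_def)
      qed (use Lfun_integrable[OF FL] flux_subgradient[OF rs(2)] in auto)
      finally have "pint M r Ft / r - pint M r F / r \<le> t * (LINT x|M. flux r (Ft x) \<bullet> H x)"
        using r0 by (simp add: field_simps)
      moreover have "J F \<le> J Ft" using JF mJ[OF FtY] by linarith
      ultimately have "t * G H \<le> t * (LINT x|M. flux r (Ft x) \<bullet> H x)" unfolding J_def GFt by argo
      then show ?thesis using t unfolding Ft_def by simp
    qed
    define Q where "Q x = norm (F x) + norm (H x)" for x
    have QL: "Q \<in> Lfun M r" unfolding Q_def using Lfun_add(1)[OF Lfun_norm[OF FL] Lfun_norm[OF HL] r0] .
    have "(\<lambda>k. LINT x|M. flux r (F x + inverse (real (Suc k)) *\<^sub>R H x) \<bullet> H x) \<longlonglongrightarrow> (LINT x|M. flux r (F x) \<bullet> H x)"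
    proof (rule integral_dominated_convergence)
      show "integrable M (\<lambda>x. norm (Q x) powr r)" using QL by (simp add: Lfun_def)
      show "AE x in M. (\<lambda>k. flux r (F x + inverse (real (Suc k)) *\<^sub>R H x) \<bullet> H x) \<longlonglongrightarrow> flux r (F x) \<bullet> H x"
      proof (rule AE_I2)
        fix x
        have "(\<lambda>k. F x + inverse (real (Suc k)) *\<^sub>R H x) \<longlonglongrightarrow> F x + 0 *\<^sub>R H x"
          by (intro tendsto_intros LIMSEQ_inverse_real_of_nat)
        moreover have "isCont (flux r) (F x)" using continuous_flux[OF rs(2)] continuous_on_eq_continuous_at by blast
        ultimately have "(\<lambda>k. flux r (F x + inverse (real (Suc k)) *\<^sub>R H x)) \<longlonglongrightarrow> flux r (F x)"
          using isCont_tendsto_compose by fastforce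
        then show "(\<lambda>k. flux r (F x + inverse (real (Suc k)) *\<^sub>R H x) \<bullet> H x) \<longlonglongrightarrow> flux r (F x) \<bullet> H x"
          by (intro tendsto_intros)
      qed
      fix k
      show "AE x in M. norm (flux r (F x + inverse (real (Suc k)) *\<^sub>R H x) \<bullet> H x) \<le> norm (Q x) powr r"
      proof (rule AE_I2)
        fix x
        define t where "t = inverse (real (Suc k))"
        have t: "0 \<le> t" "t \<le> 1" unfolding t_def by (auto simp: field_simps)
        have "norm (F x + t *\<^sub>R H x) \<le> norm (F x) + t * norm (H x)" using t norm_triangle_ineq[of "F x" "t *\<^sub>R H x"] by simp
        also have "\<dots> \<le> Q x" unfolding Q_def using t mult_right_mono[of t 1 "norm (H x)"] by simp
        finally have n: "norm (F x + t *\<^sub>R H x) \<le> Q x" .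
        have "norm (flux r (F x + t *\<^sub>R H x) \<bullet> H x) \<le> norm (F x + t *\<^sub>R H x) powr (r-1) * norm (H x)"
          using flux_inner_le by auto
        also have "\<dots> \<le> Q x powr (r-1) * Q x"
          using n rs by (intro mult_mono powr_mono2) (auto simp: Q_def)
        also have "\<dots> = Q x powr r" using powr_add[of "Q x" "r-1" 1]
          by (cases "Q x = 0") (auto simp: Q_def)
        finally show "norm (flux r (F x + inverse (real (Suc k)) *\<^sub>R H x) \<bullet> H x) \<le> norm (Q x) powr r"
          by (simp add: t_def Q_def)
      qed
    qed auto
    moreover have "G H \<le> (LINT x|M. flux r (F x + inverse (real (Suc k)) *\<^sub>R H x) \<bullet> H x)" for k
      by (rule step) simp
    ultimately show ?thesis using LIMSEQ_le_const by blast
  qed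
  \<comment> \<open>The one-sided inequality is used for H and for its negative.\<close>
  have "(LINT x|M. flux r (F x) \<bullet> H x) = G H" if HY: "H \<in> Y" for H
    using EL[OF HY] EL[OF Yscale[OF HY, of "-1"]] G_scale[OF HY, of "-1"] by simp
  then show ?thesis using FY by blast
qed

text \<open>The direct method with the whole space as Y: the flux of the minimizer lies in L^s and
  is the representing function.\<close>

corollary Lfun_riesz:
  fixes G :: "('a \<Rightarrow> 'b::euclidean_space) \<Rightarrow> real"
  assumes rs: "1/r + 1/s = 1" "r > 1"
    and G_add: "\<And>F H. F \<in> Lfun M r \<Longrightarrow> H \<in> Lfun M r \<Longrightarrow> G (\<lambda>x. F x + H x) = G F + G H"
    and G_scale: "\<And>c F. F \<in> Lfun M r \<Longrightarrow> G (\<lambda>x. c *\<^sub>R F x) = c * G F"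
    and G_bound: "\<And>F. F \<in> Lfun M r \<Longrightarrow> \<bar>G F\<bar> \<le> C * pint M r F powr (1/r)"
  shows "\<exists>V\<in>Lfun M s. \<forall>H\<in>Lfun M r. (LINT x|M. V x \<bullet> H x) = G H"
proof -
  have "closed_subspace_Lfun M r (Lfun M r :: ('a \<Rightarrow> 'b) set)" using rs by (intro closed_subspace_Lfun_UNIV) simp
  then have "\<exists>F\<in>Lfun M r. \<forall>H\<in>Lfun M r. (LINT x|M. flux r (F x) \<bullet> H x) = G H"
    by (rule flux_represents_functional[OF rs]) (fact G_add G_scale G_bound)+
  then obtain F where "F \<in> Lfun M r" "\<forall>H\<in>Lfun M r. (LINT x|M. flux r (F x) \<bullet> H x) = G H" by blast
  then show ?thesis using flux_Lfun(1)[OF rs] by (intro bexI[of _ "\<lambda>x. flux r (F x)"]) auto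
qed

text \<open>A double annihilator theorem. The functional given by the flux of V is represented on Y
  by the flux of some H in Y. The difference of the two fluxes annihilates Y, hence V as well, so
  its integral against H - V vanishes and strict monotonicity yields H = V a.e.\<close>

lemma annihilator_closed_subspace:
  fixes Y :: "('a \<Rightarrow> 'b::euclidean_space) set"
  assumes rs: "1/r + 1/s = 1" "r > 1" and Y: "closed_subspace_Lfun M r Y" and V: "V \<in> Lfun M r"
    and ann: "\<And>F. F \<in> Lfun M s \<Longrightarrow> (\<And>H. H \<in> Y \<Longrightarrow> (LINT x|M. F x \<bullet> H x) = 0) \<Longrightarrow> (LINT x|M. F x \<bullet> V x) = 0"
  shows "\<exists>H\<in>Y. AE x in M. H x = V x"
proof -
  have YL: "F \<in> Lfun M r" if "F \<in> Y" for F using Y that by (auto simp: closed_subspace_Lfun_def)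
  note fV = flux_Lfun[OF rs V]
  have i: "integrable M (\<lambda>x. flux r (F x) \<bullet> H x)" if "F \<in> Lfun M r" "H \<in> Lfun M r" for F H
    using holder_inner(1)[OF rs that(2) flux_Lfun(1)[OF rs that(1)]] by (simp add: inner_commute)
  have "\<exists>F\<in>Y. \<forall>H\<in>Y. (LINT x|M. flux r (F x) \<bullet> H x) = (LINT x|M. flux r (V x) \<bullet> H x)"
  proof (rule flux_represents_functional[OF rs Y])
    fix F assume "F \<in> Y"
    then show "\<bar>LINT x|M. flux r (V x) \<bullet> F x\<bar> \<le> pint M s (\<lambda>x. flux r (V x)) powr (1/s) * pint M r F powr (1/r)"
      using holder_inner(2)[OF rs YL fV(1)] by (simp add: inner_commute mult.commute)
  qed (use YL i[OF V] in \<open>simp_all add: inner_add_right\<close>)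
  then obtain H where H: "H \<in> Y" "\<And>K. K \<in> Y \<Longrightarrow> (LINT x|M. flux r (H x) \<bullet> K x) = (LINT x|M. flux r (V x) \<bullet> K x)" by blast
  note HL = YL[OF H(1)]
  have [measurable]: "V \<in> borel_measurable M" "H \<in> borel_measurable M" using V HL by (auto simp: Lfun_def)
  have z: "(LINT x|M. (flux r (H x) - flux r (V x)) \<bullet> K x) = 0" if "K \<in> Y" for K
    using H(2)[OF that] i[OF HL YL[OF that]] i[OF V YL[OF that]] by (simp add: inner_diff_left)
  have "(LINT x|M. (flux r (H x) - flux r (V x)) \<bullet> V x) = 0"
    by (rule ann[OF Lfun_diff(1)[OF flux_Lfun(1)[OF rs HL] fV(1)] z]) (use conjugate_exponents[OF rs] in auto)
  moreover note z[OF H(1)]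
  moreover have ii: "integrable M (\<lambda>x. (flux r (H x) - flux r (V x)) \<bullet> H x)" "integrable M (\<lambda>x. (flux r (H x) - flux r (V x)) \<bullet> V x)"
    using i[OF HL HL] i[OF V HL] i[OF HL V] i[OF V V] by (simp_all add: inner_diff_left)
  ultimately have "(LINT x|M. (flux r (H x) - flux r (V x)) \<bullet> (H x - V x)) = 0"
    by (simp add: inner_diff_right)
  moreover have "integrable M (\<lambda>x. (flux r (H x) - flux r (V x)) \<bullet> (H x - V x))"
    using ii by (simp add: inner_diff_right)
  ultimately have "AE x in M. (flux r (H x) - flux r (V x)) \<bullet> (H x - V x) = 0"
    by (subst (asm) integral_nonneg_eq_0_iff_AE) (auto intro: flux_monotone[OF rs(2)])
  then have "AE x in M. H x = V x" by eventually_elim (rule flux_strictly_monotone[OF rs(2)])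
  then show ?thesis using H(1) by blast
qed

text \<open>In the integrated absorption bound the small factor multiplies bounded integrals, and
  the remaining term is a multiple of the distance.\<close>

lemma flux_tendsto_Lfun:
  fixes F :: "nat \<Rightarrow> 'a \<Rightarrow> 'b::euclidean_space"
  assumes rs: "1/r + 1/s = 1" "r > 1" and F: "\<And>k. F k \<in> Lfun M r" and F0: "F0 \<in> Lfun M r"
    and lim: "(\<lambda>k. pint M r (\<lambda>x. F k x - F0 x)) \<longlonglongrightarrow> 0"
  shows "(\<lambda>k. pint M s (\<lambda>x. flux r (F k x) - flux r (F0 x))) \<longlonglongrightarrow> 0"
proof (rule LIMSEQ_I)
  fix \<epsilon> :: real assume \<epsilon>: "\<epsilon> > 0"
  note s = conjugate_exponents[OF rs]
  have r0: "r > 0" using rs by simp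
  \<comment> \<open>Bounds the sum of the two integrals as soon as the distance is below 1.\<close>
  define A where "A = 2 powr r * (1 + pint M r F0) + pint M r F0"
  have A0: "A \<ge> 0" unfolding A_def by (intro add_nonneg_nonneg mult_nonneg_nonneg) auto
  define \<delta> where "\<delta> = \<epsilon> / (2 * (A + 1))"
  have \<delta>: "\<delta> > 0" using \<epsilon> A0 by (simp add: \<delta>_def)
  obtain D where D: "D \<ge> 0" "\<And>a b :: 'b. norm (flux r a - flux r b) powr (r/(r-1)) \<le> \<delta> * (norm a powr r + norm b powr r) + D * norm (a - b) powr r"
    using flux_continuity_absorb[OF rs(2) \<delta>, where 'a='b] by blast
  have "(\<lambda>k. D * pint M r (\<lambda>x. F k x - F0 x)) \<longlonglongrightarrow> D * 0" by (intro tendsto_mult_left lim)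
  then have "eventually (\<lambda>k. D * pint M r (\<lambda>x. F k x - F0 x) < \<epsilon>/2 \<and> pint M r (\<lambda>x. F k x - F0 x) < 1) sequentially"
    using \<epsilon> lim by (intro eventually_conj order_tendstoD(2)[where y=0]) auto
  then obtain N where N: "\<And>k. k \<ge> N \<Longrightarrow> D * pint M r (\<lambda>x. F k x - F0 x) < \<epsilon>/2" "\<And>k. k \<ge> N \<Longrightarrow> pint M r (\<lambda>x. F k x - F0 x) < 1"
    by (auto simp: eventually_sequentially)
  have "norm (pint M s (\<lambda>x. flux r (F k x) - flux r (F0 x)) - 0) < \<epsilon>" if "k \<ge> N" for k
  proof -
    note dL = Lfun_diff[OF F[of k] F0 r0]
    have "pint M r (F k) \<le> 2 powr r * (pint M r (\<lambda>x. F k x - F0 x) + pint M r F0)"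
      using Lfun_add(2)[OF dL(1) F0 r0] by simp
    also have "\<dots> \<le> 2 powr r * (1 + pint M r F0)" using N(2)[OF that] by (intro mult_left_mono) auto
    finally have A: "pint M r (F k) + pint M r F0 \<le> A" by (simp add: A_def)
    have "pint M s (\<lambda>x. flux r (F k x) - flux r (F0 x)) \<le> (LINT x|M. \<delta> * (norm (F k x) powr r + norm (F0 x) powr r) + D * norm (F k x - F0 x) powr r)"
      unfolding pint_def
    proof (rule integral_mono)
      show "integrable M (\<lambda>x. norm (flux r (F k x) - flux r (F0 x)) powr s)"
        using Lfun_diff(1)[OF flux_Lfun(1)[OF rs F[of k]] flux_Lfun(1)[OF rs F0]] s by (simp add: Lfun_def)
    qed (use D(2) F F0 dL s(1) in \<open>auto simp: Lfun_def\<close>)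
    also have "\<dots> = \<delta> * (pint M r (F k) + pint M r F0) + D * pint M r (\<lambda>x. F k x - F0 x)"
      using F[of k] F0 dL by (simp add: Lfun_def pint_def)
    also have "\<dots> \<le> \<delta> * A + D * pint M r (\<lambda>x. F k x - F0 x)" using A \<delta> by simp
    also have "\<dots> < \<epsilon>"
    proof -
      have "\<delta> * A = \<epsilon> / 2 * (A / (A + 1))" by (simp add: \<delta>_def)
      also have "\<dots> \<le> \<epsilon> / 2 * 1" using \<epsilon> A0 by (intro mult_left_mono) auto
      finally show ?thesis using N(1)[OF that] by simp
    qed
    finally show ?thesis by simp
  qed
  then show "\<exists>N. \<forall>k\<ge>N. norm (pint M s (\<lambda>x. flux r (F k x) - flux r (F0 x)) - 0) < \<epsilon>" by blast
qed

section \<open>Smooth bump functions\<close>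

text \<open>The family over all polynomials P is closed under differentiation, so smoothness at 0 of
  the classical cutoff exp(-c/t) follows by induction on the order. The parameter c will tend to
  0.\<close>

definition flat :: "real poly \<Rightarrow> real \<Rightarrow> real \<Rightarrow> real" where
  "flat P c t = (if t > 0 then poly P (1/t) * exp (- c / t) else 0)"

lemma tendsto_power_exp_neg:
  assumes "c > (0::real)"
  shows "((\<lambda>y. y ^ n * exp (- c * y)) \<longlongrightarrow> 0) at_top"
proof -
  have "filterlim (\<lambda>y. c * y) at_top at_top"
    using assms by (intro filterlim_tendsto_pos_mult_at_top[OF tendsto_const] filterlim_ident)
  from filterlim_compose[OF tendsto_power_div_exp_0 this]
  have "((\<lambda>y. inverse (c ^ n) * ((c * y) ^ n / exp (c * y))) \<longlongrightarrow> inverse (c ^ n) * 0) at_top"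
    by (intro tendsto_mult_left)
  moreover have "inverse (c ^ n) * ((c * y) ^ n / exp (c * y)) = y ^ n * exp (- c * y)" for y
    using assms by (simp add: power_mult_distrib exp_minus field_simps)
  ultimately show ?thesis by simp
qed

lemma tendsto_poly_exp_neg:
  assumes "c > (0::real)"
  shows "((\<lambda>y. y ^ n * poly P y * exp (- c * y)) \<longlongrightarrow> 0) at_top"
proof (induction P arbitrary: n)
  case 0
  then show ?case by simp
next
  case (pCons a P)
  have "((\<lambda>y. a * (y ^ n * exp (- c * y)) + y ^ Suc n * poly P y * exp (- c * y)) \<longlongrightarrow> a * 0 + 0) at_top"
    by (intro tendsto_add tendsto_mult_left tendsto_power_exp_neg assms pCons)
  then show ?case by (simp add: algebra_simps)
qed

lemma flat_tendsto_0:
  assumes "c > 0"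
  shows "(flat P c \<longlongrightarrow> 0) (at 0)"
proof -
  have "((\<lambda>t. poly P (inverse t) * exp (- c * inverse t)) \<longlongrightarrow> 0) (at_right 0)"
    using filterlim_compose[OF tendsto_poly_exp_neg[OF assms, of 0 P] filterlim_inverse_at_top_right] by simp
  moreover have "eventually (\<lambda>t. poly P (inverse t) * exp (- c * inverse t) = flat P c t) (at_right 0)"
    using eventually_at_right_less[of "0::real"] by eventually_elim (simp add: flat_def divide_inverse)
  ultimately have "(flat P c \<longlongrightarrow> 0) (at_right 0)" by (rule Lim_transform_eventually)
  moreover have "(flat P c \<longlongrightarrow> 0) (at_left 0)"
    by (rule tendsto_eventually) (auto simp: eventually_at_filter flat_def)
  ultimately show ?thesis by (simp add: filterlim_at_split)
qed

text \<open>With y = 1/t, differentiation in t multiplies by y^2 and replaces P by c P - P'.\<close>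

definition flat_deriv :: "real poly \<Rightarrow> real \<Rightarrow> real poly" where
  "flat_deriv P c = monom 1 2 * (smult c P - pderiv P)"

lemma flat_has_derivative:
  assumes c: "c > 0"
  shows "(flat P c has_real_derivative flat (flat_deriv P c) c t) (at t)"
proof -
  consider "t > 0" | "t < 0" | "t = 0" by linarith
  then show ?thesis
  proof cases
    case 1
    have "((\<lambda>t. poly P (1/t) * exp (- c / t)) has_real_derivative
        (poly (pderiv P) (1/t) * (- 1/t^2)) * exp (- c/t) + (exp (- c/t) * (c/t^2)) * poly P (1/t)) (at t)"
      using 1 by (auto intro!: derivative_eq_intros DERIV_chain2[OF poly_DERIV] simp: power2_eq_square)
    moreover have "(poly (pderiv P) (1/t) * (- 1/t^2)) * exp (- c/t) + (exp (- c/t) * (c/t^2)) * poly P (1/t)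
       = flat (flat_deriv P c) c t"
      using 1 by (simp add: flat_def flat_deriv_def poly_monom power_one_over field_simps)
    ultimately have "((\<lambda>t. poly P (1/t) * exp (- c / t)) has_real_derivative flat (flat_deriv P c) c t) (at t)" by simp
    then show ?thesis
      by (rule has_field_derivative_transform_within_open[of _ _ _ "{0<..}"]) (use 1 in \<open>auto simp: flat_def\<close>)
  next
    case 2
    have "((\<lambda>t. 0) has_real_derivative flat (flat_deriv P c) c t) (at t)" using 2 by (simp add: flat_def)
    then show ?thesis
      by (rule has_field_derivative_transform_within_open[of _ _ _ "{..<0}"]) (use 2 in \<open>auto simp: flat_def\<close>)
  next
    case 3
    \<comment> \<open>\<open>pCons 0 P\<close> is P times its variable, so
      \<open>flat (pCons 0 P) c\<close> is the difference quotient of \<open>flat P c\<close> at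
      0.\<close>
    have "(flat (pCons 0 P) c \<longlongrightarrow> 0) (at 0)" by (rule flat_tendsto_0[OF c])
    moreover have "eventually (\<lambda>h. flat (pCons 0 P) c h = (flat P c (0 + h) - flat P c 0) / h) (at 0)"
      by (auto simp: eventually_at_filter flat_def)
    ultimately have "((\<lambda>h. (flat P c (0 + h) - flat P c 0) / h) \<longlongrightarrow> 0) (at 0)"
      by (rule Lim_transform_eventually)
    then show ?thesis unfolding 3 DERIV_def by (simp add: flat_def)
  qed
qed

section \<open>Differentiation rules for \<open>C_k\<close> functions\<close>

lemma C_k_SucD: "C_k (Suc k) \<phi> \<Longrightarrow> C_k k \<phi>"
  by (induction k arbitrary: \<phi>) (auto intro: differentiable_imp_continuous_on)

lemma C_k_SucI:
  assumes "\<And>x. (\<phi> has_derivative \<phi>' x) (at x)" "\<And>b. b \<in> Basis \<Longrightarrow> C_k k (\<lambda>x. \<phi>' x b)"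
  shows "C_k (Suc k) \<phi>"
proof -
  have "frechet_derivative \<phi> (at x) = \<phi>' x" for x using frechet_derivative_at[OF assms(1)] by simp
  then show ?thesis using assms by (auto simp: differentiable_on_def differentiable_def)
qed

lemma C_k_SucE:
  assumes "C_k (Suc k) \<phi>"
  shows "(\<phi> has_derivative frechet_derivative \<phi> (at x)) (at x)"
    "b \<in> Basis \<Longrightarrow> C_k k (\<lambda>x. frechet_derivative \<phi> (at x) b)"
  using assms by (auto simp: differentiable_on_def frechet_derivative_works)

lemma C_k_const: "C_k k (\<lambda>x. a)"
proof (induction k arbitrary: a)
  case (Suc k)
  show ?case by (rule C_k_SucI[where \<phi>'="\<lambda>x h. 0"]) (use Suc in auto)
qed simp

lemma C_k_add: "C_k k \<phi> \<Longrightarrow> C_k k \<psi> \<Longrightarrow> C_k k (\<lambda>x. \<phi> x + \<psi> x)"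
proof (induction k arbitrary: \<phi> \<psi>)
  case (Suc k)
  show ?case
  proof (rule C_k_SucI[OF has_derivative_add[OF C_k_SucE(1)[OF Suc.prems(1)] C_k_SucE(1)[OF Suc.prems(2)]]])
    fix b :: 'a assume b: "b \<in> Basis"
    show "C_k k (\<lambda>x. frechet_derivative \<phi> (at x) b + frechet_derivative \<psi> (at x) b)"
      by (rule Suc.IH[OF C_k_SucE(2)[OF Suc.prems(1) b] C_k_SucE(2)[OF Suc.prems(2) b]])
  qed
qed (auto intro: continuous_intros)

lemma C_k_mult: "C_k k \<phi> \<Longrightarrow> C_k k \<psi> \<Longrightarrow> C_k k (\<lambda>x. \<phi> x * \<psi> x)"
proof (induction k arbitrary: \<phi> \<psi>)
  case (Suc k)
  note L = C_k_SucD[OF Suc.prems(1)] C_k_SucD[OF Suc.prems(2)]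
  show ?case
  proof (rule C_k_SucI[OF has_derivative_mult[OF C_k_SucE(1)[OF Suc.prems(1)] C_k_SucE(1)[OF Suc.prems(2)]]])
    fix b :: 'a assume b: "b \<in> Basis"
    show "C_k k (\<lambda>x. \<phi> x * frechet_derivative \<psi> (at x) b + frechet_derivative \<phi> (at x) b * \<psi> x)"
      by (rule C_k_add[OF Suc.IH[OF L(1) C_k_SucE(2)[OF Suc.prems(2) b]] Suc.IH[OF C_k_SucE(2)[OF Suc.prems(1) b] L(2)]])
  qed
qed (auto intro: continuous_intros)

lemma C_k_prod: "(\<And>i. i \<in> I \<Longrightarrow> C_k k (\<phi> i)) \<Longrightarrow> C_k k (\<lambda>x. \<Prod>i\<in>I. \<phi> i x)"
  by (induction I rule: infinite_finite_induct) (auto intro: C_k_const C_k_mult)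

lemma C_k_flat: "c > 0 \<Longrightarrow> C_k k (\<lambda>x. flat P c (x \<bullet> v + d))"
proof (induction k arbitrary: P)
  case 0
  have "isCont (flat P c) t" for t using flat_has_derivative[OF 0] DERIV_isCont by blast
  then have "continuous_on UNIV (flat P c)" by (simp add: continuous_at_imp_continuous_on)
  then show ?case by (auto intro!: continuous_on_compose2[of UNIV "flat P c"] continuous_intros)
next
  case (Suc k)
  show ?case
  proof (rule C_k_SucI)
    fix x
    show "((\<lambda>x. flat P c (x \<bullet> v + d)) has_derivative (\<lambda>h. (h \<bullet> v) * flat (flat_deriv P c) c (x \<bullet> v + d))) (at x)"
      by (rule DERIV_compose_FDERIV[OF flat_has_derivative[OF Suc.prems]]) (auto intro!: derivative_eq_intros)
  qed (intro C_k_mult C_k_const Suc)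
qed

text \<open>One smooth factor for each face of the box with corners l and r. As c decreases to 0 the
  bumps converge boundedly to the indicator of the open box, so test functions reach indicators
  without any convolution.\<close>

definition bump :: "real \<Rightarrow> 'a::euclidean_space \<Rightarrow> 'a \<Rightarrow> 'a \<Rightarrow> real" where
  "bump c l r x = (\<Prod>b\<in>Basis. flat 1 c (x \<bullet> b - l \<bullet> b) * flat 1 c (r \<bullet> b - x \<bullet> b))"

lemma C_k_bump: "c > 0 \<Longrightarrow> C_k k (bump c l r)"
  unfolding bump_def[abs_def]
proof (intro C_k_prod C_k_mult)
  fix b :: 'a assume c: "c > 0"
  show "C_k k (\<lambda>x. flat 1 c (x \<bullet> b - l \<bullet> b))" using C_k_flat[OF c, of k 1 b "- (l \<bullet> b)"] by simp
  show "C_k k (\<lambda>x. flat 1 c (r \<bullet> b - x \<bullet> b))" using C_k_flat[OF c, of k 1 "- b" "r \<bullet> b"] by simp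
qed

lemma flat_1: "flat 1 c t = (if t > 0 then exp (- c / t) else 0)"
  by (simp add: flat_def)

lemma bump_outside: "x \<notin> box l r \<Longrightarrow> bump c l r x = 0"
  by (force simp: bump_def mem_box flat_1 intro!: prod_zero)

lemma bump_bounds: "c > 0 \<Longrightarrow> 0 \<le> bump c l r x" "c > 0 \<Longrightarrow> bump c l r x \<le> 1"
proof -
  assume c: "c > 0"
  have f: "0 \<le> flat 1 c t" "flat 1 c t \<le> 1" for t using c by (auto simp: flat_1)
  show "0 \<le> bump c l r x" unfolding bump_def by (intro prod_nonneg ballI mult_nonneg_nonneg f)
  show "bump c l r x \<le> 1" unfolding bump_def by (intro prod_le_1 conjI mult_nonneg_nonneg f mult_le_one)
qed

lemma bump_tendsto_indicator:
  "(\<lambda>m. bump (1 / real (Suc m)) l r x) \<longlonglongrightarrow> indicat_real (box l r) x"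
proof (cases "x \<in> box l r")
  case True
  have z: "(\<lambda>m. 1 / real (Suc m)) \<longlonglongrightarrow> 0" using LIMSEQ_inverse_real_of_nat by (simp add: inverse_eq_divide)
  have 1: "(\<lambda>m. flat 1 (1 / real (Suc m)) t) \<longlonglongrightarrow> 1" if "t > 0" for t
  proof -
    have "(\<lambda>m. exp (- (1 / real (Suc m)) / t)) \<longlonglongrightarrow> exp (- 0 / t)"
      by (intro tendsto_exp tendsto_divide tendsto_minus z tendsto_const) (use that in auto)
    then show ?thesis using that by (simp add: flat_1)
  qed
  have "(\<lambda>m. bump (1 / real (Suc m)) l r x) \<longlonglongrightarrow> (\<Prod>b\<in>(Basis::'a set). 1 * 1)"
    unfolding bump_def using True by (intro tendsto_prod tendsto_mult 1) (auto simp: mem_box)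
  then show ?thesis using True by simp
qed (simp add: bump_outside)

lemma bump_test_function:
  assumes "cbox l r \<subseteq> \<Omega>" "c > 0"
  shows "bump c l r \<in> test_functions \<Omega>"
proof -
  have "{x. bump c l r x \<noteq> 0} \<subseteq> cbox l r" using bump_outside box_subset_cbox by blast
  then have cl: "closure {x. bump c l r x \<noteq> 0} \<subseteq> cbox l r" by (simp add: closure_minimal closed_cbox)
  moreover have "compact (closure {x. bump c l r x \<noteq> 0})"
    using cl bounded_subset[OF bounded_cbox] by (simp add: compact_eq_bounded_closed) blast
  ultimately show ?thesis using assms C_k_bump[OF assms(2)] by (auto simp: test_functions_def)
qed

section \<open>The fundamental lemma of the calculus of variations\<close>

text \<open>Boxes are stable under intersection and generate the Borel sets, so a Dynkin argument
  applies; the total integral serves the complement step.\<close>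

lemma integral_boxes_zero_imp_AE_zero:
  fixes g :: "'a::euclidean_space \<Rightarrow> real"
  assumes g: "integrable lborel g" and box: "\<And>a b. (LINT x|lborel. indicator (box a b) x * g x) = 0"
    and total: "(LINT x|lborel. g x) = 0"
  shows "AE x in lborel. g x = 0"
proof (rule sigma_finite_measure.density_zero[OF lborel.sigma_finite_measure_axioms g])
  fix A :: "'a set" assume "A \<in> sets lborel"
  then have A: "A \<in> sigma_sets UNIV (range (\<lambda>(a, b). box a b))"
    using borel_eq_box[where 'a='a] by (metis sets_lborel sets_measure_of top_greatest UNIV_I Pow_UNIV)
  have si: "set_integrable lborel B g" if "B \<in> sets borel" for B
    unfolding set_integrable_def using integrable_mult_indicator[of B lborel g] g that by simp
  have sb: "B \<in> sets borel" if "B \<in> sigma_sets UNIV (range (\<lambda>(a, b). box a b))" for B :: "'a set"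
    using that borel_eq_box[where 'a='a] by (metis sets_measure_of top_greatest Pow_UNIV)
  have "Int_stable (range (\<lambda>(a, b). box a b :: 'a set))"
    by (rule Int_stableI) (force simp: box_Int_box)
  moreover have "range (\<lambda>(a, b). box a b :: 'a set) \<subseteq> Pow UNIV" by simp
  ultimately show "set_lebesgue_integral lborel A g = 0" using A
  proof (induct A rule: sigma_sets_induct_disjoint)
    case (basic A)
    then show ?case using box by (auto simp: set_lebesgue_integral_def)
  next
    case empty
    then show ?case by (simp add: set_lebesgue_integral_def)
  next
    case (compl A)
    have "set_lebesgue_integral lborel (UNIV - A) g = set_lebesgue_integral lborel UNIV g - set_lebesgue_integral lborel A g"
    proof -
      have "(LINT x|lborel. indicator (UNIV - A) x *\<^sub>R g x) = (LINT x|lborel. indicator UNIV x *\<^sub>R g x - indicator A x *\<^sub>R g x)"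
        by (rule Bochner_Integration.integral_cong) (auto simp: indicator_def)
      then show ?thesis using si[of UNIV] si[OF sb[OF compl(1)]]
        unfolding set_lebesgue_integral_def set_integrable_def by simp
    qed
    then show ?case using compl total by (simp add: set_lebesgue_integral_def)
  next
    case (union A)
    have "set_lebesgue_integral lborel (\<Union>i. A i) g = (\<Sum>i. set_lebesgue_integral lborel (A i) g)"
    proof (rule lebesgue_integral_countable_add)
      show "A i \<in> sets lborel" for i using sb[of "A i"] union by auto
      then show "set_integrable lborel (\<Union>i. A i) g" by (intro si) auto
      show "A i \<inter> A j = {}" if "i \<noteq> j" for i j using union(1) that by (auto simp: disjoint_family_on_def)
    qed
    then show ?case using union by simp
  qed
qed

lemma integral_lebesgue_on_eq:
  fixes f :: "'a::euclidean_space \<Rightarrow> 'b::{banach, second_countable_topology}"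
  assumes "\<Omega> \<in> sets lebesgue"
  shows "(LINT x|lebesgue_on \<Omega>. f x) = (LINT x|lebesgue. indicator \<Omega> x *\<^sub>R f x)"
    "integrable (lebesgue_on \<Omega>) f \<longleftrightarrow> integrable lebesgue (\<lambda>x. indicator \<Omega> x *\<^sub>R f x)"
  using assms by (simp_all add: integral_restrict_space integrable_restrict_space)

lemma test_function_outside:
  assumes "\<phi> \<in> test_functions \<Omega>" "x \<notin> \<Omega>"
  shows "\<phi> x = 0"
  using assms closure_subset[of "{x. \<phi> x \<noteq> 0}"] by (auto simp: test_functions_def)

text \<open>Bumps with c tending to 0 transfer the hypothesis to indicators of boxes. Hence u
  vanishes a.e. on each cell inside \<Omega>, and countably many cells cover \<Omega>.\<close>

theorem fundamental_lemma:
  fixes u :: "'a::euclidean_space \<Rightarrow> real"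
  assumes \<Omega>: "open \<Omega>" and u: "locally_integrable \<Omega> u"
    and zero: "\<And>\<phi>. \<phi> \<in> test_functions \<Omega> \<Longrightarrow> (LINT x|lebesgue_on \<Omega>. u x * \<phi> x) = 0"
  shows "AE x in lebesgue_on \<Omega>. u x = 0"
proof -
  have \<Omega>m: "\<Omega> \<in> sets lebesgue" by (rule sets_completionI_sets) (use \<Omega> in simp)
  have iK: "integrable lebesgue (\<lambda>x. indicator (cbox l r) x * u x)" if "cbox l r \<subseteq> \<Omega>" for l r
    using u that unfolding locally_integrable_def by (auto simp: integral_lebesgue_on_eq dest!: spec[of _ "cbox l r"])
  have box0: "(LINT x|lebesgue. indicator (box l r) x * u x) = 0" if K: "cbox l r \<subseteq> \<Omega>" for l r
  proof -
    have f0: "(\<lambda>x. indicator (cbox l r) x * u x) \<in> borel_measurable lebesgue" using iK[OF K] by auto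
    have bm: "bump (1 / real (Suc m)) l r \<in> borel_measurable lebesgue" for m
    proof -
      have "C_k 0 (bump (1 / real (Suc m)) l r)" by (rule C_k_bump) simp
      then have "bump (1 / real (Suc m)) l r \<in> borel_measurable borel" by (simp add: borel_measurable_continuous_onI)
      then show ?thesis by (simp add: measurable_completion)
    qed
    have eq: "indicator (cbox l r) x * u x * indicator (box l r) x = indicator (box l r) x * u x" for x
      using box_subset_cbox[of l r] by (auto simp: indicator_def)
    have "(\<lambda>m. LINT x|lebesgue. (indicator (cbox l r) x * u x) * bump (1 / real (Suc m)) l r x)
        \<longlonglongrightarrow> (LINT x|lebesgue. indicator (cbox l r) x * u x * indicator (box l r) x)"
    proof (rule integral_dominated_convergence)
      show "integrable lebesgue (\<lambda>x. \<bar>indicator (cbox l r) x * u x\<bar>)" using iK[OF K] by (rule integrable_abs)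
      show "AE x in lebesgue. (\<lambda>m. indicator (cbox l r) x * u x * bump (1 / real (Suc m)) l r x)
          \<longlonglongrightarrow> indicator (cbox l r) x * u x * indicator (box l r) x"
        by (intro AE_I2 tendsto_intros bump_tendsto_indicator)
      show "AE x in lebesgue. norm (indicator (cbox l r) x * u x * bump (1 / real (Suc m)) l r x) \<le> \<bar>indicator (cbox l r) x * u x\<bar>" for m
        using bump_bounds[of "1 / real (Suc m)" l r]
        by (intro AE_I2) (auto simp: abs_mult intro!: mult_left_le)
      show "(\<lambda>x. indicator (cbox l r) x * u x * indicator (box l r) x) \<in> borel_measurable lebesgue"
        by (intro borel_measurable_times f0 borel_measurable_indicator) auto
      show "(\<lambda>x. indicator (cbox l r) x * u x * bump (1 / real (Suc m)) l r x) \<in> borel_measurable lebesgue" for m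
        by (intro borel_measurable_times f0 bm)
    qed
    moreover have "(LINT x|lebesgue. (indicator (cbox l r) x * u x) * bump (1 / real (Suc m)) l r x) = 0" for m
    proof -
      have "(LINT x|lebesgue. (indicator (cbox l r) x * u x) * bump (1 / real (Suc m)) l r x) =
        (LINT x|lebesgue_on \<Omega>. u x * bump (1 / real (Suc m)) l r x)"
        unfolding integral_lebesgue_on_eq[OF \<Omega>m]
        by (rule Bochner_Integration.integral_cong)
          (use K box_subset_cbox[of l r] bump_outside[of _ l r] in \<open>fastforce simp: indicator_def\<close>)+
      also have "\<dots> = 0" by (rule zero[OF bump_test_function[OF K]]) simp
      finally show ?thesis .
    qed
    ultimately show ?thesis by (simp add: eq LIMSEQ_const_iff)
  qed
  \<comment> \<open>On a single cell u is integrable. A Borel representative \<open>g'\<close> of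
    its extension by zero makes the generator of the Borel sets available, and any box meets the
    interior of the cell in a box whose closure stays in \<Omega>.\<close>
  have cell: "AE x in lebesgue. x \<in> cbox l r \<longrightarrow> u x = 0" if K: "cbox l r \<subseteq> \<Omega>" for l r
  proof -
    define g where "g x = indicator (cbox l r) x * u x" for x
    have ig: "integrable lebesgue g" unfolding g_def by (rule iK[OF K])
    then have gm: "g \<in> borel_measurable lebesgue" by auto
    obtain g' where g': "g' \<in> borel_measurable lborel" "AE x in lborel. g x = g' x"
      using completion_ex_borel_measurable_real[OF gm] by blast
    have AE': "AE x in lebesgue. g x = g' x" using g'(2) by (rule AE_completion)
    have m': "g' \<in> borel_measurable lebesgue" using g'(1) by (simp add: measurable_completion)
    have ig': "integrable lborel g'"
      using ig integrable_cong_AE[OF gm m' AE'] integrable_completion[OF g'(1)] by simp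
    have bd: "AE x in lebesgue. x \<in> cbox l r \<longrightarrow> x \<in> box l r"
    proof -
      have "cbox l r - box l r \<in> null_sets lebesgue"
        using negligible_frontier_interval[of l r] by (simp add: negligible_iff_null_sets)
      from AE_not_in[OF this] show ?thesis by eventually_elim auto
    qed
    have bx: "(LINT x|lborel. indicator (box a b) x * g' x) = 0" for a b
    proof -
      define c where "c = (\<Sum>i\<in>Basis. max (a\<bullet>i) (l\<bullet>i) *\<^sub>R i)"
      define d where "d = (\<Sum>i\<in>Basis. min (b\<bullet>i) (r\<bullet>i) *\<^sub>R i)"
      have cd: "box a b \<inter> box l r = box c d" unfolding c_def d_def by (rule box_Int_box)
      have "cbox c d \<subseteq> cbox l r" by (auto simp: c_def d_def mem_box)
      then have K': "cbox c d \<subseteq> \<Omega>" using K by blast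
      have "(LINT x|lborel. indicator (box a b) x * g' x) = (LINT x|lebesgue. indicator (box a b) x * g' x)"
        by (rule integral_completion[symmetric]) (use g' in auto)
      also have "\<dots> = (LINT x|lebesgue. indicator (box c d) x * u x)"
      proof (rule integral_cong_AE)
        show "(\<lambda>x. indicator (box a b) x * g' x) \<in> borel_measurable lebesgue" by (intro borel_measurable_times borel_measurable_indicator m') auto
        have "(\<lambda>x. indicator (box c d) x * (indicator (cbox c d) x * u x)) \<in> borel_measurable lebesgue"
          by (rule borel_measurable_times[OF borel_measurable_indicator borel_measurable_integrable[OF iK[OF K']]]) auto
        moreover have "(\<lambda>x. indicator (box c d) x * (indicator (cbox c d) x * u x)) = (\<lambda>x. indicator (box c d) x * u x)"
          using box_subset_cbox[of c d] by (auto simp: indicator_def fun_eq_iff)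
        ultimately show "(\<lambda>x. indicator (box c d) x * u x) \<in> borel_measurable lebesgue" by simp
        show "AE x in lebesgue. indicator (box a b) x * g' x = indicator (box c d) x * u x"
          using AE' bd unfolding cd[symmetric]
          by eventually_elim (use box_subset_cbox[of l r] in \<open>auto simp: g_def indicator_def\<close>)
      qed
      also have "\<dots> = 0" by (rule box0[OF K'])
      finally show ?thesis .
    qed
    have tot: "(LINT x|lborel. g' x) = 0"
    proof -
      have "(LINT x|lborel. g' x) = (LINT x|lebesgue. g' x)"
        by (rule integral_completion[symmetric]) (use g' in auto)
      also have "\<dots> = (LINT x|lborel. indicator (box l r) x * g' x)"
      proof -
        have "(LINT x|lebesgue. g' x) = (LINT x|lebesgue. indicator (box l r) x * g' x)"
        proof (rule integral_cong_AE)
          show "AE x in lebesgue. g' x = indicator (box l r) x * g' x"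
            using AE' bd by eventually_elim (auto simp: g_def indicator_def)
        qed (auto intro!: borel_measurable_times borel_measurable_indicator m')
        then show ?thesis using g' by (simp add: integral_completion)
      qed
      also have "\<dots> = 0" by (rule bx)
      finally show ?thesis .
    qed
    have "AE x in lborel. g' x = 0" by (rule integral_boxes_zero_imp_AE_zero[OF ig' bx tot])
    then have "AE x in lebesgue. g' x = 0" by (rule AE_completion)
    then show ?thesis using AE' by eventually_elim (auto simp: g_def)
  qed
  obtain D where D: "countable D" "D \<subseteq> Pow \<Omega>" "\<And>X. X \<in> D \<Longrightarrow> \<exists>a b. X = cbox a b" "\<Union>D = \<Omega>"
    using open_countable_Union_open_cbox[OF \<Omega>] by metis
  have "AE x in lebesgue. \<forall>X\<in>D. x \<in> X \<longrightarrow> u x = 0"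
  proof (subst AE_ball_countable[OF D(1)], rule ballI)
    fix X assume "X \<in> D"
    then obtain a b where "X = cbox a b" "X \<subseteq> \<Omega>" using D(2,3) by blast
    then show "AE x in lebesgue. x \<in> X \<longrightarrow> u x = 0" using cell by simp
  qed
  then have "AE x in lebesgue. x \<in> \<Omega> \<longrightarrow> u x = 0"
    by eventually_elim (use D(4) in auto)
  then show ?thesis using \<Omega>m by (simp add: AE_restrict_space_iff)
qed

section \<open>Gradients of test functions\<close>

definition grad :: "('a::euclidean_space \<Rightarrow> real) \<Rightarrow> 'a \<Rightarrow> 'a" where
  "grad \<phi> x = (\<Sum>b\<in>Basis. frechet_derivative \<phi> (at x) b *\<^sub>R b)"

lemma test_functionD:
  assumes "\<phi> \<in> test_functions \<Omega>"
  shows "C_k k \<phi>" "compact (closure {x. \<phi> x \<noteq> 0})" "closure {x. \<phi> x \<noteq> 0} \<subseteq> \<Omega>"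
    "(\<phi> has_derivative frechet_derivative \<phi> (at x)) (at x)" "continuous_on UNIV \<phi>" "\<phi> \<in> borel_measurable borel"
proof -
  show C: "C_k k \<phi>" for k using assms by (simp add: test_functions_def)
  show "compact (closure {x. \<phi> x \<noteq> 0})" "closure {x. \<phi> x \<noteq> 0} \<subseteq> \<Omega>" using assms by (simp_all add: test_functions_def)
  show "(\<phi> has_derivative frechet_derivative \<phi> (at x)) (at x)" by (rule C_k_SucE(1)[OF C[of "Suc 0"]])
  show c: "continuous_on UNIV \<phi>" using C[of 0] by simp
  show "\<phi> \<in> borel_measurable borel" by (rule borel_measurable_continuous_onI[OF c])
qed

lemma test_function_bounded: "\<phi> \<in> test_functions \<Omega> \<Longrightarrow> \<exists>B\<ge>0. \<forall>x. \<bar>\<phi> x\<bar> \<le> B"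
proof -
  assume p: "\<phi> \<in> test_functions \<Omega>"
  let ?K = "closure {x. \<phi> x \<noteq> 0}"
  have "compact (\<phi> ` ?K)"
    by (rule compact_continuous_image[OF continuous_on_subset[OF test_functionD(5)[OF p]] test_functionD(2)[OF p]]) simp
  then obtain B where B: "\<And>x. x \<in> ?K \<Longrightarrow> \<bar>\<phi> x\<bar> \<le> B"
    using compact_imp_bounded bounded_iff by (metis imageI real_norm_def)
  have "\<bar>\<phi> x\<bar> \<le> max B 0" for x
    using B[of x] closure_subset[of "{x. \<phi> x \<noteq> 0}"] by (cases "\<phi> x = 0") (auto simp: max_def)
  then show ?thesis by (intro exI[of _ "max B 0"]) auto
qed

lemma test_function_frechet_derivative:
  assumes p: "\<phi> \<in> test_functions \<Omega>" and b: "b \<in> Basis"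
  shows "(\<lambda>x. frechet_derivative \<phi> (at x) b) \<in> test_functions \<Omega>"
proof -
  let ?K = "closure {x. \<phi> x \<noteq> 0}"
  have "frechet_derivative \<phi> (at x) b = 0" if "x \<notin> ?K" for x
  proof -
    have "((\<lambda>x. 0) has_derivative (\<lambda>h. 0)) (at x)" by simp
    then have "(\<phi> has_derivative (\<lambda>h. 0)) (at x)"
      by (rule has_derivative_transform_within_open[of _ _ _ _ "- ?K"])
        (use that closure_subset[of "{x. \<phi> x \<noteq> 0}"] in auto)
    then show ?thesis using frechet_derivative_at by metis
  qed
  then have "{x. frechet_derivative \<phi> (at x) b \<noteq> 0} \<subseteq> ?K" by blast
  then have sub: "closure {x. frechet_derivative \<phi> (at x) b \<noteq> 0} \<subseteq> ?K" by (simp add: closure_minimal)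
  have "compact (closure {x. frechet_derivative \<phi> (at x) b \<noteq> 0})"
    using compact_Int_closed[OF test_functionD(2)[OF p] closed_closure, of "{x. frechet_derivative \<phi> (at x) b \<noteq> 0}"] sub
    by (simp add: inf.absorb2)
  moreover have "C_k k (\<lambda>x. frechet_derivative \<phi> (at x) b)" for k
    by (rule C_k_SucE(2)[OF test_functionD(1)[OF p] b])
  ultimately show ?thesis using sub test_functionD(3)[OF p] by (auto simp: test_functions_def)
qed

lemma test_function_mult:
  assumes p: "\<phi> \<in> test_functions \<Omega>" and q: "\<psi> \<in> test_functions \<Omega>"
  shows "(\<lambda>x. \<phi> x * \<psi> x) \<in> test_functions \<Omega>"
proof -
  have sub: "closure {x. \<phi> x * \<psi> x \<noteq> 0} \<subseteq> closure {x. \<phi> x \<noteq> 0}" by (rule closure_mono) auto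
  have "compact (closure {x. \<phi> x * \<psi> x \<noteq> 0})"
    using compact_Int_closed[OF test_functionD(2)[OF p] closed_closure, of "{x. \<phi> x * \<psi> x \<noteq> 0}"] sub
    by (simp add: inf.absorb2)
  then show ?thesis using sub test_functionD(3)[OF p] C_k_mult[OF test_functionD(1)[OF p] test_functionD(1)[OF q]]
    by (auto simp: test_functions_def)
qed

lemma test_function_add:
  assumes p: "\<phi> \<in> test_functions \<Omega>" and q: "\<psi> \<in> test_functions \<Omega>"
  shows "(\<lambda>x. \<phi> x + \<psi> x) \<in> test_functions \<Omega>"
proof -
  have "closure {x. \<phi> x + \<psi> x \<noteq> 0} \<subseteq> closure ({x. \<phi> x \<noteq> 0} \<union> {x. \<psi> x \<noteq> 0})" by (rule closure_mono) auto
  then have sub: "closure {x. \<phi> x + \<psi> x \<noteq> 0} \<subseteq> closure {x. \<phi> x \<noteq> 0} \<union> closure {x. \<psi> x \<noteq> 0}" by simp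
  have "compact (closure {x. \<phi> x + \<psi> x \<noteq> 0})"
    using compact_Int_closed[OF compact_Un[OF test_functionD(2)[OF p] test_functionD(2)[OF q]] closed_closure, of "{x. \<phi> x + \<psi> x \<noteq> 0}"] sub
    by (simp add: inf.absorb2)
  then show ?thesis using sub test_functionD(3)[OF p] test_functionD(3)[OF q] C_k_add[OF test_functionD(1)[OF p] test_functionD(1)[OF q]]
    by (auto simp: test_functions_def)
qed

lemma test_function_cmult:
  assumes p: "\<phi> \<in> test_functions \<Omega>"
  shows "(\<lambda>x. c * \<phi> x) \<in> test_functions \<Omega>"
proof -
  have sub: "closure {x. c * \<phi> x \<noteq> 0} \<subseteq> closure {x. \<phi> x \<noteq> 0}" by (rule closure_mono) auto
  have "compact (closure {x. c * \<phi> x \<noteq> 0})"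
    using compact_Int_closed[OF test_functionD(2)[OF p] closed_closure, of "{x. c * \<phi> x \<noteq> 0}"] sub
    by (simp add: inf.absorb2)
  then show ?thesis using sub test_functionD(3)[OF p] C_k_mult[OF C_k_const test_functionD(1)[OF p]]
    by (auto simp: test_functions_def)
qed

lemma grad_inner_Basis: "b \<in> Basis \<Longrightarrow> grad \<phi> x \<bullet> b = frechet_derivative \<phi> (at x) b"
  by (simp add: grad_def inner_sum_left_Basis)

lemma grad_inner:
  assumes "\<phi> \<in> test_functions \<Omega>"
  shows "frechet_derivative \<phi> (at x) h = grad \<phi> x \<bullet> h"
proof -
  interpret bounded_linear "frechet_derivative \<phi> (at x)"
    using test_functionD(4)[OF assms] by (rule has_derivative_bounded_linear)
  have "frechet_derivative \<phi> (at x) h = frechet_derivative \<phi> (at x) (\<Sum>b\<in>Basis. (h \<bullet> b) *\<^sub>R b)"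
    by (simp add: euclidean_representation)
  also have "\<dots> = (\<Sum>b\<in>Basis. (h \<bullet> b) * frechet_derivative \<phi> (at x) b)" by (simp add: sum scale)
  also have "\<dots> = grad \<phi> x \<bullet> h" by (simp add: grad_def inner_sum_left inner_commute[of h] mult.commute)
  finally show ?thesis .
qed

lemma grad_test_function:
  assumes "\<phi> \<in> test_functions \<Omega>"
  shows "continuous_on UNIV (grad \<phi>)" "\<exists>B\<ge>0. \<forall>x. norm (grad \<phi> x) \<le> B" "x \<notin> \<Omega> \<Longrightarrow> grad \<phi> x = 0"
proof -
  note d = test_function_frechet_derivative[OF assms]
  show "continuous_on UNIV (grad \<phi>)" unfolding grad_def[abs_def]
    by (intro continuous_on_sum continuous_on_scaleR continuous_on_const test_functionD(5)[OF d])
  have "\<forall>b\<in>Basis. \<exists>B\<ge>0. \<forall>x. \<bar>frechet_derivative \<phi> (at x) b\<bar> \<le> B" using test_function_bounded[OF d] by blast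
  then obtain B where B: "\<And>b x. b \<in> Basis \<Longrightarrow> 0 \<le> B b \<and> \<bar>frechet_derivative \<phi> (at x) b\<bar> \<le> B b" by metis
  have "norm (grad \<phi> x) \<le> (\<Sum>b\<in>Basis. B b)" for x unfolding grad_def
    by (rule sum_norm_le) (use B in simp)
  moreover have "0 \<le> (\<Sum>b\<in>Basis. B b)" using B by (intro sum_nonneg) auto
  ultimately show "\<exists>B\<ge>0. \<forall>x. norm (grad \<phi> x) \<le> B" by blast
  show "grad \<phi> x = 0" if "x \<notin> \<Omega>"
    unfolding grad_def using test_function_outside[OF d that] by simp
qed

lemma test_function_lipschitz:
  assumes "\<phi> \<in> test_functions \<Omega>" "\<And>x. norm (grad \<phi> x) \<le> B"
  shows "\<bar>\<phi> x - \<phi> y\<bar> \<le> B * norm (x - y)"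
proof -
  have "norm (\<phi> x - \<phi> y) \<le> B * norm (x - y)"
  proof (rule differentiable_bound[of UNIV \<phi>])
    show "(\<phi> has_derivative frechet_derivative \<phi> (at x)) (at x within UNIV)" for x using test_functionD(4)[OF assms(1)] .
    show "onorm (frechet_derivative \<phi> (at x)) \<le> B" for x
    proof (rule onorm_bound)
      show "0 \<le> B" using assms(2)[of x] norm_ge_zero order_trans by blast
      fix h
      have "norm (frechet_derivative \<phi> (at x) h) \<le> norm (grad \<phi> x) * norm h"
        unfolding grad_inner[OF assms(1)] by (simp add: Cauchy_Schwarz_ineq2)
      also have "\<dots> \<le> B * norm h" by (intro mult_right_mono assms) simp
      finally show "norm (frechet_derivative \<phi> (at x) h) \<le> B * norm h" .
    qed
  qed auto
  then show ?thesis by simp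
qed

lemma lborel_integral_translation:
  fixes f :: "'a::euclidean_space \<Rightarrow> 'b::{banach, second_countable_topology}"
  assumes "f \<in> borel_measurable borel"
  shows "(LINT x|lborel. f (h + x)) = (LINT x|lborel. f x)"
    "integrable lborel f \<Longrightarrow> integrable lborel (\<lambda>x. f (h + x))"
proof -
  have "(LINT x|distr lborel borel ((+) h). f x) = (LINT x|lborel. f (h + x))"
    by (rule integral_distr) (use assms in auto)
  then show "(LINT x|lborel. f (h + x)) = (LINT x|lborel. f x)" by (simp add: lborel_distr_plus)
  have "integrable (distr lborel borel ((+) h)) f = integrable lborel (\<lambda>x. f (h + x))"
    by (rule integrable_distr_eq) (use assms in auto)
  then show "integrable lborel f \<Longrightarrow> integrable lborel (\<lambda>x. f (h + x))" by (simp add: lborel_distr_plus)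
qed

lemma continuous_compact_support_integrable:
  fixes f :: "'a::euclidean_space \<Rightarrow> 'b::euclidean_space"
  assumes f: "continuous_on UNIV f" and B: "\<And>x. norm (f x) \<le> B" and out: "\<And>x. x \<notin> \<Omega> \<Longrightarrow> f x = 0" and "bounded \<Omega>"
  shows "integrable lborel f"
proof -
  obtain R where "\<forall>x\<in>\<Omega>. norm x \<le> R" using \<open>bounded \<Omega>\<close> unfolding bounded_pos by blast
  then have R: "\<Omega> \<subseteq> cball 0 R" by auto
  have [measurable]: "f \<in> borel_measurable borel" by (rule borel_measurable_continuous_onI[OF f])
  show ?thesis
  proof (rule Bochner_Integration.integrable_bound[of lborel "\<lambda>x. indicator (cball 0 R) x * B"])
    show "integrable lborel (\<lambda>x. indicator (cball 0 R) x * B :: real)"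
      by (intro integrable_mult_left integrable_real_indicator emeasure_bounded_finite) auto
    have "norm (f x) \<le> norm (indicator (cball 0 R) x * B :: real)" for x
    proof (cases "x \<in> cball 0 R")
      case True
      then show ?thesis using B[of x] by simp
    next
      case False
      then have "x \<notin> \<Omega>" using R by blast
      then show ?thesis using out by simp
    qed
    then show "AE x in lborel. norm (f x) \<le> norm (indicator (cball 0 R) x * B :: real)" by simp
  qed simp
qed

text \<open>Difference quotients integrate to zero by translation invariance, and the Lipschitz
  bound dominates their convergence to the directional derivative.\<close>

lemma integral_frechet_derivative_test_function:
  fixes \<phi> :: "'a::euclidean_space \<Rightarrow> real"
  assumes p: "\<phi> \<in> test_functions \<Omega>"
  shows "(LINT x|lborel. frechet_derivative \<phi> (at x) b) = 0"
proof -
  have bounded: "bounded (closure {x. \<phi> x \<noteq> 0})" using test_functionD(2)[OF p] by (rule compact_imp_bounded)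
  then obtain R where "\<And>x. x \<in> closure {x. \<phi> x \<noteq> 0} \<Longrightarrow> norm x \<le> R" unfolding bounded_pos by blast
  then have R: "closure {x. \<phi> x \<noteq> 0} \<subseteq> cball 0 R" by auto
  have out: "\<phi> x = 0" if "x \<notin> closure {x. \<phi> x \<noteq> 0}" for x using that closure_subset[of "{x. \<phi> x \<noteq> 0}"] by blast
  obtain C where C: "C \<ge> 0" "\<And>x. \<bar>\<phi> x\<bar> \<le> C" using test_function_bounded[OF p] by blast
  obtain B where B: "B \<ge> 0" "\<And>x. norm (grad \<phi> x) \<le> B" using grad_test_function(2)[OF p] by blast
  have m[measurable]: "\<phi> \<in> borel_measurable borel" by (rule test_functionD(6)[OF p])
  have i: "integrable lborel \<phi>"
    by (rule continuous_compact_support_integrable[OF test_functionD(5)[OF p] _ out bounded]) (use C in auto)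
  define h where "h k = inverse (real (Suc k)) *\<^sub>R b" for k
  define q where "q k x = real (Suc k) * (\<phi> (h k + x) - \<phi> x)" for k x
  have q0: "(LINT x|lborel. q k x) = 0" for k
    unfolding q_def using lborel_integral_translation[OF m, of "h k"] i by simp
  have [measurable]: "(\<lambda>x. frechet_derivative \<phi> (at x) b) \<in> borel_measurable borel"
    unfolding grad_inner[OF p]
    by (intro borel_measurable_continuous_onI continuous_intros grad_test_function(1)[OF p])
  have "(\<lambda>k. LINT x|lborel. q k x) \<longlonglongrightarrow> (LINT x|lborel. frechet_derivative \<phi> (at x) b)"
  proof (rule integral_dominated_convergence)
    \<comment> \<open>The shifts \<open>h k\<close> are no longer than b, so every quotient vanishes
      outside the ball enlarged by \<open>norm b\<close>.\<close>
    show "integrable lborel (\<lambda>x. indicator (cball 0 (R + norm b)) x * (B * norm b) :: real)"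
      by (intro integrable_mult_left integrable_real_indicator emeasure_bounded_finite) auto
    show "AE x in lborel. norm (q k x) \<le> indicator (cball 0 (R + norm b)) x * (B * norm b)" for k
    proof (rule AE_I2)
      fix x
      have nh: "norm (h k) \<le> norm b" "norm (h k) = norm b / real (Suc k)"
        unfolding h_def by (auto simp: field_simps)
      show "norm (q k x) \<le> indicator (cball 0 (R + norm b)) x * (B * norm b)"
      proof (cases "x \<in> cball 0 (R + norm b)")
        case True
        have "\<bar>\<phi> (h k + x) - \<phi> x\<bar> \<le> B * norm (h k)"
          using test_function_lipschitz[OF p B(2), of "h k + x" x] by simp
        then have "real (Suc k) * \<bar>\<phi> (h k + x) - \<phi> x\<bar> \<le> real (Suc k) * (B * norm (h k))"
          by (intro mult_left_mono) auto
        then show ?thesis using True nh(2) by (simp add: q_def abs_mult)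
      next
        case False
        then have x: "norm x > R + norm b" by simp
        have "norm x \<le> norm (h k + x) + norm (h k)" by (metis add_diff_cancel_left' norm_triangle_sub add.commute norm_triangle_ineq4)
        then have "norm (h k + x) > R" "norm x > R" using x nh(1) norm_ge_zero[of b] by linarith+
        then have "h k + x \<notin> cball 0 R" "x \<notin> cball 0 R" by simp_all
        then have "\<phi> (h k + x) = 0" "\<phi> x = 0" using R out by blast+
        then show ?thesis using False by (simp add: q_def)
      qed
    qed
    show "AE x in lborel. (\<lambda>k. q k x) \<longlonglongrightarrow> frechet_derivative \<phi> (at x) b"
    proof (rule AE_I2)
      fix x
      have "((\<lambda>t. \<phi> (x + t *\<^sub>R b)) has_real_derivative frechet_derivative \<phi> (at x) b) (at 0)"
      proof -
        have "((\<lambda>t. \<phi> (x + t *\<^sub>R b)) has_derivative (\<lambda>t. frechet_derivative \<phi> (at x) (t *\<^sub>R b))) (at 0)"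
        proof (rule has_derivative_compose[where g=\<phi>])
          show "((\<lambda>t. x + t *\<^sub>R b) has_derivative (\<lambda>t. t *\<^sub>R b)) (at 0)" by (auto intro!: derivative_eq_intros)
          show "(\<phi> has_derivative frechet_derivative \<phi> (at x)) (at (x + 0 *\<^sub>R b))" using test_functionD(4)[OF p] by simp
        qed
        then show ?thesis unfolding has_field_derivative_def grad_inner[OF p] by (simp add: mult_commute_abs)
      qed
      then have "((\<lambda>t. (\<phi> (x + t *\<^sub>R b) - \<phi> x) / t) \<longlongrightarrow> frechet_derivative \<phi> (at x) b) (at 0)"
        by (simp add: DERIV_def)
      moreover have "filterlim (\<lambda>k. inverse (real (Suc k))) (at 0) sequentially"
        using LIMSEQ_inverse_real_of_nat by (auto simp: filterlim_at)
      ultimately have "(\<lambda>k. (\<phi> (x + inverse (real (Suc k)) *\<^sub>R b) - \<phi> x) / inverse (real (Suc k))) \<longlonglongrightarrow> frechet_derivative \<phi> (at x) b"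
        by (rule filterlim_compose)
      then show "(\<lambda>k. q k x) \<longlonglongrightarrow> frechet_derivative \<phi> (at x) b"
        by (simp add: q_def h_def divide_inverse mult.commute add.commute)
    qed
  qed (auto simp: q_def)
  then show ?thesis by (simp add: q0 LIMSEQ_const_iff)
qed

section \<open>Weak gradients\<close>

lemma Lfun_eLp_norm:
  assumes "u \<in> Lfun (lebesgue_on \<Omega>) r"
  shows "eLp_norm \<Omega> r u = ennreal (pint (lebesgue_on \<Omega>) r u powr (1/r))"
proof -
  have "(\<integral>\<^sup>+x. ennreal (norm (u x) powr r) \<partial>lebesgue_on \<Omega>) = ennreal (pint (lebesgue_on \<Omega>) r u)"
    using assms by (simp add: Lfun_def pint_def nn_integral_eq_integral)
  then show ?thesis by (simp add: eLp_norm_def enn_powr_def)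
qed

lemma not_Lfun_eLp_norm:
  assumes "u \<in> borel_measurable (lebesgue_on \<Omega>)" "u \<notin> Lfun (lebesgue_on \<Omega>) r"
  shows "eLp_norm \<Omega> r u = \<infinity>"
proof -
  have "\<not> (\<integral>\<^sup>+x. ennreal (norm (u x) powr r) \<partial>lebesgue_on \<Omega>) < \<infinity>"
  proof
    assume "(\<integral>\<^sup>+x. ennreal (norm (u x) powr r) \<partial>lebesgue_on \<Omega>) < \<infinity>"
    then have "integrable (lebesgue_on \<Omega>) (\<lambda>x. norm (u x) powr r)"
      using assms(1) by (intro integrableI_bounded) auto
    then show False using assms by (simp add: Lfun_def)
  qed
  then show ?thesis by (simp add: eLp_norm_def enn_powr_def top.not_eq_extremum)
qed

lemma Lp_eq_Lfun: "Lp \<Omega> r = Lfun (lebesgue_on \<Omega>) r"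
proof (intro set_eqI iffI)
  fix u :: "'a \<Rightarrow> 'b"
  show "u \<in> Lfun (lebesgue_on \<Omega>) r" if "u \<in> Lp \<Omega> r"
    using that not_Lfun_eLp_norm[of u \<Omega> r] by (cases "u \<in> Lfun (lebesgue_on \<Omega>) r") (auto simp: Lp_def)
  show "u \<in> Lp \<Omega> r" if "u \<in> Lfun (lebesgue_on \<Omega>) r"
    using that Lfun_eLp_norm[OF that] by (simp add: Lp_def Lfun_def)
qed

lemma Lp_norm_eq: "u \<in> Lfun (lebesgue_on \<Omega>) r \<Longrightarrow> Lp_norm \<Omega> r u = pint (lebesgue_on \<Omega>) r u powr (1/r)"
  by (simp add: Lp_norm_def Lfun_eLp_norm)

lemma eLp_norm_le_imp:
  assumes "u \<in> borel_measurable (lebesgue_on \<Omega>)" "eLp_norm \<Omega> r u \<le> ennreal c" "c \<ge> 0"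
  shows "u \<in> Lfun (lebesgue_on \<Omega>) r" "pint (lebesgue_on \<Omega>) r u powr (1/r) \<le> c"
proof -
  show L: "u \<in> Lfun (lebesgue_on \<Omega>) r"
    using assms not_Lfun_eLp_norm[OF assms(1)] by (metis ennreal_neq_top infinity_ennreal_def neq_top_trans)
  show "pint (lebesgue_on \<Omega>) r u powr (1/r) \<le> c" using assms Lfun_eLp_norm[OF L] by simp
qed

text \<open>Weak gradients are picked by \<open>SOME\<close>, and compositions with a Caratheodory
  function are identified as limits only a.e.; completeness of the measure is what makes them
  measurable.\<close>

lemma (in complete_measure) borel_measurable_cong_AE:
  assumes "f \<in> borel_measurable M" "AE x in M. f x = g x"
  shows "g \<in> borel_measurable M"
proof (rule measurableI)
  fix A :: "'b set" assume A: "A \<in> sets borel"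
  have "f -` A \<inter> space M \<in> sets M" using assms(1) A by (rule measurable_sets)
  moreover have "AE x in M. x \<in> f -` A \<inter> space M \<longleftrightarrow> x \<in> g -` A \<inter> space M"
    using assms(2) by eventually_elim auto
  ultimately show "g -` A \<inter> space M \<in> sets M" using in_sets_AE by blast
qed simp

lemma complete_measure_lebesgue_on:
  assumes "\<Omega> \<in> sets lebesgue"
  shows "complete_measure (lebesgue_on \<Omega>)"
proof
  fix A B assume "B \<subseteq> A" "A \<in> null_sets (lebesgue_on \<Omega>)"
  then have "A \<subseteq> \<Omega>" "A \<in> null_sets lebesgue" using assms by (simp_all add: null_sets_restrict_space)
  then have "B \<in> sets lebesgue" "B \<subseteq> \<Omega>" using \<open>B \<subseteq> A\<close> completion.complete by blast+
  then show "B \<in> sets (lebesgue_on \<Omega>)" using assms by (auto simp: sets_restrict_space_iff)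
qed

lemma integrable_lebesgue_on_subset:
  fixes f :: "'a::euclidean_space \<Rightarrow> 'b::{banach, second_countable_topology}"
  assumes "integrable (lebesgue_on \<Omega>) f" "\<Omega> \<in> sets lebesgue" "K \<in> sets lebesgue" "K \<subseteq> \<Omega>"
  shows "integrable (lebesgue_on K) f"
proof -
  have "integrable lebesgue (\<lambda>x. indicator \<Omega> x *\<^sub>R f x)" using assms by (simp add: integral_lebesgue_on_eq)
  from integrable_mult_indicator[OF assms(3) this]
  have "integrable lebesgue (\<lambda>x. indicator K x *\<^sub>R indicator \<Omega> x *\<^sub>R f x)" .
  moreover have "(\<lambda>x. indicator K x *\<^sub>R indicator \<Omega> x *\<^sub>R f x) = (\<lambda>x. indicator K x *\<^sub>R f x)"
    using assms(4) by (auto simp: indicator_def fun_eq_iff)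
  ultimately show ?thesis using assms(3) by (simp add: integral_lebesgue_on_eq)
qed

lemma locally_integrable_mult_test_function:
  fixes F :: "'a::euclidean_space \<Rightarrow> 'b::euclidean_space"
  assumes "open \<Omega>" "locally_integrable \<Omega> F" "\<phi> \<in> test_functions \<Omega>"
  shows "integrable (lebesgue_on \<Omega>) (\<lambda>x. \<phi> x *\<^sub>R F x)"
proof -
  have \<Omega>m: "\<Omega> \<in> sets lebesgue" by (rule sets_completionI_sets) (use assms(1) in simp)
  let ?K = "closure {x. \<phi> x \<noteq> 0}"
  have K: "compact ?K" "?K \<subseteq> \<Omega>" using test_functionD[OF assms(3)] by auto
  have Km: "?K \<in> sets lebesgue" by (rule sets_completionI_sets) simp
  have "integrable (lebesgue_on ?K) F" using assms(2) K by (simp add: locally_integrable_def)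
  then have i: "integrable lebesgue (\<lambda>x. indicator ?K x *\<^sub>R F x)" using Km by (simp add: integral_lebesgue_on_eq)
  obtain B where B: "B \<ge> 0" "\<And>x. \<bar>\<phi> x\<bar> \<le> B" using test_function_bounded[OF assms(3)] by blast
  have [measurable]: "\<phi> \<in> borel_measurable lebesgue" using test_functionD(6)[OF assms(3)] by (simp add: measurable_completion)
  have "integrable lebesgue (\<lambda>x. \<phi> x *\<^sub>R (indicator ?K x *\<^sub>R F x))"
  proof (rule Bochner_Integration.integrable_bound[of _ "\<lambda>x. B *\<^sub>R (indicator ?K x *\<^sub>R F x)"])
    show "integrable lebesgue (\<lambda>x. B *\<^sub>R (indicator ?K x *\<^sub>R F x))" using i by (rule integrable_scaleR_right)
    show "(\<lambda>x. \<phi> x *\<^sub>R (indicator ?K x *\<^sub>R F x)) \<in> borel_measurable lebesgue"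
      by (rule borel_measurable_scaleR[OF _ borel_measurable_integrable[OF i]]) simp
  qed (use B in \<open>auto intro!: mult_right_mono AE_I2 simp: abs_mult\<close>)
  then have I: "integrable lebesgue (\<lambda>x. \<phi> x *\<^sub>R (indicator ?K x *\<^sub>R F x))" .
  have eq: "\<phi> x *\<^sub>R (indicator ?K x *\<^sub>R F x) = indicator \<Omega> x *\<^sub>R (\<phi> x *\<^sub>R F x)" for x
  proof (cases "\<phi> x = 0")
    case False
    then have "x \<in> ?K" using closure_subset[of "{x. \<phi> x \<noteq> 0}"] by blast
    then show ?thesis using K by auto
  qed simp
  show ?thesis using I unfolding integral_lebesgue_on_eq(2)[OF \<Omega>m] eq .
qed

lemma locally_integrable_inner:
  assumes "locally_integrable \<Omega> F"
  shows "locally_integrable \<Omega> (\<lambda>x. F x \<bullet> b)"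
  using assms by (auto simp: locally_integrable_def)

lemma locally_integrable_add:
  assumes "locally_integrable \<Omega> F" "locally_integrable \<Omega> G"
  shows "locally_integrable \<Omega> (\<lambda>x. F x + G x)"
  using assms by (auto simp: locally_integrable_def)

lemma locally_integrable_scaleR:
  assumes "locally_integrable \<Omega> F"
  shows "locally_integrable \<Omega> (\<lambda>x. c *\<^sub>R F x)"
  using assms by (auto simp: locally_integrable_def)

text \<open>In each component the difference integrates to zero against all test functions, so the
  fundamental lemma applies.\<close>

lemma has_weak_gradient_unique:
  assumes \<Omega>: "open \<Omega>" and "has_weak_gradient \<Omega> u G" "has_weak_gradient \<Omega> u H"
  shows "AE x in lebesgue_on \<Omega>. G x = H x"
proof -
  have "AE x in lebesgue_on \<Omega>. G x \<bullet> b - H x \<bullet> b = 0" if b: "b \<in> Basis" for b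
  proof (rule fundamental_lemma[OF \<Omega>])
    have li: "locally_integrable \<Omega> (\<lambda>x. G x \<bullet> b)" "locally_integrable \<Omega> (\<lambda>x. H x \<bullet> b)"
      using assms by (auto simp: has_weak_gradient_def intro: locally_integrable_inner)
    show "locally_integrable \<Omega> (\<lambda>x. G x \<bullet> b - H x \<bullet> b)"
      using locally_integrable_add[OF li(1) locally_integrable_scaleR[OF li(2), of "-1"]] by simp
    fix \<phi> assume p: "\<phi> \<in> test_functions \<Omega>"
    have "integrable (lebesgue_on \<Omega>) (\<lambda>x. (G x \<bullet> b) * \<phi> x)" "integrable (lebesgue_on \<Omega>) (\<lambda>x. (H x \<bullet> b) * \<phi> x)"
      using locally_integrable_mult_test_function[OF \<Omega> li(1) p] locally_integrable_mult_test_function[OF \<Omega> li(2) p]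
      by (simp_all add: mult.commute)
    then show "(LINT x|lebesgue_on \<Omega>. (G x \<bullet> b - H x \<bullet> b) * \<phi> x) = 0"
      using assms p b by (auto simp: has_weak_gradient_def left_diff_distrib)
  qed
  then have "AE x in lebesgue_on \<Omega>. \<forall>b\<in>Basis. G x \<bullet> b - H x \<bullet> b = 0" by (simp add: AE_finite_all)
  then show ?thesis by eventually_elim (auto intro: euclidean_eqI)
qed

lemma has_weak_gradient_add:
  assumes \<Omega>: "open \<Omega>" and u: "has_weak_gradient \<Omega> u G" and v: "has_weak_gradient \<Omega> v H"
  shows "has_weak_gradient \<Omega> (\<lambda>x. u x + v x) (\<lambda>x. G x + H x)"
  unfolding has_weak_gradient_def
proof (intro conjI ballI)
  show "locally_integrable \<Omega> (\<lambda>x. u x + v x)" "locally_integrable \<Omega> (\<lambda>x. G x + H x)"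
    using u v by (auto simp: has_weak_gradient_def intro: locally_integrable_add)
  fix \<phi> b assume p: "\<phi> \<in> test_functions \<Omega>" and b: "b \<in> (Basis :: 'a set)"
  note d = test_function_frechet_derivative[OF p b]
  have i: "integrable (lebesgue_on \<Omega>) (\<lambda>x. w x * \<psi> x)" if "locally_integrable \<Omega> w" "\<psi> \<in> test_functions \<Omega>" for w \<psi>
    using locally_integrable_mult_test_function[OF \<Omega> that] by (simp add: mult.commute)
  have li: "locally_integrable \<Omega> u" "locally_integrable \<Omega> v" "locally_integrable \<Omega> (\<lambda>x. G x \<bullet> b)" "locally_integrable \<Omega> (\<lambda>x. H x \<bullet> b)"
    using u v by (auto simp: has_weak_gradient_def intro: locally_integrable_inner)
  show "(LINT x|lebesgue_on \<Omega>. (u x + v x) * frechet_derivative \<phi> (at x) b) = - (LINT x|lebesgue_on \<Omega>. ((G x + H x) \<bullet> b) * \<phi> x)"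
    using u v p b i[OF li(1) d] i[OF li(2) d] i[OF li(3) p] i[OF li(4) p]
    by (simp add: has_weak_gradient_def distrib_right inner_add_left)
qed

lemma has_weak_gradient_cmult:
  assumes u: "has_weak_gradient \<Omega> u G"
  shows "has_weak_gradient \<Omega> (\<lambda>x. c * u x) (\<lambda>x. c *\<^sub>R G x)"
  using u locally_integrable_scaleR[of \<Omega> u c] locally_integrable_scaleR[of \<Omega> G c]
  by (simp add: has_weak_gradient_def mult.assoc)

lemma integral_lebesgue_on_eq_lborel:
  fixes F :: "'a::euclidean_space \<Rightarrow> 'b::{banach, second_countable_topology}"
  assumes "\<Omega> \<in> sets lebesgue" "F \<in> borel_measurable borel" "\<And>x. x \<notin> \<Omega> \<Longrightarrow> F x = 0"
  shows "(LINT x|lebesgue_on \<Omega>. F x) = (LINT x|lborel. F x)"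
    "integrable (lebesgue_on \<Omega>) F \<longleftrightarrow> integrable lborel F"
proof -
  have "indicator \<Omega> x *\<^sub>R F x = F x" for x using assms(3)[of x] by (auto simp: indicator_def)
  then show "(LINT x|lebesgue_on \<Omega>. F x) = (LINT x|lborel. F x)"
    "integrable (lebesgue_on \<Omega>) F \<longleftrightarrow> integrable lborel F"
    using assms by (simp_all add: integral_lebesgue_on_eq integral_completion integrable_completion)
qed

lemma test_function_integrable:
  assumes p: "\<phi> \<in> test_functions \<Omega>"
  shows "integrable lborel \<phi>" "integrable lborel (grad \<phi>)"
proof -
  have bounded: "bounded (closure {x. \<phi> x \<noteq> 0})" using test_functionD(2)[OF p] by (rule compact_imp_bounded)
  have p': "\<phi> \<in> test_functions (closure {x. \<phi> x \<noteq> 0})" using p by (auto simp: test_functions_def)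
  obtain C where C: "\<And>x. \<bar>\<phi> x\<bar> \<le> C" using test_function_bounded[OF p] by blast
  obtain B where B: "\<And>x. norm (grad \<phi> x) \<le> B" using grad_test_function(2)[OF p] by blast
  show "integrable lborel \<phi>"
    by (rule continuous_compact_support_integrable[OF test_functionD(5)[OF p] _ test_function_outside[OF p'] bounded])
      (use C in simp)
  show "integrable lborel (grad \<phi>)"
    by (rule continuous_compact_support_integrable[OF grad_test_function(1)[OF p] B grad_test_function(3)[OF p'] bounded])
qed

lemma integrable_lborel_imp_locally_integrable:
  assumes "integrable lborel F"
  shows "locally_integrable \<Omega> F"
  unfolding locally_integrable_def
proof (intro allI impI)
  fix K :: "'a set" assume "compact K \<and> K \<subseteq> \<Omega>"
  then have K: "K \<in> sets lebesgue" by (intro sets_completionI_sets) (simp add: borel_compact)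
  have "integrable lebesgue F" using assms by (simp add: integrable_completion)
  from integrable_mult_indicator[OF K this] show "integrable (lebesgue_on K) F"
    using K by (simp add: integral_lebesgue_on_eq)
qed

text \<open>Integration by parts: a partial derivative of the product of two test functions has
  integral zero.\<close>

lemma test_function_has_weak_gradient:
  assumes \<Omega>: "open \<Omega>" and p: "\<phi> \<in> test_functions \<Omega>"
  shows "has_weak_gradient \<Omega> \<phi> (grad \<phi>)"
  unfolding has_weak_gradient_def
proof (intro conjI ballI)
  have \<Omega>m: "\<Omega> \<in> sets lebesgue" by (rule sets_completionI_sets) (use \<Omega> in simp)
  show "locally_integrable \<Omega> \<phi>" "locally_integrable \<Omega> (grad \<phi>)"
    by (intro integrable_lborel_imp_locally_integrable test_function_integrable[OF p])+
  fix \<psi> b assume q: "\<psi> \<in> test_functions \<Omega>" and b: "b \<in> (Basis :: 'a set)"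
  note pq = test_function_mult[OF p test_function_frechet_derivative[OF q b]]
    and qp = test_function_mult[OF test_function_frechet_derivative[OF p b] q]
  have D: "((\<lambda>x. \<phi> x * \<psi> x) has_derivative (\<lambda>h. \<phi> x * frechet_derivative \<psi> (at x) h + frechet_derivative \<phi> (at x) h * \<psi> x)) (at x)" for x
    by (rule has_derivative_mult[OF test_functionD(4)[OF p] test_functionD(4)[OF q]])
  have "frechet_derivative (\<lambda>x. \<phi> x * \<psi> x) (at x) b = \<phi> x * frechet_derivative \<psi> (at x) b + frechet_derivative \<phi> (at x) b * \<psi> x" for x
    by (simp add: frechet_derivative_at[OF D, symmetric])
  then have "0 = (LINT x|lborel. \<phi> x * frechet_derivative \<psi> (at x) b + frechet_derivative \<phi> (at x) b * \<psi> x)"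
    using integral_frechet_derivative_test_function[OF test_function_mult[OF p q], of b] by simp
  also have "\<dots> = (LINT x|lborel. \<phi> x * frechet_derivative \<psi> (at x) b) + (LINT x|lborel. frechet_derivative \<phi> (at x) b * \<psi> x)"
    by (rule Bochner_Integration.integral_add[OF test_function_integrable(1)[OF pq] test_function_integrable(1)[OF qp]])
  also have "(LINT x|lborel. \<phi> x * frechet_derivative \<psi> (at x) b) = (LINT x|lebesgue_on \<Omega>. \<phi> x * frechet_derivative \<psi> (at x) b)"
    by (rule integral_lebesgue_on_eq_lborel(1)[symmetric, OF \<Omega>m test_functionD(6)[OF pq] test_function_outside[OF pq]])
  also have "(LINT x|lborel. frechet_derivative \<phi> (at x) b * \<psi> x) = (LINT x|lebesgue_on \<Omega>. frechet_derivative \<phi> (at x) b * \<psi> x)"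
    by (rule integral_lebesgue_on_eq_lborel(1)[symmetric, OF \<Omega>m test_functionD(6)[OF qp] test_function_outside[OF qp]])
  finally show "(LINT x|lebesgue_on \<Omega>. \<phi> x * frechet_derivative \<psi> (at x) b) = - (LINT x|lebesgue_on \<Omega>. (grad \<phi> x \<bullet> b) * \<psi> x)"
    by (simp add: grad_inner_Basis[OF b])
qed

section \<open>Sobolev spaces on bounded open sets\<close>

locale bounded_open_set =
  fixes \<Omega> :: "'a::euclidean_space set" and p :: real
  assumes open_domain: "open \<Omega>" and bounded_domain: "bounded \<Omega>" and p_gt_1: "1 < p"
begin

abbreviation "\<mu> \<equiv> lebesgue_on \<Omega>"

lemma domain_sets [simp]: "\<Omega> \<in> sets lebesgue"
  by (rule sets_completionI_sets) (use open_domain in simp)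

sublocale finite_measure \<mu>
  by (rule finite_measure_lebesgue_on[OF lmeasurable_open[OF bounded_domain open_domain]])

sublocale complete_measure \<mu>
  by (rule complete_measure_lebesgue_on) simp

text \<open>Pointwise a^s \<le> 1 + a^r. The additive bound is cruder than Hoelder's but suffices
  where only boundedness matters.\<close>

lemma Lfun_mono_exponent:
  fixes F :: "'a \<Rightarrow> 'b::euclidean_space"
  assumes "F \<in> Lfun \<mu> r" "0 \<le> s" "s \<le> r"
  shows "F \<in> Lfun \<mu> s" "pint \<mu> s F \<le> measure \<mu> (space \<mu>) + pint \<mu> r F"
proof -
  have b: "norm (F x) powr s \<le> 1 + norm (F x) powr r" for x
  proof (cases "norm (F x) \<le> 1")
    case True
    then have "norm (F x) powr s \<le> 1" using assms by (intro powr_le1) auto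
    then show ?thesis using powr_ge_zero[of "norm (F x)" r] by linarith
  next
    case False
    then have "norm (F x) powr s \<le> norm (F x) powr r" using assms by (intro powr_mono) auto
    then show ?thesis by linarith
  qed
  have i: "integrable \<mu> (\<lambda>x. 1 + norm (F x) powr r)" using Lfun_integrable[OF assms(1)] by simp
  note L = Lfun_bound[OF Lfun_measurable[OF assms(1)] i AE_I2[OF b]]
  show "F \<in> Lfun \<mu> s" by (rule L)
  show "pint \<mu> s F \<le> measure \<mu> (space \<mu>) + pint \<mu> r F"
    using L(2) Lfun_integrable[OF assms(1)] by (simp add: pint_def)
qed

lemma Lfun_1_iff: "F \<in> Lfun \<mu> 1 \<longleftrightarrow> integrable \<mu> F"
  by (auto simp: Lfun_def integrable_norm_iff)

lemma Lfun_imp_integrable: "F \<in> Lfun \<mu> r \<Longrightarrow> 1 \<le> r \<Longrightarrow> integrable \<mu> F"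
  using Lfun_mono_exponent(1)[of F r 1] by (simp add: Lfun_1_iff)

lemma integrable_imp_locally_integrable:
  fixes F :: "'a \<Rightarrow> 'b::euclidean_space"
  assumes "integrable \<mu> F"
  shows "locally_integrable \<Omega> F"
  unfolding locally_integrable_def
proof (intro allI impI)
  fix K assume K: "compact K \<and> K \<subseteq> \<Omega>"
  then have "K \<in> sets lebesgue" by (intro sets_completionI_sets) (simp add: borel_compact)
  then show "integrable (lebesgue_on K) F" using integrable_lebesgue_on_subset[OF assms] K by simp
qed

text \<open>One gradient in L^p pins down, up to null sets, the choice made by
  \<open>SOME\<close>.\<close>

lemma weak_grad_eq:
  assumes "has_weak_gradient \<Omega> u G" "G \<in> Lfun \<mu> p"
  shows "has_weak_gradient \<Omega> u (weak_grad \<Omega> u)" "AE x in \<mu>. weak_grad \<Omega> u x = G x" "weak_grad \<Omega> u \<in> Lfun \<mu> p"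
proof -
  show w: "has_weak_gradient \<Omega> u (weak_grad \<Omega> u)" unfolding weak_grad_def by (rule someI[of "has_weak_gradient \<Omega> u", OF assms(1)])
  show e: "AE x in \<mu>. weak_grad \<Omega> u x = G x" by (rule has_weak_gradient_unique[OF open_domain w assms(1)])
  have "AE x in \<mu>. G x = weak_grad \<Omega> u x" using e by eventually_elim simp
  then have m: "weak_grad \<Omega> u \<in> borel_measurable \<mu>"
    by (rule borel_measurable_cong_AE[OF Lfun_measurable[OF assms(2)]])
  have "AE x in \<mu>. norm (weak_grad \<Omega> u x) powr p \<le> norm (G x) powr p" using e by eventually_elim simp
  then show "weak_grad \<Omega> u \<in> Lfun \<mu> p" by (rule Lfun_bound(1)[OF m Lfun_integrable[OF assms(2)]])
qed

lemma W1pD: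
  assumes "u \<in> W1p \<Omega> p"
  shows "u \<in> Lfun \<mu> p" "weak_grad \<Omega> u \<in> Lfun \<mu> p" "has_weak_gradient \<Omega> u (weak_grad \<Omega> u)"
  using assms weak_grad_eq by (auto simp: W1p_def Lp_eq_Lfun)

lemma W1pI:
  assumes "u \<in> Lfun \<mu> p" "has_weak_gradient \<Omega> u G" "G \<in> Lfun \<mu> p"
  shows "u \<in> W1p \<Omega> p"
  using assms by (auto simp: W1p_def Lp_eq_Lfun)

lemma W1p_add:
  assumes "u \<in> W1p \<Omega> p" "v \<in> W1p \<Omega> p"
  shows "(\<lambda>x. u x + v x) \<in> W1p \<Omega> p" "AE x in \<mu>. weak_grad \<Omega> (\<lambda>x. u x + v x) x = weak_grad \<Omega> u x + weak_grad \<Omega> v x"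
proof -
  note h = has_weak_gradient_add[OF open_domain W1pD(3)[OF assms(1)] W1pD(3)[OF assms(2)]]
  have L: "(\<lambda>x. weak_grad \<Omega> u x + weak_grad \<Omega> v x) \<in> Lfun \<mu> p" "(\<lambda>x. u x + v x) \<in> Lfun \<mu> p"
    using W1pD[OF assms(1)] W1pD[OF assms(2)] p_gt_1 by (simp_all add: Lfun_add(1))
  show "(\<lambda>x. u x + v x) \<in> W1p \<Omega> p" by (rule W1pI[OF L(2) h L(1)])
  show "AE x in \<mu>. weak_grad \<Omega> (\<lambda>x. u x + v x) x = weak_grad \<Omega> u x + weak_grad \<Omega> v x" by (rule weak_grad_eq(2)[OF h L(1)])
qed

lemma W1p_cmult:
  assumes "u \<in> W1p \<Omega> p"
  shows "(\<lambda>x. c * u x) \<in> W1p \<Omega> p" "AE x in \<mu>. weak_grad \<Omega> (\<lambda>x. c * u x) x = c *\<^sub>R weak_grad \<Omega> u x"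
proof -
  note h = has_weak_gradient_cmult[OF W1pD(3)[OF assms(1)], of c]
  have L: "(\<lambda>x. c *\<^sub>R weak_grad \<Omega> u x) \<in> Lfun \<mu> p" "(\<lambda>x. c * u x) \<in> Lfun \<mu> p"
    using Lfun_scaleR(1)[OF W1pD(2)[OF assms], of c] Lfun_scaleR(1)[OF W1pD(1)[OF assms], of c] by simp_all
  show "(\<lambda>x. c * u x) \<in> W1p \<Omega> p" by (rule W1pI[OF L(2) h L(1)])
  show "AE x in \<mu>. weak_grad \<Omega> (\<lambda>x. c * u x) x = c *\<^sub>R weak_grad \<Omega> u x" by (rule weak_grad_eq(2)[OF h L(1)])
qed

lemma W1p_diff:
  assumes "u \<in> W1p \<Omega> p" "v \<in> W1p \<Omega> p"
  shows "(\<lambda>x. u x - v x) \<in> W1p \<Omega> p" "AE x in \<mu>. weak_grad \<Omega> (\<lambda>x. u x - v x) x = weak_grad \<Omega> u x - weak_grad \<Omega> v x"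
proof -
  note a = W1p_add[OF assms(1) W1p_cmult(1)[OF assms(2), of "-1"]]
  show "(\<lambda>x. u x - v x) \<in> W1p \<Omega> p" using a(1) by simp
  show "AE x in \<mu>. weak_grad \<Omega> (\<lambda>x. u x - v x) x = weak_grad \<Omega> u x - weak_grad \<Omega> v x"
    using a(2) W1p_cmult(2)[OF assms(2), of "-1"] by eventually_elim simp
qed

lemma W1p_norm_tendsto_0_iff:
  assumes "\<And>k. w k \<in> W1p \<Omega> p"
  shows "(\<lambda>k. W1p_norm \<Omega> p (w k)) \<longlonglongrightarrow> 0 \<longleftrightarrow>
    (\<lambda>k. pint \<mu> p (w k)) \<longlonglongrightarrow> 0 \<and> (\<lambda>k. pint \<mu> p (weak_grad \<Omega> (w k))) \<longlonglongrightarrow> 0"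
proof -
  have e: "W1p_norm \<Omega> p (w k) = pint \<mu> p (w k) powr (1/p) + pint \<mu> p (weak_grad \<Omega> (w k)) powr (1/p)" for k
    using W1pD[OF assms[of k]] by (simp add: W1p_norm_def Lp_norm_eq)
  have r: "a \<longlonglongrightarrow> 0" if b: "(\<lambda>k. b k) \<longlonglongrightarrow> 0" and ab: "\<And>k. 0 \<le> a k" "\<And>k. a k powr (1/p) \<le> b k" for a b :: "nat \<Rightarrow> real"
  proof (rule Lim_null_comparison)
    have "a k \<le> b k powr p" for k
    proof -
      have "(a k powr (1/p)) powr p \<le> b k powr p" using ab p_gt_1 by (intro powr_mono2) auto
      then show ?thesis using ab(1)[of k] p_gt_1 by (simp add: powr_powr)
    qed
    then show "eventually (\<lambda>k. norm (a k) \<le> b k powr p) sequentially" using ab(1) by simp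
    have "b k \<ge> 0" for k using ab(2)[of k] powr_ge_zero[of "a k" "1/p"] by linarith
    then have "(\<lambda>k. b k powr p) \<longlonglongrightarrow> 0 powr p" using p_gt_1 by (intro tendsto_powr2[OF b]) auto
    then show "(\<lambda>k. b k powr p) \<longlonglongrightarrow> 0" by simp
  qed
  show ?thesis
  proof (intro iffI conjI)
    assume L: "(\<lambda>k. W1p_norm \<Omega> p (w k)) \<longlonglongrightarrow> 0"
    show "(\<lambda>k. pint \<mu> p (w k)) \<longlonglongrightarrow> 0" by (rule r[OF L]) (simp_all add: e)
    show "(\<lambda>k. pint \<mu> p (weak_grad \<Omega> (w k))) \<longlonglongrightarrow> 0" by (rule r[OF L]) (simp_all add: e)
  next
    assume "(\<lambda>k. pint \<mu> p (w k)) \<longlonglongrightarrow> 0 \<and> (\<lambda>k. pint \<mu> p (weak_grad \<Omega> (w k))) \<longlonglongrightarrow> 0"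
    then have "(\<lambda>k. pint \<mu> p (w k) powr (1/p) + pint \<mu> p (weak_grad \<Omega> (w k)) powr (1/p)) \<longlonglongrightarrow> 0 powr (1/p) + 0 powr (1/p)"
      using p_gt_1 by (intro tendsto_add tendsto_powr2) auto
    then show "(\<lambda>k. W1p_norm \<Omega> p (w k)) \<longlonglongrightarrow> 0" by (simp add: e)
  qed
qed

lemma test_function_W1p:
  assumes "\<phi> \<in> test_functions \<Omega>"
  shows "\<phi> \<in> W1p \<Omega> p" "AE x in \<mu>. weak_grad \<Omega> \<phi> x = grad \<phi> x" "grad \<phi> \<in> Lfun \<mu> p"
proof -
  have bl: "F \<in> Lfun \<mu> r" if "F \<in> borel_measurable borel" "\<And>x. norm (F x) \<le> B" "r \<ge> 0" for F :: "'a \<Rightarrow> 'b::euclidean_space" and B r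
  proof (rule Lfun_bound(1)[of _ _ "\<lambda>x. B powr r"])
    show "F \<in> borel_measurable \<mu>" using that(1) by (intro measurable_restrict_space1 measurable_completion) simp
  qed (use that in \<open>auto intro!: powr_mono2\<close>)
  obtain C where C: "C \<ge> 0" "\<And>x. \<bar>\<phi> x\<bar> \<le> C" using test_function_bounded[OF assms] by blast
  obtain B where B: "B \<ge> 0" "\<And>x. norm (grad \<phi> x) \<le> B" using grad_test_function(2)[OF assms] by blast
  show g: "grad \<phi> \<in> Lfun \<mu> p"
    by (rule bl[OF borel_measurable_continuous_onI[OF grad_test_function(1)[OF assms]] B(2)]) (use p_gt_1 in simp)
  have L: "\<phi> \<in> Lfun \<mu> p" by (rule bl[OF test_functionD(6)[OF assms]]) (use C p_gt_1 in auto)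
  show "\<phi> \<in> W1p \<Omega> p" by (rule W1pI[OF L test_function_has_weak_gradient[OF open_domain assms] g])
  show "AE x in \<mu>. weak_grad \<Omega> \<phi> x = grad \<phi> x" by (rule weak_grad_eq(2)[OF test_function_has_weak_gradient[OF open_domain assms] g])
qed

end

text \<open>Working form of the definition: the weak gradient of a test function is replaced by the
  classical one, and the roots in the norms are dropped.\<close>

lemma (in bounded_open_set) W01p_iff:
  "u \<in> W01p \<Omega> p \<longleftrightarrow> u \<in> W1p \<Omega> p \<and> (\<exists>\<phi>. (\<forall>k. \<phi> k \<in> test_functions \<Omega>) \<and>
     (\<lambda>k. pint \<mu> p (\<lambda>x. u x - \<phi> k x)) \<longlonglongrightarrow> 0 \<and> (\<lambda>k. pint \<mu> p (\<lambda>x. weak_grad \<Omega> u x - grad (\<phi> k) x)) \<longlonglongrightarrow> 0)"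
proof -
  have "(\<lambda>k. W1p_norm \<Omega> p (\<lambda>x. u x - \<phi> k x)) \<longlonglongrightarrow> 0 \<longleftrightarrow>
     (\<lambda>k. pint \<mu> p (\<lambda>x. u x - \<phi> k x)) \<longlonglongrightarrow> 0 \<and> (\<lambda>k. pint \<mu> p (\<lambda>x. weak_grad \<Omega> u x - grad (\<phi> k) x)) \<longlonglongrightarrow> 0"
    if u: "u \<in> W1p \<Omega> p" and t: "\<forall>k. \<phi> k \<in> test_functions \<Omega>" for \<phi> :: "nat \<Rightarrow> 'a \<Rightarrow> real"
  proof -
    have tk: "\<phi> k \<in> test_functions \<Omega>" for k using t by blast
    have W: "(\<lambda>x. u x - \<phi> k x) \<in> W1p \<Omega> p" for k by (rule W1p_diff(1)[OF u test_function_W1p(1)[OF tk]])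
    have "pint \<mu> p (weak_grad \<Omega> (\<lambda>x. u x - \<phi> k x)) = pint \<mu> p (\<lambda>x. weak_grad \<Omega> u x - grad (\<phi> k) x)" for k
    proof (rule pint_cong_AE)
      show "weak_grad \<Omega> (\<lambda>x. u x - \<phi> k x) \<in> borel_measurable \<mu>" by (rule Lfun_measurable[OF W1pD(2)[OF W]])
      show "(\<lambda>x. weak_grad \<Omega> u x - grad (\<phi> k) x) \<in> borel_measurable \<mu>"
        by (intro borel_measurable_diff Lfun_measurable[OF W1pD(2)[OF u]] Lfun_measurable[OF test_function_W1p(3)[OF tk]])
      show "AE x in \<mu>. weak_grad \<Omega> (\<lambda>x. u x - \<phi> k x) x = weak_grad \<Omega> u x - grad (\<phi> k) x"
        using W1p_diff(2)[OF u test_function_W1p(1)[OF tk[of k]]] test_function_W1p(2)[OF tk[of k]] by eventually_elim simp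
    qed
    then show ?thesis using W1p_norm_tendsto_0_iff[OF W] by simp
  qed
  then show ?thesis unfolding W01p_def by blast
qed

lemma tendsto_0_linear_bound:
  fixes a :: "nat \<Rightarrow> real"
  assumes "a \<longlonglongrightarrow> 0" "b \<longlonglongrightarrow> 0" "\<And>k. 0 \<le> c k" "\<And>k. c k \<le> K * (a k + b k)"
  shows "c \<longlonglongrightarrow> 0"
proof (rule Lim_null_comparison)
  show "eventually (\<lambda>k. norm (c k) \<le> K * (a k + b k)) sequentially" using assms by simp
  have "(\<lambda>k. K * (a k + b k)) \<longlonglongrightarrow> K * (0 + 0)" by (intro tendsto_intros assms)
  then show "(\<lambda>k. K * (a k + b k)) \<longlonglongrightarrow> 0" by simp
qed

lemma pint_add_tendsto_0:
  assumes "\<And>k. F k \<in> Lfun M r" "\<And>k. G k \<in> Lfun M r" "r > 0"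
    "(\<lambda>k. pint M r (F k)) \<longlonglongrightarrow> 0" "(\<lambda>k. pint M r (G k)) \<longlonglongrightarrow> 0"
  shows "(\<lambda>k. pint M r (\<lambda>x. F k x + G k x)) \<longlonglongrightarrow> 0"
  by (rule tendsto_0_linear_bound[OF assms(4,5) pint_nonneg Lfun_add(2)[OF assms(1,2,3)]])

context bounded_open_set begin

lemma p_gt_0: "p > 0"
  using p_gt_1 by simp

lemma W01p_imp_W1p: "u \<in> W01p \<Omega> p \<Longrightarrow> u \<in> W1p \<Omega> p"
  by (simp add: W01p_def)

lemma W01p_add:
  assumes "u \<in> W01p \<Omega> p" "v \<in> W01p \<Omega> p"
  shows "(\<lambda>x. u x + v x) \<in> W01p \<Omega> p"
proof -
  note u = W01p_imp_W1p[OF assms(1)] and v = W01p_imp_W1p[OF assms(2)] and p0 = p_gt_0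
  obtain \<phi> where \<phi>: "\<And>k. \<phi> k \<in> test_functions \<Omega>" "(\<lambda>k. pint \<mu> p (\<lambda>x. u x - \<phi> k x)) \<longlonglongrightarrow> 0"
      "(\<lambda>k. pint \<mu> p (\<lambda>x. weak_grad \<Omega> u x - grad (\<phi> k) x)) \<longlonglongrightarrow> 0"
    using assms(1) unfolding W01p_iff by blast
  obtain \<psi> where \<psi>: "\<And>k. \<psi> k \<in> test_functions \<Omega>" "(\<lambda>k. pint \<mu> p (\<lambda>x. v x - \<psi> k x)) \<longlonglongrightarrow> 0"
      "(\<lambda>k. pint \<mu> p (\<lambda>x. weak_grad \<Omega> v x - grad (\<psi> k) x)) \<longlonglongrightarrow> 0"
    using assms(2) unfolding W01p_iff by blast
  have t: "(\<lambda>x. \<phi> k x + \<psi> k x) \<in> test_functions \<Omega>" for k by (rule test_function_add[OF \<phi>(1) \<psi>(1)])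
  have m: "(\<lambda>x. u x + v x - (\<phi> k x + \<psi> k x)) = (\<lambda>x. (u x - \<phi> k x) + (v x - \<psi> k x))" for k by auto
  note L = Lfun_diff(1)[OF W1pD(1)[OF u] W1pD(1)[OF test_function_W1p(1)[OF \<phi>(1)]] p0]
    Lfun_diff(1)[OF W1pD(1)[OF v] W1pD(1)[OF test_function_W1p(1)[OF \<psi>(1)]] p0]
    Lfun_diff(1)[OF W1pD(2)[OF u] test_function_W1p(3)[OF \<phi>(1)] p0]
    Lfun_diff(1)[OF W1pD(2)[OF v] test_function_W1p(3)[OF \<psi>(1)] p0]
  have 1: "(\<lambda>k. pint \<mu> p (\<lambda>x. u x + v x - (\<phi> k x + \<psi> k x))) \<longlonglongrightarrow> 0" unfolding m
    by (rule pint_add_tendsto_0[OF L(1,2) p0 \<phi>(2) \<psi>(2)])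
  have 2: "(\<lambda>k. pint \<mu> p (\<lambda>x. (weak_grad \<Omega> u x - grad (\<phi> k) x) + (weak_grad \<Omega> v x - grad (\<psi> k) x))) \<longlonglongrightarrow> 0"
    by (rule pint_add_tendsto_0[OF L(3,4) p0 \<phi>(3) \<psi>(3)])
  have e: "pint \<mu> p (\<lambda>x. weak_grad \<Omega> (\<lambda>x. u x + v x) x - grad (\<lambda>x. \<phi> k x + \<psi> k x) x) =
      pint \<mu> p (\<lambda>x. (weak_grad \<Omega> u x - grad (\<phi> k) x) + (weak_grad \<Omega> v x - grad (\<psi> k) x))" for k
  proof (rule pint_cong_AE)
    show "AE x in \<mu>. weak_grad \<Omega> (\<lambda>x. u x + v x) x - grad (\<lambda>x. \<phi> k x + \<psi> k x) x =
       (weak_grad \<Omega> u x - grad (\<phi> k) x) + (weak_grad \<Omega> v x - grad (\<psi> k) x)"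
      using W1p_add(2)[OF u v] W1p_add(2)[OF test_function_W1p(1)[OF \<phi>(1)[of k]] test_function_W1p(1)[OF \<psi>(1)[of k]]]
        test_function_W1p(2)[OF \<phi>(1)[of k]] test_function_W1p(2)[OF \<psi>(1)[of k]] test_function_W1p(2)[OF t[of k]]
      by eventually_elim simp
    show "(\<lambda>x. weak_grad \<Omega> (\<lambda>x. u x + v x) x - grad (\<lambda>x. \<phi> k x + \<psi> k x) x) \<in> borel_measurable \<mu>"
      by (rule borel_measurable_diff[OF Lfun_measurable[OF W1pD(2)[OF W1p_add(1)[OF u v]]] Lfun_measurable[OF test_function_W1p(3)[OF t]]])
    show "(\<lambda>x. (weak_grad \<Omega> u x - grad (\<phi> k) x) + (weak_grad \<Omega> v x - grad (\<psi> k) x)) \<in> borel_measurable \<mu>"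
      by (rule borel_measurable_add[OF Lfun_measurable[OF L(3)] Lfun_measurable[OF L(4)]])
  qed
  have 3: "(\<lambda>k. pint \<mu> p (\<lambda>x. weak_grad \<Omega> (\<lambda>x. u x + v x) x - grad (\<lambda>x. \<phi> k x + \<psi> k x) x)) \<longlonglongrightarrow> 0"
    using 2 unfolding e .
  show ?thesis unfolding W01p_iff
    by (intro conjI exI[of _ "\<lambda>k x. \<phi> k x + \<psi> k x"] allI) (rule W1p_add(1)[OF u v] t 1 3)+
qed

lemma W01p_cmult:
  assumes "u \<in> W01p \<Omega> p"
  shows "(\<lambda>x. c * u x) \<in> W01p \<Omega> p"
proof -
  note u = W01p_imp_W1p[OF assms(1)] and p0 = p_gt_0
  obtain \<phi> where \<phi>: "\<And>k. \<phi> k \<in> test_functions \<Omega>" "(\<lambda>k. pint \<mu> p (\<lambda>x. u x - \<phi> k x)) \<longlonglongrightarrow> 0"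
      "(\<lambda>k. pint \<mu> p (\<lambda>x. weak_grad \<Omega> u x - grad (\<phi> k) x)) \<longlonglongrightarrow> 0"
    using assms unfolding W01p_iff by blast
  have t: "(\<lambda>x. c * \<phi> k x) \<in> test_functions \<Omega>" for k by (rule test_function_cmult[OF \<phi>(1)])
  note L = Lfun_diff(1)[OF W1pD(1)[OF u] W1pD(1)[OF test_function_W1p(1)[OF \<phi>(1)]] p0]
    Lfun_diff(1)[OF W1pD(2)[OF u] test_function_W1p(3)[OF \<phi>(1)] p0]
  have "(\<lambda>k. \<bar>c\<bar> powr p * pint \<mu> p (\<lambda>x. u x - \<phi> k x)) \<longlonglongrightarrow> \<bar>c\<bar> powr p * 0" by (intro tendsto_mult_left \<phi>)
  then have 1: "(\<lambda>k. pint \<mu> p (\<lambda>x. c * u x - c * \<phi> k x)) \<longlonglongrightarrow> 0"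
    using Lfun_scaleR(2)[OF L(1), of c] by (simp add: right_diff_distrib)
  have "(\<lambda>k. \<bar>c\<bar> powr p * pint \<mu> p (\<lambda>x. weak_grad \<Omega> u x - grad (\<phi> k) x)) \<longlonglongrightarrow> \<bar>c\<bar> powr p * 0" by (intro tendsto_mult_left \<phi>)
  then have 2: "(\<lambda>k. pint \<mu> p (\<lambda>x. c *\<^sub>R (weak_grad \<Omega> u x - grad (\<phi> k) x))) \<longlonglongrightarrow> 0"
    using Lfun_scaleR(2)[OF L(2), of c] by simp
  have e: "pint \<mu> p (\<lambda>x. weak_grad \<Omega> (\<lambda>x. c * u x) x - grad (\<lambda>x. c * \<phi> k x) x) =
      pint \<mu> p (\<lambda>x. c *\<^sub>R (weak_grad \<Omega> u x - grad (\<phi> k) x))" for k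
  proof (rule pint_cong_AE)
    show "AE x in \<mu>. weak_grad \<Omega> (\<lambda>x. c * u x) x - grad (\<lambda>x. c * \<phi> k x) x = c *\<^sub>R (weak_grad \<Omega> u x - grad (\<phi> k) x)"
      using W1p_cmult(2)[OF u, of c] W1p_cmult(2)[OF test_function_W1p(1)[OF \<phi>(1)[of k]], of c]
        test_function_W1p(2)[OF \<phi>(1)[of k]] test_function_W1p(2)[OF t[of k]]
      by eventually_elim (simp add: scaleR_diff_right)
    show "(\<lambda>x. weak_grad \<Omega> (\<lambda>x. c * u x) x - grad (\<lambda>x. c * \<phi> k x) x) \<in> borel_measurable \<mu>"
      by (rule borel_measurable_diff[OF Lfun_measurable[OF W1pD(2)[OF W1p_cmult(1)[OF u]]] Lfun_measurable[OF test_function_W1p(3)[OF t]]])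
    show "(\<lambda>x. c *\<^sub>R (weak_grad \<Omega> u x - grad (\<phi> k) x)) \<in> borel_measurable \<mu>"
      by (rule borel_measurable_scaleR[OF borel_measurable_const Lfun_measurable[OF L(2)]])
  qed
  have 3: "(\<lambda>k. pint \<mu> p (\<lambda>x. weak_grad \<Omega> (\<lambda>x. c * u x) x - grad (\<lambda>x. c * \<phi> k x) x)) \<longlonglongrightarrow> 0"
    using 2 unfolding e .
  show ?thesis unfolding W01p_iff
    by (intro conjI exI[of _ "\<lambda>k x. c * \<phi> k x"] allI) (rule W1p_cmult(1)[OF u] t 1 3)+
qed

lemma W01p_diff: "u \<in> W01p \<Omega> p \<Longrightarrow> v \<in> W01p \<Omega> p \<Longrightarrow> (\<lambda>x. u x - v x) \<in> W01p \<Omega> p"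
  using W01p_add[of u "\<lambda>x. -1 * v x"] W01p_cmult[of v "-1"] by simp

lemma test_function_W01p: "\<phi> \<in> test_functions \<Omega> \<Longrightarrow> \<phi> \<in> W01p \<Omega> p"
proof -
  assume t: "\<phi> \<in> test_functions \<Omega>"
  have "pint \<mu> p (\<lambda>x. weak_grad \<Omega> \<phi> x - grad \<phi> x) = pint \<mu> p (\<lambda>x. 0 :: 'a)"
  proof (rule pint_cong_AE)
    show "(\<lambda>x. weak_grad \<Omega> \<phi> x - grad \<phi> x) \<in> borel_measurable \<mu>"
      by (rule borel_measurable_diff[OF Lfun_measurable[OF W1pD(2)[OF test_function_W1p(1)[OF t]]] Lfun_measurable[OF test_function_W1p(3)[OF t]]])
    show "AE x in \<mu>. weak_grad \<Omega> \<phi> x - grad \<phi> x = 0" using test_function_W1p(2)[OF t] by eventually_elim simp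
  qed simp
  then have "pint \<mu> p (\<lambda>x. weak_grad \<Omega> \<phi> x - grad \<phi> x) = 0" by (simp add: pint_def)
  then show ?thesis unfolding W01p_iff using t test_function_W1p(1)[OF t]
    by (intro conjI exI[of _ "\<lambda>k. \<phi>"]) (auto simp: pint_def)
qed

lemma test_function_zero: "(\<lambda>x. 0) \<in> test_functions \<Omega>"
  by (simp add: test_functions_def C_k_const del: C_k.simps)

lemma W01p_zero: "(\<lambda>x. 0) \<in> W01p \<Omega> p"
  by (rule test_function_W01p[OF test_function_zero])

lemma grad_zero: "grad (\<lambda>x::'a. 0) = (\<lambda>x. 0)"
  by (simp add: grad_def fun_eq_iff)

lemma W01p_sum:
  assumes "finite I" "\<And>i. i \<in> I \<Longrightarrow> u i \<in> W01p \<Omega> p"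
  shows "(\<lambda>x. \<Sum>i\<in>I. c i * u i x) \<in> W01p \<Omega> p"
    "AE x in \<mu>. weak_grad \<Omega> (\<lambda>x. \<Sum>i\<in>I. c i * u i x) x = (\<Sum>i\<in>I. c i *\<^sub>R weak_grad \<Omega> (u i) x)"
proof -
  have "(\<lambda>x. \<Sum>i\<in>I. c i * u i x) \<in> W01p \<Omega> p \<and>
    (AE x in \<mu>. weak_grad \<Omega> (\<lambda>x. \<Sum>i\<in>I. c i * u i x) x = (\<Sum>i\<in>I. c i *\<^sub>R weak_grad \<Omega> (u i) x))"
    using assms
  proof (induction I)
    case empty
    have "AE x in \<mu>. weak_grad \<Omega> (\<lambda>x. 0) x = grad (\<lambda>x. 0) x" by (rule test_function_W1p(2)[OF test_function_zero])
    then show ?case using W01p_zero by (simp add: grad_zero)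
  next
    case (insert i I)
    have i: "u i \<in> W01p \<Omega> p" using insert by auto
    note a = W01p_cmult[OF i, of "c i"]
    have b: "(\<lambda>x. \<Sum>i\<in>I. c i * u i x) \<in> W01p \<Omega> p"
      "AE x in \<mu>. weak_grad \<Omega> (\<lambda>x. \<Sum>i\<in>I. c i * u i x) x = (\<Sum>i\<in>I. c i *\<^sub>R weak_grad \<Omega> (u i) x)"
      using insert by auto
    have "AE x in \<mu>. weak_grad \<Omega> (\<lambda>x. c i * u i x + (\<Sum>i\<in>I. c i * u i x)) x =
       c i *\<^sub>R weak_grad \<Omega> (u i) x + (\<Sum>i\<in>I. c i *\<^sub>R weak_grad \<Omega> (u i) x)"
      using b(2) W1p_add(2)[OF W01p_imp_W1p[OF a] W01p_imp_W1p[OF b(1)]] W1p_cmult(2)[OF W01p_imp_W1p[OF i], of "c i"]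
      by eventually_elim simp
    then show ?case using W01p_add[OF a b(1)] insert.hyps by simp
  qed
  then show "(\<lambda>x. \<Sum>i\<in>I. c i * u i x) \<in> W01p \<Omega> p"
    "AE x in \<mu>. weak_grad \<Omega> (\<lambda>x. \<Sum>i\<in>I. c i * u i x) x = (\<Sum>i\<in>I. c i *\<^sub>R weak_grad \<Omega> (u i) x)" by auto
qed

lemma W01p_norm_eq: "u \<in> W01p \<Omega> p \<Longrightarrow> W01p_norm \<Omega> p u = pint \<mu> p (weak_grad \<Omega> u) powr (1/p)"
  by (simp add: W01p_norm_def Lp_norm_eq W1pD(2) W01p_imp_W1p)

text \<open>\<Omega> has finite measure, hence it suffices to approximate uniformly on \<Omega>. The step functions
  used for this are constant on the cells given by the first sufficiently close member of a dense
  sequence, and take values in this sequence.\<close>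

lemma W01p_separable:
  obtains e :: "nat \<Rightarrow> 'a \<Rightarrow> real" where "\<And>i. e i \<in> test_functions \<Omega>"
    "\<And>u \<epsilon>. u \<in> W01p \<Omega> p \<Longrightarrow> \<epsilon> > 0 \<Longrightarrow> \<exists>i. pint \<mu> p (\<lambda>x. weak_grad \<Omega> u x - grad (e i) x) < \<epsilon>"
proof -
  note p0 = p_gt_0
  obtain D :: "'a set" where D: "countable D" "\<And>X. open X \<Longrightarrow> X \<noteq> {} \<Longrightarrow> \<exists>d\<in>D. d \<in> X"
    using countable_dense_setE by blast
  then have "D \<noteq> {}" using open_UNIV by blast
  define d where "d = from_nat_into D"
  have d: "\<exists>i. dist x (d i) < r" if "r > 0" for x r
  proof -
    obtain y where "y \<in> D" "y \<in> ball x r" using D(2)[of "ball x r"] \<open>r > 0\<close> by auto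
    then show ?thesis using from_nat_into_surj[OF D(1)] unfolding d_def by (metis mem_ball)
  qed
  define c where "c m x = (LEAST i. dist x (d i) < 1 / real (Suc m))" for m x
  have c: "dist x (d (c m x)) < 1 / real (Suc m)" for m x
    unfolding c_def by (rule LeastI_ex) (intro d, simp)
  \<comment> \<open>The pair consists of the mesh index m and a finite list of indices of values, so
    these step functions form a countable family.\<close>
  define q where "q mL x = (if c (fst mL) x < length (snd mL) then d (snd mL ! c (fst mL) x) else 0)" for mL :: "nat \<times> nat list" and x
  have qm: "q mL \<in> borel_measurable borel" for mL
  proof -
    have cm: "c m \<in> borel \<rightarrow>\<^sub>M count_space UNIV" for m unfolding c_def by measurable
    show ?thesis unfolding q_def
      by (rule measurable_compose[OF cm, of "\<lambda>i. if i < length (snd mL) then d (snd mL ! i) else 0"]) auto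
  qed
  have qm': "q mL \<in> borel_measurable \<mu>" for mL using qm by (intro measurable_restrict_space1 measurable_completion) simp
  have dense: "\<exists>mL. pint \<mu> p (\<lambda>x. q mL x - grad \<phi> x) < \<epsilon> \<and> q mL \<in> Lfun \<mu> p" if t: "\<phi> \<in> test_functions \<Omega>" and \<epsilon>: "\<epsilon> > 0" for \<phi> \<epsilon>
  proof -
    obtain B where B: "B \<ge> 0" "\<And>x y. norm (grad \<phi> x - grad \<phi> y) \<le> B * norm (x - y)"
    proof -
      have "\<exists>B\<ge>0. \<forall>x y. \<bar>frechet_derivative \<phi> (at x) b - frechet_derivative \<phi> (at y) b\<bar> \<le> B * norm (x - y)" if "b \<in> Basis" for b
        using test_function_lipschitz[OF test_function_frechet_derivative[OF t that]]
          grad_test_function(2)[OF test_function_frechet_derivative[OF t that]] by meson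
      then obtain B where B: "\<And>b. b \<in> Basis \<Longrightarrow> B b \<ge> 0"
        "\<And>b x y. b \<in> Basis \<Longrightarrow> \<bar>frechet_derivative \<phi> (at x) b - frechet_derivative \<phi> (at y) b\<bar> \<le> B b * norm (x - y)" by metis
      have "norm (grad \<phi> x - grad \<phi> y) \<le> (\<Sum>b\<in>Basis. B b) * norm (x - y)" for x y
      proof -
        have "grad \<phi> x - grad \<phi> y = (\<Sum>b\<in>Basis. (frechet_derivative \<phi> (at x) b - frechet_derivative \<phi> (at y) b) *\<^sub>R b)"
          by (simp add: grad_def scaleR_left_diff_distrib sum_subtractf)
        also have "norm \<dots> \<le> (\<Sum>b\<in>Basis. B b * norm (x - y))" by (rule sum_norm_le) (use B in simp)
        finally show ?thesis by (simp add: sum_distrib_right)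
      qed
      then show ?thesis using that[of "\<Sum>b\<in>Basis. B b"] B(1) by (simp add: sum_nonneg)
    qed
    define V where "V = measure \<mu> (space \<mu>)"
    have V: "V \<ge> 0" by (simp add: V_def)
    define \<eta> where "\<eta> = (\<epsilon> / (2 * (V + 1))) powr (1/p)"
    have \<eta>: "\<eta> > 0" "\<eta> powr p = \<epsilon> / (2 * (V + 1))" unfolding \<eta>_def using \<epsilon> V p0 by (auto simp: powr_powr)
    obtain m where "(B + 1) / \<eta> < real m" using reals_Archimedean2 by blast
    \<comment> \<open>The uniform error has two sources: 1 / (m + 1) from rounding the values to the
      dense sequence, and B / (m + 1) from the variation of the gradient on a cell.\<close>
    then have m: "(B + 1) / real (Suc m) \<le> \<eta>" using \<eta>(1) by (simp add: field_simps)
    have "compact (closure \<Omega>)" using bounded_domain by simp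
    moreover have "closure \<Omega> \<subseteq> (\<Union>i\<in>UNIV. ball (d i) (1 / real (Suc m)))"
    proof
      fix x
      obtain i where "dist x (d i) < 1 / real (Suc m)" using d[of "1 / real (Suc m)" x] by auto
      then have "x \<in> ball (d i) (1 / real (Suc m))" by (simp add: dist_commute)
      then show "x \<in> (\<Union>i\<in>UNIV. ball (d i) (1 / real (Suc m)))" by blast
    qed
    \<comment> \<open>By compactness only finitely many cells meet \<Omega>, so a finite list of
      values suffices.\<close>
    ultimately obtain I where I: "finite I" "closure \<Omega> \<subseteq> (\<Union>i\<in>I. ball (d i) (1 / real (Suc m)))"
      using compactE_image[of "closure \<Omega>" UNIV "\<lambda>i. ball (d i) (1 / real (Suc m))"] by (metis open_ball)
    define n where "n = Suc (Max (insert 0 I))"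
    have cn: "c m x < n" if "x \<in> \<Omega>" for x
    proof -
      have "x \<in> closure \<Omega>" using that closure_subset by blast
      then obtain i where i: "i \<in> I" "x \<in> ball (d i) (1 / real (Suc m))" using I(2) by blast
      then have "dist x (d i) < 1 / real (Suc m)" by (simp add: dist_commute)
      then have "c m x \<le> i" unfolding c_def by (rule Least_le)
      also have "i \<le> Max (insert 0 I)" using i I by simp
      finally show ?thesis by (simp add: n_def)
    qed
    have "\<exists>j. dist (grad \<phi> (d i)) (d j) < 1 / real (Suc m)" for i by (rule d) simp
    then obtain j where j: "\<And>i. dist (grad \<phi> (d i)) (d (j i)) < 1 / real (Suc m)" by metis
    define mL where "mL = (m, map j [0..<n])"
    have bd: "norm (q mL x - grad \<phi> x) \<le> \<eta>" if "x \<in> \<Omega>" for x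
    proof -
      have "q mL x = d (j (c m x))" using cn[OF that] by (simp add: q_def mL_def)
      then have "norm (q mL x - grad \<phi> x) \<le> norm (d (j (c m x)) - grad \<phi> (d (c m x))) + norm (grad \<phi> (d (c m x)) - grad \<phi> x)"
        using norm_triangle_ineq[of "d (j (c m x)) - grad \<phi> (d (c m x))" "grad \<phi> (d (c m x)) - grad \<phi> x"] by simp
      also have "\<dots> \<le> 1 / real (Suc m) + B * (1 / real (Suc m))"
      proof (rule add_mono)
        show "norm (d (j (c m x)) - grad \<phi> (d (c m x))) \<le> 1 / real (Suc m)"
          using j[of "c m x"] by (simp add: dist_norm norm_minus_commute)
        have "norm (grad \<phi> (d (c m x)) - grad \<phi> x) \<le> B * norm (d (c m x) - x)" by (rule B)
        also have "\<dots> \<le> B * (1 / real (Suc m))"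
          using c[of x m] B(1) by (intro mult_left_mono) (auto simp: dist_norm norm_minus_commute)
        finally show "norm (grad \<phi> (d (c m x)) - grad \<phi> x) \<le> B * (1 / real (Suc m))" .
      qed
      also have "\<dots> = (B + 1) / real (Suc m)" by (simp add: add_divide_distrib)
      finally show ?thesis using m by linarith
    qed
    have mm: "(\<lambda>x. q mL x - grad \<phi> x) \<in> borel_measurable \<mu>"
      by (rule borel_measurable_diff[OF qm' Lfun_measurable[OF test_function_W1p(3)[OF t]]])
    have ae: "AE x in \<mu>. norm (q mL x - grad \<phi> x) powr p \<le> \<eta> powr p"
      using bd p0 by (intro AE_I2 powr_mono2) auto
    have ic: "integrable \<mu> (\<lambda>x. \<eta> powr p)" by simp
    have L: "(\<lambda>x. q mL x - grad \<phi> x) \<in> Lfun \<mu> p" "pint \<mu> p (\<lambda>x. q mL x - grad \<phi> x) \<le> V * \<eta> powr p"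
      using Lfun_bound[OF mm ic ae] by (simp_all add: V_def)
    have "V * \<eta> powr p = \<epsilon> / 2 * (V / (V + 1))" by (simp add: \<eta>(2))
    also have "\<dots> \<le> \<epsilon> / 2 * 1" using \<epsilon> V by (intro mult_left_mono) auto
    finally have "pint \<mu> p (\<lambda>x. q mL x - grad \<phi> x) < \<epsilon>" using L(2) \<epsilon> by simp
    moreover have "q mL \<in> Lfun \<mu> p" using Lfun_add(1)[OF L(1) test_function_W1p(3)[OF t] p0] by simp
    ultimately show ?thesis by blast
  qed
  \<comment> \<open>Step functions are not gradients. For every step function and tolerance, one
    gradient within the tolerance is selected, if there is any; this is how a subset inherits
    separability from the ambient space.\<close>
  define good where "good z \<phi> \<longleftrightarrow> \<phi> \<in> test_functions \<Omega> \<and>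
     ((\<exists>\<psi>\<in>test_functions \<Omega>. pint \<mu> p (\<lambda>x. q (fst z) x - grad \<psi> x) < 1 / real (Suc (snd z))) \<longrightarrow>
       pint \<mu> p (\<lambda>x. q (fst z) x - grad \<phi> x) < 1 / real (Suc (snd z)))" for z :: "(nat \<times> nat list) \<times> nat" and \<phi>
  have "\<exists>\<phi>. good z \<phi>" for z
    unfolding good_def using test_function_zero by (cases "\<exists>\<psi>\<in>test_functions \<Omega>. pint \<mu> p (\<lambda>x. q (fst z) x - grad \<psi> x) < 1 / real (Suc (snd z))") blast+
  then obtain E where E': "\<And>z. good z (E z)" by metis
  note E = E'[unfolded good_def]
  show ?thesis
  proof (rule that[of "\<lambda>n. E (from_nat n)"])
    show "E (from_nat i) \<in> test_functions \<Omega>" for i using E by blast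
    fix u and \<epsilon> :: real assume u: "u \<in> W01p \<Omega> p" and \<epsilon>: "\<epsilon> > 0"
    obtain \<phi> where \<phi>: "\<And>k. \<phi> k \<in> test_functions \<Omega>" "(\<lambda>k. pint \<mu> p (\<lambda>x. weak_grad \<Omega> u x - grad (\<phi> k) x)) \<longlonglongrightarrow> 0"
      using u unfolding W01p_iff by blast
    define P where "P = 2 powr p"
    have P: "P \<ge> 1" unfolding P_def using p0 by (simp add: ge_one_powr_ge_zero)
    \<comment> \<open>Two nested quasi-triangle inequalities with factor P turn the errors into at
      most 3 P^2 times \<delta>.\<close>
    define \<delta> where "\<delta> = \<epsilon> / (4 * P * P)"
    have \<delta>: "\<delta> > 0" using \<epsilon> P by (simp add: \<delta>_def)
    obtain k where k: "pint \<mu> p (\<lambda>x. weak_grad \<Omega> u x - grad (\<phi> k) x) < \<delta>"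
      using order_tendstoD(2)[OF \<phi>(2) \<delta>] by (auto simp: eventually_sequentially)
    obtain l where l: "1 / real (Suc l) < \<delta>" using reals_Archimedean[OF \<delta>] by (auto simp: inverse_eq_divide)
    have l0: "0 < 1 / real (Suc l)" by simp
    obtain mL where mL: "pint \<mu> p (\<lambda>x. q mL x - grad (\<phi> k) x) < 1 / real (Suc l)" "q mL \<in> Lfun \<mu> p"
      using dense[OF \<phi>(1) l0] by blast
    define \<psi> where "\<psi> = E (mL, l)"
    have \<psi>: "\<psi> \<in> test_functions \<Omega>" "pint \<mu> p (\<lambda>x. q mL x - grad \<psi> x) < 1 / real (Suc l)"
      unfolding \<psi>_def using E[of "(mL, l)"] mL \<phi>(1) by auto
    note G = test_function_W1p(3)
    have g: "weak_grad \<Omega> u \<in> Lfun \<mu> p" by (rule W1pD(2)[OF W01p_imp_W1p[OF u]])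
    have a: "pint \<mu> p (\<lambda>x. grad (\<phi> k) x - grad \<psi> x) \<le> P * (\<delta> + \<delta>)"
    proof -
      have "pint \<mu> p (\<lambda>x. (grad (\<phi> k) x - q mL x) + (q mL x - grad \<psi> x)) \<le> P * (pint \<mu> p (\<lambda>x. grad (\<phi> k) x - q mL x) + pint \<mu> p (\<lambda>x. q mL x - grad \<psi> x))"
        unfolding P_def by (rule Lfun_add(2)[OF Lfun_diff(1)[OF G[OF \<phi>(1)] mL(2) p0] Lfun_diff(1)[OF mL(2) G[OF \<psi>(1)] p0] p0])
      also have "\<dots> \<le> P * (\<delta> + \<delta>)"
        using mL(1) \<psi>(2) l P pint_minus_commute[of \<mu> p "q mL" "grad (\<phi> k)"] by (intro mult_left_mono add_mono) auto
      finally show ?thesis by simp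
    qed
    have "pint \<mu> p (\<lambda>x. (weak_grad \<Omega> u x - grad (\<phi> k) x) + (grad (\<phi> k) x - grad \<psi> x)) \<le> P * (pint \<mu> p (\<lambda>x. weak_grad \<Omega> u x - grad (\<phi> k) x) + pint \<mu> p (\<lambda>x. grad (\<phi> k) x - grad \<psi> x))"
      unfolding P_def by (rule Lfun_add(2)[OF Lfun_diff(1)[OF g G[OF \<phi>(1)] p0] Lfun_diff(1)[OF G[OF \<phi>(1)] G[OF \<psi>(1)] p0] p0])
    also have "\<dots> < P * (\<delta> + P * (\<delta> + \<delta>))" using a k P by (intro mult_strict_left_mono add_less_le_mono) auto
    also have "\<dots> \<le> P * (P * \<delta> + P * (\<delta> + \<delta>))" using P \<delta> by (intro mult_left_mono add_right_mono) auto
    also have "\<dots> = 3 / 4 * \<epsilon>" using P by (simp add: \<delta>_def field_simps)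
    also have "\<dots> < \<epsilon>" using \<epsilon> by simp
    finally have "pint \<mu> p (\<lambda>x. weak_grad \<Omega> u x - grad \<psi> x) < \<epsilon>" by simp
    then show "\<exists>i. pint \<mu> p (\<lambda>x. weak_grad \<Omega> u x - grad (E (from_nat i)) x) < \<epsilon>"
      unfolding \<psi>_def by (intro exI[of _ "to_nat (mL, l)"]) simp
  qed
qed

end

section \<open>Duality and weak compactness\<close>

lemma dual_spaceD:
  assumes "g \<in> dual_space V nrm"
  shows "u \<in> V \<Longrightarrow> v \<in> V \<Longrightarrow> g (\<lambda>x. u x + v x) = g u + g v"
    "u \<in> V \<Longrightarrow> g (\<lambda>x. c * u x) = c * g u"
    "\<exists>C. \<forall>u\<in>V. \<bar>g u\<bar> \<le> C * nrm u"
  using assms by (auto simp: dual_space_def)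

lemma Lfun_conv_inner:
  fixes F :: "nat \<Rightarrow> 'a \<Rightarrow> 'b::euclidean_space"
  assumes rs: "1/r + 1/s = 1" "r > 1" and F: "\<And>k. F k \<in> Lfun M r" and F0: "F0 \<in> Lfun M r"
    and lim: "(\<lambda>k. pint M r (\<lambda>x. F k x - F0 x)) \<longlonglongrightarrow> 0" and H: "H \<in> Lfun M s"
  shows "(\<lambda>k. LINT x|M. F k x \<bullet> H x) \<longlonglongrightarrow> (LINT x|M. F0 x \<bullet> H x)"
proof -
  have r0: "r > 0" using rs by simp
  have "(\<lambda>k. pint M r (\<lambda>x. F k x - F0 x) powr (1/r) * pint M s H powr (1/s)) \<longlonglongrightarrow> 0 powr (1/r) * pint M s H powr (1/s)"
    by (intro tendsto_mult_right tendsto_powr2 lim) (use r0 in auto)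
  then have c: "(\<lambda>k. pint M r (\<lambda>x. F k x - F0 x) powr (1/r) * pint M s H powr (1/s)) \<longlonglongrightarrow> 0" by simp
  have b: "\<bar>(LINT x|M. F k x \<bullet> H x) - (LINT x|M. F0 x \<bullet> H x)\<bar> \<le> pint M r (\<lambda>x. F k x - F0 x) powr (1/r) * pint M s H powr (1/s)" for k
  proof -
    have "(LINT x|M. (F k x - F0 x) \<bullet> H x) = (LINT x|M. F k x \<bullet> H x) - (LINT x|M. F0 x \<bullet> H x)"
      using holder_inner(1)[OF rs F[of k] H] holder_inner(1)[OF rs F0 H] by (simp add: inner_diff_left)
    then show ?thesis using holder_inner(2)[OF rs Lfun_diff(1)[OF F[of k] F0 r0] H] by simp
  qed
  have "(\<lambda>k. (LINT x|M. F k x \<bullet> H x) - (LINT x|M. F0 x \<bullet> H x)) \<longlonglongrightarrow> 0"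
    by (rule Lim_null_comparison[OF always_eventually c]) (use b in simp)
  then show ?thesis by (rule LIM_zero_cancel)
qed

text \<open>The admissible exponents include p itself, where the embedding is Poincare's inequality:
  the gradient alone controls the function.\<close>

locale sobolev_embedding = bounded_open_set \<Omega> p for \<Omega> :: "'a::euclidean_space set" and p :: real +
  fixes pstar :: real and S :: "real \<Rightarrow> real"
  assumes p_less_pstar: "p < pstar"
    and embedding: "\<And>t. 1 \<le> t \<Longrightarrow> t \<le> pstar \<Longrightarrow>
          0 < S t \<and> (\<forall>u\<in>W01p \<Omega> p. eLp_norm \<Omega> t u \<le> ennreal (S t * Lp_norm \<Omega> p (weak_grad \<Omega> u)))"
begin

abbreviation "X \<equiv> W01p \<Omega> p"
abbreviation "D \<equiv> weak_grad \<Omega>"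
abbreviation "p' \<equiv> p / (p - 1)"

definition gnorm :: "('a \<Rightarrow> real) \<Rightarrow> real" where
  "gnorm u = pint \<mu> p (D u) powr (1/p)"

lemma conj_p: "1/p + 1/p' = 1" "1/p' + 1/p = 1" "p' > 1" "p' > 0"
  using p_gt_1 by (auto simp: field_simps)

lemma D_Lfun: "u \<in> X \<Longrightarrow> D u \<in> Lfun \<mu> p"
  by (rule W1pD(2)[OF W01p_imp_W1p])

lemma gnorm_nonneg [simp]: "0 \<le> gnorm u"
  by (simp add: gnorm_def)

lemma gnorm_powr: "gnorm u powr p = pint \<mu> p (D u)"
  using p_gt_1 by (simp add: gnorm_def powr_powr)

lemma W01p_norm_gnorm: "u \<in> X \<Longrightarrow> W01p_norm \<Omega> p u = gnorm u"
  by (simp add: W01p_norm_eq gnorm_def)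

lemma S_pos: "1 \<le> t \<Longrightarrow> t \<le> pstar \<Longrightarrow> 0 < S t"
  using embedding by blast

lemma embedding_Lfun:
  assumes "u \<in> X" "1 \<le> t" "t \<le> pstar"
  shows "u \<in> Lfun \<mu> t" "pint \<mu> t u powr (1/t) \<le> S t * gnorm u" "pint \<mu> t u \<le> (S t * gnorm u) powr t"
proof -
  have m: "u \<in> borel_measurable \<mu>" by (rule Lfun_measurable[OF W1pD(1)[OF W01p_imp_W1p[OF assms(1)]]])
  have e: "eLp_norm \<Omega> t u \<le> ennreal (S t * gnorm u)"
    using embedding[OF assms(2,3)] assms(1) by (simp add: Lp_norm_eq[OF D_Lfun] gnorm_def)
  have z: "S t * gnorm u \<ge> 0" using S_pos[OF assms(2,3)] by simp
  show "u \<in> Lfun \<mu> t" by (rule eLp_norm_le_imp(1)[OF m e z])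
  show b: "pint \<mu> t u powr (1/t) \<le> S t * gnorm u" by (rule eLp_norm_le_imp(2)[OF m e z])
  have "(pint \<mu> t u powr (1/t)) powr t \<le> (S t * gnorm u) powr t" using b assms by (intro powr_mono2) auto
  then show "pint \<mu> t u \<le> (S t * gnorm u) powr t" using assms by (simp add: powr_powr)
qed

lemma gnorm_AE:
  assumes "u \<in> X" "F \<in> borel_measurable \<mu>" "AE x in \<mu>. D u x = F x"
  shows "gnorm u = pint \<mu> p F powr (1/p)"
  unfolding gnorm_def using pint_cong_AE[OF Lfun_measurable[OF D_Lfun[OF assms(1)]] assms(2,3)] by simp

lemma gnorm_diff:
  assumes "u \<in> X" "v \<in> X"
  shows "gnorm (\<lambda>x. u x - v x) = pint \<mu> p (\<lambda>x. D u x - D v x) powr (1/p)"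
  by (rule gnorm_AE[OF W01p_diff[OF assms] Lfun_measurable[OF Lfun_diff(1)[OF D_Lfun[OF assms(1)] D_Lfun[OF assms(2)] p_gt_0]]
     W1p_diff(2)[OF W01p_imp_W1p[OF assms(1)] W01p_imp_W1p[OF assms(2)]]])

lemma functional_diff:
  assumes "l \<in> Wm1 \<Omega> p" "u \<in> X" "v \<in> X"
  shows "l (\<lambda>x. u x - v x) = l u - l v"
  using dual_spaceD(1)[OF assms(1,2) W01p_cmult[OF assms(3), of "-1"]] dual_spaceD(2)[OF assms(1,3), of "-1"] by simp

text \<open>Equal gradients put u and v at distance zero, which no bounded functional can
  see.\<close>

lemma functional_AE_eq:
  assumes l: "l \<in> Wm1 \<Omega> p" and u: "u \<in> X" and v: "v \<in> X" and e: "AE x in \<mu>. D u x = D v x"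
  shows "l u = l v"
proof -
  obtain C where C: "\<And>u. u \<in> X \<Longrightarrow> \<bar>l u\<bar> \<le> C * W01p_norm \<Omega> p u" using dual_spaceD(3)[OF l] by blast
  have "pint \<mu> p (\<lambda>x. D u x - D v x) = pint \<mu> p (\<lambda>x. 0 :: 'a)"
  proof (rule pint_cong_AE)
    show "AE x in \<mu>. D u x - D v x = 0" using e by eventually_elim simp
    show "(\<lambda>x. D u x - D v x) \<in> borel_measurable \<mu>" by (rule Lfun_measurable[OF Lfun_diff(1)[OF D_Lfun[OF u] D_Lfun[OF v] p_gt_0]])
  qed simp
  then have "gnorm (\<lambda>x. u x - v x) = 0" using gnorm_diff[OF u v] by (simp add: pint_def)
  then show ?thesis using C[OF W01p_diff[OF u v]] functional_diff[OF l u v] W01p_norm_gnorm[OF W01p_diff[OF u v]] by simp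
qed

text \<open>Saturated under a.e. equality: \<open>D\<close> is linear only up to null sets, so the
  bare image of \<open>X\<close> need not be a subspace.\<close>

definition grads :: "('a \<Rightarrow> 'a) set" where
  "grads = {F \<in> Lfun \<mu> p. \<exists>u\<in>X. AE x in \<mu>. F x = D u x}"

lemma D_grads: "u \<in> X \<Longrightarrow> D u \<in> grads"
  by (auto simp: grads_def D_Lfun)

text \<open>Poincare's inequality makes the functions themselves a Cauchy sequence. Their limit has
  F as weak gradient, since the defining identity passes to the limit against each test function,
  and one test function chosen close to each \<open>u k\<close> keeps the limit in
  \<open>W01p\<close>.\<close>

lemma W01p_closed:
  assumes u: "\<And>k. u k \<in> X" and F: "F \<in> Lfun \<mu> p" and lim: "(\<lambda>k. pint \<mu> p (\<lambda>x. D (u k) x - F x)) \<longlonglongrightarrow> 0"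
  shows "\<exists>v\<in>X. AE x in \<mu>. D v x = F x"
proof -
  note p0 = p_gt_0
  have p1: "1 \<le> p" "p \<le> pstar" using p_gt_1 p_less_pstar by auto
  have uL: "u k \<in> Lfun \<mu> p" for k by (rule embedding_Lfun(1)[OF u p1])
  define c where "c = S p powr p * 2 powr p"
  have c: "c > 0" unfolding c_def using S_pos[OF p1] by simp
  have ub: "pint \<mu> p (\<lambda>x. u m x - u n x) \<le> c * (pint \<mu> p (\<lambda>x. D (u m) x - F x) + pint \<mu> p (\<lambda>x. D (u n) x - F x))" for m n
  proof -
    have "pint \<mu> p (\<lambda>x. u m x - u n x) \<le> (S p * gnorm (\<lambda>x. u m x - u n x)) powr p"
      by (rule embedding_Lfun(3)[OF W01p_diff[OF u u] p1])
    also have "\<dots> = S p powr p * pint \<mu> p (\<lambda>x. (D (u m) x - F x) - (D (u n) x - F x))"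
      using S_pos[OF p1] p0 by (simp add: powr_mult gnorm_diff[OF u u] powr_powr)
    also have "\<dots> \<le> S p powr p * (2 powr p * (pint \<mu> p (\<lambda>x. D (u m) x - F x) + pint \<mu> p (\<lambda>x. D (u n) x - F x)))"
      by (intro mult_left_mono Lfun_diff(2)[OF Lfun_diff(1)[OF D_Lfun[OF u] F p0] Lfun_diff(1)[OF D_Lfun[OF u] F p0] p0]) simp
    finally show ?thesis by (simp add: c_def)
  qed
  have "\<exists>u0\<in>Lfun \<mu> p. (\<lambda>k. pint \<mu> p (\<lambda>x. u k x - u0 x)) \<longlonglongrightarrow> 0"
  proof (rule Lfun_complete[OF uL p0])
    fix \<epsilon> :: real assume "\<epsilon> > 0"
    then have "\<epsilon> / (2 * c) > 0" using c by simp
    from order_tendstoD(2)[OF lim this] obtain N where N: "\<And>k. k \<ge> N \<Longrightarrow> pint \<mu> p (\<lambda>x. D (u k) x - F x) < \<epsilon> / (2 * c)"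
      by (auto simp: eventually_sequentially)
    have "pint \<mu> p (\<lambda>x. u m x - u n x) < \<epsilon>" if "m \<ge> N" "n \<ge> N" for m n
    proof -
      have "c * (pint \<mu> p (\<lambda>x. D (u m) x - F x) + pint \<mu> p (\<lambda>x. D (u n) x - F x)) < c * (\<epsilon> / (2 * c) + \<epsilon> / (2 * c))"
        using N[OF that(1)] N[OF that(2)] c by (intro mult_strict_left_mono add_strict_mono)
      also have "\<dots> = \<epsilon>" using c by (simp add: field_simps)
      finally show ?thesis using ub[of m n] by linarith
    qed
    then show "\<exists>N. \<forall>m\<ge>N. \<forall>n\<ge>N. pint \<mu> p (\<lambda>x. u m x - u n x) < \<epsilon>" by blast
  qed
  then obtain v where vL: "v \<in> Lfun \<mu> p" and vlim: "(\<lambda>k. pint \<mu> p (\<lambda>x. u k x - v x)) \<longlonglongrightarrow> 0" by blast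
  \<comment> \<open>A second instance of the locale, with the conjugate exponent, places test
    functions in the dual Lebesgue space.\<close>
  have bo: "bounded_open_set \<Omega> p'" using open_domain bounded_domain conj_p(3) by unfold_locales
  note tL = bounded_open_set.W1pD(1)[OF bo bounded_open_set.test_function_W1p(1)[OF bo]]
  have wg: "has_weak_gradient \<Omega> v F"
    unfolding has_weak_gradient_def
  proof (intro conjI ballI)
    show "locally_integrable \<Omega> v" "locally_integrable \<Omega> F"
      using vL F p_gt_1 by (auto intro!: integrable_imp_locally_integrable Lfun_imp_integrable)
    fix \<phi> b assume t: "\<phi> \<in> test_functions \<Omega>" and b: "b \<in> (Basis :: 'a set)"
    have 1: "(\<lambda>k. LINT x|\<mu>. u k x \<bullet> frechet_derivative \<phi> (at x) b) \<longlonglongrightarrow> (LINT x|\<mu>. v x \<bullet> frechet_derivative \<phi> (at x) b)"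
      by (rule Lfun_conv_inner[OF conj_p(1) p_gt_1 uL vL vlim tL[OF test_function_frechet_derivative[OF t b]]])
    have bL: "(\<lambda>x. \<phi> x *\<^sub>R b) \<in> Lfun \<mu> p'"
    proof (rule Lfun_bound(1)[OF _ Lfun_integrable[OF tL[OF t]]])
      show "(\<lambda>x. \<phi> x *\<^sub>R b) \<in> borel_measurable \<mu>" using Lfun_measurable[OF tL[OF t]] by simp
    qed (use b in simp)
    have 2: "(\<lambda>k. LINT x|\<mu>. D (u k) x \<bullet> (\<phi> x *\<^sub>R b)) \<longlonglongrightarrow> (LINT x|\<mu>. F x \<bullet> (\<phi> x *\<^sub>R b))"
      by (rule Lfun_conv_inner[OF conj_p(1) p_gt_1 D_Lfun[OF u] F lim bL])
    have "(LINT x|\<mu>. u k x * frechet_derivative \<phi> (at x) b) = - (LINT x|\<mu>. (D (u k) x \<bullet> b) * \<phi> x)" for k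
      using W1pD(3)[OF W01p_imp_W1p[OF u]] t b by (auto simp: has_weak_gradient_def)
    then have "(\<lambda>k. LINT x|\<mu>. u k x \<bullet> frechet_derivative \<phi> (at x) b) = (\<lambda>k. - (LINT x|\<mu>. D (u k) x \<bullet> (\<phi> x *\<^sub>R b)))"
      by (simp add: mult.commute)
    then have "(\<lambda>k. LINT x|\<mu>. u k x \<bullet> frechet_derivative \<phi> (at x) b) \<longlonglongrightarrow> - (LINT x|\<mu>. F x \<bullet> (\<phi> x *\<^sub>R b))"
      using tendsto_minus[OF 2] by simp
    from LIMSEQ_unique[OF 1 this] show "(LINT x|\<mu>. v x * frechet_derivative \<phi> (at x) b) = - (LINT x|\<mu>. (F x \<bullet> b) * \<phi> x)"
      by (simp add: mult.commute)
  qed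
  have vW: "v \<in> W1p \<Omega> p" by (rule W1pI[OF vL wg F])
  have vF: "AE x in \<mu>. D v x = F x" by (rule weak_grad_eq(2)[OF wg F])
  have "\<exists>\<phi>\<in>test_functions \<Omega>. pint \<mu> p (\<lambda>x. u k x - \<phi> x) < 1 / real (Suc k) \<and> pint \<mu> p (\<lambda>x. D (u k) x - grad \<phi> x) < 1 / real (Suc k)" for k
  proof -
    obtain \<phi> where \<phi>: "\<And>j. \<phi> j \<in> test_functions \<Omega>" "(\<lambda>j. pint \<mu> p (\<lambda>x. u k x - \<phi> j x)) \<longlonglongrightarrow> 0"
      "(\<lambda>j. pint \<mu> p (\<lambda>x. D (u k) x - grad (\<phi> j) x)) \<longlonglongrightarrow> 0" using u[of k] unfolding W01p_iff by blast
    have "eventually (\<lambda>j. pint \<mu> p (\<lambda>x. u k x - \<phi> j x) < 1 / real (Suc k) \<and> pint \<mu> p (\<lambda>x. D (u k) x - grad (\<phi> j) x) < 1 / real (Suc k)) sequentially"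
      by (intro eventually_conj order_tendstoD(2)[OF \<phi>(2)] order_tendstoD(2)[OF \<phi>(3)]) auto
    then show ?thesis using \<phi>(1) by (auto simp: eventually_sequentially)
  qed
  then obtain \<phi> where \<phi>: "\<And>k. \<phi> k \<in> test_functions \<Omega>" "\<And>k. pint \<mu> p (\<lambda>x. u k x - \<phi> k x) < 1 / real (Suc k)"
    "\<And>k. pint \<mu> p (\<lambda>x. D (u k) x - grad (\<phi> k) x) < 1 / real (Suc k)" by metis
  have z: "(\<lambda>k. 1 / real (Suc k)) \<longlonglongrightarrow> 0" using LIMSEQ_inverse_real_of_nat by (simp add: inverse_eq_divide)
  have z1: "(\<lambda>k. pint \<mu> p (\<lambda>x. u k x - \<phi> k x)) \<longlonglongrightarrow> 0" "(\<lambda>k. pint \<mu> p (\<lambda>x. D (u k) x - grad (\<phi> k) x)) \<longlonglongrightarrow> 0"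
    by (rule Lim_null_comparison[OF always_eventually z], use \<phi> in \<open>auto intro: less_imp_le\<close>)+
  have G: "grad (\<phi> k) \<in> Lfun \<mu> p" "\<phi> k \<in> Lfun \<mu> p" for k
    using test_function_W1p(3)[OF \<phi>(1)] W1pD(1)[OF test_function_W1p(1)[OF \<phi>(1)]] by auto
  have "(\<lambda>k. pint \<mu> p (\<lambda>x. (v x - u k x) + (u k x - \<phi> k x))) \<longlonglongrightarrow> 0"
    by (rule pint_add_tendsto_0[OF Lfun_diff(1)[OF vL uL p0] Lfun_diff(1)[OF uL G(2) p0] p0 _ z1(1)])
      (use vlim in \<open>simp add: pint_minus_commute[of _ _ v]\<close>)
  then have a: "(\<lambda>k. pint \<mu> p (\<lambda>x. v x - \<phi> k x)) \<longlonglongrightarrow> 0" by simp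
  have "(\<lambda>k. pint \<mu> p (\<lambda>x. (F x - D (u k) x) + (D (u k) x - grad (\<phi> k) x))) \<longlonglongrightarrow> 0"
    by (rule pint_add_tendsto_0[OF Lfun_diff(1)[OF F D_Lfun[OF u] p0] Lfun_diff(1)[OF D_Lfun[OF u] G(1) p0] p0 _ z1(2)])
      (use lim in \<open>simp add: pint_minus_commute[of _ _ F]\<close>)
  then have "(\<lambda>k. pint \<mu> p (\<lambda>x. F x - grad (\<phi> k) x)) \<longlonglongrightarrow> 0" by simp
  moreover have "pint \<mu> p (\<lambda>x. D v x - grad (\<phi> k) x) = pint \<mu> p (\<lambda>x. F x - grad (\<phi> k) x)" for k
  proof (rule pint_cong_AE)
    show "AE x in \<mu>. D v x - grad (\<phi> k) x = F x - grad (\<phi> k) x" using vF by eventually_elim simp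
    show "(\<lambda>x. D v x - grad (\<phi> k) x) \<in> borel_measurable \<mu>" "(\<lambda>x. F x - grad (\<phi> k) x) \<in> borel_measurable \<mu>"
      using Lfun_measurable[OF Lfun_diff(1)[OF F G(1) p0]] Lfun_measurable[OF Lfun_diff(1)[OF W1pD(2)[OF vW] G(1) p0]] by blast+
  qed
  ultimately have b: "(\<lambda>k. pint \<mu> p (\<lambda>x. D v x - grad (\<phi> k) x)) \<longlonglongrightarrow> 0" by simp
  have "v \<in> X" unfolding W01p_iff by (intro conjI exI[of _ \<phi>] allI) (rule vW \<phi>(1) a b)+
  then show ?thesis using vF by blast
qed

lemma grads_closed: "closed_subspace_Lfun \<mu> p grads"
  unfolding closed_subspace_Lfun_def
proof (intro conjI ballI allI impI)
  note p0 = p_gt_0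
  show "grads \<subseteq> Lfun \<mu> p" by (auto simp: grads_def)
  have "AE x in \<mu>. D (\<lambda>x. 0) x = grad (\<lambda>x. 0) x" by (rule test_function_W1p(2)[OF test_function_zero])
  then have "AE x in \<mu>. 0 = D (\<lambda>x. 0) x" by eventually_elim (simp add: grad_zero)
  then show "(\<lambda>x. 0) \<in> grads" using W01p_zero by (auto simp: grads_def)
  show "(\<lambda>x. F x + G x) \<in> grads" if "F \<in> grads" "G \<in> grads" for F G
  proof -
    obtain u v where u: "u \<in> X" "AE x in \<mu>. F x = D u x" and v: "v \<in> X" "AE x in \<mu>. G x = D v x"
      using \<open>F \<in> grads\<close> \<open>G \<in> grads\<close> unfolding grads_def by blast
    have "AE x in \<mu>. F x + G x = D (\<lambda>x. u x + v x) x"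
      using u(2) v(2) W1p_add(2)[OF W01p_imp_W1p[OF u(1)] W01p_imp_W1p[OF v(1)]] by eventually_elim simp
    then show ?thesis using that W01p_add[OF u(1) v(1)] Lfun_add(1)[of F \<mu> p G] p0 by (auto simp: grads_def)
  qed
  show "(\<lambda>x. c *\<^sub>R F x) \<in> grads" if "F \<in> grads" for F c
  proof -
    obtain u where u: "u \<in> X" "AE x in \<mu>. F x = D u x" using \<open>F \<in> grads\<close> unfolding grads_def by blast
    have "AE x in \<mu>. c *\<^sub>R F x = D (\<lambda>x. c * u x) x"
      using u(2) W1p_cmult(2)[OF W01p_imp_W1p[OF u(1)], of c] by eventually_elim simp
    then show ?thesis using that W01p_cmult[OF u(1)] Lfun_scaleR(1)[of F \<mu> p c] by (auto simp: grads_def)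
  qed
  show "F \<in> grads" if Fk: "\<forall>k. Fk k \<in> grads" and F: "F \<in> Lfun \<mu> p" and lim: "(\<lambda>k. pint \<mu> p (\<lambda>x. Fk k x - F x)) \<longlonglongrightarrow> 0" for Fk F
  proof -
    have "\<forall>k. \<exists>u\<in>X. AE x in \<mu>. Fk k x = D u x" using Fk unfolding grads_def by blast
    then obtain u where u: "\<And>k. u k \<in> X" "\<And>k. AE x in \<mu>. Fk k x = D (u k) x" by metis
    have FkL: "Fk k \<in> Lfun \<mu> p" for k using Fk unfolding grads_def by blast
    have "pint \<mu> p (\<lambda>x. D (u k) x - F x) = pint \<mu> p (\<lambda>x. Fk k x - F x)" for k
    proof (rule pint_cong_AE)
      show "AE x in \<mu>. D (u k) x - F x = Fk k x - F x" using u(2)[of k] by eventually_elim simp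
      show "(\<lambda>x. D (u k) x - F x) \<in> borel_measurable \<mu>" "(\<lambda>x. Fk k x - F x) \<in> borel_measurable \<mu>"
        using Lfun_measurable[OF Lfun_diff(1)[OF D_Lfun[OF u(1)] F p0]] Lfun_measurable[OF Lfun_diff(1)[OF FkL F p0]] by blast+
    qed
    then have "\<exists>v\<in>X. AE x in \<mu>. D v x = F x" using lim by (intro W01p_closed[OF u(1) F]) simp
    then obtain v where v: "v \<in> X" "AE x in \<mu>. D v x = F x" by blast
    have "AE x in \<mu>. F x = D v x" using v(2) by eventually_elim simp
    then show ?thesis using F v(1) by (auto simp: grads_def)
  qed
qed

text \<open>The p-Laplace equation with right-hand side l, solved by minimization over the closed
  space \<open>grads\<close>. The selection U of a primitive for each gradient field is harmless,
  because l depends on the gradient only.\<close>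

lemma functional_flux_representation:
  assumes l: "l \<in> Wm1 \<Omega> p"
  shows "\<exists>w\<in>X. \<forall>v\<in>X. (LINT x|\<mu>. flux p (D w x) \<bullet> D v x) = l v"
proof -
  define U where "U F = (SOME u. u \<in> X \<and> (AE x in \<mu>. F x = D u x))" for F
  have U: "U F \<in> X" "AE x in \<mu>. F x = D (U F) x" if "F \<in> grads" for F
  proof -
    have "\<exists>u. u \<in> X \<and> (AE x in \<mu>. F x = D u x)" using that unfolding grads_def by blast
    from someI_ex[OF this] show "U F \<in> X" "AE x in \<mu>. F x = D (U F) x" unfolding U_def by blast+
  qed
  have lU: "l (U F) = l u" if "F \<in> grads" "u \<in> X" "AE x in \<mu>. F x = D u x" for F u
  proof (rule functional_AE_eq[OF l U(1)[OF that(1)] that(2)])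
    show "AE x in \<mu>. D (U F) x = D u x" using U(2)[OF that(1)] that(3) by eventually_elim simp
  qed
  obtain C where C: "\<And>u. u \<in> X \<Longrightarrow> \<bar>l u\<bar> \<le> C * W01p_norm \<Omega> p u" using dual_spaceD(3)[OF l] by blast
  have ga: "(\<lambda>x. F x + H x) \<in> grads" if "F \<in> grads" "H \<in> grads" for F H
    using grads_closed that unfolding closed_subspace_Lfun_def by blast
  have gs: "(\<lambda>x. c *\<^sub>R F x) \<in> grads" if "F \<in> grads" for F c
    using grads_closed that unfolding closed_subspace_Lfun_def by blast
  have gL: "F \<in> Lfun \<mu> p" if "F \<in> grads" for F using that by (simp add: grads_def)
  have "\<exists>F\<in>grads. \<forall>H\<in>grads. (LINT x|\<mu>. flux p (F x) \<bullet> H x) = l (U H)"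
  proof (rule flux_represents_functional[OF conj_p(1) p_gt_1 grads_closed])
    fix F H assume FH: "F \<in> grads" "H \<in> grads"
    have "AE x in \<mu>. F x + H x = D (\<lambda>x. U F x + U H x) x"
      using U(2)[OF FH(1)] U(2)[OF FH(2)] W1p_add(2)[OF W01p_imp_W1p[OF U(1)[OF FH(1)]] W01p_imp_W1p[OF U(1)[OF FH(2)]]] by eventually_elim simp
    from lU[OF ga[OF FH] W01p_add[OF U(1)[OF FH(1)] U(1)[OF FH(2)]] this]
    show "l (U (\<lambda>x. F x + H x)) = l (U F) + l (U H)" using dual_spaceD(1)[OF l U(1)[OF FH(1)] U(1)[OF FH(2)]] by simp
  next
    fix c F assume F: "F \<in> grads"
    have "AE x in \<mu>. c *\<^sub>R F x = D (\<lambda>x. c * U F x) x"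
      using U(2)[OF F] W1p_cmult(2)[OF W01p_imp_W1p[OF U(1)[OF F]], of c] by eventually_elim simp
    from lU[OF gs[OF F] W01p_cmult[OF U(1)[OF F]] this]
    show "l (U (\<lambda>x. c *\<^sub>R F x)) = c * l (U F)" using dual_spaceD(2)[OF l U(1)[OF F]] by simp
  next
    fix F assume F: "F \<in> grads"
    have "AE x in \<mu>. D (U F) x = F x" using U(2)[OF F] by eventually_elim simp
    then show "\<bar>l (U F)\<bar> \<le> C * pint \<mu> p F powr (1/p)"
      using C[OF U(1)[OF F]] W01p_norm_gnorm[OF U(1)[OF F]] gnorm_AE[OF U(1)[OF F] Lfun_measurable[OF gL[OF F]]] by simp
  qed
  then obtain F where F: "F \<in> grads" "\<And>H. H \<in> grads \<Longrightarrow> (LINT x|\<mu>. flux p (F x) \<bullet> H x) = l (U H)" by blast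
  have "(LINT x|\<mu>. flux p (D (U F) x) \<bullet> D v x) = l v" if v: "v \<in> X" for v
  proof -
    have "(LINT x|\<mu>. flux p (D (U F) x) \<bullet> D v x) = (LINT x|\<mu>. flux p (F x) \<bullet> D v x)"
    proof (rule integral_cong_AE)
      show "AE x in \<mu>. flux p (D (U F) x) \<bullet> D v x = flux p (F x) \<bullet> D v x" using U(2)[OF F(1)] by eventually_elim simp
    qed (intro borel_measurable_inner borel_measurable_flux Lfun_measurable[OF D_Lfun[OF v]] Lfun_measurable[OF gL[OF F(1)]] Lfun_measurable[OF D_Lfun[OF U(1)[OF F(1)]]])+
    also have "\<dots> = l (U (D v))" by (rule F(2)[OF D_grads[OF v]])
    also have "\<dots> = l v" by (rule lU[OF D_grads[OF v] v]) simp
    finally show ?thesis .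
  qed
  then show ?thesis using U(1)[OF F(1)] by blast
qed

section \<open>Functionals in divergence form and the dual norm\<close>

lemma neg_div_bound:
  assumes F: "F \<in> Lfun \<mu> p'" and v: "v \<in> X"
  shows "integrable \<mu> (\<lambda>x. F x \<bullet> D v x)" "\<bar>neg_div \<Omega> F v\<bar> \<le> pint \<mu> p' F powr (1/p') * gnorm v"
  using holder_inner[OF conj_p(2,3) F D_Lfun[OF v]] by (simp_all add: neg_div_def gnorm_def)

lemma neg_div_Wm1:
  assumes F: "F \<in> Lfun \<mu> p'"
  shows "neg_div \<Omega> F \<in> Wm1 \<Omega> p"
  unfolding dual_space_def
proof (intro CollectI conjI ballI allI)
  note Fm = Lfun_measurable[OF F]
  fix u assume u: "u \<in> X"
  show "neg_div \<Omega> F (\<lambda>x. c * u x) = c * neg_div \<Omega> F u" for c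
  proof -
    have "(LINT x|\<mu>. F x \<bullet> D (\<lambda>x. c * u x) x) = (LINT x|\<mu>. c * (F x \<bullet> D u x))"
    proof (rule integral_cong_AE)
      show "AE x in \<mu>. F x \<bullet> D (\<lambda>x. c * u x) x = c * (F x \<bullet> D u x)"
        using W1p_cmult(2)[OF W01p_imp_W1p[OF u], of c] by eventually_elim simp
      show "(\<lambda>x. F x \<bullet> D (\<lambda>x. c * u x) x) \<in> borel_measurable \<mu>"
        by (rule borel_measurable_inner[OF Fm Lfun_measurable[OF D_Lfun[OF W01p_cmult[OF u]]]])
      show "(\<lambda>x. c * (F x \<bullet> D u x)) \<in> borel_measurable \<mu>"
        by (rule borel_measurable_times[OF borel_measurable_const borel_measurable_inner[OF Fm Lfun_measurable[OF D_Lfun[OF u]]]])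
    qed
    then show ?thesis by (simp add: neg_div_def)
  qed
  fix v assume v: "v \<in> X"
  have "(LINT x|\<mu>. F x \<bullet> D (\<lambda>x. u x + v x) x) = (LINT x|\<mu>. F x \<bullet> D u x + F x \<bullet> D v x)"
  proof (rule integral_cong_AE)
    show "AE x in \<mu>. F x \<bullet> D (\<lambda>x. u x + v x) x = F x \<bullet> D u x + F x \<bullet> D v x"
      using W1p_add(2)[OF W01p_imp_W1p[OF u] W01p_imp_W1p[OF v]] by eventually_elim (simp add: inner_add_right)
    show "(\<lambda>x. F x \<bullet> D (\<lambda>x. u x + v x) x) \<in> borel_measurable \<mu>"
      by (rule borel_measurable_inner[OF Fm Lfun_measurable[OF D_Lfun[OF W01p_add[OF u v]]]])
    show "(\<lambda>x. F x \<bullet> D u x + F x \<bullet> D v x) \<in> borel_measurable \<mu>"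
      by (intro borel_measurable_add borel_measurable_inner Fm Lfun_measurable[OF D_Lfun[OF u]] Lfun_measurable[OF D_Lfun[OF v]])
  qed
  then show "neg_div \<Omega> F (\<lambda>x. u x + v x) = neg_div \<Omega> F u + neg_div \<Omega> F v"
    using neg_div_bound(1)[OF F u] neg_div_bound(1)[OF F v] by (simp add: neg_div_def)
next
  show "\<exists>C. \<forall>u\<in>X. \<bar>neg_div \<Omega> F u\<bar> \<le> C * W01p_norm \<Omega> p u"
    using neg_div_bound(2)[OF F] by (auto simp: W01p_norm_gnorm)
qed

lemma dual_bdd_above:
  assumes l: "l \<in> Wm1 \<Omega> p"
  shows "bdd_above ((\<lambda>u. \<bar>l u\<bar>) ` {u \<in> X. W01p_norm \<Omega> p u \<le> 1})"
proof -
  obtain C where C: "\<And>u. u \<in> X \<Longrightarrow> \<bar>l u\<bar> \<le> C * gnorm u"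
    using dual_spaceD(3)[OF l] W01p_norm_gnorm by metis
  show ?thesis
  proof (rule bdd_aboveI2)
    fix w assume w: "w \<in> {u \<in> X. W01p_norm \<Omega> p u \<le> 1}"
    then have "\<bar>l w\<bar> \<le> C * gnorm w" "gnorm w \<le> 1" using C by (auto simp: W01p_norm_gnorm)
    moreover have "C * gnorm w \<le> \<bar>C\<bar> * 1" using \<open>gnorm w \<le> 1\<close> by (intro mult_mono) auto
    ultimately show "\<bar>l w\<bar> \<le> \<bar>C\<bar>" by simp
  qed
qed

lemma zero_in_unit_ball: "(\<lambda>x. 0) \<in> {u \<in> X. W01p_norm \<Omega> p u \<le> 1}"
proof -
  have "gnorm (\<lambda>x. 0) = pint \<mu> p (\<lambda>x. 0 :: 'a) powr (1/p)"
    using test_function_W1p(2)[OF test_function_zero] by (intro gnorm_AE W01p_zero) (simp_all add: grad_zero)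
  then show ?thesis using W01p_zero W01p_norm_gnorm[OF W01p_zero] by (simp add: pint_def)
qed

lemma dual_norm_nonneg:
  assumes l: "l \<in> Wm1 \<Omega> p"
  shows "0 \<le> Wm1_norm \<Omega> p l"
proof -
  have "0 \<le> \<bar>l (\<lambda>x. 0)\<bar>" by simp
  also have "\<dots> \<le> Wm1_norm \<Omega> p l" unfolding dual_norm_def
    by (rule cSUP_upper[OF zero_in_unit_ball dual_bdd_above[OF l]])
  finally show ?thesis .
qed

text \<open>Scaling to norm one; a vector of norm zero cannot be scaled and is handled by the
  constant from the definition of the dual.\<close>

lemma dual_norm_bound:
  assumes l: "l \<in> Wm1 \<Omega> p" and u: "u \<in> X"
  shows "\<bar>l u\<bar> \<le> Wm1_norm \<Omega> p l * gnorm u"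
proof -
  obtain C where C: "\<And>u. u \<in> X \<Longrightarrow> \<bar>l u\<bar> \<le> C * gnorm u"
    using dual_spaceD(3)[OF l] W01p_norm_gnorm by metis
  show ?thesis
  proof (cases "gnorm u = 0")
    case True
    then show ?thesis using C[OF u] by simp
  next
    case False
    then have g: "gnorm u > 0" using gnorm_nonneg by (metis less_eq_real_def)
    define v where "v x = (1 / gnorm u) * u x" for x
    have v: "v \<in> X" unfolding v_def by (rule W01p_cmult[OF u])
    have "gnorm v = pint \<mu> p (\<lambda>x. (1 / gnorm u) *\<^sub>R D u x) powr (1/p)" unfolding v_def
      by (rule gnorm_AE[OF W01p_cmult[OF u] Lfun_measurable[OF Lfun_scaleR(1)[OF D_Lfun[OF u]]] W1p_cmult(2)[OF W01p_imp_W1p[OF u]]])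
    also have "\<dots> = ((1 / gnorm u) powr p * pint \<mu> p (D u)) powr (1/p)"
      using Lfun_scaleR(2)[OF D_Lfun[OF u], of "1 / gnorm u"] by simp
    also have "\<dots> = 1 / gnorm u * gnorm u"
      using p_gt_1 by (simp add: powr_mult powr_powr gnorm_def)
    finally have gv: "gnorm v = 1" using g by simp
    have "\<bar>l v\<bar> \<le> Wm1_norm \<Omega> p l" unfolding dual_norm_def
      by (rule cSUP_upper[OF _ dual_bdd_above[OF l]]) (use v gv in \<open>simp add: W01p_norm_gnorm\<close>)
    moreover have "l v = (1 / gnorm u) * l u" unfolding v_def by (rule dual_spaceD(2)[OF l u])
    ultimately show ?thesis using g by (simp add: abs_mult divide_le_eq)
  qed
qed

lemma dual_norm_le:
  assumes "\<And>u. u \<in> X \<Longrightarrow> \<bar>l u\<bar> \<le> C * gnorm u" "C \<ge> 0"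
  shows "Wm1_norm \<Omega> p l \<le> C"
  unfolding dual_norm_def
proof (rule cSUP_least)
  show "{u \<in> X. W01p_norm \<Omega> p u \<le> 1} \<noteq> {}" using zero_in_unit_ball by blast
  fix u assume "u \<in> {u \<in> X. W01p_norm \<Omega> p u \<le> 1}"
  then have u: "u \<in> X" "gnorm u \<le> 1" by (auto simp: W01p_norm_gnorm)
  have "C * gnorm u \<le> C * 1" using u assms by (intro mult_left_mono) auto
  then show "\<bar>l u\<bar> \<le> C" using assms(1)[OF u(1)] by simp
qed

lemma Wm1_add:
  assumes l: "l \<in> Wm1 \<Omega> p" and m: "m \<in> Wm1 \<Omega> p"
  shows "(\<lambda>v. l v + m v) \<in> Wm1 \<Omega> p"
  unfolding dual_space_def
proof (intro CollectI conjI ballI allI)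
  obtain A B where A: "\<And>u. u \<in> X \<Longrightarrow> \<bar>l u\<bar> \<le> A * W01p_norm \<Omega> p u" and B: "\<And>u. u \<in> X \<Longrightarrow> \<bar>m u\<bar> \<le> B * W01p_norm \<Omega> p u"
    using dual_spaceD(3)[OF l] dual_spaceD(3)[OF m] by blast
  have "\<bar>l u + m u\<bar> \<le> (A + B) * W01p_norm \<Omega> p u" if "u \<in> X" for u
    using A[OF that] B[OF that] by (simp add: distrib_right)
  then show "\<exists>C. \<forall>u\<in>X. \<bar>l u + m u\<bar> \<le> C * W01p_norm \<Omega> p u" by blast
qed (use dual_spaceD(1,2)[OF l] dual_spaceD(1,2)[OF m] in \<open>simp_all add: distrib_left\<close>)

lemma Wm1_cmult:
  assumes l: "l \<in> Wm1 \<Omega> p"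
  shows "(\<lambda>v. c * l v) \<in> Wm1 \<Omega> p"
  unfolding dual_space_def
proof (intro CollectI conjI ballI allI)
  obtain A where A: "\<And>u. u \<in> X \<Longrightarrow> \<bar>l u\<bar> \<le> A * W01p_norm \<Omega> p u" using dual_spaceD(3)[OF l] by blast
  have "\<bar>c * l u\<bar> \<le> (\<bar>c\<bar> * A) * W01p_norm \<Omega> p u" if "u \<in> X" for u
    using mult_left_mono[OF A[OF that], of "\<bar>c\<bar>"] by (simp add: abs_mult mult.assoc)
  then show "\<exists>C. \<forall>u\<in>X. \<bar>c * l u\<bar> \<le> C * W01p_norm \<Omega> p u" by blast
qed (use dual_spaceD(1,2)[OF l] in \<open>simp_all add: distrib_left\<close>)

lemma Wm1_diff: "l \<in> Wm1 \<Omega> p \<Longrightarrow> m \<in> Wm1 \<Omega> p \<Longrightarrow> (\<lambda>v. l v - m v) \<in> Wm1 \<Omega> p"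
  using Wm1_add[of l "\<lambda>v. -1 * m v"] Wm1_cmult[of m "-1"] by simp

text \<open>Composed with \<open>neg_div\<close>, g becomes a functional on L^(p'), hence is given
  by some V in L^p. Fields that annihilate all gradients annihilate V, so V is itself the gradient
  of some v. Every l agrees on \<open>X\<close> with \<open>neg_div\<close> of a flux, and this
  carries the identity over to l.\<close>

theorem W01p_reflexive:
  assumes g: "g \<in> dual_space (Wm1 \<Omega> p) (Wm1_norm \<Omega> p)"
  shows "\<exists>v\<in>X. \<forall>l\<in>Wm1 \<Omega> p. g l = l v"
proof -
  obtain C where C: "\<And>l. l \<in> Wm1 \<Omega> p \<Longrightarrow> \<bar>g l\<bar> \<le> C * Wm1_norm \<Omega> p l" using dual_spaceD(3)[OF g] by blast
  \<comment> \<open>Functionals are arbitrary off \<open>X\<close>. Agreement on \<open>X\<close>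
    means dual distance zero, which the bounded g cannot see.\<close>
  have cong: "g l = g m" if l: "l \<in> Wm1 \<Omega> p" and m: "m \<in> Wm1 \<Omega> p" and eq: "\<And>u. u \<in> X \<Longrightarrow> l u = m u" for l m
  proof -
    define d where "d v = l v + (-1) * m v" for v
    have d: "d \<in> Wm1 \<Omega> p" unfolding d_def by (rule Wm1_add[OF l Wm1_cmult[OF m]])
    have "Wm1_norm \<Omega> p d \<le> 0" by (rule dual_norm_le) (use eq in \<open>auto simp: d_def\<close>)
    moreover have "Wm1_norm \<Omega> p d \<ge> 0" by (rule dual_norm_nonneg[OF d])
    ultimately have "g d = 0" using C[OF d] by simp
    then show ?thesis using dual_spaceD(1)[OF g l Wm1_cmult[OF m, of "-1"]] dual_spaceD(2)[OF g m, of "-1"] by (simp add: d_def[abs_def])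
  qed
  have nb: "Wm1_norm \<Omega> p (neg_div \<Omega> F) \<le> pint \<mu> p' F powr (1/p')" if "F \<in> Lfun \<mu> p'" for F
    by (rule dual_norm_le[OF neg_div_bound(2)[OF that]]) auto
  have "\<exists>V\<in>Lfun \<mu> p. \<forall>F\<in>Lfun \<mu> p'. (LINT x|\<mu>. V x \<bullet> F x) = g (neg_div \<Omega> F)"
  proof (rule Lfun_riesz[OF conj_p(2,3), of \<mu> "\<lambda>F. g (neg_div \<Omega> F)" "\<bar>C\<bar>"])
    fix F H :: "'a \<Rightarrow> 'a" assume F: "F \<in> Lfun \<mu> p'" and H: "H \<in> Lfun \<mu> p'"
    note FH = Lfun_add(1)[OF F H conj_p(4)]
    have "g (neg_div \<Omega> (\<lambda>x. F x + H x)) = g (\<lambda>v. neg_div \<Omega> F v + neg_div \<Omega> H v)"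
      by (rule cong[OF neg_div_Wm1[OF FH] Wm1_add[OF neg_div_Wm1[OF F] neg_div_Wm1[OF H]]])
        (use neg_div_bound(1)[OF F] neg_div_bound(1)[OF H] in \<open>simp add: neg_div_def inner_add_left\<close>)
    then show "g (neg_div \<Omega> (\<lambda>x. F x + H x)) = g (neg_div \<Omega> F) + g (neg_div \<Omega> H)"
      using dual_spaceD(1)[OF g neg_div_Wm1[OF F] neg_div_Wm1[OF H]] by simp
  next
    fix c and F :: "'a \<Rightarrow> 'a" assume F: "F \<in> Lfun \<mu> p'"
    have "neg_div \<Omega> (\<lambda>x. c *\<^sub>R F x) = (\<lambda>v. c * neg_div \<Omega> F v)" by (simp add: neg_div_def fun_eq_iff)
    then show "g (neg_div \<Omega> (\<lambda>x. c *\<^sub>R F x)) = c * g (neg_div \<Omega> F)" using dual_spaceD(2)[OF g neg_div_Wm1[OF F]] by simp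
  next
    fix F :: "'a \<Rightarrow> 'a" assume F: "F \<in> Lfun \<mu> p'"
    have "\<bar>g (neg_div \<Omega> F)\<bar> \<le> C * Wm1_norm \<Omega> p (neg_div \<Omega> F)" by (rule C[OF neg_div_Wm1[OF F]])
    also have "\<dots> \<le> \<bar>C\<bar> * pint \<mu> p' F powr (1/p')"
      using nb[OF F] dual_norm_nonneg[OF neg_div_Wm1[OF F]] by (intro mult_mono) auto
    finally show "\<bar>g (neg_div \<Omega> F)\<bar> \<le> \<bar>C\<bar> * pint \<mu> p' F powr (1/p')" .
  qed
  then obtain V where V: "V \<in> Lfun \<mu> p" "\<And>F. F \<in> Lfun \<mu> p' \<Longrightarrow> (LINT x|\<mu>. V x \<bullet> F x) = g (neg_div \<Omega> F)" by blast
  have "\<exists>H\<in>grads. AE x in \<mu>. H x = V x"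
  proof (rule annihilator_closed_subspace[OF conj_p(1) p_gt_1 grads_closed V(1)])
    fix F assume F: "F \<in> Lfun \<mu> p'" and ann: "\<And>H. H \<in> grads \<Longrightarrow> (LINT x|\<mu>. F x \<bullet> H x) = 0"
    have zero: "(\<lambda>v. 0) \<in> Wm1 \<Omega> p" using Wm1_cmult[OF neg_div_Wm1[OF F], of 0] by simp
    have "g (neg_div \<Omega> F) = g (\<lambda>v. 0)"
      by (rule cong[OF neg_div_Wm1[OF F] zero]) (use ann[OF D_grads] in \<open>simp add: neg_div_def\<close>)
    also have "g (\<lambda>v. 0) = 0" using dual_spaceD(2)[OF g zero, of 0] by simp
    finally show "(LINT x|\<mu>. F x \<bullet> V x) = 0" using V(2)[OF F] by (simp add: inner_commute)
  qed
  then obtain H v where H: "H \<in> grads" "AE x in \<mu>. H x = V x" and v: "v \<in> X" "AE x in \<mu>. H x = D v x"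
    unfolding grads_def by blast
  have Vv: "AE x in \<mu>. V x = D v x" using H(2) v(2) by eventually_elim simp
  have "g l = l v" if l: "l \<in> Wm1 \<Omega> p" for l
  proof -
    obtain w where w: "w \<in> X" "\<And>u. u \<in> X \<Longrightarrow> (LINT x|\<mu>. flux p (D w x) \<bullet> D u x) = l u"
      using functional_flux_representation[OF l] by blast
    have F: "(\<lambda>x. flux p (D w x)) \<in> Lfun \<mu> p'" by (rule flux_Lfun(1)[OF conj_p(1) p_gt_1 D_Lfun[OF w(1)]])
    have "g l = g (neg_div \<Omega> (\<lambda>x. flux p (D w x)))"
      by (rule cong[OF l neg_div_Wm1[OF F]]) (simp add: neg_div_def w(2))
    also have "\<dots> = (LINT x|\<mu>. V x \<bullet> flux p (D w x))" using V(2)[OF F] by simp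
    also have "\<dots> = (LINT x|\<mu>. flux p (D w x) \<bullet> D v x)"
    proof (rule integral_cong_AE)
      show "AE x in \<mu>. V x \<bullet> flux p (D w x) = flux p (D w x) \<bullet> D v x" using Vv by eventually_elim (simp add: inner_commute)
      show "(\<lambda>x. V x \<bullet> flux p (D w x)) \<in> borel_measurable \<mu>"
        by (rule borel_measurable_inner[OF Lfun_measurable[OF V(1)] Lfun_measurable[OF F]])
      show "(\<lambda>x. flux p (D w x) \<bullet> D v x) \<in> borel_measurable \<mu>"
        by (rule borel_measurable_inner[OF Lfun_measurable[OF F] Lfun_measurable[OF D_Lfun[OF v(1)]]])
    qed
    also have "\<dots> = l v" by (rule w(2)[OF v(1)])
    finally show ?thesis .
  qed
  then show ?thesis using v(1) by blast
qed

text \<open>Diagonal extraction over countably many functionals, the p-Laplacians of a dense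
  sequence. They are dense in the dual, because every functional is the p-Laplacian of some w and
  the flux is continuous from L^p to L^(p'). The limits then define an element of the bidual, and
  reflexivity provides the weak limit.\<close>

lemma weak_compactness:
  assumes u: "\<And>n. u n \<in> X" and b: "\<And>n. gnorm (u n) \<le> C"
  shows "\<exists>\<rho> w. strict_mono (\<rho> :: nat \<Rightarrow> nat) \<and> w \<in> X \<and> (\<forall>l\<in>Wm1 \<Omega> p. (\<lambda>n. l (u (\<rho> n))) \<longlonglongrightarrow> l w)"
proof -
  have C: "C \<ge> 0" using b[of 0] gnorm_nonneg[of "u 0"] by linarith
  obtain e :: "nat \<Rightarrow> 'a \<Rightarrow> real" where e: "\<And>i. e i \<in> test_functions \<Omega>"
    "\<And>u \<epsilon>. u \<in> X \<Longrightarrow> \<epsilon> > 0 \<Longrightarrow> \<exists>i. pint \<mu> p (\<lambda>x. D u x - grad (e i) x) < \<epsilon>"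
    using W01p_separable by blast
  define A where "A i v = neg_div \<Omega> (\<lambda>x. flux p (grad (e i) x)) v" for i v
  have fL: "(\<lambda>x. flux p (grad (e i) x)) \<in> Lfun \<mu> p'" for i
    by (rule flux_Lfun(1)[OF conj_p(1) p_gt_1 test_function_W1p(3)[OF e(1)]])
  have AW: "A i \<in> Wm1 \<Omega> p" for i unfolding A_def using neg_div_Wm1[OF fL] by simp
  interpret subseqs "\<lambda>i s. convergent (\<lambda>n. A i (u (s n)))"
  proof
    fix i :: nat and s :: "nat \<Rightarrow> nat"
    have "\<bar>A i (u (s n))\<bar> \<le> \<bar>Wm1_norm \<Omega> p (A i)\<bar> * C" for n
    proof -
      have "\<bar>A i (u (s n))\<bar> \<le> Wm1_norm \<Omega> p (A i) * gnorm (u (s n))" by (rule dual_norm_bound[OF AW u])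
      also have "\<dots> \<le> \<bar>Wm1_norm \<Omega> p (A i)\<bar> * C" using b by (intro mult_mono) auto
      finally show ?thesis .
    qed
    then have "bounded (range (\<lambda>n. A i (u (s n))))" by (intro boundedI) auto
    then obtain l r where "strict_mono (r :: nat \<Rightarrow> nat)" "((\<lambda>n. A i (u (s n))) \<circ> r) \<longlonglongrightarrow> l"
      using bounded_imp_convergent_subsequence by blast
    then show "\<exists>r'. strict_mono r' \<and> convergent (\<lambda>n. A i (u ((s \<circ> r') n)))"
      by (auto simp: convergent_def o_def)
  qed
  have Ac: "convergent (\<lambda>n. A i (u (diagseq n)))" for i
  proof -
    \<comment> \<open>The diagonal is a subsequence of the i-th stage only from index i + 1 on; the
      shift is removed afterwards.\<close>
    have "convergent (\<lambda>n. A i (u ((diagseq \<circ> ((+) (Suc i))) n)))"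
    proof (rule diagseq_holds)
      fix s r :: "nat \<Rightarrow> nat" and n assume "strict_mono r" "convergent (\<lambda>m. A n (u (s m)))"
      then show "convergent (\<lambda>m. A n (u ((s \<circ> r) m)))"
        using convergent_subseq_convergent[of "\<lambda>m. A n (u (s m))" r] by (simp add: o_def)
    qed
    then have "convergent (\<lambda>n. A i (u (diagseq (n + Suc i))))" by (simp add: add.commute)
    then show ?thesis by (subst (asm) convergent_ignore_initial_segment)
  qed
  have conv: "convergent (\<lambda>n. l (u (diagseq n)))" if l: "l \<in> Wm1 \<Omega> p" for l
  proof -
    obtain w where w: "w \<in> X" "\<And>v. v \<in> X \<Longrightarrow> (LINT x|\<mu>. flux p (D w x) \<bullet> D v x) = l v"
      using functional_flux_representation[OF l] by blast
    have "\<exists>i. pint \<mu> p (\<lambda>x. D w x - grad (e i) x) < 1 / real (Suc k)" for k by (rule e(2)[OF w(1)]) simp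
    then obtain i where i: "\<And>k. pint \<mu> p (\<lambda>x. D w x - grad (e (i k)) x) < 1 / real (Suc k)" by metis
    have z: "(\<lambda>k. 1 / real (Suc k)) \<longlonglongrightarrow> 0" using LIMSEQ_inverse_real_of_nat by (simp add: inverse_eq_divide)
    have "(\<lambda>k. pint \<mu> p (\<lambda>x. grad (e (i k)) x - D w x)) \<longlonglongrightarrow> 0"
      by (rule Lim_null_comparison[OF always_eventually z]) (use i in \<open>auto simp: pint_minus_commute[of _ _ "grad _"] intro: less_imp_le\<close>)
    from flux_tendsto_Lfun[OF conj_p(1) p_gt_1 test_function_W1p(3)[OF e(1)] D_Lfun[OF w(1)] this]
    have f0: "(\<lambda>k. pint \<mu> p' (\<lambda>x. flux p (grad (e (i k)) x) - flux p (D w x))) \<longlonglongrightarrow> 0" .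
    have "(\<lambda>k. pint \<mu> p' (\<lambda>x. flux p (grad (e (i k)) x) - flux p (D w x)) powr (1/p') * C) \<longlonglongrightarrow> 0 powr (1/p') * C"
      using conj_p(4) p_gt_1 by (intro tendsto_mult_right tendsto_powr2[OF f0]) auto
    then have f1: "(\<lambda>k. pint \<mu> p' (\<lambda>x. flux p (grad (e (i k)) x) - flux p (D w x)) powr (1/p') * C) \<longlonglongrightarrow> 0" by simp
    have d: "\<bar>A (i k) (u n) - l (u n)\<bar> \<le> pint \<mu> p' (\<lambda>x. flux p (grad (e (i k)) x) - flux p (D w x)) powr (1/p') * C" for k n
    proof -
      note L = Lfun_diff(1)[OF fL[of "i k"] flux_Lfun(1)[OF conj_p(1) p_gt_1 D_Lfun[OF w(1)]] conj_p(4)]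
      have "A (i k) (u n) - l (u n) = neg_div \<Omega> (\<lambda>x. flux p (grad (e (i k)) x) - flux p (D w x)) (u n)"
        using neg_div_bound(1)[OF fL u[of n], of "i k"] neg_div_bound(1)[OF flux_Lfun(1)[OF conj_p(1) p_gt_1 D_Lfun[OF w(1)]] u[of n]]
        unfolding A_def neg_div_def w(2)[OF u[of n], symmetric] by (simp add: inner_diff_left)
      also have "\<bar>\<dots>\<bar> \<le> pint \<mu> p' (\<lambda>x. flux p (grad (e (i k)) x) - flux p (D w x)) powr (1/p') * gnorm (u n)"
        by (rule neg_div_bound(2)[OF L u])
      also have "\<dots> \<le> pint \<mu> p' (\<lambda>x. flux p (grad (e (i k)) x) - flux p (D w x)) powr (1/p') * C"
        by (intro mult_left_mono b) simp
      finally show ?thesis .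
    qed
    have "Cauchy (\<lambda>n. l (u (diagseq n)))"
    proof (rule metric_CauchyI)
      fix \<epsilon> :: real assume \<epsilon>: "\<epsilon> > 0"
      then have "\<epsilon>/3 > 0" by simp
      from order_tendstoD(2)[OF f1 this] obtain k where k: "pint \<mu> p' (\<lambda>x. flux p (grad (e (i k)) x) - flux p (D w x)) powr (1/p') * C < \<epsilon>/3"
        by (auto simp: eventually_sequentially)
      have "Cauchy (\<lambda>n. A (i k) (u (diagseq n)))" using Ac by (simp add: Cauchy_convergent_iff)
      from metric_CauchyD[OF this \<open>\<epsilon>/3 > 0\<close>] obtain N where N: "\<And>m n. m \<ge> N \<Longrightarrow> n \<ge> N \<Longrightarrow> dist (A (i k) (u (diagseq m))) (A (i k) (u (diagseq n))) < \<epsilon>/3" by blast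
      have "dist (l (u (diagseq m))) (l (u (diagseq n))) < \<epsilon>" if "m \<ge> N" "n \<ge> N" for m n
        using N[OF that] d[of k "diagseq m"] d[of k "diagseq n"] k unfolding dist_real_def by linarith
      then show "\<exists>N. \<forall>m\<ge>N. \<forall>n\<ge>N. dist (l (u (diagseq m))) (l (u (diagseq n))) < \<epsilon>" by blast
    qed
    then show ?thesis by (simp add: Cauchy_convergent_iff)
  qed
  define g where "g l = lim (\<lambda>n. l (u (diagseq n)))" for l :: "('a \<Rightarrow> real) \<Rightarrow> real"
  have gl: "(\<lambda>n. l (u (diagseq n))) \<longlonglongrightarrow> g l" if "l \<in> Wm1 \<Omega> p" for l
    unfolding g_def using conv[OF that] by (simp add: convergent_LIMSEQ_iff)
  have "g \<in> dual_space (Wm1 \<Omega> p) (Wm1_norm \<Omega> p)"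
    unfolding dual_space_def[of "Wm1 \<Omega> p"]
  proof (intro CollectI conjI ballI allI)
    fix l m assume l: "l \<in> Wm1 \<Omega> p" and m: "m \<in> Wm1 \<Omega> p"
    show "g (\<lambda>x. l x + m x) = g l + g m" unfolding g_def[of "\<lambda>x. l x + m x"]
      by (rule limI[OF tendsto_add[OF gl[OF l] gl[OF m]]])
  next
    fix c l assume l: "l \<in> Wm1 \<Omega> p"
    show "g (\<lambda>x. c * l x) = c * g l" unfolding g_def[of "\<lambda>x. c * l x"]
      by (rule limI[OF tendsto_mult_left[OF gl[OF l]]])
  next
    have "\<bar>g l\<bar> \<le> C * Wm1_norm \<Omega> p l" if l: "l \<in> Wm1 \<Omega> p" for l
    proof (rule LIMSEQ_le_const2[OF tendsto_rabs[OF gl[OF l]]])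
      have "\<bar>l (u (diagseq n))\<bar> \<le> C * Wm1_norm \<Omega> p l" for n
      proof -
        have "\<bar>l (u (diagseq n))\<bar> \<le> Wm1_norm \<Omega> p l * gnorm (u (diagseq n))" by (rule dual_norm_bound[OF l u])
        also have "\<dots> \<le> Wm1_norm \<Omega> p l * C" by (intro mult_left_mono b dual_norm_nonneg[OF l])
        finally show ?thesis by (simp add: mult.commute)
      qed
      then show "\<exists>N. \<forall>n\<ge>N. \<bar>l (u (diagseq n))\<bar> \<le> C * Wm1_norm \<Omega> p l" by blast
    qed
    then show "\<exists>C. \<forall>l\<in>Wm1 \<Omega> p. \<bar>g l\<bar> \<le> C * Wm1_norm \<Omega> p l" by blast
  qed
  then obtain w where w: "w \<in> X" "\<And>l. l \<in> Wm1 \<Omega> p \<Longrightarrow> g l = l w" using W01p_reflexive by blast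
  have "(\<lambda>n. l (u (diagseq n))) \<longlonglongrightarrow> l w" if "l \<in> Wm1 \<Omega> p" for l
    using gl[OF that] w(2)[OF that] by simp
  then show ?thesis using subseq_diagseq w(1) by blast
qed

section \<open>Functionals given by integration against a function\<close>

lemma fun_functional_bound:
  assumes st: "1/s + 1/t = 1" "s > 1" "t \<le> pstar" and h: "h \<in> Lfun \<mu> s" and v: "v \<in> X"
  shows "integrable \<mu> (\<lambda>x. h x * v x)" "\<bar>fun_functional \<Omega> h v\<bar> \<le> pint \<mu> s h powr (1/s) * (S t * gnorm v)"
proof -
  have t: "1 \<le> t" using conjugate_exponents(2)[OF st(1,2)] by simp
  note e = embedding_Lfun[OF v t st(3)]
  note H = holder_inner[OF st(1,2) h e(1)]
  show "integrable \<mu> (\<lambda>x. h x * v x)" using H(1) by simp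
  have "\<bar>fun_functional \<Omega> h v\<bar> \<le> pint \<mu> s h powr (1/s) * pint \<mu> t v powr (1/t)"
    using H(2) by (simp add: fun_functional_def)
  also have "\<dots> \<le> pint \<mu> s h powr (1/s) * (S t * gnorm v)" by (intro mult_left_mono e) simp
  finally show "\<bar>fun_functional \<Omega> h v\<bar> \<le> pint \<mu> s h powr (1/s) * (S t * gnorm v)" .
qed

lemma fun_functional_Wm1:
  assumes st: "1/s + 1/t = 1" "s > 1" "t \<le> pstar" and h: "h \<in> Lfun \<mu> s"
  shows "fun_functional \<Omega> h \<in> Wm1 \<Omega> p"
  unfolding dual_space_def
proof (intro CollectI conjI ballI allI)
  fix u v assume u: "u \<in> X" and v: "v \<in> X"
  show "fun_functional \<Omega> h (\<lambda>x. u x + v x) = fun_functional \<Omega> h u + fun_functional \<Omega> h v"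
    using fun_functional_bound(1)[OF st h u] fun_functional_bound(1)[OF st h v]
    by (simp add: fun_functional_def distrib_left)
next
  fix c u assume u: "u \<in> X"
  show "fun_functional \<Omega> h (\<lambda>x. c * u x) = c * fun_functional \<Omega> h u"
    by (simp add: fun_functional_def mult.left_commute)
next
  have "\<bar>fun_functional \<Omega> h u\<bar> \<le> (pint \<mu> s h powr (1/s) * S t) * W01p_norm \<Omega> p u" if "u \<in> X" for u
    using fun_functional_bound(2)[OF st h that] by (simp add: W01p_norm_gnorm[OF that] mult.assoc)
  then show "\<exists>C. \<forall>u\<in>X. \<bar>fun_functional \<Omega> h u\<bar> \<le> C * W01p_norm \<Omega> p u" by blast
qed

end

section \<open>Compactness of the embedding\<close>

text \<open>The fundamental theorem of calculus along the segment from x to x + h, then Fubini and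
  translation invariance. Nonnegative extended integrals can be exchanged freely.\<close>

lemma test_function_translation:
  fixes \<phi> :: "'a::euclidean_space \<Rightarrow> real"
  assumes t: "\<phi> \<in> test_functions \<Omega>"
  shows "(\<integral>\<^sup>+x. ennreal \<bar>\<phi> (x + h) - \<phi> x\<bar> \<partial>lborel) \<le> ennreal (norm h) * (\<integral>\<^sup>+x. ennreal (norm (grad \<phi> x)) \<partial>lborel)"
proof -
  have gm[measurable]: "grad \<phi> \<in> borel_measurable borel" by (rule borel_measurable_continuous_onI[OF grad_test_function(1)[OF t]])
  have pt: "ennreal \<bar>\<phi> (x + h) - \<phi> x\<bar> \<le> (\<integral>\<^sup>+s. ennreal (norm h * norm (grad \<phi> (x + s *\<^sub>R h))) * indicator {0..1} s \<partial>lborel)" for x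
  proof -
    have "((\<lambda>s. \<phi> (x + s *\<^sub>R h)) has_real_derivative (grad \<phi> (x + s *\<^sub>R h) \<bullet> h)) (at s)" for s
    proof -
      have "((\<lambda>s. \<phi> (x + s *\<^sub>R h)) has_derivative (\<lambda>r. frechet_derivative \<phi> (at (x + s *\<^sub>R h)) (r *\<^sub>R h))) (at s)"
      proof (rule has_derivative_compose[where g=\<phi>])
        show "((\<lambda>s. x + s *\<^sub>R h) has_derivative (\<lambda>r. r *\<^sub>R h)) (at s)" by (auto intro!: derivative_eq_intros)
        show "(\<phi> has_derivative frechet_derivative \<phi> (at (x + s *\<^sub>R h))) (at (x + s *\<^sub>R h))" by (rule test_functionD(4)[OF t])
      qed
      then show ?thesis unfolding has_field_derivative_def grad_inner[OF t] by (simp add: mult_commute_abs)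
    qed
    moreover have "isCont (\<lambda>s. grad \<phi> (x + s *\<^sub>R h) \<bullet> h) s" for s
    proof -
      have "continuous_on UNIV (\<lambda>s. grad \<phi> (x + s *\<^sub>R h) \<bullet> h)"
        by (intro continuous_intros continuous_on_compose2[OF grad_test_function(1)[OF t]]) auto
      then show ?thesis by (simp add: continuous_on_eq_continuous_at)
    qed
    ultimately have "has_bochner_integral lborel (\<lambda>s. (grad \<phi> (x + s *\<^sub>R h) \<bullet> h) * indicator {0..1} s) (\<phi> (x + 1 *\<^sub>R h) - \<phi> (x + 0 *\<^sub>R h))"
      by (intro has_bochner_integral_FTC_Icc_real) auto
    then have i: "integrable lborel (\<lambda>s. (grad \<phi> (x + s *\<^sub>R h) \<bullet> h) * indicator {0..1} s)"
      and v: "(LINT s|lborel. (grad \<phi> (x + s *\<^sub>R h) \<bullet> h) * indicator {0..1} s) = \<phi> (x + h) - \<phi> x"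
      by (simp_all add: has_bochner_integral_iff)
    have "ennreal \<bar>\<phi> (x + h) - \<phi> x\<bar> \<le> (\<integral>\<^sup>+s. ennreal (norm ((grad \<phi> (x + s *\<^sub>R h) \<bullet> h) * indicator {0..1} s)) \<partial>lborel)"
      using integral_norm_bound_ennreal[OF i] unfolding v by simp
    also have "\<dots> \<le> (\<integral>\<^sup>+s. ennreal (norm h * norm (grad \<phi> (x + s *\<^sub>R h))) * indicator {0..1} s \<partial>lborel)"
    proof (rule nn_integral_mono)
      fix s :: real
      have "\<bar>grad \<phi> (x + s *\<^sub>R h) \<bullet> h\<bar> \<le> norm h * norm (grad \<phi> (x + s *\<^sub>R h))"
        using Cauchy_Schwarz_ineq2[of "grad \<phi> (x + s *\<^sub>R h)" h] by (simp add: mult.commute)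
      then show "ennreal (norm ((grad \<phi> (x + s *\<^sub>R h) \<bullet> h) * indicator {0..1} s)) \<le> ennreal (norm h * norm (grad \<phi> (x + s *\<^sub>R h))) * indicator {0..1} s"
        by (auto simp: indicator_def ennreal_leI)
    qed
    finally show ?thesis .
  qed
  have tr: "(\<integral>\<^sup>+x. ennreal (norm h * norm (grad \<phi> (x + s *\<^sub>R h))) \<partial>lborel) = ennreal (norm h) * (\<integral>\<^sup>+x. ennreal (norm (grad \<phi> x)) \<partial>lborel)" for s
  proof -
    have "(\<integral>\<^sup>+x. ennreal (norm h * norm (grad \<phi> x)) \<partial>distr lborel borel ((+) (s *\<^sub>R h))) = (\<integral>\<^sup>+x. ennreal (norm h * norm (grad \<phi> (s *\<^sub>R h + x))) \<partial>lborel)"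
      by (rule nn_integral_distr) auto
    then show ?thesis by (simp add: lborel_distr_plus add.commute ennreal_mult nn_integral_cmult)
  qed
  have "(\<integral>\<^sup>+x. ennreal \<bar>\<phi> (x + h) - \<phi> x\<bar> \<partial>lborel) \<le> (\<integral>\<^sup>+x. (\<integral>\<^sup>+s. ennreal (norm h * norm (grad \<phi> (x + s *\<^sub>R h))) * indicator {0..1} s \<partial>lborel) \<partial>lborel)"
    by (rule nn_integral_mono) (rule pt)
  also have "\<dots> = (\<integral>\<^sup>+s. (\<integral>\<^sup>+x. ennreal (norm h * norm (grad \<phi> (x + s *\<^sub>R h))) * indicator {0..1} s \<partial>lborel) \<partial>lborel)"
    by (rule lborel_pair.Fubini'[symmetric]) measurable
  also have "\<dots> = (\<integral>\<^sup>+s. (ennreal (norm h) * (\<integral>\<^sup>+x. ennreal (norm (grad \<phi> x)) \<partial>lborel)) * indicator {0..1::real} s \<partial>lborel)"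
    by (intro nn_integral_cong) (simp add: nn_integral_multc tr)
  also have "\<dots> = ennreal (norm h) * (\<integral>\<^sup>+x. ennreal (norm (grad \<phi> x)) \<partial>lborel)"
    by (simp add: nn_integral_cmult_indicator)
  finally show ?thesis .
qed

text \<open>A is the mean of \<phi> over balls of radius \<delta>, left unnormalized with factor V.
  Its deviation from V \<phi> is an integral of translation differences over the ball, each at most
  \<delta> times the L^1 norm of the gradient.\<close>

lemma test_function_average:
  fixes \<phi> :: "'a::euclidean_space \<Rightarrow> real"
  assumes t: "\<phi> \<in> test_functions \<Omega>" and \<delta>: "\<delta> > 0" and \<Omega>: "open \<Omega>" "bounded \<Omega>"
  defines "V \<equiv> measure lborel (ball (0::'a) \<delta>)"
    and "A \<equiv> \<lambda>x. LINT y|lborel. indicator (ball 0 \<delta>) y * \<phi> (x + y)"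
  shows "A \<in> borel_measurable borel" "\<exists>B. \<forall>x. \<bar>A x\<bar> \<le> B"
    "V * (LINT x|lebesgue_on \<Omega>. \<bar>\<phi> x\<bar>) \<le> (LINT x|lebesgue_on \<Omega>. \<bar>A x\<bar>) + V * \<delta> * (LINT x|lebesgue_on \<Omega>. norm (grad \<phi> x))"
proof -
  have \<Omega>m: "\<Omega> \<in> sets lebesgue" by (rule sets_completionI_sets) (use \<Omega> in simp)
  have gm[measurable]: "grad \<phi> \<in> borel_measurable borel" by (rule borel_measurable_continuous_onI[OF grad_test_function(1)[OF t]])
  have pm[measurable]: "\<phi> \<in> borel_measurable borel" by (rule test_functionD(6)[OF t])
  have Ob[measurable]: "\<Omega> \<in> sets borel" using \<Omega>(1) by simp
  have [measurable]: "ball (0::'a) \<delta> \<in> sets borel" by simp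
  have "(\<lambda>z. \<phi> (fst z + snd z)) \<in> borel_measurable (borel \<Otimes>\<^sub>M borel)" by measurable
  then have [measurable]: "(\<lambda>z. \<phi> (fst z + snd z)) \<in> borel_measurable (borel \<Otimes>\<^sub>M lborel)"
    using measurable_cong_sets[OF sets_pair_measure_cong[OF refl sets_lborel] refl] by blast
  show Am[measurable]: "A \<in> borel_measurable borel" unfolding A_def by measurable
  obtain B where B: "B \<ge> 0" "\<And>x. \<bar>\<phi> x\<bar> \<le> B" using test_function_bounded[OF t] by blast
  have V: "V \<ge> 0" "emeasure lborel (ball (0::'a) \<delta>) = ennreal V"
    using emeasure_bounded_finite[of "ball (0::'a) \<delta>"] by (auto simp: V_def emeasure_eq_ennreal_measure top.not_eq_extremum)
  have ind: "integrable lborel (\<lambda>y. indicator (ball (0::'a) \<delta>) y :: real)"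
    by (intro integrable_real_indicator emeasure_bounded_finite) auto
  have iA: "integrable lborel (\<lambda>y. indicator (ball 0 \<delta>) y * \<phi> (x + y))" for x
    by (rule Bochner_Integration.integrable_bound[OF integrable_mult_left[OF ind, of B]])
      (use B in \<open>auto simp: indicator_def abs_of_nonneg\<close>)
  have Ab: "\<bar>A x\<bar> \<le> V * B" for x
  proof -
    have "\<bar>A x\<bar> \<le> (LINT y|lborel. \<bar>indicator (ball 0 \<delta>) y * \<phi> (x + y)\<bar>)" unfolding A_def by (rule integral_abs_bound)
    also have "\<dots> \<le> (LINT y|lborel. indicator (ball (0::'a) \<delta>) y * B)"
    proof (rule integral_mono')
      show "integrable lborel (\<lambda>y. indicator (ball (0::'a) \<delta>) y * B)" by (rule integrable_mult_left[OF ind])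
    qed (use B in \<open>auto simp: indicator_def\<close>)
    also have "\<dots> = V * B" by (simp add: V_def)
    finally show ?thesis .
  qed
  then show "\<exists>B. \<forall>x. \<bar>A x\<bar> \<le> B" by blast
  have pt: "ennreal (V * \<bar>\<phi> x\<bar>) \<le> ennreal \<bar>A x\<bar> + (\<integral>\<^sup>+y. ennreal \<bar>\<phi> (x + y) - \<phi> x\<bar> * indicator (ball 0 \<delta>) y \<partial>lborel)" for x
  proof -
    have ic: "integrable lborel (\<lambda>y. indicator (ball (0::'a) \<delta>) y * \<phi> x)" by (rule integrable_mult_left[OF ind])
    have "A x - V * \<phi> x = (LINT y|lborel. indicator (ball 0 \<delta>) y * \<phi> (x + y) - indicator (ball 0 \<delta>) y * \<phi> x)"
      using iA[of x] ic by (simp add: A_def V_def)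
    moreover have "ennreal (norm (LINT y|lborel. indicator (ball 0 \<delta>) y * \<phi> (x + y) - indicator (ball 0 \<delta>) y * \<phi> x)) \<le>
       (\<integral>\<^sup>+y. ennreal (norm (indicator (ball 0 \<delta>) y * \<phi> (x + y) - indicator (ball 0 \<delta>) y * \<phi> x)) \<partial>lborel)"
      by (rule integral_norm_bound_ennreal[OF Bochner_Integration.integrable_diff[OF iA ic]])
    moreover have "(\<integral>\<^sup>+y. ennreal (norm (indicator (ball 0 \<delta>) y * \<phi> (x + y) - indicator (ball 0 \<delta>) y * \<phi> x)) \<partial>lborel)
       = (\<integral>\<^sup>+y. ennreal \<bar>\<phi> (x + y) - \<phi> x\<bar> * indicator (ball 0 \<delta>) y \<partial>lborel)"
      by (rule nn_integral_cong) (auto simp: indicator_def)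
    ultimately have d: "ennreal \<bar>A x - V * \<phi> x\<bar> \<le> (\<integral>\<^sup>+y. ennreal \<bar>\<phi> (x + y) - \<phi> x\<bar> * indicator (ball 0 \<delta>) y \<partial>lborel)" by simp
    have "V * \<bar>\<phi> x\<bar> = \<bar>V * \<phi> x\<bar>" using V by (simp add: abs_mult)
    then have "V * \<bar>\<phi> x\<bar> \<le> \<bar>A x\<bar> + \<bar>A x - V * \<phi> x\<bar>" by linarith
    then have "ennreal (V * \<bar>\<phi> x\<bar>) \<le> ennreal (\<bar>A x\<bar> + \<bar>A x - V * \<phi> x\<bar>)" by (rule ennreal_leI)
    also have "\<dots> = ennreal \<bar>A x\<bar> + ennreal \<bar>A x - V * \<phi> x\<bar>" by simp
    also have "\<dots> \<le> ennreal \<bar>A x\<bar> + (\<integral>\<^sup>+y. ennreal \<bar>\<phi> (x + y) - \<phi> x\<bar> * indicator (ball 0 \<delta>) y \<partial>lborel)"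
      by (intro add_left_mono d)
    finally show ?thesis .
  qed
  define G where "G = (LINT x|lborel. norm (grad \<phi> x))"
  have G: "(\<integral>\<^sup>+x. ennreal (norm (grad \<phi> x)) \<partial>lborel) = ennreal G" "G \<ge> 0" unfolding G_def
    using test_function_integrable(2)[OF t] by (simp_all add: nn_integral_eq_integral)
  have iO: "integrable lborel (\<lambda>x. indicator \<Omega> x * \<bar>A x\<bar>)"
  proof (rule Bochner_Integration.integrable_bound[of lborel "\<lambda>x. indicator \<Omega> x * (V * B)"])
    show "integrable lborel (\<lambda>x. indicator \<Omega> x * (V * B) :: real)"
      by (intro integrable_mult_left integrable_real_indicator emeasure_bounded_finite) (use \<Omega> in auto)
    show "(\<lambda>x. indicator \<Omega> x * \<bar>A x\<bar>) \<in> borel_measurable lborel"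
      using Am Ob by (intro borel_measurable_times borel_measurable_indicator borel_measurable_abs) auto
  qed (use Ab B V in \<open>auto simp: indicator_def\<close>)
  have "ennreal (V * (LINT x|lborel. \<bar>\<phi> x\<bar>)) = (\<integral>\<^sup>+x. ennreal (V * \<bar>\<phi> x\<bar>) \<partial>lborel)"
    using test_function_integrable(1)[OF t] V by (subst nn_integral_eq_integral) auto
  also have "\<dots> = (\<integral>\<^sup>+x. ennreal (V * \<bar>\<phi> x\<bar>) * indicator \<Omega> x \<partial>lborel)"
    using test_function_outside[OF t] by (intro nn_integral_cong) (auto simp: indicator_def)
  also have "\<dots> \<le> (\<integral>\<^sup>+x. ennreal (indicator \<Omega> x * \<bar>A x\<bar>) + (\<integral>\<^sup>+y. ennreal \<bar>\<phi> (x + y) - \<phi> x\<bar> * indicator (ball 0 \<delta>) y \<partial>lborel) \<partial>lborel)"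
    using pt by (intro nn_integral_mono) (auto simp: indicator_def)
  also have "\<dots> = (\<integral>\<^sup>+x. ennreal (indicator \<Omega> x * \<bar>A x\<bar>) \<partial>lborel) + (\<integral>\<^sup>+x. (\<integral>\<^sup>+y. ennreal \<bar>\<phi> (x + y) - \<phi> x\<bar> * indicator (ball 0 \<delta>) y \<partial>lborel) \<partial>lborel)"
    using \<Omega>(1) by (intro nn_integral_add) auto
  also have "(\<integral>\<^sup>+x. ennreal (indicator \<Omega> x * \<bar>A x\<bar>) \<partial>lborel) = ennreal (LINT x|lborel. indicator \<Omega> x * \<bar>A x\<bar>)"
    by (rule nn_integral_eq_integral[OF iO]) auto
  also have "(\<integral>\<^sup>+x. (\<integral>\<^sup>+y. ennreal \<bar>\<phi> (x + y) - \<phi> x\<bar> * indicator (ball 0 \<delta>) y \<partial>lborel) \<partial>lborel) =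
      (\<integral>\<^sup>+y. (\<integral>\<^sup>+x. ennreal \<bar>\<phi> (x + y) - \<phi> x\<bar> * indicator (ball 0 \<delta>) y \<partial>lborel) \<partial>lborel)"
    by (rule lborel_pair.Fubini'[symmetric]) measurable
  also have "\<dots> \<le> (\<integral>\<^sup>+y. ennreal (\<delta> * G) * indicator (ball (0::'a) \<delta>) y \<partial>lborel)"
  proof (rule nn_integral_mono)
    fix y :: 'a
    have "(\<integral>\<^sup>+x. ennreal \<bar>\<phi> (x + y) - \<phi> x\<bar> \<partial>lborel) \<le> ennreal (\<delta> * G)" if "y \<in> ball 0 \<delta>"
    proof -
      have "(\<integral>\<^sup>+x. ennreal \<bar>\<phi> (x + y) - \<phi> x\<bar> \<partial>lborel) \<le> ennreal (norm y * G)"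
        using test_function_translation[OF t, of y] G by (simp add: ennreal_mult)
      also have "\<dots> \<le> ennreal (\<delta> * G)" using that G by (intro ennreal_leI mult_right_mono) auto
      finally show ?thesis .
    qed
    then show "(\<integral>\<^sup>+x. ennreal \<bar>\<phi> (x + y) - \<phi> x\<bar> * indicator (ball 0 \<delta>) y \<partial>lborel) \<le> ennreal (\<delta> * G) * indicator (ball (0::'a) \<delta>) y"
      by (cases "y \<in> ball 0 \<delta>") auto
  qed
  also have "\<dots> = ennreal (V * \<delta> * G)"
    using V G \<delta> by (simp add: nn_integral_cmult_indicator ennreal_mult[symmetric] mult.commute mult.left_commute)
  finally have "ennreal (V * (LINT x|lborel. \<bar>\<phi> x\<bar>)) \<le> ennreal (LINT x|lborel. indicator \<Omega> x * \<bar>A x\<bar>) + ennreal (V * \<delta> * G)"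
    by (simp add: add_left_mono)
  also have "\<dots> = ennreal ((LINT x|lborel. indicator \<Omega> x * \<bar>A x\<bar>) + V * \<delta> * G)"
    using V G \<delta> by (intro ennreal_plus[symmetric] integral_nonneg_AE) auto
  finally have fin: "V * (LINT x|lborel. \<bar>\<phi> x\<bar>) \<le> (LINT x|lborel. indicator \<Omega> x * \<bar>A x\<bar>) + V * \<delta> * G"
    using V G \<delta> by (subst (asm) ennreal_le_iff) (auto intro!: add_nonneg_nonneg integral_nonneg_AE)
  have "(LINT x|lebesgue_on \<Omega>. \<bar>\<phi> x\<bar>) = (LINT x|lborel. \<bar>\<phi> x\<bar>)"
    by (rule integral_lebesgue_on_eq_lborel(1)[OF \<Omega>m]) (use test_function_outside[OF t] in auto)
  moreover have "(LINT x|lebesgue_on \<Omega>. norm (grad \<phi> x)) = G" unfolding G_def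
    by (rule integral_lebesgue_on_eq_lborel(1)[OF \<Omega>m]) (use grad_test_function(3)[OF t] in auto)
  moreover have "(LINT x|lebesgue_on \<Omega>. \<bar>A x\<bar>) = (LINT x|lborel. indicator \<Omega> x * \<bar>A x\<bar>)"
  proof -
    have "(LINT x|lebesgue_on \<Omega>. \<bar>A x\<bar>) = (LINT x|lebesgue_on \<Omega>. indicator \<Omega> x * \<bar>A x\<bar>)"
      by (rule Bochner_Integration.integral_cong) auto
    also have "\<dots> = (LINT x|lborel. indicator \<Omega> x * \<bar>A x\<bar>)"
      by (rule integral_lebesgue_on_eq_lborel(1)[OF \<Omega>m]) (use \<Omega>(1) in auto)
    finally show ?thesis .
  qed
  ultimately show "V * (LINT x|lebesgue_on \<Omega>. \<bar>\<phi> x\<bar>) \<le> (LINT x|lebesgue_on \<Omega>. \<bar>A x\<bar>) + V * \<delta> * (LINT x|lebesgue_on \<Omega>. norm (grad \<phi> x))"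
    using fin by simp
qed

context sobolev_embedding begin

lemma integral_mul_one_le:
  assumes F: "F \<in> Lfun \<mu> p"
  shows "(LINT x|\<mu>. norm (F x)) \<le> pint \<mu> p F powr (1/p) * measure \<mu> (space \<mu>) powr (1/p')"
proof -
  have o: "(\<lambda>x. 1 :: real) \<in> Lfun \<mu> p'" by (simp add: Lfun_def)
  have "pint \<mu> p' (\<lambda>x. 1 :: real) = measure \<mu> (space \<mu>)" by (simp add: pint_def)
  then show ?thesis using holder(2)[OF conj_p(1) p_gt_1 F o] by simp
qed

text \<open>A ball average at x is the pairing with the indicator of a ball, so weak convergence
  makes the averages tend to 0 at every point, and boundedly. The error of averaging is at most
  \<delta> times the L^1 norm of the gradients, hence small uniformly in n.\<close>

lemma rellich_test_functions:
  assumes t: "\<And>n. \<phi> n \<in> test_functions \<Omega>" and b: "\<And>n. gnorm (\<phi> n) \<le> C"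
    and w: "\<And>l. l \<in> Wm1 \<Omega> p \<Longrightarrow> (\<lambda>n. l (\<phi> n)) \<longlonglongrightarrow> 0"
  shows "(\<lambda>n. LINT x|\<mu>. \<bar>\<phi> n x\<bar>) \<longlonglongrightarrow> 0"
proof (rule LIMSEQ_I)
  fix \<epsilon> :: real assume \<epsilon>: "\<epsilon> > 0"
  define m where "m = measure \<mu> (space \<mu>)"
  have C: "C \<ge> 0" using b[of 0] gnorm_nonneg[of "\<phi> 0"] by linarith
  have p1: "1 \<le> p" "p \<le> pstar" using p_gt_1 p_less_pstar by auto
  note X = test_function_W01p[OF t]
  define G where "G = C * m powr (1/p')"
  have G0: "G \<ge> 0" unfolding G_def using C by simp
  have G: "(LINT x|\<mu>. norm (grad (\<phi> n) x)) \<le> G" for n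
  proof -
    have "(LINT x|\<mu>. norm (grad (\<phi> n) x)) \<le> pint \<mu> p (grad (\<phi> n)) powr (1/p) * m powr (1/p')"
      unfolding m_def by (rule integral_mul_one_le[OF test_function_W1p(3)[OF t]])
    also have "pint \<mu> p (grad (\<phi> n)) powr (1/p) = gnorm (\<phi> n)"
      by (rule gnorm_AE[OF X Lfun_measurable[OF test_function_W1p(3)[OF t]] test_function_W1p(2)[OF t], symmetric])
    also have "gnorm (\<phi> n) * m powr (1/p') \<le> G" unfolding G_def by (intro mult_right_mono b) simp
    finally show ?thesis .
  qed
  define \<delta> where "\<delta> = \<epsilon> / (2 * (G + 1))"
  have \<delta>: "\<delta> > 0" using \<epsilon> G0 by (simp add: \<delta>_def)
  define V where "V = measure lborel (ball (0::'a) \<delta>)"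
  have V: "V > 0" unfolding V_def using \<delta> by (rule content_ball_pos)
  define A where "A n x = (LINT y|lborel. indicator (ball 0 \<delta>) y * \<phi> n (x + y))" for n x
  note av = test_function_average[OF t \<delta> open_domain bounded_domain, folded V_def]
  have Am: "A n \<in> borel_measurable borel" for n using av(1)[of n] by (simp add: A_def[abs_def])
  have ineq: "V * (LINT x|\<mu>. \<bar>\<phi> n x\<bar>) \<le> (LINT x|\<mu>. \<bar>A n x\<bar>) + V * \<delta> * (LINT x|\<mu>. norm (grad (\<phi> n) x))" for n
    using av(3)[of n] by (simp add: A_def)
  have ind: "(indicator (ball x \<delta>) :: 'a \<Rightarrow> real) \<in> Lfun \<mu> p'" "pint \<mu> p' (indicator (ball x \<delta>) :: 'a \<Rightarrow> real) \<le> m" for x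
  proof -
    have im: "(indicator (ball x \<delta>) :: 'a \<Rightarrow> real) \<in> borel_measurable \<mu>"
      by (intro measurable_restrict_space1 measurable_completion borel_measurable_indicator) simp
    have i1: "integrable \<mu> (\<lambda>x. 1 :: real)" by simp
    have ae: "AE y in \<mu>. norm (indicator (ball x \<delta>) y :: real) powr p' \<le> 1"
      by (auto simp: indicator_def)
    show "(indicator (ball x \<delta>) :: 'a \<Rightarrow> real) \<in> Lfun \<mu> p'" "pint \<mu> p' (indicator (ball x \<delta>) :: 'a \<Rightarrow> real) \<le> m"
      using Lfun_bound[OF im i1 ae] by (simp_all add: m_def)
  qed
  \<comment> \<open>Translation moves the ball to x, so that the average becomes one fixed
    functional evaluated at \<open>\<phi> n\<close>.\<close>
  have Aeq: "A n x = fun_functional \<Omega> (indicator (ball x \<delta>)) (\<phi> n)" for n x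
  proof -
    have [measurable]: "\<phi> n \<in> borel_measurable borel" by (rule test_functionD(6)[OF t])
    have [measurable]: "ball x \<delta> \<in> sets borel" by simp
    have "indicator (ball x \<delta>) (x + y) = (indicator (ball 0 \<delta>) y :: real)" for y :: 'a
      by (simp add: indicator_def dist_norm)
    then have "A n x = (LINT y|lborel. indicator (ball x \<delta>) (x + y) * \<phi> n (x + y))" by (simp add: A_def)
    also have "\<dots> = (LINT y|lborel. indicator (ball x \<delta>) y * \<phi> n y)"
      by (rule lborel_integral_translation(1)) measurable
    also have "\<dots> = (LINT y|\<mu>. indicator (ball x \<delta>) y * \<phi> n y)"
      by (rule integral_lebesgue_on_eq_lborel(1)[symmetric]) (use test_function_outside[OF t] in auto)
    finally show ?thesis by (simp add: fun_functional_def)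
  qed
  have A0: "(\<lambda>n. A n x) \<longlonglongrightarrow> 0" for x unfolding Aeq
    by (rule w[OF fun_functional_Wm1[OF conj_p(2,3) p1(2) ind(1)]])
  define K where "K = m powr (1/p') * (S p * C)"
  have Ab: "\<bar>A n x\<bar> \<le> K" for n x
  proof -
    have "\<bar>A n x\<bar> \<le> pint \<mu> p' (indicator (ball x \<delta>) :: 'a \<Rightarrow> real) powr (1/p') * (S p * gnorm (\<phi> n))"
      unfolding Aeq by (rule fun_functional_bound(2)[OF conj_p(2,3) p1(2) ind(1) X])
    also have "\<dots> \<le> K" unfolding K_def
      using S_pos[OF p1] ind(2) b[of n] p_gt_1 by (intro mult_mono powr_mono2) (auto simp: m_def)
    finally show ?thesis .
  qed
  have "(\<lambda>n. LINT x|\<mu>. \<bar>A n x\<bar>) \<longlonglongrightarrow> (LINT x|\<mu>. 0)"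
  proof (rule integral_dominated_convergence)
    show "integrable \<mu> (\<lambda>x. K)" by simp
    show "AE x in \<mu>. (\<lambda>n. \<bar>A n x\<bar>) \<longlonglongrightarrow> 0" using A0 by (intro AE_I2 tendsto_rabs_zero) auto
    show "(\<lambda>x. \<bar>A n x\<bar>) \<in> borel_measurable \<mu>" for n
      using Am by (intro measurable_restrict_space1 measurable_completion) simp
  qed (use Ab in auto)
  moreover have "V * \<epsilon> / 2 > 0" using V \<epsilon> by simp
  ultimately have "eventually (\<lambda>n. (LINT x|\<mu>. \<bar>A n x\<bar>) < V * \<epsilon> / 2) sequentially"
    by (intro order_tendstoD(2)) auto
  then obtain N where N: "\<And>n. n \<ge> N \<Longrightarrow> (LINT x|\<mu>. \<bar>A n x\<bar>) < V * \<epsilon> / 2" by (auto simp: eventually_sequentially)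
  have "norm ((LINT x|\<mu>. \<bar>\<phi> n x\<bar>) - 0) < \<epsilon>" if "n \<ge> N" for n
  proof -
    have "\<delta> * G \<le> \<epsilon> / 2"
    proof -
      have "\<delta> * G = \<epsilon> / 2 * (G / (G + 1))" by (simp add: \<delta>_def)
      also have "\<dots> \<le> \<epsilon> / 2 * 1" using \<epsilon> G0 by (intro mult_left_mono) auto
      finally show ?thesis by simp
    qed
    then have "V * (\<delta> * (LINT x|\<mu>. norm (grad (\<phi> n) x))) \<le> V * (\<epsilon> / 2)"
      using mult_left_mono[OF G[of n], of \<delta>] \<delta> V by (intro mult_left_mono) linarith+
    then have "V * (LINT x|\<mu>. \<bar>\<phi> n x\<bar>) < V * \<epsilon>"
      using ineq[of n] N[OF that] by (simp add: mult.assoc)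
    then have "(LINT x|\<mu>. \<bar>\<phi> n x\<bar>) < \<epsilon>" using V by simp
    then show ?thesis by (simp add: integral_nonneg_AE)
  qed
  then show "\<exists>N. \<forall>n\<ge>N. norm ((LINT x|\<mu>. \<bar>\<phi> n x\<bar>) - 0) < \<epsilon>" by blast
qed

text \<open>Averages were estimated for test functions. Each \<open>v n\<close> is compared with a
  test function within 1 / (n + 1); since the difference tends to 0 in norm, boundedness, weak
  convergence and the conclusion pass between the two sequences.\<close>

lemma rellich_L1:
  assumes v: "\<And>n. v n \<in> X" and b: "\<And>n. gnorm (v n) \<le> C"
    and w: "\<And>l. l \<in> Wm1 \<Omega> p \<Longrightarrow> (\<lambda>n. l (v n)) \<longlonglongrightarrow> 0"
  shows "(\<lambda>n. LINT x|\<mu>. \<bar>v n x\<bar>) \<longlonglongrightarrow> 0"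
proof -
  note p0 = p_gt_0
  have "\<exists>\<phi>\<in>test_functions \<Omega>. pint \<mu> p (\<lambda>x. v n x - \<phi> x) < 1 / real (Suc n) \<and> pint \<mu> p (\<lambda>x. D (v n) x - grad \<phi> x) < 1 / real (Suc n)" for n
  proof -
    obtain \<phi> where \<phi>: "\<And>j. \<phi> j \<in> test_functions \<Omega>" "(\<lambda>j. pint \<mu> p (\<lambda>x. v n x - \<phi> j x)) \<longlonglongrightarrow> 0"
      "(\<lambda>j. pint \<mu> p (\<lambda>x. D (v n) x - grad (\<phi> j) x)) \<longlonglongrightarrow> 0" using v[of n] unfolding W01p_iff by blast
    have "eventually (\<lambda>j. pint \<mu> p (\<lambda>x. v n x - \<phi> j x) < 1 / real (Suc n) \<and> pint \<mu> p (\<lambda>x. D (v n) x - grad (\<phi> j) x) < 1 / real (Suc n)) sequentially"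
      by (intro eventually_conj order_tendstoD(2)[OF \<phi>(2)] order_tendstoD(2)[OF \<phi>(3)]) auto
    then show ?thesis using \<phi>(1) by (auto simp: eventually_sequentially)
  qed
  then obtain \<phi> where \<phi>: "\<And>n. \<phi> n \<in> test_functions \<Omega>" "\<And>n. pint \<mu> p (\<lambda>x. v n x - \<phi> n x) < 1 / real (Suc n)"
    "\<And>n. pint \<mu> p (\<lambda>x. D (v n) x - grad (\<phi> n) x) < 1 / real (Suc n)" by metis
  note T = test_function_W01p[OF \<phi>(1)]
  have g: "gnorm (\<lambda>x. v n x - \<phi> n x) = pint \<mu> p (\<lambda>x. D (v n) x - grad (\<phi> n) x) powr (1/p)" for n
  proof (rule gnorm_AE[OF W01p_diff[OF v T]])
    show "(\<lambda>x. D (v n) x - grad (\<phi> n) x) \<in> borel_measurable \<mu>"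
      by (rule Lfun_measurable[OF Lfun_diff(1)[OF D_Lfun[OF v] test_function_W1p(3)[OF \<phi>(1)] p0]])
    show "AE x in \<mu>. D (\<lambda>x. v n x - \<phi> n x) x = D (v n) x - grad (\<phi> n) x"
      using W1p_diff(2)[OF W01p_imp_W1p[OF v[of n]] W01p_imp_W1p[OF T[of n]]] test_function_W1p(2)[OF \<phi>(1)[of n]]
      by eventually_elim simp
  qed
  have z: "(\<lambda>k. 1 / real (Suc k)) \<longlonglongrightarrow> 0" using LIMSEQ_inverse_real_of_nat by (simp add: inverse_eq_divide)
  have z1: "(\<lambda>k. pint \<mu> p (\<lambda>x. v k x - \<phi> k x)) \<longlonglongrightarrow> 0" "(\<lambda>k. pint \<mu> p (\<lambda>x. D (v k) x - grad (\<phi> k) x)) \<longlonglongrightarrow> 0"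
    by (rule Lim_null_comparison[OF always_eventually z], use \<phi> in \<open>auto intro: less_imp_le\<close>)+
  have pw: "(\<lambda>k. a k powr (1/p)) \<longlonglongrightarrow> 0" if "a \<longlonglongrightarrow> 0" "\<And>k. 0 \<le> a k" for a :: "nat \<Rightarrow> real"
  proof -
    have "(\<lambda>k. a k powr (1/p)) \<longlonglongrightarrow> 0 powr (1/p)" by (intro tendsto_powr2[OF that(1)]) (use that p0 in auto)
    then show ?thesis by simp
  qed
  have g0: "(\<lambda>n. gnorm (\<lambda>x. v n x - \<phi> n x)) \<longlonglongrightarrow> 0" unfolding g by (rule pw[OF z1(2)]) simp
  have "(\<lambda>n. LINT x|\<mu>. \<bar>\<phi> n x\<bar>) \<longlonglongrightarrow> 0"
  proof (rule rellich_test_functions[OF \<phi>(1)])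
    show "(\<lambda>n. l (\<phi> n)) \<longlonglongrightarrow> 0" if l: "l \<in> Wm1 \<Omega> p" for l
    proof -
      have "(\<lambda>n. Wm1_norm \<Omega> p l * gnorm (\<lambda>x. v n x - \<phi> n x)) \<longlonglongrightarrow> Wm1_norm \<Omega> p l * 0" by (intro tendsto_mult_left g0)
      then have "(\<lambda>n. Wm1_norm \<Omega> p l * gnorm (\<lambda>x. v n x - \<phi> n x)) \<longlonglongrightarrow> 0" by simp
      then have "(\<lambda>n. l (\<lambda>x. v n x - \<phi> n x)) \<longlonglongrightarrow> 0"
        by (rule Lim_null_comparison[rotated]) (use dual_norm_bound[OF l W01p_diff[OF v T]] in simp)
      then have "(\<lambda>n. l (v n) - l (\<lambda>x. v n x - \<phi> n x)) \<longlonglongrightarrow> 0 - 0" by (intro tendsto_diff w[OF l])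
      then show ?thesis using functional_diff[OF l v T] by simp
    qed
    define Q where "Q = (2 powr p * (C powr p + 1)) powr (1/p)"
    show "gnorm (\<phi> n) \<le> Q" for n
    proof -
      have "pint \<mu> p (\<lambda>x. D (v n) x - (D (v n) x - grad (\<phi> n) x)) \<le> 2 powr p * (pint \<mu> p (D (v n)) + pint \<mu> p (\<lambda>x. D (v n) x - grad (\<phi> n) x))"
        by (rule Lfun_diff(2)[OF D_Lfun[OF v] Lfun_diff(1)[OF D_Lfun[OF v] test_function_W1p(3)[OF \<phi>(1)] p0] p0])
      also have "\<dots> \<le> 2 powr p * (C powr p + 1)"
      proof (intro mult_left_mono add_mono)
        show "pint \<mu> p (D (v n)) \<le> C powr p" unfolding gnorm_powr[symmetric] using b p0 by (intro powr_mono2) auto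
        have "1 / real (Suc n) \<le> 1" by simp
        then show "pint \<mu> p (\<lambda>x. D (v n) x - grad (\<phi> n) x) \<le> 1" using \<phi>(3)[of n] by linarith
      qed simp
      finally have "pint \<mu> p (grad (\<phi> n)) \<le> 2 powr p * (C powr p + 1)" by simp
      then have "pint \<mu> p (grad (\<phi> n)) powr (1/p) \<le> Q" unfolding Q_def using p0 by (intro powr_mono2) auto
      then show ?thesis
        using gnorm_AE[OF T Lfun_measurable[OF test_function_W1p(3)[OF \<phi>(1)]] test_function_W1p(2)[OF \<phi>(1)]] by simp
    qed
  qed
  moreover have "(\<lambda>n. pint \<mu> p (\<lambda>x. v n x - \<phi> n x) powr (1/p) * measure \<mu> (space \<mu>) powr (1/p')) \<longlonglongrightarrow> 0 * measure \<mu> (space \<mu>) powr (1/p')"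
    by (intro tendsto_mult_right pw[OF z1(1)]) simp
  ultimately have lim: "(\<lambda>n. (LINT x|\<mu>. \<bar>\<phi> n x\<bar>) + pint \<mu> p (\<lambda>x. v n x - \<phi> n x) powr (1/p) * measure \<mu> (space \<mu>) powr (1/p')) \<longlonglongrightarrow> 0"
    using tendsto_add by fastforce
  have L: "v n \<in> Lfun \<mu> p" "\<phi> n \<in> Lfun \<mu> p" for n
    using W1pD(1)[OF W01p_imp_W1p[OF v]] W1pD(1)[OF W01p_imp_W1p[OF T]] by auto
  have "(LINT x|\<mu>. \<bar>v n x\<bar>) \<le> (LINT x|\<mu>. \<bar>\<phi> n x\<bar>) + pint \<mu> p (\<lambda>x. v n x - \<phi> n x) powr (1/p) * measure \<mu> (space \<mu>) powr (1/p')" for n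
  proof -
    have i: "integrable \<mu> (v n)" "integrable \<mu> (\<phi> n)" using Lfun_imp_integrable[OF L(1)] Lfun_imp_integrable[OF L(2)] p_gt_1 by auto
    have "(LINT x|\<mu>. \<bar>v n x\<bar>) \<le> (LINT x|\<mu>. \<bar>\<phi> n x\<bar> + \<bar>v n x - \<phi> n x\<bar>)"
      by (rule integral_mono) (use i in auto)
    also have "\<dots> = (LINT x|\<mu>. \<bar>\<phi> n x\<bar>) + (LINT x|\<mu>. norm (v n x - \<phi> n x))" using i by simp
    also have "\<dots> \<le> (LINT x|\<mu>. \<bar>\<phi> n x\<bar>) + pint \<mu> p (\<lambda>x. v n x - \<phi> n x) powr (1/p) * measure \<mu> (space \<mu>) powr (1/p')"
      by (intro add_left_mono integral_mul_one_le[OF Lfun_diff(1)[OF L(1) L(2) p0]])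
    finally show ?thesis .
  qed
  then show ?thesis by (intro Lim_null_comparison[OF always_eventually lim]) (simp add: integral_nonneg_AE)
qed

text \<open>Pointwise interpolation a^t \<le> \<eta> a^pstar + K a, possible as t <
  \<open>pstar\<close>. The critical integrals are bounded by the embedding, and the L^1 norms tend
  to 0.\<close>

theorem rellich:
  assumes v: "\<And>n. v n \<in> X" and b: "\<And>n. gnorm (v n) \<le> C"
    and w: "\<And>l. l \<in> Wm1 \<Omega> p \<Longrightarrow> (\<lambda>n. l (v n)) \<longlonglongrightarrow> 0" and t: "1 \<le> t" "t < pstar"
  shows "(\<lambda>n. pint \<mu> t (v n)) \<longlonglongrightarrow> 0"
proof (rule LIMSEQ_I)
  fix \<epsilon> :: real assume \<epsilon>: "\<epsilon> > 0"
  have C: "C \<ge> 0" using b[of 0] gnorm_nonneg[of "v 0"] by linarith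
  have ps: "1 \<le> pstar" "pstar \<le> pstar" using t by auto
  define B where "B = (S pstar * C) powr pstar"
  have B: "pint \<mu> pstar (v n) \<le> B" for n
  proof -
    have "pint \<mu> pstar (v n) \<le> (S pstar * gnorm (v n)) powr pstar" by (rule embedding_Lfun(3)[OF v ps])
    also have "\<dots> \<le> B" unfolding B_def using S_pos[OF ps] b[of n] ps
      by (intro powr_mono2 mult_left_mono) auto
    finally show ?thesis .
  qed
  have B0: "B \<ge> 0" unfolding B_def by simp
  define \<eta> where "\<eta> = \<epsilon> / (2 * (B + 1))"
  have \<eta>: "\<eta> > 0" using \<epsilon> B0 by (simp add: \<eta>_def)
  \<comment> \<open>Beyond R the power t is at most \<eta> times the critical power, as the exponent
    t - pstar is negative; up to R the factor K makes a linear bound sufficient.\<close>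
  define R where "R = \<eta> powr (1 / (t - pstar))"
  have R: "R > 0" "R powr (t - pstar) = \<eta>" unfolding R_def using \<eta> t by (auto simp: powr_powr)
  define K where "K = R powr (t - 1)"
  have pt: "a powr t \<le> \<eta> * a powr pstar + K * a" if a: "a \<ge> 0" for a :: real
  proof (cases "a \<le> R")
    case True
    have "a powr t = a powr (t - 1) * a" using powr_add[of a "t-1" 1] a by (cases "a = 0") auto
    also have "\<dots> \<le> K * a" unfolding K_def using True a t by (intro mult_right_mono powr_mono2) auto
    finally show ?thesis using \<eta> by (simp add: add_increasing)
  next
    case False
    have "a powr t = a powr (t - pstar) * a powr pstar" by (simp flip: powr_add)
    also have "\<dots> \<le> \<eta> * a powr pstar" unfolding R(2)[symmetric]
      using False R t by (intro mult_right_mono powr_mono2') auto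
    finally show ?thesis using a unfolding K_def by (simp add: add_increasing2)
  qed
  have i: "integrable \<mu> (\<lambda>x. norm (v n x) powr t)" "integrable \<mu> (\<lambda>x. norm (v n x) powr pstar)" "integrable \<mu> (v n)" for n
    using Lfun_integrable[OF embedding_Lfun(1)[OF v t(1) less_imp_le[OF t(2)]]] Lfun_integrable[OF embedding_Lfun(1)[OF v ps]]
      Lfun_imp_integrable[OF embedding_Lfun(1)[OF v ps] ps(1)] by auto
  have est: "pint \<mu> t (v n) \<le> \<eta> * B + K * (LINT x|\<mu>. \<bar>v n x\<bar>)" for n
  proof -
    have "pint \<mu> t (v n) \<le> (LINT x|\<mu>. \<eta> * norm (v n x) powr pstar + K * \<bar>v n x\<bar>)"
      unfolding pint_def by (rule integral_mono) (use i[of n] pt in auto)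
    also have "\<dots> = \<eta> * pint \<mu> pstar (v n) + K * (LINT x|\<mu>. \<bar>v n x\<bar>)" using i[of n] by (simp add: pint_def)
    also have "\<dots> \<le> \<eta> * B + K * (LINT x|\<mu>. \<bar>v n x\<bar>)" using B[of n] \<eta> by simp
    finally show ?thesis .
  qed
  have "(\<lambda>n. K * (LINT x|\<mu>. \<bar>v n x\<bar>)) \<longlonglongrightarrow> K * 0" 
    by (intro tendsto_mult_left rellich_L1[of v C] v b w)
  then have "eventually (\<lambda>n. K * (LINT x|\<mu>. \<bar>v n x\<bar>) < \<epsilon>/2) sequentially"
    using \<epsilon> by (intro order_tendstoD(2)[of _ 0]) auto
  then obtain N where N: "\<And>n. n \<ge> N \<Longrightarrow> K * (LINT x|\<mu>. \<bar>v n x\<bar>) < \<epsilon>/2" by (auto simp: eventually_sequentially)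
  have "\<eta> * B \<le> \<epsilon>/2"
  proof -
    have "\<eta> * B = \<epsilon> / 2 * (B / (B + 1))" by (simp add: \<eta>_def)
    also have "\<dots> \<le> \<epsilon> / 2 * 1" using \<epsilon> B0 by (intro mult_left_mono) auto
    finally show ?thesis by simp
  qed
  then have "norm (pint \<mu> t (v n) - 0) < \<epsilon>" if "n \<ge> N" for n using est[of n] N[OF that] by simp
  then show "\<exists>N. \<forall>n\<ge>N. norm (pint \<mu> t (v n) - 0) < \<epsilon>" by blast
qed

end

section \<open>Zeros of finite-dimensional maps\<close>

text \<open>The dimension of the Galerkin spaces varies, so coordinates are indexed by natural numbers
  instead of a type, and Brouwer's theorem is replaced by a direct appeal to Kuhn's lemma.\<close>

lemma convergent_subsequence_coordinates:
  fixes x :: "nat \<Rightarrow> nat \<Rightarrow> real"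
  assumes "\<And>k i. i < n \<Longrightarrow> \<bar>x k i\<bar> \<le> R"
  shows "\<exists>\<rho>. strict_mono (\<rho> :: nat \<Rightarrow> nat) \<and> (\<forall>i<n. convergent (\<lambda>k. x (\<rho> k) i))"
  using assms
proof (induction n)
  case 0
  then show ?case by (intro exI[of _ id]) (auto simp: strict_mono_def)
next
  case (Suc n)
  then obtain \<rho> :: "nat \<Rightarrow> nat" where \<rho>: "strict_mono \<rho>" "\<And>i. i < n \<Longrightarrow> convergent (\<lambda>k. x (\<rho> k) i)" by force
  have "bounded (range (\<lambda>k. x (\<rho> k) n))" by (rule boundedI[of _ R]) (use Suc.prems in auto)
  then obtain l and s :: "nat \<Rightarrow> nat" where s: "strict_mono s" "((\<lambda>k. x (\<rho> k) n) \<circ> s) \<longlonglongrightarrow> l"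
    using bounded_imp_convergent_subsequence by blast
  have "convergent (\<lambda>k. x ((\<rho> \<circ> s) k) i)" if "i < Suc n" for i
  proof (cases "i = n")
    case True
    then show ?thesis using s(2) by (auto simp: convergent_def o_def)
  next
    case False
    then show ?thesis using convergent_subseq_convergent[OF \<rho>(2)[of i] s(1)] that by (simp add: o_def)
  qed
  then show ?case using strict_mono_o[OF \<rho>(1) s(1)] by blast
qed

definition coord_norm :: "nat \<Rightarrow> (nat \<Rightarrow> real) \<Rightarrow> real" where
  "coord_norm n c = sqrt (\<Sum>i<n. (c i)\<^sup>2)"

text \<open>Clearing the coordinates from n on makes a vector determined by the first n of them, so
  that the retraction fixes points of the ball as functions.\<close>

definition coord_ball :: "nat \<Rightarrow> real \<Rightarrow> (nat \<Rightarrow> real) set" where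
  "coord_ball n R = {c. (\<forall>i\<ge>n. c i = 0) \<and> coord_norm n c \<le> R}"

lemma coord_norm_nonneg [simp]: "0 \<le> coord_norm n c"
  by (simp add: coord_norm_def sum_nonneg)

lemma coord_norm_square: "(coord_norm n c)\<^sup>2 = (\<Sum>i<n. (c i)\<^sup>2)"
  by (simp add: coord_norm_def sum_nonneg)

lemma coord_le_norm: "i < n \<Longrightarrow> \<bar>c i\<bar> \<le> coord_norm n c"
proof -
  assume "i < n"
  then have "(c i)\<^sup>2 \<le> (\<Sum>i<n. (c i)\<^sup>2)" using member_le_sum[of i "{..<n}" "\<lambda>i. (c i)\<^sup>2"] by simp
  then show ?thesis unfolding coord_norm_def by (metis real_sqrt_abs real_sqrt_le_mono)
qed

lemma tendsto_coord_norm: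
  assumes "\<And>i. i < n \<Longrightarrow> (\<lambda>k. c k i) \<longlonglongrightarrow> c0 i"
  shows "(\<lambda>k. coord_norm n (c k)) \<longlonglongrightarrow> coord_norm n c0"
  unfolding coord_norm_def using assms by (intro tendsto_intros) auto

lemma tendsto_coordinates_perturb:
  fixes a b :: "nat \<Rightarrow> real"
  assumes "b \<longlonglongrightarrow> l" "\<And>k. \<bar>a k - b k\<bar> \<le> d k" "d \<longlonglongrightarrow> 0"
  shows "a \<longlonglongrightarrow> l"
proof -
  have "(\<lambda>k. a k - b k) \<longlonglongrightarrow> 0"
    by (rule Lim_null_comparison[OF always_eventually assms(3)]) (use assms(2) in simp)
  from tendsto_add[OF this assms(1)] show ?thesis by simp
qed

text \<open>Kuhn's lemma on ever finer grids of the cube of half-width R gives a point y at which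
  each component of g vanishes or points out of the cube through a face containing y. The boundary
  hypothesis then places y in the ball and forces F to vanish there.\<close>

theorem exists_zero_coord_ball:
  fixes F :: "(nat \<Rightarrow> real) \<Rightarrow> nat \<Rightarrow> real"
  assumes R: "R > 0"
    and cont: "\<And>c c0 i. (\<And>k. c k \<in> coord_ball n R) \<Longrightarrow> c0 \<in> coord_ball n R \<Longrightarrow> (\<And>j. j < n \<Longrightarrow> (\<lambda>k. c k j) \<longlonglongrightarrow> c0 j)
            \<Longrightarrow> i < n \<Longrightarrow> (\<lambda>k. F (c k) i) \<longlonglongrightarrow> F c0 i"
    and bdry: "\<And>c. c \<in> coord_ball n R \<Longrightarrow> coord_norm n c = R \<Longrightarrow> (\<Sum>i<n. F c i * c i) \<ge> 0"
  shows "\<exists>c\<in>coord_ball n R. \<forall>i<n. F c i = 0"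
proof -
  \<comment> \<open>Radial retraction onto the ball, which also clears the coordinates from n
    on.\<close>
  define P where "P x i = (if i < n then R / max R (coord_norm n x) * x i else 0)" for x :: "nat \<Rightarrow> real" and i
  have PB: "P x \<in> coord_ball n R" for x
  proof -
    let ?m = "max R (coord_norm n x)"
    have m: "?m > 0" "coord_norm n x \<le> ?m" using R by auto
    have "(coord_norm n (P x))\<^sup>2 = (R / ?m)\<^sup>2 * (coord_norm n x)\<^sup>2"
      unfolding coord_norm_square sum_distrib_left by (rule sum.cong) (simp_all add: P_def power_mult_distrib power_divide)
    also have "\<dots> = (R / ?m * coord_norm n x)\<^sup>2" by (rule power_mult_distrib[symmetric])
    finally have "coord_norm n (P x) = R / ?m * coord_norm n x"
      by (rule power2_eq_imp_eq) (use R m in auto)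
    also have "\<dots> \<le> R / ?m * ?m" using m R by (intro mult_left_mono) auto
    also have "\<dots> = R" using m by simp
    finally show ?thesis by (simp add: coord_ball_def P_def)
  qed
  \<comment> \<open>Displacement of the map sending x to P x - F (P x); within the ball its fixed
    points are the zeros of F.\<close>
  define g where "g x i = P x i - F (P x) i - x i" for x i
  define pt where "pt m q i = - R + 2 * R / real (Suc m) * real (q i)" for m and q :: "nat \<Rightarrow> nat" and i
  have step: "\<exists>x. (\<forall>i<n. \<bar>x i\<bar> \<le> R) \<and> (\<forall>i<n. \<exists>a b. (\<forall>j<n. \<bar>a j - x j\<bar> \<le> 2 * R / real (Suc m)) \<and> (\<forall>j<n. \<bar>b j - x j\<bar> \<le> 2 * R / real (Suc m)) \<and>
       (g a i \<ge> 0 \<or> a i = - R) \<and> (g b i \<le> 0 \<or> b i = R))" for m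
  proof -
    \<comment> \<open>Inside the cube the label records the sign of g. On the faces it is the fixed
      value 0 or 1 that Kuhn's lemma demands, whence the alternatives with - R and R.\<close>
    define label where "label q i = (if q i = 0 \<or> (q i \<noteq> Suc m \<and> g (pt m q) i \<ge> 0) then 0 else 1 :: nat)" for q :: "nat \<Rightarrow> nat" and i
    obtain q where q: "\<forall>i<n. q i < Suc m"
      "\<forall>i<n. \<exists>r s. (\<forall>j<n. q j \<le> r j \<and> r j \<le> q j + 1) \<and> (\<forall>j<n. q j \<le> s j \<and> s j \<le> q j + 1) \<and> label r i \<noteq> label s i"
      by (rule kuhn_lemma[of "Suc m" n label]) (auto simp: label_def)
    have close: "\<bar>pt m r j - pt m q j\<bar> \<le> 2 * R / real (Suc m)" if "q j \<le> r j" "r j \<le> q j + 1" for r j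
    proof -
      have "pt m r j - pt m q j = 2 * R / real (Suc m) * (real (r j) - real (q j))"
        unfolding pt_def right_diff_distrib by simp
      moreover have "0 \<le> real (r j) - real (q j)" "real (r j) - real (q j) \<le> 1" using that by linarith+
      ultimately show ?thesis using R mult_left_le[of "real (r j) - real (q j)" "2 * R / real (Suc m)"]
        by (metis abs_of_nonneg divide_nonneg_nonneg less_imp_le mult_nonneg_nonneg of_nat_0_le_iff zero_le_numeral)
    qed
    have lab: "(label r i = 0 \<longrightarrow> g (pt m r) i \<ge> 0 \<or> pt m r i = - R) \<and> (label r i \<noteq> 0 \<longrightarrow> g (pt m r) i \<le> 0 \<or> pt m r i = R)" for r i
    proof -
      have "pt m r i = - R" if "r i = 0" using that by (simp add: pt_def)
      moreover have "pt m r i = R" if "r i = Suc m"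
      proof -
        have "2 * R / real (Suc m) * real (Suc m) = 2 * R" by simp
        then show ?thesis unfolding pt_def that by simp
      qed
      ultimately show ?thesis unfolding label_def by auto
    qed
    show ?thesis
    proof (rule exI[of _ "pt m q"], rule conjI; intro allI impI)
      fix i assume i: "i < n"
      have "2 * R / real (Suc m) * real (q i) \<le> 2 * R / real (Suc m) * real (Suc m)"
        using q(1) i R by (intro mult_left_mono) (auto simp: less_imp_le)
      then have "0 \<le> 2 * R / real (Suc m) * real (q i)" "2 * R / real (Suc m) * real (q i) \<le> 2 * R"
        using R by simp_all
      then show "\<bar>pt m q i\<bar> \<le> R" by (simp add: pt_def abs_le_iff)
      obtain r s where rs: "\<forall>j<n. q j \<le> r j \<and> r j \<le> q j + 1" "\<forall>j<n. q j \<le> s j \<and> s j \<le> q j + 1" "label r i \<noteq> label s i"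
        using q(2) i by blast
      have cr: "\<forall>j<n. \<bar>pt m r j - pt m q j\<bar> \<le> 2 * R / real (Suc m)" and cs: "\<forall>j<n. \<bar>pt m s j - pt m q j\<bar> \<le> 2 * R / real (Suc m)"
        using close rs by auto
      show "\<exists>a b. (\<forall>j<n. \<bar>a j - pt m q j\<bar> \<le> 2 * R / real (Suc m)) \<and> (\<forall>j<n. \<bar>b j - pt m q j\<bar> \<le> 2 * R / real (Suc m)) \<and>
         (g a i \<ge> 0 \<or> a i = - R) \<and> (g b i \<le> 0 \<or> b i = R)"
      proof (cases "label r i = 0")
        case True
        then have "label s i \<noteq> 0" using rs(3) by simp
        then show ?thesis using lab[of r i] lab[of s i] True cr cs by blast
      next
        case False
        then have "label s i = 0" using rs(3) by (auto simp: label_def split: if_splits)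
        then show ?thesis using lab[of r i] lab[of s i] False cr cs by blast
      qed
    qed
  qed
  define Q where "Q m x a b \<longleftrightarrow> (\<forall>i<n. \<bar>x i\<bar> \<le> R) \<and> (\<forall>i<n. (\<forall>j<n. \<bar>a i j - x j\<bar> \<le> 2 * R / real (Suc m)) \<and> (\<forall>j<n. \<bar>b i j - x j\<bar> \<le> 2 * R / real (Suc m)) \<and>
       (g (a i) i \<ge> 0 \<or> a i i = - R) \<and> (g (b i) i \<le> 0 \<or> b i i = R))"
    for m :: nat and x :: "nat \<Rightarrow> real" and a b :: "nat \<Rightarrow> nat \<Rightarrow> real"
  have "\<exists>x a b. Q m x a b" for m
    unfolding Q_def using step[of m] by metis
  then obtain x a b where xab: "\<And>m. Q m (x m) (a m) (b m)" by metis
  have x: "\<And>m i. i < n \<Longrightarrow> \<bar>x m i\<bar> \<le> R"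
    and a: "\<And>m i j. i < n \<Longrightarrow> j < n \<Longrightarrow> \<bar>a m i j - x m j\<bar> \<le> 2 * R / real (Suc m)"
    and b: "\<And>m i j. i < n \<Longrightarrow> j < n \<Longrightarrow> \<bar>b m i j - x m j\<bar> \<le> 2 * R / real (Suc m)"
    and ga: "\<And>m i. i < n \<Longrightarrow> g (a m i) i \<ge> 0 \<or> a m i i = - R"
    and gb: "\<And>m i. i < n \<Longrightarrow> g (b m i) i \<le> 0 \<or> b m i i = R"
    using xab unfolding Q_def by blast+
  obtain \<rho> :: "nat \<Rightarrow> nat" where \<rho>: "strict_mono \<rho>" "\<forall>i<n. convergent (\<lambda>k. x (\<rho> k) i)"
    using convergent_subsequence_coordinates[of n x R] x by blast
  define y where "y i = (if i < n then lim (\<lambda>k. x (\<rho> k) i) else 0)" for i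
  have xl: "(\<lambda>k. x (\<rho> k) i) \<longlonglongrightarrow> y i" if "i < n" for i
    using \<rho>(2) that by (simp add: y_def convergent_LIMSEQ_iff)
  have d0: "(\<lambda>k. 2 * R / real (Suc (\<rho> k))) \<longlonglongrightarrow> 0"
  proof -
    have "(\<lambda>k. 2 * R * inverse (real (Suc k))) \<longlonglongrightarrow> 2 * R * 0" by (intro tendsto_mult_left LIMSEQ_inverse_real_of_nat)
    then have "(\<lambda>k. 2 * R / real (Suc k)) \<longlonglongrightarrow> 0" by (simp add: divide_inverse)
    from LIMSEQ_subseq_LIMSEQ[OF this \<rho>(1)] show ?thesis by (simp add: o_def)
  qed
  have al: "(\<lambda>k. a (\<rho> k) i j) \<longlonglongrightarrow> y j" if "i < n" "j < n" for i j
    by (rule tendsto_coordinates_perturb[OF xl[OF that(2)] a[OF that] d0])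
  have bl: "(\<lambda>k. b (\<rho> k) i j) \<longlonglongrightarrow> y j" if "i < n" "j < n" for i j
    by (rule tendsto_coordinates_perturb[OF xl[OF that(2)] b[OF that] d0])
  have gl: "(\<lambda>k. g (c k) i) \<longlonglongrightarrow> g y i" if c: "\<And>j. j < n \<Longrightarrow> (\<lambda>k. c k j) \<longlonglongrightarrow> y j" and i: "i < n" for c i
  proof -
    have Pl: "(\<lambda>k. P (c k) j) \<longlonglongrightarrow> P y j" if "j < n" for j
    proof -
      have "max R (coord_norm n y) \<noteq> 0" using R by simp
      then have "(\<lambda>k. R / max R (coord_norm n (c k)) * c k j) \<longlonglongrightarrow> R / max R (coord_norm n y) * y j"
        by (intro tendsto_intros tendsto_coord_norm c that)
      then show ?thesis using that by (simp add: P_def)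
    qed
    have "(\<lambda>k. F (P (c k)) i) \<longlonglongrightarrow> F (P y) i" by (rule cont[OF PB PB Pl i])
    then show ?thesis unfolding g_def by (intro tendsto_diff Pl c i)
  qed
  have lower: "g y i \<ge> 0 \<or> y i = - R" if i: "i < n" for i
  proof (rule disjCI)
    assume "y i \<noteq> - R"
    with al[OF i i] have "eventually (\<lambda>k. a (\<rho> k) i i \<noteq> - R) sequentially" by (rule tendsto_imp_eventually_ne)
    then have "eventually (\<lambda>k. 0 \<le> g (a (\<rho> k) i) i) sequentially" using ga[OF i] by (auto elim!: eventually_mono)
    then show "g y i \<ge> 0" using tendsto_lowerbound[OF gl[OF al[OF i] i]] by simp
  qed
  have upper: "g y i \<le> 0 \<or> y i = R" if i: "i < n" for i
  proof (rule disjCI)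
    assume "y i \<noteq> R"
    with bl[OF i i] have "eventually (\<lambda>k. b (\<rho> k) i i \<noteq> R) sequentially" by (rule tendsto_imp_eventually_ne)
    then have "eventually (\<lambda>k. g (b (\<rho> k) i) i \<le> 0) sequentially" using gb[OF i] by (auto elim!: eventually_mono)
    then show "g y i \<le> 0" using tendsto_upperbound[OF gl[OF bl[OF i] i]] by simp
  qed
  define s where "s = R / max R (coord_norm n y)"
  have s: "0 < s" "s \<le> 1" unfolding s_def using R by auto
  have Py: "P y i = s * y i" if "i < n" for i using that by (simp add: P_def s_def)
  \<comment> \<open>A nonzero component g y i has the sign of y i, since it occurs only on the
    corresponding face. Inserting P y = s y gives the bound.\<close>
  have key: "F (P y) i * y i \<le> - (1 - s) * (y i)\<^sup>2" if i: "i < n" for i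
  proof -
    have "g y i * y i \<ge> 0"
    proof -
      consider "g y i = 0" | "g y i > 0" "y i = R" | "g y i < 0" "y i = - R" using lower[OF i] upper[OF i] R by linarith
      then show ?thesis using R by cases (auto simp: mult_nonneg_nonneg mult_nonpos_nonneg)
    qed
    then show ?thesis using Py[OF i] by (simp add: g_def algebra_simps power2_eq_square)
  qed
  have sumle: "(\<Sum>i<n. F (P y) i * y i) \<le> - (1 - s) * (coord_norm n y)\<^sup>2"
    unfolding coord_norm_square sum_distrib_left by (rule sum_mono) (use key in simp)
  \<comment> \<open>Otherwise P y lies on the sphere, where the hypothesis makes the sum
    nonnegative, while the bound just obtained makes it negative because s < 1.\<close>
  have yR: "coord_norm n y \<le> R"
  proof (rule ccontr)
    assume c: "\<not> coord_norm n y \<le> R"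
    then have s1: "s < 1" "s * coord_norm n y = R" unfolding s_def using R by auto
    have "(coord_norm n (P y))\<^sup>2 = s\<^sup>2 * (coord_norm n y)\<^sup>2"
      unfolding coord_norm_square sum_distrib_left by (rule sum.cong) (auto simp: Py power_mult_distrib)
    then have "(coord_norm n (P y))\<^sup>2 = R\<^sup>2" using s1(2) by (metis power_mult_distrib)
    then have "coord_norm n (P y) = R" using R by (simp add: power2_eq_iff_nonneg)
    then have "0 \<le> (\<Sum>i<n. F (P y) i * P y i)" by (rule bdry[OF PB])
    also have "\<dots> = s * (\<Sum>i<n. F (P y) i * y i)" unfolding sum_distrib_left by (rule sum.cong) (auto simp: Py)
    finally have "0 \<le> (\<Sum>i<n. F (P y) i * y i)" using s by (simp add: zero_le_mult_iff)
    then have "(1 - s) * (coord_norm n y)\<^sup>2 \<le> 0" using sumle by (simp add: left_diff_distrib)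
    moreover have "(1 - s) * (coord_norm n y)\<^sup>2 > 0" using s1 c R by simp
    ultimately show False by simp
  qed
  have s1: "s = 1" unfolding s_def using yR R by simp
  have Pyy: "P y = y" using s1 by (auto simp: P_def s_def y_def fun_eq_iff)
  have nonpos: "F y i * y i \<le> 0" if "i < n" for i using key[OF that] by (simp add: Pyy s1)
  have gy: "g y i = - F y i" for i by (simp add: g_def Pyy)
  have yB: "y \<in> coord_ball n R" using PB[of y] by (simp add: Pyy)
  \<comment> \<open>A nonzero component would put y on a face of the cube, hence on the sphere.
    There the sum is nonnegative although no term is positive, so the product F y i * y i is 0,
    against |y i| = R.\<close>
  have "F y i = 0" if i: "i < n" for i
  proof (rule ccontr)
    assume nz: "F y i \<noteq> 0"
    have "\<bar>y i\<bar> = R"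
    proof (rule ccontr)
      assume "\<bar>y i\<bar> \<noteq> R"
      then have "g y i \<ge> 0" "g y i \<le> 0" using lower[OF i] upper[OF i] R by auto
      then show False using nz gy by simp
    qed
    then have cn: "coord_norm n y = R" using coord_le_norm[OF i, of y] yR by simp
    have "0 \<le> (\<Sum>i<n. F y i * y i)" by (rule bdry[OF yB cn])
    moreover have "(\<Sum>j<n. F y j * y j) \<le> F y i * y i"
      using nonpos sum.remove[of "{..<n}" i "\<lambda>j. F y j * y j"] i sum_nonpos[of "{..<n} - {i}" "\<lambda>j. F y j * y j"] by simp
    ultimately have "F y i * y i = 0" using nonpos[OF i] by linarith
    then have "y i = 0" using nz i by auto
    then show False using \<open>\<bar>y i\<bar> = R\<close> R by simp
  qed
  then show ?thesis using yB by blast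
qed

section \<open>Galerkin approximation\<close>

context sobolev_embedding begin

lemma functional_sum:
  assumes l: "l \<in> Wm1 \<Omega> p" and "finite I" "\<And>i. i \<in> I \<Longrightarrow> u i \<in> X"
  shows "l (\<lambda>x. \<Sum>i\<in>I. c i * u i x) = (\<Sum>i\<in>I. c i * l (u i))"
  using assms(2,3)
proof (induction I)
  case empty
  then show ?case using dual_spaceD(2)[OF l W01p_zero, of 0] by simp
next
  case (insert i I)
  have "l (\<lambda>x. c i * u i x + (\<Sum>i\<in>I. c i * u i x)) = l (\<lambda>x. c i * u i x) + l (\<lambda>x. \<Sum>i\<in>I. c i * u i x)"
    by (rule dual_spaceD(1)[OF l W01p_cmult W01p_sum(1)]) (use insert in auto)
  also have "l (\<lambda>x. c i * u i x) = c i * l (u i)" by (rule dual_spaceD(2)[OF l]) (use insert in auto)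
  finally show ?case using insert by simp
qed

lemma gnorm_cmult:
  assumes "u \<in> X"
  shows "gnorm (\<lambda>x. c * u x) = \<bar>c\<bar> * gnorm u"
proof -
  have "gnorm (\<lambda>x. c * u x) = pint \<mu> p (\<lambda>x. c *\<^sub>R D u x) powr (1/p)"
    by (rule gnorm_AE[OF W01p_cmult[OF assms] Lfun_measurable[OF Lfun_scaleR(1)[OF D_Lfun[OF assms]]] W1p_cmult(2)[OF W01p_imp_W1p[OF assms]]])
  also have "\<dots> = \<bar>c\<bar> * gnorm u"
    using Lfun_scaleR(2)[OF D_Lfun[OF assms], of c] p_gt_1 by (simp add: powr_mult powr_powr gnorm_def)
  finally show ?thesis .
qed

lemma pint_sum_tendsto_0:
  fixes F :: "nat \<Rightarrow> 'a \<Rightarrow> 'a"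
  assumes F: "\<And>i. F i \<in> Lfun \<mu> p" and d: "\<And>i. i < n \<Longrightarrow> (\<lambda>k. d k i) \<longlonglongrightarrow> 0"
  shows "(\<lambda>k. pint \<mu> p (\<lambda>x. \<Sum>i<n. d k i *\<^sub>R F i x)) \<longlonglongrightarrow> 0"
  using d
proof (induction n)
  case 0
  then show ?case by (simp add: pint_def)
next
  case (Suc n)
  have L: "(\<lambda>x. \<Sum>i<n. d k i *\<^sub>R F i x) \<in> Lfun \<mu> p" for k
    using Lfun_sum[of "{..<n}" "\<lambda>i x. d k i *\<^sub>R F i x"] Lfun_scaleR(1)[OF F] p_gt_0 by blast
  have "(\<lambda>k. \<bar>d k n\<bar> powr p * pint \<mu> p (F n)) \<longlonglongrightarrow> \<bar>0\<bar> powr p * pint \<mu> p (F n)"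
    by (intro tendsto_mult_right tendsto_powr2 tendsto_rabs Suc.prems tendsto_const) (use p_gt_0 in auto)
  then have 1: "(\<lambda>k. pint \<mu> p (\<lambda>x. d k n *\<^sub>R F n x)) \<longlonglongrightarrow> 0" using Lfun_scaleR(2)[OF F] by simp
  have 2: "(\<lambda>k. pint \<mu> p (\<lambda>x. \<Sum>i<n. d k i *\<^sub>R F i x)) \<longlonglongrightarrow> 0" by (rule Suc.IH) (use Suc.prems in auto)
  show ?case using pint_add_tendsto_0[OF L Lfun_scaleR(1)[OF F] p_gt_0 2 1] by simp
qed

text \<open>As the e i may be dependent up to null sets, the norm of W c need not control c, and A
  alone is not known to have a sign on large spheres of coefficients. Adding \<epsilon> c i repairs
  this, because A w w is bounded below. At the zero found, A (W c) (e i) = - \<epsilon> c i, and a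
  bound on c independent of \<epsilon> makes these values small.\<close>

lemma galerkin_approximation:
  fixes A :: "('a \<Rightarrow> real) \<Rightarrow> ('a \<Rightarrow> real) \<Rightarrow> real" and e :: "nat \<Rightarrow> 'a \<Rightarrow> real"
  assumes AW: "\<And>w. w \<in> X \<Longrightarrow> A w \<in> Wm1 \<Omega> p"
    and cont: "\<And>wk w v. (\<And>k. wk k \<in> X) \<Longrightarrow> w \<in> X \<Longrightarrow> (\<lambda>k. gnorm (\<lambda>x. wk k x - w x)) \<longlonglongrightarrow> 0 \<Longrightarrow> v \<in> X \<Longrightarrow>
        (\<lambda>k. A (wk k) v) \<longlonglongrightarrow> A w v"
    and lower: "\<And>w. w \<in> X \<Longrightarrow> - M \<le> A w w"
    and coercive: "\<And>w. w \<in> X \<Longrightarrow> A w w \<le> 0 \<Longrightarrow> gnorm w \<le> R0"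
    and e: "\<And>i. e i \<in> X" and \<eta>: "\<eta> > 0"
  shows "\<exists>w\<in>X. gnorm w \<le> R0 \<and> \<bar>A w w\<bar> \<le> \<eta> \<and> (\<forall>j<n. \<bar>A w (e j)\<bar> \<le> \<eta>)"
proof -
  define W where "W c = (\<lambda>x. \<Sum>i<n. c i * e i x)" for c :: "nat \<Rightarrow> real"
  define N where "N c = gnorm (W c)" for c
  have WX: "W c \<in> X" for c unfolding W_def by (rule W01p_sum(1)) (use e in auto)
  have Wsum: "l (W c) = (\<Sum>i<n. c i * l (e i))" if "l \<in> Wm1 \<Omega> p" for l c
    unfolding W_def by (rule functional_sum[OF that]) (use e in auto)
  have N0: "N c \<ge> 0" for c by (simp add: N_def)
  have Wdiff: "(\<lambda>x. W c x - W d x) = W (\<lambda>i. c i - d i)" for c d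
    by (simp add: W_def fun_eq_iff left_diff_distrib sum_subtractf)
  have Ntend: "(\<lambda>k. N (d k)) \<longlonglongrightarrow> 0" if "\<And>i. i < n \<Longrightarrow> (\<lambda>k. d k i) \<longlonglongrightarrow> 0" for d :: "nat \<Rightarrow> nat \<Rightarrow> real"
  proof -
    have L: "(\<lambda>x. \<Sum>i<n. d k i *\<^sub>R D (e i) x) \<in> Lfun \<mu> p" for k
      using Lfun_sum[of "{..<n}" "\<lambda>i x. d k i *\<^sub>R D (e i) x"] Lfun_scaleR(1)[OF D_Lfun[OF e]] p_gt_0 by blast
    have "N (d k) = pint \<mu> p (\<lambda>x. \<Sum>i<n. d k i *\<^sub>R D (e i) x) powr (1/p)" for k
      unfolding N_def by (rule gnorm_AE[OF WX Lfun_measurable[OF L]]) (unfold W_def, rule W01p_sum(2), use e in auto)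
    moreover have "(\<lambda>k. pint \<mu> p (\<lambda>x. \<Sum>i<n. d k i *\<^sub>R D (e i) x) powr (1/p)) \<longlonglongrightarrow> 0 powr (1/p)"
      by (rule tendsto_powr2[OF pint_sum_tendsto_0[OF D_Lfun[OF e] that]]) (use p_gt_0 in auto)
    ultimately show ?thesis by simp
  qed
  have Wtend: "(\<lambda>k. gnorm (\<lambda>x. W (c k) x - W c0 x)) \<longlonglongrightarrow> 0" if "\<And>i. i < n \<Longrightarrow> (\<lambda>k. c k i) \<longlonglongrightarrow> c0 i" for c c0
    unfolding Wdiff N_def[symmetric] by (rule Ntend) (use that in \<open>auto intro: LIM_zero\<close>)
  have Nscale: "N (\<lambda>i. t * c i) = \<bar>t\<bar> * N c" for t c
  proof -
    have "W (\<lambda>i. t * c i) = (\<lambda>x. t * W c x)" by (simp add: W_def fun_eq_iff sum_distrib_left mult.assoc)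
    then show ?thesis unfolding N_def using gnorm_cmult[OF WX] by simp
  qed
  have Nlim: "N c0 = 0" if lim: "\<And>i. i < n \<Longrightarrow> (\<lambda>k. c k i) \<longlonglongrightarrow> c0 i" and z: "(\<lambda>k. N (c k)) \<longlonglongrightarrow> 0" for c c0
  proof -
    have le: "pint \<mu> p (D (W c0)) \<le> 2 powr p * (N (c k) powr p + N (\<lambda>i. c k i - c0 i) powr p)" for k
    proof -
      have "D (W (c k)) \<in> Lfun \<mu> p" "D (W c0) \<in> Lfun \<mu> p" by (rule D_Lfun[OF WX])+
      then have "pint \<mu> p (\<lambda>x. D (W (c k)) x - (D (W (c k)) x - D (W c0) x)) \<le> 2 powr p * (pint \<mu> p (D (W (c k))) + pint \<mu> p (\<lambda>x. D (W (c k)) x - D (W c0) x))"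
        by (intro Lfun_diff p_gt_0)
      moreover have "pint \<mu> p (\<lambda>x. D (W (c k)) x - D (W c0) x) = N (\<lambda>i. c k i - c0 i) powr p"
        unfolding N_def Wdiff[symmetric] gnorm_diff[OF WX WX] using p_gt_0 by (simp add: powr_powr)
      ultimately show ?thesis by (simp add: N_def gnorm_powr)
    qed
    have "(\<lambda>k. N (\<lambda>i. c k i - c0 i)) \<longlonglongrightarrow> 0" by (rule Ntend) (use lim in \<open>auto intro: LIM_zero\<close>)
    then have "(\<lambda>k. 2 powr p * (N (c k) powr p + N (\<lambda>i. c k i - c0 i) powr p)) \<longlonglongrightarrow> 2 powr p * (0 powr p + 0 powr p)"
      by (intro tendsto_intros tendsto_powr2 z) (use p_gt_0 N0 in auto)
    then have "(\<lambda>k. 2 powr p * (N (c k) powr p + N (\<lambda>i. c k i - c0 i) powr p)) \<longlonglongrightarrow> 0" by simp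
    then have "pint \<mu> p (D (W c0)) \<le> 0" by (rule LIMSEQ_le_const) (use le in blast)
    then have "pint \<mu> p (D (W c0)) = 0" using pint_nonneg by (metis order_antisym)
    then show ?thesis by (simp add: N_def gnorm_def)
  qed
  \<comment> \<open>Orthogonality to the kernel of the seminorm N. On such vectors N dominates the
    Euclidean norm, by compactness of the unit sphere.\<close>
  define orth where "orth c \<longleftrightarrow> (\<forall>k. N k = 0 \<longrightarrow> (\<Sum>i<n. k i * c i) = 0)" for c
  obtain \<delta> where \<delta>: "\<delta> > 0" "\<And>c. orth c \<Longrightarrow> \<delta> * coord_norm n c \<le> N c"
  proof (rule ccontr)
    assume "\<not> thesis"
    then have "\<exists>c. orth c \<and> N c < 1 / real (Suc m) * coord_norm n c" for m
      using that[of "1 / real (Suc m)"] by (metis linorder_not_le of_nat_0_less_iff zero_less_Suc zero_less_divide_1_iff)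
    then obtain c where c: "\<And>m. orth (c m)" "\<And>m. N (c m) < 1 / real (Suc m) * coord_norm n (c m)" by metis
    have cp: "coord_norm n (c m) > 0" for m
    proof -
      have "0 < 1 / real (Suc m) * coord_norm n (c m)" using c(2)[of m] N0[of "c m"] by linarith
      then show ?thesis by (simp add: zero_less_divide_iff)
    qed
    define d where "d m i = 1 / coord_norm n (c m) * c m i" for m i
    have dn: "coord_norm n (d m) = 1" for m
    proof -
      have "(coord_norm n (d m))\<^sup>2 = (1 / coord_norm n (c m))\<^sup>2 * (coord_norm n (c m))\<^sup>2"
        unfolding coord_norm_square sum_distrib_left by (rule sum.cong) (simp_all add: d_def power_mult_distrib power_divide)
      also have "\<dots> = 1\<^sup>2" using cp[of m] by (simp add: power_divide)
      finally show ?thesis by (rule power2_eq_imp_eq) auto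
    qed
    have dN: "N (d m) \<le> 1 / real (Suc m)" for m
    proof -
      have "N (d m) = 1 / coord_norm n (c m) * N (c m)" using cp[of m] Nscale[of "1 / coord_norm n (c m)" "c m"] by (simp add: d_def[abs_def])
      also have "\<dots> \<le> 1 / coord_norm n (c m) * (1 / real (Suc m) * coord_norm n (c m))"
        using c(2)[of m] cp[of m] by (intro mult_left_mono) auto
      also have "\<dots> = 1 / real (Suc m)" using cp[of m] by simp
      finally show ?thesis .
    qed
    have do: "orth (d m)" for m unfolding orth_def
    proof (intro allI impI)
      fix k assume "N k = 0"
      have "(\<Sum>i<n. k i * d m i) = 1 / coord_norm n (c m) * (\<Sum>i<n. k i * c m i)"
        unfolding sum_distrib_left by (rule sum.cong) (auto simp: d_def)
      then show "(\<Sum>i<n. k i * d m i) = 0" using c(1)[of m] \<open>N k = 0\<close> unfolding orth_def by simp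
    qed
    obtain \<rho> :: "nat \<Rightarrow> nat" where \<rho>: "strict_mono \<rho>" "\<forall>i<n. convergent (\<lambda>k. d (\<rho> k) i)"
      using convergent_subsequence_coordinates[of n d 1] coord_le_norm[of _ n "d _"] dn by metis
    define y where "y i = lim (\<lambda>k. d (\<rho> k) i)" for i
    have y: "(\<lambda>k. d (\<rho> k) i) \<longlonglongrightarrow> y i" if "i < n" for i
      using \<rho>(2) that by (simp add: y_def convergent_LIMSEQ_iff)
    have z: "(\<lambda>k. 1 / real (Suc k)) \<longlonglongrightarrow> 0" using LIMSEQ_inverse_real_of_nat by (simp add: inverse_eq_divide)
    have "(\<lambda>m. N (d m)) \<longlonglongrightarrow> 0"
      by (rule Lim_null_comparison[OF always_eventually z]) (use dN N0 in auto)
    then have "(\<lambda>k. N (d (\<rho> k))) \<longlonglongrightarrow> 0" using LIMSEQ_subseq_LIMSEQ[OF _ \<rho>(1)] by (force simp: o_def)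
    \<comment> \<open>The limit y is in the kernel of N and is a limit of vectors orthogonal to that
      kernel; so it is orthogonal to itself, although its norm is 1.\<close>
    then have "N y = 0" by (intro Nlim[where c="\<lambda>k. d (\<rho> k)"] y)
    then have "(\<Sum>i<n. y i * d (\<rho> k) i) = 0" for k using do unfolding orth_def by blast
    moreover have "(\<lambda>k. \<Sum>i<n. y i * d (\<rho> k) i) \<longlonglongrightarrow> (\<Sum>i<n. y i * y i)" by (intro tendsto_sum tendsto_mult_left y) auto
    ultimately have "(\<Sum>i<n. y i * y i) = 0" by (simp add: LIMSEQ_const_iff)
    then have "coord_norm n y = 0" by (simp add: coord_norm_def power2_eq_square)
    moreover have "(\<lambda>k. coord_norm n (d (\<rho> k))) \<longlonglongrightarrow> coord_norm n y" by (rule tendsto_coord_norm[OF y])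
    ultimately show False by (simp add: dn LIMSEQ_const_iff)
  qed
  define R1 where "R1 = max R0 0"
  \<comment> \<open>The zero c will satisfy |c| \<le> R1 / \<delta>, a bound free of \<epsilon>.
    This choice makes \<epsilon> |c|^2 and \<epsilon> |c j| at most \<eta>.\<close>
  define \<epsilon> where "\<epsilon> = min (\<eta> / ((R1 / \<delta>)\<^sup>2 + 1)) (\<eta> / (R1 / \<delta> + 1))"
  have R1: "R1 / \<delta> \<ge> 0" using \<delta> by (simp add: R1_def)
  have \<epsilon>: "\<epsilon> > 0" unfolding \<epsilon>_def using \<eta> R1 by (simp add: add_nonneg_pos)
  have \<epsilon>1: "\<epsilon> * (R1 / \<delta>)\<^sup>2 \<le> \<eta>"
  proof -
    have "\<epsilon> * (R1 / \<delta>)\<^sup>2 \<le> \<eta> / ((R1 / \<delta>)\<^sup>2 + 1) * ((R1 / \<delta>)\<^sup>2 + 1)"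
      by (intro mult_mono) (use \<eta> in \<open>auto simp: \<epsilon>_def\<close>)
    also have "\<dots> = \<eta>" by (metis add_nonneg_pos less_irrefl nonzero_eq_divide_eq zero_le_power2 zero_less_one)
    finally show ?thesis .
  qed
  have \<epsilon>2: "\<epsilon> * (R1 / \<delta>) \<le> \<eta>"
  proof -
    have "\<epsilon> * (R1 / \<delta>) \<le> \<eta> / (R1 / \<delta> + 1) * (R1 / \<delta> + 1)"
      by (rule mult_mono) (use \<eta> R1 in \<open>auto simp: \<epsilon>_def\<close>)
    also have "\<dots> = \<eta>" using R1 by (metis add_nonneg_pos less_irrefl nonzero_eq_divide_eq zero_less_one)
    finally show ?thesis .
  qed
  \<comment> \<open>Large enough for \<epsilon> R^2 to outweigh the lower bound - M of A on the
    sphere. R grows as \<epsilon> shrinks, but the bound on the zero does not involve it.\<close>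
  define R where "R = sqrt (max M 0 / \<epsilon>) + 1"
  have R: "R > 0" unfolding R_def using \<epsilon> by (simp add: add_nonneg_pos)
  have RM: "M \<le> \<epsilon> * R\<^sup>2"
  proof -
    have "max M 0 / \<epsilon> = (sqrt (max M 0 / \<epsilon>))\<^sup>2" using \<epsilon> by simp
    also have "\<dots> \<le> R\<^sup>2" unfolding R_def using \<epsilon> by (intro power_mono) auto
    finally show ?thesis using \<epsilon> by (simp add: divide_le_eq mult.commute)
  qed
  define F where "F c i = A (W c) (e i) + \<epsilon> * c i" for c i
  have Fsum: "(\<Sum>i<n. F c i * c i) = A (W c) (W c) + \<epsilon> * (coord_norm n c)\<^sup>2" for c
    unfolding Wsum[OF AW[OF WX]] coord_norm_square sum_distrib_left sum.distrib[symmetric]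
    by (rule sum.cong) (auto simp: F_def algebra_simps power2_eq_square)
  have "\<exists>c\<in>coord_ball n R. \<forall>i<n. F c i = 0"
  proof (rule exists_zero_coord_ball[OF R])
    fix c :: "nat \<Rightarrow> nat \<Rightarrow> real" and c0 i assume lim: "\<And>j. j < n \<Longrightarrow> (\<lambda>k. c k j) \<longlonglongrightarrow> c0 j" and i: "i < n"
    show "(\<lambda>k. F (c k) i) \<longlonglongrightarrow> F c0 i"
      unfolding F_def by (intro tendsto_add tendsto_mult_left lim i cont[OF WX WX Wtend e])
  next
    fix c assume "coord_norm n c = R"
    then show "0 \<le> (\<Sum>i<n. F c i * c i)" unfolding Fsum using lower[OF WX[of c]] RM by simp
  qed
  then obtain c where c: "\<And>i. i < n \<Longrightarrow> F c i = 0" by blast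
  have Ae: "A (W c) (e i) = - \<epsilon> * c i" if "i < n" for i using c[OF that] by (simp add: F_def)
  have "(\<Sum>i<n. F c i * c i) = 0" using c by simp
  then have AWW: "A (W c) (W c) = - \<epsilon> * (coord_norm n c)\<^sup>2" unfolding Fsum by simp
  then have "A (W c) (W c) \<le> 0" using \<epsilon> by simp
  then have gW: "gnorm (W c) \<le> R0" by (rule coercive[OF WX])
  \<comment> \<open>The bounded functional A (W c) vanishes at W k for every k in the kernel, and A
    (W c) (e i) = - \<epsilon> c i turns this into orthogonality.\<close>
  have "orth c" unfolding orth_def
  proof (intro allI impI)
    fix k assume k: "N k = 0"
    have "\<bar>A (W c) (W k)\<bar> \<le> Wm1_norm \<Omega> p (A (W c)) * N k" unfolding N_def by (rule dual_norm_bound[OF AW[OF WX] WX])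
    then have "0 = A (W c) (W k)" using k by simp
    also have "\<dots> = (\<Sum>i<n. k i * A (W c) (e i))" by (rule Wsum[OF AW[OF WX]])
    also have "\<dots> = (\<Sum>i<n. - \<epsilon> * (k i * c i))" by (rule sum.cong) (auto simp: Ae)
    also have "\<dots> = - \<epsilon> * (\<Sum>i<n. k i * c i)" by (simp only: sum_distrib_left)
    finally show "(\<Sum>i<n. k i * c i) = 0" using \<epsilon> by simp
  qed
  then have "\<delta> * coord_norm n c \<le> R1" using \<delta>(2)[of c] gW by (simp add: N_def R1_def)
  then have cn: "coord_norm n c \<le> R1 / \<delta>" using \<delta>(1) by (simp add: le_divide_eq mult.commute)
  have "\<bar>A (W c) (W c)\<bar> = \<epsilon> * (coord_norm n c)\<^sup>2" unfolding AWW using \<epsilon> by simp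
  also have "\<dots> \<le> \<epsilon> * (R1 / \<delta>)\<^sup>2" using cn \<epsilon> by (intro mult_left_mono power_mono) auto
  finally have 1: "\<bar>A (W c) (W c)\<bar> \<le> \<eta>" using \<epsilon>1 by simp
  have 2: "\<bar>A (W c) (e j)\<bar> \<le> \<eta>" if "j < n" for j
  proof -
    have "\<bar>A (W c) (e j)\<bar> = \<epsilon> * \<bar>c j\<bar>" unfolding Ae[OF that] using \<epsilon> by (simp add: abs_mult)
    also have "\<dots> \<le> \<epsilon> * (R1 / \<delta>)" using coord_le_norm[OF that, of c] cn \<epsilon> by (intro mult_left_mono) auto
    finally show ?thesis using \<epsilon>2 by simp
  qed
  show ?thesis using WX gW 1 2 by blast
qed

end

section \<open>The nonlinear operator\<close>

lemma LIMSEQ_subsequence_principle: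
  fixes a :: "nat \<Rightarrow> 'a::metric_space"
  assumes "\<And>\<rho>. strict_mono (\<rho> :: nat \<Rightarrow> nat) \<Longrightarrow> \<exists>s. strict_mono (s :: nat \<Rightarrow> nat) \<and> (\<lambda>k. a (\<rho> (s k))) \<longlonglongrightarrow> l"
  shows "a \<longlonglongrightarrow> l"
proof (rule ccontr)
  assume "\<not> a \<longlonglongrightarrow> l"
  then obtain \<epsilon> where \<epsilon>: "\<epsilon> > 0" "\<not> eventually (\<lambda>n. dist (a n) l < \<epsilon>) sequentially"
    unfolding tendsto_iff by blast
  define I where "I = {n. \<not> dist (a n) l < \<epsilon>}"
  have "infinite I" using \<epsilon>(2) unfolding I_def eventually_sequentially infinite_nat_iff_unbounded_le by auto
  then obtain \<rho> :: "nat \<Rightarrow> nat" where \<rho>: "strict_mono \<rho>" "\<And>n. \<rho> n \<in> I" using infinite_enumerate by blast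
  obtain s :: "nat \<Rightarrow> nat" where s: "(\<lambda>k. a (\<rho> (s k))) \<longlonglongrightarrow> l" using assms[OF \<rho>(1)] by blast
  from s \<epsilon>(1) have "eventually (\<lambda>k. dist (a (\<rho> (s k))) l < \<epsilon>) sequentially" by (rule tendstoD)
  then obtain k where "dist (a (\<rho> (s k))) l < \<epsilon>" by (auto simp: eventually_sequentially)
  then show False using \<rho>(2)[of "s k"] by (simp add: I_def)
qed

text \<open>Simple functions approximating the pair (u, v) reduce the claim to finitely many frozen
  arguments. Continuity of f passes to the limit at almost every x, and completeness of the measure
  deals with the remaining points.\<close>

lemma caratheodory_measurable:
  fixes f :: "'a::euclidean_space \<Rightarrow> real \<Rightarrow> 'a \<Rightarrow> real"
  assumes \<Omega>: "\<Omega> \<in> sets lebesgue" and f: "caratheodory \<Omega> f"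
    and u: "u \<in> borel_measurable (lebesgue_on \<Omega>)" and v: "v \<in> borel_measurable (lebesgue_on \<Omega>)"
  shows "(\<lambda>x. f x (u x) (v x)) \<in> borel_measurable (lebesgue_on \<Omega>)"
proof -
  let ?M = "lebesgue_on \<Omega>"
  interpret complete_measure ?M by (rule complete_measure_lebesgue_on[OF \<Omega>])
  have "(\<lambda>x. (u x, v x)) \<in> borel_measurable ?M" using u v by (rule borel_measurable_Pair)
  then obtain s where s: "\<And>i. simple_function ?M (s i)" "\<And>x. x \<in> space ?M \<Longrightarrow> (\<lambda>i. s i x) \<longlonglongrightarrow> (u x, v x)"
    using borel_measurable_implies_sequence_metric[of "\<lambda>x. (u x, v x)" ?M undefined] by metis
  have m: "(\<lambda>x. f x (fst (s i x)) (snd (s i x))) \<in> borel_measurable ?M" for i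
  proof -
    have fin: "finite (s i ` space ?M)" using s(1) by (simp add: simple_function_def)
    have "(\<lambda>x. \<Sum>y\<in>s i ` space ?M. indicator (s i -` {y} \<inter> space ?M) x * f x (fst y) (snd y)) \<in> borel_measurable ?M"
    proof (intro borel_measurable_sum borel_measurable_times borel_measurable_indicator)
      fix y assume "y \<in> s i ` space ?M"
      then show "s i -` {y} \<inter> space ?M \<in> sets ?M" using s(1)[of i] unfolding simple_function_def by blast
      show "(\<lambda>x. f x (fst y) (snd y)) \<in> borel_measurable ?M" using f by (simp add: caratheodory_def)
    qed
    moreover have "(\<Sum>y\<in>s i ` space ?M. indicator (s i -` {y} \<inter> space ?M) x * f x (fst y) (snd y)) = f x (fst (s i x)) (snd (s i x))"
      if x: "x \<in> space ?M" for x
    proof -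
      have "(\<Sum>y\<in>s i ` space ?M. indicator (s i -` {y} \<inter> space ?M) x * f x (fst y) (snd y)) =
        (\<Sum>y\<in>s i ` space ?M. if y = s i x then f x (fst y) (snd y) else 0)"
        by (rule sum.cong) (use x in \<open>auto simp: indicator_def\<close>)
      also have "\<dots> = f x (fst (s i x)) (snd (s i x))" using fin x by (subst sum.delta) auto
      finally show ?thesis .
    qed
    ultimately show ?thesis by (subst measurable_cong[symmetric]) auto
  qed
  define g where "g x = lim (\<lambda>i. f x (fst (s i x)) (snd (s i x)))" for x
  have gm: "g \<in> borel_measurable ?M" unfolding g_def by (rule borel_measurable_lim_metric[OF m])
  have "AE x in ?M. x \<in> space ?M" by (rule AE_space)
  moreover have "AE x in ?M. continuous_on UNIV (\<lambda>(s, \<xi>). f x s \<xi>)" using f by (simp add: caratheodory_def)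
  ultimately have "AE x in ?M. g x = f x (u x) (v x)"
  proof eventually_elim
    case (elim x)
    then have "isCont (\<lambda>(s, \<xi>). f x s \<xi>) (u x, v x)" by (simp add: continuous_on_eq_continuous_at)
    from isCont_tendsto_compose[OF this s(2)[OF elim(1)]]
    have "(\<lambda>i. f x (fst (s i x)) (snd (s i x))) \<longlonglongrightarrow> f x (u x) (v x)" by (simp add: case_prod_unfold)
    then show ?case unfolding g_def by (rule limI)
  qed
  then show ?thesis by (rule borel_measurable_cong_AE[OF gm])
qed

text \<open>R is the point where s^(q-p) equals \<epsilon>: beyond it the quotient of the powers is
  at most \<epsilon>, before it the left side is bounded.\<close>

lemma powr_le_small_powr:
  fixes q p \<epsilon> :: real
  assumes "0 < q" "q < p" "\<epsilon> > 0"
  shows "\<exists>C\<ge>0. \<forall>s\<ge>0. s powr q \<le> \<epsilon> * s powr p + C"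
proof -
  define R where "R = \<epsilon> powr (1 / (q - p))"
  have R: "R > 0" "R powr (q - p) = \<epsilon>" unfolding R_def using assms by (auto simp: powr_powr)
  have "s powr q \<le> \<epsilon> * s powr p + R powr q" if s: "s \<ge> 0" for s
  proof (cases "s \<le> R")
    case True
    then have "s powr q \<le> R powr q" using s assms by (intro powr_mono2) auto
    then show ?thesis using assms by (simp add: add_increasing)
  next
    case False
    have "s powr q = s powr (q - p) * s powr p" by (simp flip: powr_add)
    also have "\<dots> \<le> \<epsilon> * s powr p" unfolding R(2)[symmetric]
      using False R assms by (intro mult_right_mono powr_mono2') auto
    finally show ?thesis by (simp add: add_increasing2)
  qed
  then show ?thesis by (intro exI[of _ "R powr q"]) auto
qed

lemma conjugate_antimono:
  fixes a b :: real
  assumes "1 < a" "a \<le> b"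
  shows "b / (b - 1) \<le> a / (a - 1)"
  using assms by (simp add: field_simps)

locale quasilinear_problem = sobolev_embedding \<Omega> p pstar S
  for \<Omega> :: "'a::euclidean_space set" and p pstar :: real and S :: "real \<Rightarrow> real" +
  fixes q a1 a2 \<alpha> \<beta> r K1 K2 K3 :: real
    and T :: "('a \<Rightarrow> real) \<Rightarrow> 'a \<Rightarrow> real" and f :: "'a \<Rightarrow> real \<Rightarrow> 'a \<Rightarrow> real" and u0 \<sigma> :: "'a \<Rightarrow> real"
  assumes exps: "1 < q" "q < p"
    and T: "continuous_map_nrm (W01p \<Omega> p) (W01p_norm \<Omega> p) (W1p \<Omega> p) (W1p_norm \<Omega> p) T"
    and f: "caratheodory \<Omega> f"
    and u0: "u0 \<in> W1p \<Omega> p"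
    and a: "0 \<le> a1" "0 \<le> a2"
    and \<alpha>: "0 < \<alpha>" "\<alpha> < pstar - 1"
    and \<beta>: "0 < \<beta>" "\<beta> < p / conj_exp pstar"
    and r: "1 \<le> r" "r < pstar"
    and \<sigma>: "if r = 1 then \<sigma> \<in> Linf \<Omega> else \<sigma> \<in> Lp \<Omega> (conj_exp r)"
    and growth: "AE x in lebesgue_on \<Omega>. \<forall>s \<xi>.
          \<bar>f x s \<xi>\<bar> \<le> \<sigma> x + a1 * \<bar>s\<bar> powr \<alpha> + a2 * norm \<xi> powr \<beta>"
    and K: "0 \<le> K1" "0 \<le> K2" "0 \<le> K3"
    and small: "a1 * K1 * S (pstar / (pstar - \<alpha>)) + a2 * K2 * S (p / (p - \<beta>)) < 1"
    and T_bound: "\<And>u. u \<in> W01p \<Omega> p \<Longrightarrow>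
          enn_powr (eLp_norm \<Omega> pstar (T u)) \<alpha>
            \<le> ennreal (K1 * Lp_norm \<Omega> p (weak_grad \<Omega> u) powr (p - 1) + K3)"
    and grad_T_bound: "\<And>u. u \<in> W01p \<Omega> p \<Longrightarrow>
          Lp_norm \<Omega> p (weak_grad \<Omega> (T u)) powr \<beta>
            \<le> K2 * Lp_norm \<Omega> p (weak_grad \<Omega> u) powr (p - 1) + K3"
begin

text \<open>The conjugates of \<open>pstar / \<alpha>\<close> and \<open>p / \<beta>\<close>, the
  exponents in which |T w|^\<alpha> and |D (T w)|^\<beta> are controlled; they are the indices of S
  in the smallness condition. Their maximum with r is still below \<open>pstar\<close> and serves
  all three growth terms.\<close>

definition t1 :: real where "t1 = pstar / (pstar - \<alpha>)"
definition t2 :: real where "t2 = p / (p - \<beta>)"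
definition t :: real where "t = max r (max t1 t2)"

abbreviation "tc \<equiv> t / (t - 1)"

lemma pstar_gt_1: "1 < pstar"
  using p_gt_1 p_less_pstar by simp

text \<open>The second inequality is the hypothesis on \<beta> with the conjugate of
  \<open>pstar\<close> written out; it places \<open>t2\<close> below \<open>pstar\<close>.\<close>

lemma beta_less_p: "\<beta> < p" "p - \<beta> > p / pstar"
proof -
  have "p / conj_exp pstar = p - p / pstar" using pstar_gt_1 by (simp add: conj_exp_def field_simps)
  then show "p - \<beta> > p / pstar" using \<beta> by simp
  moreover have "p / pstar > 0" using p_gt_1 pstar_gt_1 by simp
  ultimately show "\<beta> < p" by simp
qed

lemma t1: "1 < t1" "t1 < pstar" "1 / (pstar / \<alpha>) + 1 / t1 = 1" "1 < pstar / \<alpha>"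
proof -
  have d: "pstar - \<alpha> > 1" using \<alpha> by simp
  show "1 < t1" using d \<alpha> by (simp add: t1_def)
  show "t1 < pstar" using d pstar_gt_1 by (simp add: t1_def divide_less_eq)
  show "1 / (pstar / \<alpha>) + 1 / t1 = 1" using d \<alpha> pstar_gt_1 by (simp add: t1_def field_simps)
  show "1 < pstar / \<alpha>" using d \<alpha> by simp
qed

lemma t2: "1 < t2" "t2 < pstar" "1 / (p / \<beta>) + 1 / t2 = 1" "1 < p / \<beta>"
proof -
  have d: "p - \<beta> > 0" using beta_less_p by simp
  show "1 < t2" using d \<beta> by (simp add: t2_def)
  have "p < pstar * (p - \<beta>)" using beta_less_p(2) pstar_gt_1 by (simp add: divide_less_eq mult.commute)
  then show "t2 < pstar" using d by (simp add: t2_def divide_less_eq)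
  show "1 / (p / \<beta>) + 1 / t2 = 1" using d \<beta> p_gt_1 by (simp add: t2_def field_simps)
  show "1 < p / \<beta>" using beta_less_p \<beta> by simp
qed

lemma t: "1 < t" "t < pstar" "1 / tc + 1 / t = 1" "1 / t + 1 / tc = 1" "1 < tc" "r \<le> t" "tc \<le> pstar / \<alpha>" "tc \<le> p / \<beta>"
proof -
  show 1: "1 < t" "t < pstar" "r \<le> t" using t1 t2 r by (auto simp: t_def)
  show 2: "1 / tc + 1 / t = 1" "1 / t + 1 / tc = 1" "1 < tc" using 1 by (auto simp: field_simps)
  have le: "t1 \<le> t" "t2 \<le> t" by (simp_all add: t_def)
  have "t1 / (t1 - 1) = pstar / \<alpha>" using conjugate_exponents(1)[of t1 "pstar / \<alpha>"] t1 by (simp add: add.commute)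
  then show "tc \<le> pstar / \<alpha>" using conjugate_antimono[OF t1(1) le(1)] by simp
  have "t2 / (t2 - 1) = p / \<beta>" using conjugate_exponents(1)[of t2 "p / \<beta>"] t2 by (simp add: add.commute)
  then show "tc \<le> p / \<beta>" using conjugate_antimono[OF t2(1) le(2)] by simp
qed

text \<open>From r \<le> t the conjugate exponents are ordered the other way, and \<Omega> has
  finite measure; r = 1 is the case of a bounded \<sigma>.\<close>

lemma sigma_Lfun: "\<sigma> \<in> Lfun \<mu> tc"
proof (cases "r = 1")
  case True
  then obtain C where C: "\<sigma> \<in> borel_measurable \<mu>" "AE x in \<mu>. norm (\<sigma> x) \<le> C" using \<sigma> by (auto simp: Linf_def)
  have "AE x in \<mu>. norm (\<sigma> x) powr tc \<le> C powr tc" using C(2) by eventually_elim (use t in \<open>auto intro: powr_mono2\<close>)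
  then show ?thesis by (intro Lfun_bound(1)[OF C(1)]) auto
next
  case False
  then have "\<sigma> \<in> Lfun \<mu> (r / (r - 1))" using \<sigma> by (simp add: Lp_eq_Lfun conj_exp_def)
  then show ?thesis by (rule Lfun_mono_exponent(1)) (use conjugate_antimono[of r t] t r False in auto)
qed

section \<open>Integrability and growth of the right-hand side\<close>

lemma T_W1p: "w \<in> X \<Longrightarrow> T w \<in> W1p \<Omega> p"
  using T by (simp add: continuous_map_nrm_def)

lemma Lp_norm_D: "w \<in> X \<Longrightarrow> Lp_norm \<Omega> p (weak_grad \<Omega> w) = gnorm w"
  by (simp add: Lp_norm_eq[OF D_Lfun] gnorm_def)

text \<open>\<open>enn_powr\<close> keeps infinity infinite, so the finite right-hand side of the
  bound forces T w into L^pstar.\<close>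

lemma T_Lfun:
  assumes w: "w \<in> X"
  shows "T w \<in> Lfun \<mu> pstar" "(pint \<mu> pstar (T w) powr (1/pstar)) powr \<alpha> \<le> K1 * gnorm w powr (p - 1) + K3"
proof -
  have m: "T w \<in> borel_measurable \<mu>" by (rule Lfun_measurable[OF W1pD(1)[OF T_W1p[OF w]]])
  have b: "enn_powr (eLp_norm \<Omega> pstar (T w)) \<alpha> \<le> ennreal (K1 * gnorm w powr (p - 1) + K3)"
    using T_bound[OF w] by (simp add: Lp_norm_D[OF w])
  show L: "T w \<in> Lfun \<mu> pstar"
  proof (rule ccontr)
    assume "T w \<notin> Lfun \<mu> pstar"
    then show False using b not_Lfun_eLp_norm[OF m] by (simp add: enn_powr_def top_unique)
  qed
  have "0 \<le> K1 * gnorm w powr (p - 1) + K3" using K by simp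
  then show "(pint \<mu> pstar (T w) powr (1/pstar)) powr \<alpha> \<le> K1 * gnorm w powr (p - 1) + K3"
    using b by (simp add: Lfun_eLp_norm[OF L] enn_powr_def)
qed

lemma DT_bound:
  assumes w: "w \<in> X"
  shows "D (T w) \<in> Lfun \<mu> p" "(pint \<mu> p (D (T w)) powr (1/p)) powr \<beta> \<le> K2 * gnorm w powr (p - 1) + K3"
proof -
  show L: "D (T w) \<in> Lfun \<mu> p" by (rule W1pD(2)[OF T_W1p[OF w]])
  show "(pint \<mu> p (D (T w)) powr (1/p)) powr \<beta> \<le> K2 * gnorm w powr (p - 1) + K3"
    using grad_T_bound[OF w] by (simp add: Lp_norm_D[OF w] Lp_norm_eq[OF L])
qed

definition h :: "('a \<Rightarrow> real) \<Rightarrow> 'a \<Rightarrow> real" where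
  "h w x = f x (T w x) (D (T w) x)"

definition s1 :: "('a \<Rightarrow> real) \<Rightarrow> 'a \<Rightarrow> real" where "s1 w x = \<bar>T w x\<bar> powr \<alpha>"
definition s2 :: "('a \<Rightarrow> real) \<Rightarrow> 'a \<Rightarrow> real" where "s2 w x = norm (D (T w) x) powr \<beta>"

lemma s1_Lfun:
  assumes w: "w \<in> X"
  shows "s1 w \<in> Lfun \<mu> (pstar / \<alpha>)" "pint \<mu> (pstar / \<alpha>) (s1 w) = pint \<mu> pstar (T w)"
    "pint \<mu> (pstar / \<alpha>) (s1 w) powr (1 / (pstar / \<alpha>)) \<le> K1 * gnorm w powr (p - 1) + K3"
proof -
  note TL = T_Lfun(1)[OF w]
  have e: "norm (s1 w x) powr (pstar / \<alpha>) = norm (T w x) powr pstar" for x using \<alpha> by (simp add: s1_def powr_powr)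
  have "s1 w \<in> borel_measurable \<mu>" unfolding s1_def using Lfun_measurable[OF TL] by simp
  then show "s1 w \<in> Lfun \<mu> (pstar / \<alpha>)" using TL unfolding Lfun_def mem_Collect_eq e by blast
  show 2: "pint \<mu> (pstar / \<alpha>) (s1 w) = pint \<mu> pstar (T w)" unfolding pint_def e by (rule refl)
  show "pint \<mu> (pstar / \<alpha>) (s1 w) powr (1 / (pstar / \<alpha>)) \<le> K1 * gnorm w powr (p - 1) + K3"
    using T_Lfun(2)[OF w] unfolding 2 by (simp add: powr_powr)
qed

lemma s2_Lfun:
  assumes w: "w \<in> X"
  shows "s2 w \<in> Lfun \<mu> (p / \<beta>)" "pint \<mu> (p / \<beta>) (s2 w) = pint \<mu> p (D (T w))"
    "pint \<mu> (p / \<beta>) (s2 w) powr (1 / (p / \<beta>)) \<le> K2 * gnorm w powr (p - 1) + K3"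
proof -
  note DL = DT_bound(1)[OF w]
  have e: "norm (s2 w x) powr (p / \<beta>) = norm (D (T w) x) powr p" for x using \<beta> by (simp add: s2_def powr_powr)
  have "s2 w \<in> borel_measurable \<mu>" unfolding s2_def using Lfun_measurable[OF DL] by simp
  then show "s2 w \<in> Lfun \<mu> (p / \<beta>)" using DL unfolding Lfun_def mem_Collect_eq e by blast
  show 2: "pint \<mu> (p / \<beta>) (s2 w) = pint \<mu> p (D (T w))" unfolding pint_def e by (rule refl)
  show "pint \<mu> (p / \<beta>) (s2 w) powr (1 / (p / \<beta>)) \<le> K2 * gnorm w powr (p - 1) + K3"
    using DT_bound(2)[OF w] unfolding 2 by (simp add: powr_powr)
qed

lemma h_measurable: "w \<in> X \<Longrightarrow> h w \<in> borel_measurable \<mu>"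
  unfolding h_def
  by (rule caratheodory_measurable[OF domain_sets f Lfun_measurable[OF T_Lfun(1)] Lfun_measurable[OF DT_bound(1)]])

lemma h_growth: "AE x in \<mu>. \<bar>h w x\<bar> \<le> \<bar>\<sigma> x\<bar> + a1 * s1 w x + a2 * s2 w x"
  using growth
proof eventually_elim
  case (elim x)
  then have "\<bar>h w x\<bar> \<le> \<sigma> x + a1 * s1 w x + a2 * s2 w x" by (simp add: h_def s1_def s2_def)
  then show ?case using abs_ge_self[of "\<sigma> x"] by linarith
qed

lemma powr_bound_of_root:
  fixes A B e :: real
  assumes "A \<ge> 0" "e > 0" "A powr (1/e) \<le> B"
  shows "A \<le> B powr e"
proof -
  have "(A powr (1/e)) powr e \<le> B powr e" using assms by (intro powr_mono2) auto
  then show ?thesis using assms by (simp add: powr_powr)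
qed

text \<open>The explicit bound matters only through its monotone dependence on
  \<open>gnorm w\<close>, which gives boundedness on balls.\<close>

lemma h_Lfun:
  assumes w: "w \<in> X"
  shows "h w \<in> Lfun \<mu> tc"
    "pint \<mu> tc (h w) \<le> 2 powr tc * (2 powr tc * (pint \<mu> tc \<sigma> + a1 powr tc * (measure \<mu> (space \<mu>) + (K1 * gnorm w powr (p - 1) + K3) powr (pstar / \<alpha>)))
       + a2 powr tc * (measure \<mu> (space \<mu>) + (K2 * gnorm w powr (p - 1) + K3) powr (p / \<beta>)))"
proof -
  define m where "m = measure \<mu> (space \<mu>)"
  have tc0: "0 < tc" using t by simp
  note L1 = Lfun_mono_exponent[OF s1_Lfun(1)[OF w] less_imp_le[OF tc0] t(7)]
  note L2 = Lfun_mono_exponent[OF s2_Lfun(1)[OF w] less_imp_le[OF tc0] t(8)]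
  have b1: "pint \<mu> tc (s1 w) \<le> m + (K1 * gnorm w powr (p - 1) + K3) powr (pstar / \<alpha>)"
    using L1(2) powr_bound_of_root[OF pint_nonneg _ s1_Lfun(3)[OF w]] \<alpha> pstar_gt_1 by (simp add: m_def)
  have b2: "pint \<mu> tc (s2 w) \<le> m + (K2 * gnorm w powr (p - 1) + K3) powr (p / \<beta>)"
    using L2(2) powr_bound_of_root[OF pint_nonneg _ s2_Lfun(3)[OF w]] \<beta> p_gt_1 by (simp add: m_def)
  note N = Lfun_norm[OF sigma_Lfun]
  note A1 = Lfun_scaleR[OF L1(1), of a1] and A2 = Lfun_scaleR[OF L2(1), of a2]
  note B1 = Lfun_add[OF N A1(1) tc0]
  note B2 = Lfun_add[OF B1(1) A2(1) tc0]
  define G where "G x = norm (\<sigma> x) + a1 *\<^sub>R s1 w x + a2 *\<^sub>R s2 w x" for x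
  have GL: "G \<in> Lfun \<mu> tc" unfolding G_def by (rule B2(1))
  have "pint \<mu> tc G \<le> 2 powr tc * (pint \<mu> tc (\<lambda>x. norm (\<sigma> x) + a1 *\<^sub>R s1 w x) + a2 powr tc * pint \<mu> tc (s2 w))"
    unfolding G_def using B2(2) A2(2) a by simp
  also have "\<dots> \<le> 2 powr tc * (2 powr tc * (pint \<mu> tc \<sigma> + a1 powr tc * pint \<mu> tc (s1 w)) + a2 powr tc * pint \<mu> tc (s2 w))"
    using B1(2) A1(2) a pint_norm[of \<mu> tc \<sigma>] by (intro mult_left_mono add_right_mono) simp_all
  also have "\<dots> \<le> 2 powr tc * (2 powr tc * (pint \<mu> tc \<sigma> + a1 powr tc * (m + (K1 * gnorm w powr (p - 1) + K3) powr (pstar / \<alpha>)))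
       + a2 powr tc * (m + (K2 * gnorm w powr (p - 1) + K3) powr (p / \<beta>)))"
    by (intro mult_left_mono add_mono b1 b2) auto
  finally have Gb: "pint \<mu> tc G \<le> 2 powr tc * (2 powr tc * (pint \<mu> tc \<sigma> + a1 powr tc * (m + (K1 * gnorm w powr (p - 1) + K3) powr (pstar / \<alpha>)))
       + a2 powr tc * (m + (K2 * gnorm w powr (p - 1) + K3) powr (p / \<beta>)))" .
  have ae: "AE x in \<mu>. norm (h w x) powr tc \<le> norm (G x) powr tc"
    using h_growth[of w]
  proof eventually_elim
    case (elim x)
    then have "norm (h w x) \<le> norm (G x)" by (simp add: G_def)
    then show ?case using tc0 by (intro powr_mono2) auto
  qed
  note H = Lfun_bound[OF h_measurable[OF w] Lfun_integrable[OF GL] ae]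
  show "h w \<in> Lfun \<mu> tc" by (rule H)
  have "pint \<mu> tc (h w) \<le> pint \<mu> tc G" using H(2) by (simp add: pint_def)
  then show "pint \<mu> tc (h w) \<le> 2 powr tc * (2 powr tc * (pint \<mu> tc \<sigma> + a1 powr tc * (measure \<mu> (space \<mu>) + (K1 * gnorm w powr (p - 1) + K3) powr (pstar / \<alpha>)))
       + a2 powr tc * (measure \<mu> (space \<mu>) + (K2 * gnorm w powr (p - 1) + K3) powr (p / \<beta>)))"
    using Gb by (simp add: m_def)
qed

lemma h_bounded: "\<exists>B. \<forall>w\<in>X. gnorm w \<le> R \<longrightarrow> pint \<mu> tc (h w) \<le> B"
proof (intro exI ballI impI)
  fix w assume w: "w \<in> X" "gnorm w \<le> R"
  have g: "gnorm w powr (p - 1) \<le> R powr (p - 1)" using w p_gt_1 by (intro powr_mono2) auto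
  have "K1 * gnorm w powr (p - 1) + K3 \<le> K1 * R powr (p - 1) + K3" "K2 * gnorm w powr (p - 1) + K3 \<le> K2 * R powr (p - 1) + K3"
    using g K by (auto intro: mult_left_mono)
  then have "(K1 * gnorm w powr (p - 1) + K3) powr (pstar / \<alpha>) \<le> (K1 * R powr (p - 1) + K3) powr (pstar / \<alpha>)"
    "(K2 * gnorm w powr (p - 1) + K3) powr (p / \<beta>) \<le> (K2 * R powr (p - 1) + K3) powr (p / \<beta>)"
    using K t1(4) t2(4) by (auto intro!: powr_mono2)
  then have "2 powr tc * (2 powr tc * (pint \<mu> tc \<sigma> + a1 powr tc * (measure \<mu> (space \<mu>) + (K1 * gnorm w powr (p - 1) + K3) powr (pstar / \<alpha>)))
       + a2 powr tc * (measure \<mu> (space \<mu>) + (K2 * gnorm w powr (p - 1) + K3) powr (p / \<beta>)))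
     \<le> 2 powr tc * (2 powr tc * (pint \<mu> tc \<sigma> + a1 powr tc * (measure \<mu> (space \<mu>) + (K1 * R powr (p - 1) + K3) powr (pstar / \<alpha>)))
       + a2 powr tc * (measure \<mu> (space \<mu>) + (K2 * R powr (p - 1) + K3) powr (p / \<beta>)))"
    by (intro mult_left_mono add_mono order_refl) auto
  then show "pint \<mu> tc (h w) \<le> 2 powr tc * (2 powr tc * (pint \<mu> tc \<sigma> + a1 powr tc * (measure \<mu> (space \<mu>) + (K1 * R powr (p - 1) + K3) powr (pstar / \<alpha>)))
       + a2 powr tc * (measure \<mu> (space \<mu>) + (K2 * R powr (p - 1) + K3) powr (p / \<beta>)))"
    using h_Lfun(2)[OF w(1)] by linarith
qed

lemma tle: "t \<le> pstar" "t1 \<le> pstar" "t2 \<le> pstar"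
  using t t1 t2 by auto

text \<open>\<sigma> is paired in L^t, but each growth term is paired with w in its own exponent
  \<open>t1\<close> or \<open>t2\<close>: this produces the very constants S t1 and S t2 of the
  smallness condition. The power p - 1 in the bounds on T, times the norm of w, is the power
  p.\<close>

lemma h_pairing:
  assumes w: "w \<in> X"
  shows "fun_functional \<Omega> (h w) w \<le> (a1 * K1 * S t1 + a2 * K2 * S t2) * gnorm w powr p
     + (pint \<mu> tc \<sigma> powr (1/tc) * S t + a1 * K3 * S t1 + a2 * K3 * S t2) * gnorm w"
proof -
  note es = embedding_Lfun[OF w less_imp_le[OF t(1)] tle(1)]
    and e1 = embedding_Lfun[OF w less_imp_le[OF t1(1)] tle(2)]
    and e2 = embedding_Lfun[OF w less_imp_le[OF t2(1)] tle(3)]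
  note Hs = holder[OF t(3) t(5) sigma_Lfun es(1)]
    and H1 = holder[OF t1(3) t1(4) s1_Lfun(1)[OF w] e1(1)]
    and H2 = holder[OF t2(3) t2(4) s2_Lfun(1)[OF w] e2(1)]
  have nn: "s1 w x \<ge> 0" "s2 w x \<ge> 0" for x by (simp_all add: s1_def s2_def)
  have i: "integrable \<mu> (\<lambda>x. \<bar>\<sigma> x\<bar> * \<bar>w x\<bar>)" "integrable \<mu> (\<lambda>x. s1 w x * \<bar>w x\<bar>)" "integrable \<mu> (\<lambda>x. s2 w x * \<bar>w x\<bar>)"
    using Hs(1) H1(1) H2(1) nn by simp_all
  have "fun_functional \<Omega> (h w) w \<le> (LINT x|\<mu>. \<bar>\<sigma> x\<bar> * \<bar>w x\<bar> + a1 * (s1 w x * \<bar>w x\<bar>) + a2 * (s2 w x * \<bar>w x\<bar>))"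
    unfolding fun_functional_def
  proof (rule integral_mono_AE)
    show "integrable \<mu> (\<lambda>x. h w x * w x)" by (rule fun_functional_bound(1)[OF t(3) t(5) tle(1) h_Lfun(1)[OF w] w])
    show "AE x in \<mu>. h w x * w x \<le> \<bar>\<sigma> x\<bar> * \<bar>w x\<bar> + a1 * (s1 w x * \<bar>w x\<bar>) + a2 * (s2 w x * \<bar>w x\<bar>)"
      using h_growth[of w]
    proof eventually_elim
      case (elim x)
      have "h w x * w x \<le> \<bar>h w x\<bar> * \<bar>w x\<bar>" using abs_ge_self[of "h w x * w x"] by (simp add: abs_mult)
      also have "\<dots> \<le> (\<bar>\<sigma> x\<bar> + a1 * s1 w x + a2 * s2 w x) * \<bar>w x\<bar>" using elim by (intro mult_right_mono) auto
      finally show ?case by (simp add: algebra_simps)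
    qed
  qed (use i in auto)
  also have "\<dots> = (LINT x|\<mu>. \<bar>\<sigma> x\<bar> * \<bar>w x\<bar>) + a1 * (LINT x|\<mu>. s1 w x * \<bar>w x\<bar>) + a2 * (LINT x|\<mu>. s2 w x * \<bar>w x\<bar>)"
    using i by simp
  also have "\<dots> \<le> pint \<mu> tc \<sigma> powr (1/tc) * (S t * gnorm w) + a1 * ((K1 * gnorm w powr (p - 1) + K3) * (S t1 * gnorm w))
      + a2 * ((K2 * gnorm w powr (p - 1) + K3) * (S t2 * gnorm w))"
  proof (intro add_mono mult_left_mono a)
    show "(LINT x|\<mu>. \<bar>\<sigma> x\<bar> * \<bar>w x\<bar>) \<le> pint \<mu> tc \<sigma> powr (1/tc) * (S t * gnorm w)"
      using order_trans[OF Hs(2) mult_left_mono[OF es(2)]] by simp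
    show "(LINT x|\<mu>. s1 w x * \<bar>w x\<bar>) \<le> (K1 * gnorm w powr (p - 1) + K3) * (S t1 * gnorm w)"
      using order_trans[OF H1(2) mult_mono[OF s1_Lfun(3)[OF w] e1(2)]] K nn by simp
    show "(LINT x|\<mu>. s2 w x * \<bar>w x\<bar>) \<le> (K2 * gnorm w powr (p - 1) + K3) * (S t2 * gnorm w)"
      using order_trans[OF H2(2) mult_mono[OF s2_Lfun(3)[OF w] e2(2)]] K nn by simp
  qed
  also have "\<dots> = (a1 * K1 * S t1 + a2 * K2 * S t2) * (gnorm w powr (p - 1) * gnorm w)
     + (pint \<mu> tc \<sigma> powr (1/tc) * S t + a1 * K3 * S t1 + a2 * K3 * S t2) * gnorm w"
    by (simp add: algebra_simps)
  also have "gnorm w powr (p - 1) * gnorm w = gnorm w powr p"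
    using powr_add[of "gnorm w" "p - 1" 1] by (cases "gnorm w = 0") auto
  finally show ?thesis .
qed

section \<open>The operator: mapping properties, demicontinuity and coercivity\<close>

definition G :: "('a \<Rightarrow> real) \<Rightarrow> 'a \<Rightarrow> 'a" where "G w = D (\<lambda>y. w y + u0 y)"

definition A :: "('a \<Rightarrow> real) \<Rightarrow> ('a \<Rightarrow> real) \<Rightarrow> real" where
  "A w v = neg_div \<Omega> (\<lambda>x. flux p (G w x)) v - neg_div \<Omega> (\<lambda>x. flux q (G w x)) v - fun_functional \<Omega> (h w) v"

lemma G_Lfun:
  assumes w: "w \<in> X"
  shows "G w \<in> Lfun \<mu> p" "AE x in \<mu>. G w x = D w x + D u0 x"
    "pint \<mu> p (G w) \<le> 2 powr p * (gnorm w powr p + pint \<mu> p (D u0))"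
proof -
  note s = W1p_add[OF W01p_imp_W1p[OF w] u0]
  show 1: "G w \<in> Lfun \<mu> p" unfolding G_def by (rule W1pD(2)[OF s(1)])
  show 2: "AE x in \<mu>. G w x = D w x + D u0 x" unfolding G_def by (rule s(2))
  note L = Lfun_add[OF D_Lfun[OF w] W1pD(2)[OF u0] p_gt_0]
  have "pint \<mu> p (G w) = pint \<mu> p (\<lambda>x. D w x + D u0 x)"
    by (rule pint_cong_AE[OF Lfun_measurable[OF 1] Lfun_measurable[OF L(1)] 2])
  then show "pint \<mu> p (G w) \<le> 2 powr p * (gnorm w powr p + pint \<mu> p (D u0))" using L(2) by (simp add: gnorm_powr)
qed

lemma conj_q: "1/q + 1/(q/(q-1)) = 1" "p' \<le> q/(q-1)"
proof -
  show "1/q + 1/(q/(q-1)) = 1" using exps by (simp add: field_simps)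
  show "p' \<le> q/(q-1)" by (rule conjugate_antimono) (use exps in auto)
qed

text \<open>As q < p, the field G w is in L^q and its q-flux in L^(q'), which is contained in
  L^(p'). Each of the two changes of exponent adds the measure of \<Omega> once, whence the factor
  2.\<close>

lemma flux_G_Lfun:
  assumes w: "w \<in> X"
  shows "(\<lambda>x. flux p (G w x)) \<in> Lfun \<mu> p'" "pint \<mu> p' (\<lambda>x. flux p (G w x)) = pint \<mu> p (G w)"
    "(\<lambda>x. flux q (G w x)) \<in> Lfun \<mu> p'" "pint \<mu> p' (\<lambda>x. flux q (G w x)) \<le> 2 * measure \<mu> (space \<mu>) + pint \<mu> p (G w)"
proof -
  note g = G_Lfun(1)[OF w]
  show "(\<lambda>x. flux p (G w x)) \<in> Lfun \<mu> p'" "pint \<mu> p' (\<lambda>x. flux p (G w x)) = pint \<mu> p (G w)"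
    by (rule flux_Lfun[OF conj_p(1) p_gt_1 g])+
  have q0: "0 \<le> q" "q \<le> p" using exps by auto
  note gq = Lfun_mono_exponent[OF g q0]
  note fq = flux_Lfun[OF conj_q(1) exps(1) gq(1)]
  note L = Lfun_mono_exponent[OF fq(1) less_imp_le[OF conj_p(4)] conj_q(2)]
  show "(\<lambda>x. flux q (G w x)) \<in> Lfun \<mu> p'" by (rule L(1))
  show "pint \<mu> p' (\<lambda>x. flux q (G w x)) \<le> 2 * measure \<mu> (space \<mu>) + pint \<mu> p (G w)"
    using L(2) gq(2) unfolding fq(2) by linarith
qed

lemma h_Wm1: "w \<in> X \<Longrightarrow> fun_functional \<Omega> (h w) \<in> Wm1 \<Omega> p"
  by (rule fun_functional_Wm1[OF t(3) t(5) tle(1) h_Lfun(1)])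

lemma A_Wm1:
  assumes w: "w \<in> X"
  shows "A w \<in> Wm1 \<Omega> p"
proof -
  have "(\<lambda>v. neg_div \<Omega> (\<lambda>x. flux p (G w x)) v - neg_div \<Omega> (\<lambda>x. flux q (G w x)) v - fun_functional \<Omega> (h w) v) \<in> Wm1 \<Omega> p"
    by (rule Wm1_diff[OF Wm1_diff[OF neg_div_Wm1[OF flux_G_Lfun(1)[OF w]] neg_div_Wm1[OF flux_G_Lfun(3)[OF w]]] h_Wm1[OF w]])
  then show ?thesis by (simp add: A_def[abs_def])
qed

text \<open>One constant for all w in a ball: along the Galerkin sequence this allows an extension
  by density that is uniform in n.\<close>

lemma A_bounded: "\<exists>B\<ge>0. \<forall>w\<in>X. gnorm w \<le> R \<longrightarrow> (\<forall>v\<in>X. \<bar>A w v\<bar> \<le> B * gnorm v)"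
proof -
  obtain Bh where Bh: "\<And>w. w \<in> X \<Longrightarrow> gnorm w \<le> R \<Longrightarrow> pint \<mu> tc (h w) \<le> Bh" using h_bounded by blast
  define P where "P = 2 powr p * (R powr p + pint \<mu> p (D u0))"
  define m where "m = measure \<mu> (space \<mu>)"
  define B where "B = P powr (1/p') + (2 * m + P) powr (1/p') + Bh powr (1/tc) * S t"
  have St: "0 < S t" using S_pos t by simp
  have "\<bar>A w v\<bar> \<le> B * gnorm v" if w: "w \<in> X" "gnorm w \<le> R" and v: "v \<in> X" for w v
  proof -
    note fl = flux_G_Lfun[OF w(1)]
    have "gnorm w powr p \<le> R powr p" using w p_gt_1 by (intro powr_mono2) auto
    then have "2 powr p * (gnorm w powr p + pint \<mu> p (D u0)) \<le> P" unfolding P_def by (intro mult_left_mono add_right_mono) auto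
    then have gP: "pint \<mu> p (G w) \<le> P" using G_Lfun(3)[OF w(1)] by linarith
    have mono: "x powr (1/e) \<le> y powr (1/e)" if "0 \<le> x" "x \<le> y" "e > 0" for x y e :: real
      using that by (intro powr_mono2) auto
    have 1: "\<bar>neg_div \<Omega> (\<lambda>x. flux p (G w x)) v\<bar> \<le> P powr (1/p') * gnorm v"
      using order_trans[OF neg_div_bound(2)[OF fl(1) v] mult_right_mono[OF mono[OF pint_nonneg _ conj_p(4)] gnorm_nonneg]]
        fl(2) gP by simp
    have "pint \<mu> p' (\<lambda>x. flux q (G w x)) \<le> 2 * m + P" using fl(4) gP by (simp add: m_def)
    then have 2: "\<bar>neg_div \<Omega> (\<lambda>x. flux q (G w x)) v\<bar> \<le> (2 * m + P) powr (1/p') * gnorm v"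
      using order_trans[OF neg_div_bound(2)[OF fl(3) v] mult_right_mono[OF mono[OF pint_nonneg _ conj_p(4)] gnorm_nonneg]] by simp
    have "pint \<mu> tc (h w) powr (1/tc) \<le> Bh powr (1/tc)"
      by (rule mono[OF pint_nonneg Bh[OF w]]) (use t in simp)
    then have "pint \<mu> tc (h w) powr (1/tc) * (S t * gnorm v) \<le> Bh powr (1/tc) * (S t * gnorm v)"
      using St by (intro mult_right_mono) auto
    then have 3: "\<bar>fun_functional \<Omega> (h w) v\<bar> \<le> Bh powr (1/tc) * (S t * gnorm v)"
      by (rule order_trans[OF fun_functional_bound(2)[OF t(3) t(5) tle(1) h_Lfun(1)[OF w(1)] v]])
    have e: "\<bar>A w v\<bar> \<le> \<bar>neg_div \<Omega> (\<lambda>x. flux p (G w x)) v\<bar> + \<bar>neg_div \<Omega> (\<lambda>x. flux q (G w x)) v\<bar> + \<bar>fun_functional \<Omega> (h w) v\<bar>"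
      unfolding A_def by linarith
    have "B * gnorm v = P powr (1/p') * gnorm v + (2 * m + P) powr (1/p') * gnorm v + Bh powr (1/tc) * (S t * gnorm v)"
      unfolding B_def by (simp add: distrib_right)
    then show ?thesis using e 1 2 3 by linarith
  qed
  moreover have "B \<ge> 0" unfolding B_def using St by simp
  ultimately show ?thesis by blast
qed

lemma T_tendsto:
  assumes wk: "\<And>k. wk k \<in> X" and w: "w \<in> X" and lim: "(\<lambda>k. gnorm (\<lambda>x. wk k x - w x)) \<longlonglongrightarrow> 0"
  shows "(\<lambda>k. pint \<mu> p (\<lambda>x. T (wk k) x - T w x)) \<longlonglongrightarrow> 0"
    "(\<lambda>k. pint \<mu> p (\<lambda>x. D (T (wk k)) x - D (T w) x)) \<longlonglongrightarrow> 0"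
proof -
  have TW: "T (wk k) \<in> W1p \<Omega> p" "T w \<in> W1p \<Omega> p" for k using T_W1p wk w by auto
  have "(\<lambda>k. W1p_norm \<Omega> p (\<lambda>x. T (wk k) x - T w x)) \<longlonglongrightarrow> 0"
  proof (rule LIMSEQ_I)
    fix \<epsilon> :: real assume "\<epsilon> > 0"
    then obtain \<delta> where \<delta>: "\<delta> > 0" "\<And>v. v \<in> X \<Longrightarrow> W01p_norm \<Omega> p (\<lambda>x. v x - w x) < \<delta> \<Longrightarrow> W1p_norm \<Omega> p (\<lambda>x. T v x - T w x) < \<epsilon>"
      using T w unfolding continuous_map_nrm_def by blast
    have nn: "0 \<le> W1p_norm \<Omega> p g" for g :: "'a \<Rightarrow> real" by (simp add: W1p_norm_def Lp_norm_def)
    obtain N where N: "\<And>k. k \<ge> N \<Longrightarrow> norm (gnorm (\<lambda>x. wk k x - w x) - 0) < \<delta>" using LIMSEQ_D[OF lim \<delta>(1)] by blast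
    have "norm (W1p_norm \<Omega> p (\<lambda>x. T (wk k) x - T w x) - 0) < \<epsilon>" if "k \<ge> N" for k
      using \<delta>(2)[OF wk, of k] N[OF that] nn by (simp add: W01p_norm_gnorm[OF W01p_diff[OF wk w]])
    then show "\<exists>N. \<forall>k\<ge>N. norm (W1p_norm \<Omega> p (\<lambda>x. T (wk k) x - T w x) - 0) < \<epsilon>" by blast
  qed
  then have c: "(\<lambda>k. pint \<mu> p (\<lambda>x. T (wk k) x - T w x)) \<longlonglongrightarrow> 0" "(\<lambda>k. pint \<mu> p (D (\<lambda>x. T (wk k) x - T w x))) \<longlonglongrightarrow> 0"
    using W1p_norm_tendsto_0_iff[OF W1p_diff(1)[OF TW]] by auto
  show "(\<lambda>k. pint \<mu> p (\<lambda>x. T (wk k) x - T w x)) \<longlonglongrightarrow> 0" by (rule c(1))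
  have "pint \<mu> p (D (\<lambda>x. T (wk k) x - T w x)) = pint \<mu> p (\<lambda>x. D (T (wk k)) x - D (T w) x)" for k
    by (rule pint_cong_AE[OF Lfun_measurable[OF W1pD(2)[OF W1p_diff(1)[OF TW]]]
        Lfun_measurable[OF Lfun_diff(1)[OF W1pD(2)[OF TW(1)] W1pD(2)[OF TW(2)] p_gt_0]] W1p_diff(2)[OF TW]])
  then show "(\<lambda>k. pint \<mu> p (\<lambda>x. D (T (wk k)) x - D (T w) x)) \<longlonglongrightarrow> 0" using c(2) by simp
qed

lemma G_tendsto:
  assumes wk: "\<And>k. wk k \<in> X" and w: "w \<in> X" and lim: "(\<lambda>k. gnorm (\<lambda>x. wk k x - w x)) \<longlonglongrightarrow> 0"
  shows "(\<lambda>k. pint \<mu> p (\<lambda>x. D (wk k) x - D w x)) \<longlonglongrightarrow> 0" "(\<lambda>k. pint \<mu> p (\<lambda>x. G (wk k) x - G w x)) \<longlonglongrightarrow> 0"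
proof -
  have "(\<lambda>k. gnorm (\<lambda>x. wk k x - w x) powr p) \<longlonglongrightarrow> 0 powr p"
    by (rule tendsto_powr2[OF lim]) (use p_gt_1 in auto)
  moreover have "gnorm (\<lambda>x. wk k x - w x) powr p = pint \<mu> p (\<lambda>x. D (wk k) x - D w x)" for k
    using p_gt_1 by (simp add: gnorm_diff[OF wk w] powr_powr)
  ultimately show 1: "(\<lambda>k. pint \<mu> p (\<lambda>x. D (wk k) x - D w x)) \<longlonglongrightarrow> 0" by simp
  have "pint \<mu> p (\<lambda>x. G (wk k) x - G w x) = pint \<mu> p (\<lambda>x. D (wk k) x - D w x)" for k
  proof (rule pint_cong_AE)
    show "AE x in \<mu>. G (wk k) x - G w x = D (wk k) x - D w x"
      using G_Lfun(2)[OF wk[of k]] G_Lfun(2)[OF w] by eventually_elim simp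
  qed (use Lfun_measurable[OF G_Lfun(1)[OF wk[of k]]] Lfun_measurable[OF G_Lfun(1)[OF w]] Lfun_measurable[OF D_Lfun[OF wk[of k]]]
        Lfun_measurable[OF D_Lfun[OF w]] in \<open>auto intro: borel_measurable_diff\<close>)
  then show "(\<lambda>k. pint \<mu> p (\<lambda>x. G (wk k) x - G w x)) \<longlonglongrightarrow> 0" using 1 by simp
qed

text \<open>Norm convergence gives a.e. convergence only along subsequences, but the limit is always
  A w v, so the subsequence principle applies. Three extractions make G, T and the gradient of T
  converge a.e.; the fluxes and h are bounded in L^(p') and L^(t'), hence converge weakly.\<close>

lemma A_demicontinuous:
  assumes wk: "\<And>k. wk k \<in> X" and w: "w \<in> X" and lim: "(\<lambda>k. gnorm (\<lambda>x. wk k x - w x)) \<longlonglongrightarrow> 0" and v: "v \<in> X"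
  shows "(\<lambda>k. A (wk k) v) \<longlonglongrightarrow> A w v"
proof (rule LIMSEQ_subsequence_principle)
  fix \<rho> :: "nat \<Rightarrow> nat" assume \<rho>: "strict_mono \<rho>"
  note Gl = G_tendsto[OF wk w lim] and Tl = T_tendsto[OF wk w lim]
  have TW: "T (wk k) \<in> W1p \<Omega> p" "T w \<in> W1p \<Omega> p" for k using T_W1p wk w by auto
  note GD = Lfun_diff(1)[OF G_Lfun(1)[OF wk] G_Lfun(1)[OF w] p_gt_0]
  note TD = Lfun_diff(1)[OF W1pD(1)[OF TW(1)] W1pD(1)[OF TW(2)] p_gt_0]
  note DTD = Lfun_diff(1)[OF W1pD(2)[OF TW(1)] W1pD(2)[OF TW(2)] p_gt_0]
  have sub: "\<exists>s::nat\<Rightarrow>nat. strict_mono s \<and> (AE x in \<mu>. (\<lambda>k. F (\<theta> (s k)) x) \<longlonglongrightarrow> F0 x)"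
    if "\<And>k. (\<lambda>x. F k x - F0 x) \<in> Lfun \<mu> p" "(\<lambda>k. pint \<mu> p (\<lambda>x. F k x - F0 x)) \<longlonglongrightarrow> 0" "strict_mono \<theta>"
    for F :: "nat \<Rightarrow> 'a \<Rightarrow> 'c::euclidean_space" and F0 and \<theta> :: "nat \<Rightarrow> nat"
    using Lfun_conv_AE_subseq[of "\<lambda>k. F (\<theta> k)" F0 \<mu> p] that(1) p_gt_0 LIMSEQ_subseq_LIMSEQ[OF that(2,3)]
    by (simp add: o_def)
  have comp: "(\<lambda>k. F (\<theta> (s k)) x) \<longlonglongrightarrow> y" if "(\<lambda>k. F (\<theta> k) x) \<longlonglongrightarrow> y" "strict_mono s"
    for F :: "nat \<Rightarrow> 'a \<Rightarrow> 'c::euclidean_space" and y x and \<theta> s :: "nat \<Rightarrow> nat"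
    using LIMSEQ_subseq_LIMSEQ[OF that] by (simp add: o_def)
  obtain s1 :: "nat \<Rightarrow> nat" where s1: "strict_mono s1" "AE x in \<mu>. (\<lambda>k. G (wk (\<rho> (s1 k))) x) \<longlonglongrightarrow> G w x"
    using sub[OF GD Gl(2) \<rho>] by blast
  have \<rho>1: "strict_mono (\<lambda>k. \<rho> (s1 k))" using \<rho> s1(1) by (simp add: strict_mono_def)
  obtain s2 :: "nat \<Rightarrow> nat" where s2: "strict_mono s2" "AE x in \<mu>. (\<lambda>k. T (wk (\<rho> (s1 (s2 k)))) x) \<longlonglongrightarrow> T w x"
    using sub[OF TD Tl(1) \<rho>1] by blast
  have \<rho>2: "strict_mono (\<lambda>k. \<rho> (s1 (s2 k)))" using \<rho>1 s2(1) by (simp add: strict_mono_def)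
  obtain s3 :: "nat \<Rightarrow> nat" where s3: "strict_mono s3" "AE x in \<mu>. (\<lambda>k. D (T (wk (\<rho> (s1 (s2 (s3 k)))))) x) \<longlonglongrightarrow> D (T w) x"
    using sub[OF DTD Tl(2) \<rho>2] by blast
  define s where "s k = s1 (s2 (s3 k))" for k
  have s: "strict_mono s" using s1(1) s2(1) s3(1) by (simp add: strict_mono_def s_def)
  have s23: "strict_mono (\<lambda>k. s2 (s3 k))" using s2(1) s3(1) by (simp add: strict_mono_def)
  define z where "z k = wk (\<rho> (s k))" for k
  have z: "z k \<in> X" for k by (simp add: z_def wk)
  have cG: "AE x in \<mu>. (\<lambda>k. G (z k) x) \<longlonglongrightarrow> G w x"
    using s1(2) by eventually_elim (use s23 in \<open>simp add: z_def s_def comp[of "\<lambda>k. G (wk k)" "\<lambda>k. \<rho> (s1 k)"]\<close>)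
  have cT: "AE x in \<mu>. (\<lambda>k. T (z k) x) \<longlonglongrightarrow> T w x"
    using s2(2) by eventually_elim (use s3(1) in \<open>simp add: z_def s_def comp[of "\<lambda>k. T (wk k)" "\<lambda>k. \<rho> (s1 (s2 k))"]\<close>)
  have cD: "AE x in \<mu>. (\<lambda>k. D (T (z k)) x) \<longlonglongrightarrow> D (T w) x"
    using s3(2) by (simp add: z_def s_def)
  obtain BG where BG: "\<And>k. pint \<mu> p (G (wk k)) \<le> BG"
    using Lfun_diff_tendsto_imp_bounded[OF p_gt_0 G_Lfun(1)[OF wk] G_Lfun(1)[OF w] Gl(2)] by blast
  obtain BD where BD: "\<And>k. pint \<mu> p (D (wk k)) \<le> BD"
    using Lfun_diff_tendsto_imp_bounded[OF p_gt_0 D_Lfun[OF wk] D_Lfun[OF w] Gl(1)] by blast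
  have "gnorm (z k) \<le> BD powr (1/p)" for k
    unfolding gnorm_def z_def using BD p_gt_1 by (intro powr_mono2) auto
  then obtain Bh where Bh: "\<And>k. pint \<mu> tc (h (z k)) \<le> Bh" using h_bounded z by blast
  note fl = flux_G_Lfun[OF z]
  have flux_conv: "AE x in \<mu>. (\<lambda>k. flux e (G (z k) x)) \<longlonglongrightarrow> flux e (G w x)" if "e > 1" for e
    using cG
  proof eventually_elim
    case (elim x)
    have "continuous_on UNIV (flux e :: 'a \<Rightarrow> 'a)" by (rule continuous_flux[OF that])
    then have "isCont (flux e) (G w x)" by (simp add: continuous_on_eq_continuous_at)
    from isCont_tendsto_compose[OF this elim] show ?case .
  qed
  have m: "(\<lambda>x. flux e (G w x)) \<in> borel_measurable \<mu>" for e
    by (rule borel_measurable_flux[OF Lfun_measurable[OF G_Lfun(1)[OF w]]])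
  have bp: "pint \<mu> p' (\<lambda>x. flux p (G (z k) x)) \<le> BG" for k using fl(2) BG by (simp add: z_def)
  have bq: "pint \<mu> p' (\<lambda>x. flux q (G (z k) x)) \<le> 2 * measure \<mu> (space \<mu>) + BG" for k
    using fl(4)[of k] BG[of "\<rho> (s k)"] unfolding z_def by linarith
  have 1: "(\<lambda>k. neg_div \<Omega> (\<lambda>x. flux p (G (z k) x)) v) \<longlonglongrightarrow> neg_div \<Omega> (\<lambda>x. flux p (G w x)) v"
    unfolding neg_div_def by (rule Lfun_bounded_AE_conv_weak[OF conj_p(1) p_gt_1 fl(1) bp flux_conv[OF p_gt_1] m D_Lfun[OF v]])
  have 2: "(\<lambda>k. neg_div \<Omega> (\<lambda>x. flux q (G (z k) x)) v) \<longlonglongrightarrow> neg_div \<Omega> (\<lambda>x. flux q (G w x)) v"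
    unfolding neg_div_def by (rule Lfun_bounded_AE_conv_weak[OF conj_p(1) p_gt_1 fl(3) bq flux_conv[OF exps(1)] m D_Lfun[OF v]])
  have ch: "AE x in \<mu>. (\<lambda>k. h (z k) x) \<longlonglongrightarrow> h w x"
  proof -
    have "AE x in \<mu>. continuous_on UNIV (\<lambda>(s, \<xi>). f x s \<xi>)" using f by (simp add: caratheodory_def)
    with cT cD show ?thesis
    proof eventually_elim
      case (elim x)
      then have "isCont (\<lambda>(s, \<xi>). f x s \<xi>) (T w x, D (T w) x)" by (simp add: continuous_on_eq_continuous_at)
      from isCont_tendsto_compose[OF this tendsto_Pair[OF elim(1,2)]] show ?case by (simp add: h_def)
    qed
  qed
  have 3: "(\<lambda>k. fun_functional \<Omega> (h (z k)) v) \<longlonglongrightarrow> fun_functional \<Omega> (h w) v"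
    using Lfun_bounded_AE_conv_weak[OF t(4) t(1) h_Lfun(1)[OF z] Bh ch h_measurable[OF w] embedding_Lfun(1)[OF v less_imp_le[OF t(1)] tle(1)]]
    by (simp add: fun_functional_def)
  have "(\<lambda>k. A (z k) v) \<longlonglongrightarrow> A w v" unfolding A_def by (intro tendsto_diff 1 2 3)
  then show "\<exists>s. strict_mono s \<and> (\<lambda>k. A (wk (\<rho> (s k))) v) \<longlonglongrightarrow> A w v" using s unfolding z_def by blast
qed

lemma A_coercive: "\<exists>c>0. \<exists>C. \<forall>w\<in>X. c * gnorm w powr p - C \<le> A w w"
proof -
  define \<kappa> where "\<kappa> = a1 * K1 * S t1 + a2 * K2 * S t2"
  have \<kappa>: "\<kappa> < 1" using small by (simp add: \<kappa>_def t1_def t2_def)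
  \<comment> \<open>The p-flux with its shift and the q-flux lose \<epsilon> each, and f loses
    \<kappa>; the leading coefficient that remains is 1 - 2 \<epsilon> - \<kappa> = 2 \<epsilon>.
    One more \<epsilon> is spent on the linear term.\<close>
  define \<epsilon> where "\<epsilon> = (1 - \<kappa>) / 4"
  have \<epsilon>: "\<epsilon> > 0" using \<kappa> by (simp add: \<epsilon>_def)
  obtain C1 where C1: "C1 \<ge> 0" "\<And>a b :: 'a. norm a powr p - flux p (a + b) \<bullet> a \<le> \<epsilon> * (norm a powr p + norm b powr p) + C1 * norm b powr p"
    using flux_coercive_absorb[OF p_gt_1 \<epsilon>] by blast
  \<comment> \<open>The divisor compensates the constant of \<open>powr_add_le\<close> when the
    power of the sum of the two norms is split.\<close>
  have "\<epsilon> / 2 powr p > 0" using \<epsilon> by simp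
  then obtain C2 where C2: "C2 \<ge> 0" "\<And>s. s \<ge> 0 \<Longrightarrow> s powr q \<le> \<epsilon> / 2 powr p * s powr p + C2"
    using powr_le_small_powr[of q p "\<epsilon> / 2 powr p"] exps by auto
  have qb: "flux q (a + b) \<bullet> a \<le> \<epsilon> * (norm a powr p + norm b powr p) + C2" for a b :: 'a
  proof -
    define s where "s = norm a + norm b"
    have s0: "s \<ge> 0" by (simp add: s_def)
    have "flux q (a + b) \<bullet> a \<le> norm (a + b) powr (q - 1) * norm a"
      using flux_inner_le[of q "a + b" a] by linarith
    also have "\<dots> \<le> s powr (q - 1) * s"
      using exps by (intro mult_mono powr_mono2) (auto simp: s_def norm_triangle_ineq)
    also have "\<dots> = s powr q" using powr_add[of s "q - 1" 1] s0 by (cases "s = 0") auto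
    also have "\<dots> \<le> \<epsilon> / 2 powr p * s powr p + C2" by (rule C2(2)[OF s0])
    also have "\<epsilon> / 2 powr p * s powr p \<le> \<epsilon> / 2 powr p * (2 powr p * (norm a powr p + norm b powr p))"
      using powr_add_le[of "norm a" "norm b" p] p_gt_1 \<epsilon> by (intro mult_left_mono) (auto simp: s_def)
    also have "\<dots> = \<epsilon> * (norm a powr p + norm b powr p)" by simp
    finally show ?thesis by simp
  qed
  define C3 where "C3 = 2 * \<epsilon> + C1"
  have pw: "(1 - 2 * \<epsilon>) * norm a powr p - C3 * norm b powr p - C2 \<le> flux p (a + b) \<bullet> a - flux q (a + b) \<bullet> a" for a b :: 'a
  proof -
    have "(1 - 2 * \<epsilon>) * norm a powr p - C3 * norm b powr p - C2 =
      norm a powr p - (\<epsilon> * (norm a powr p + norm b powr p) + C1 * norm b powr p) - (\<epsilon> * (norm a powr p + norm b powr p) + C2)"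
      by (simp add: C3_def algebra_simps)
    then show ?thesis using C1(2)[of a b] qb[of a b] by linarith
  qed
  define C4 where "C4 = C3 * pint \<mu> p (D u0) + C2 * measure \<mu> (space \<mu>)"
  define C5 where "C5 = pint \<mu> tc \<sigma> powr (1/tc) * S t + a1 * K3 * S t1 + a2 * K3 * S t2"
  have low: "2 * \<epsilon> * gnorm w powr p - C5 * gnorm w - C4 \<le> A w w" if w: "w \<in> X" for w
  proof -
    note fl = flux_G_Lfun[OF w]
    have i0: "integrable \<mu> (\<lambda>x. norm (D w x) powr p)" "integrable \<mu> (\<lambda>x. norm (D u0 x) powr p)"
      using D_Lfun[OF w] W1pD(2)[OF u0] by (auto intro: Lfun_integrable)
    note i = neg_div_bound(1)[OF fl(1) w] neg_div_bound(1)[OF fl(3) w]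
    have "(1 - 2 * \<epsilon>) * gnorm w powr p - C4 = (LINT x|\<mu>. (1 - 2 * \<epsilon>) * norm (D w x) powr p - C3 * norm (D u0 x) powr p - C2)"
      using i0 by (simp add: gnorm_powr pint_def C4_def)
    also have "\<dots> \<le> (LINT x|\<mu>. flux p (G w x) \<bullet> D w x - flux q (G w x) \<bullet> D w x)"
    proof (rule integral_mono_AE)
      show "AE x in \<mu>. (1 - 2 * \<epsilon>) * norm (D w x) powr p - C3 * norm (D u0 x) powr p - C2 \<le> flux p (G w x) \<bullet> D w x - flux q (G w x) \<bullet> D w x"
        using G_Lfun(2)[OF w] by eventually_elim (simp add: pw)
    qed (use i0 i in auto)
    also have "\<dots> = neg_div \<Omega> (\<lambda>x. flux p (G w x)) w - neg_div \<Omega> (\<lambda>x. flux q (G w x)) w"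
      using i by (simp add: neg_div_def)
    finally have b: "(1 - 2 * \<epsilon>) * gnorm w powr p - C4 \<le> A w w + fun_functional \<Omega> (h w) w" by (simp add: A_def)
    have k: "fun_functional \<Omega> (h w) w \<le> \<kappa> * gnorm w powr p + C5 * gnorm w" using h_pairing[OF w] by (simp add: \<kappa>_def C5_def)
    have "1 - 2 * \<epsilon> = 2 * \<epsilon> + \<kappa>" by (simp add: \<epsilon>_def field_simps)
    then have "(1 - 2 * \<epsilon>) * gnorm w powr p = 2 * \<epsilon> * gnorm w powr p + \<kappa> * gnorm w powr p" by (simp only: distrib_right)
    then show ?thesis using b k by linarith
  qed
  \<comment> \<open>The term linear in \<open>gnorm w\<close> is absorbed as a lower power; the
    added 1 keeps the divisor positive.\<close>
  have "\<epsilon> / (\<bar>C5\<bar> + 1) > 0" using \<epsilon> by simp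
  then obtain C6 where C6: "\<And>s. s \<ge> 0 \<Longrightarrow> s powr 1 \<le> \<epsilon> / (\<bar>C5\<bar> + 1) * s powr p + C6"
    using powr_le_small_powr[of 1 p "\<epsilon> / (\<bar>C5\<bar> + 1)"] p_gt_1 by auto
  have "\<epsilon> * gnorm w powr p - ((\<bar>C5\<bar> + 1) * C6 + C4) \<le> A w w" if w: "w \<in> X" for w
  proof -
    have "C5 * gnorm w \<le> (\<bar>C5\<bar> + 1) * gnorm w powr 1" by (simp add: mult_right_mono)
    also have "\<dots> \<le> (\<bar>C5\<bar> + 1) * (\<epsilon> / (\<bar>C5\<bar> + 1) * gnorm w powr p + C6)"
      by (intro mult_left_mono C6) auto
    also have "\<dots> = \<epsilon> * gnorm w powr p + (\<bar>C5\<bar> + 1) * C6" by (simp add: distrib_left)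
    finally show ?thesis using low[OF w] by linarith
  qed
  then show ?thesis using \<epsilon> by blast
qed

text \<open>The tolerance 1 / (n + 1) holds on the first n vectors, so the value at a fixed e i is
  eventually small. A bound on the functionals uniform in n extends this to the closure of these
  vectors, which is all of \<open>X\<close>.\<close>

lemma almost_solutions:
  obtains wn :: "nat \<Rightarrow> 'a \<Rightarrow> real" and R0 where "\<And>n. wn n \<in> X" "\<And>n. gnorm (wn n) \<le> R0"
    "(\<lambda>n. A (wn n) (wn n)) \<longlonglongrightarrow> 0" "\<And>v. v \<in> X \<Longrightarrow> (\<lambda>n. A (wn n) v) \<longlonglongrightarrow> 0"
proof -
  obtain c M where c: "c > 0" and M: "\<And>w. w \<in> X \<Longrightarrow> c * gnorm w powr p - M \<le> A w w" using A_coercive by blast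
  \<comment> \<open>Where A w w \<le> 0, coercivity leaves c times the p-th power of
    \<open>gnorm w\<close> at most M.\<close>
  define R0 where "R0 = (M / c) powr (1/p)"
  have lower: "- M \<le> A w w" if w: "w \<in> X" for w
  proof -
    have "0 \<le> c * gnorm w powr p" using c by simp
    then show ?thesis using M[OF w] by linarith
  qed
  have coercive: "gnorm w \<le> R0" if w: "w \<in> X" and A: "A w w \<le> 0" for w
  proof -
    have "c * gnorm w powr p \<le> M" using M[OF w] A by linarith
    then have "gnorm w powr p \<le> M / c" using c by (simp add: pos_le_divide_eq mult.commute)
    then have "(gnorm w powr p) powr (1/p) \<le> R0" unfolding R0_def using p_gt_1 by (intro powr_mono2) auto
    then show ?thesis using p_gt_1 by (simp add: powr_powr)
  qed
  obtain e :: "nat \<Rightarrow> 'a \<Rightarrow> real" where e: "\<And>i. e i \<in> test_functions \<Omega>"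
    "\<And>u \<epsilon>. u \<in> X \<Longrightarrow> \<epsilon> > 0 \<Longrightarrow> \<exists>i. pint \<mu> p (\<lambda>x. D u x - grad (e i) x) < \<epsilon>"
    using W01p_separable by blast
  have eX: "e i \<in> X" for i by (rule test_function_W01p[OF e(1)])
  have dense: "\<exists>i. gnorm (\<lambda>x. u x - e i x) < \<epsilon>" if u: "u \<in> X" and \<epsilon>: "\<epsilon> > 0" for u \<epsilon>
  proof -
    have "\<epsilon> powr p > 0" using \<epsilon> by simp
    then obtain i where i: "pint \<mu> p (\<lambda>x. D u x - grad (e i) x) < \<epsilon> powr p" using e(2)[OF u] by blast
    have "pint \<mu> p (\<lambda>x. D u x - D (e i) x) = pint \<mu> p (\<lambda>x. D u x - grad (e i) x)"
    proof (rule pint_cong_AE)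
      show "AE x in \<mu>. D u x - D (e i) x = D u x - grad (e i) x"
        using test_function_W1p(2)[OF e(1)[of i]] by eventually_elim simp
    qed (use Lfun_measurable[OF D_Lfun[OF u]] Lfun_measurable[OF D_Lfun[OF eX[of i]]]
        Lfun_measurable[OF test_function_W1p(3)[OF e(1)[of i]]] in \<open>auto intro: borel_measurable_diff\<close>)
    then have "gnorm (\<lambda>x. u x - e i x) < (\<epsilon> powr p) powr (1/p)"
      unfolding gnorm_diff[OF u eX] using i p_gt_1 by (intro powr_less_mono2) auto
    also have "\<dots> = \<epsilon>" using \<epsilon> p_gt_1 by (simp add: powr_powr)
    finally show ?thesis by blast
  qed
  have "\<exists>w. w \<in> X \<and> gnorm w \<le> R0 \<and> \<bar>A w w\<bar> \<le> 1 / real (Suc n) \<and> (\<forall>j<n. \<bar>A w (e j)\<bar> \<le> 1 / real (Suc n))" for n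
    using galerkin_approximation[of A M R0 e "1 / real (Suc n)" n] A_Wm1 A_demicontinuous lower coercive eX
    by auto
  then obtain wn where wn: "\<And>n. wn n \<in> X" "\<And>n. gnorm (wn n) \<le> R0" "\<And>n. \<bar>A (wn n) (wn n)\<bar> \<le> 1 / real (Suc n)"
    "\<And>n j. j < n \<Longrightarrow> \<bar>A (wn n) (e j)\<bar> \<le> 1 / real (Suc n)" by metis
  have lim0: "(\<lambda>n. 1 / real (Suc n)) \<longlonglongrightarrow> 0" using LIMSEQ_inverse_real_of_nat by (simp add: inverse_eq_divide)
  have self: "(\<lambda>n. A (wn n) (wn n)) \<longlonglongrightarrow> 0"
    by (rule Lim_null_comparison[OF always_eventually lim0]) (use wn(3) in simp)
  obtain B where B: "B \<ge> 0" "\<And>n v. v \<in> X \<Longrightarrow> \<bar>A (wn n) v\<bar> \<le> B * gnorm v" using A_bounded[of R0] wn(1,2) by blast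
  have "(\<lambda>n. A (wn n) v) \<longlonglongrightarrow> 0" if v: "v \<in> X" for v
  proof (rule LIMSEQ_I)
    fix \<epsilon> :: real assume \<epsilon>: "\<epsilon> > 0"
    then have "\<epsilon> / (2 * (B + 1)) > 0" using B(1) by simp
    then obtain i where i: "gnorm (\<lambda>x. v x - e i x) < \<epsilon> / (2 * (B + 1))" using dense[OF v] by blast
    have "B * gnorm (\<lambda>x. v x - e i x) \<le> (B + 1) * (\<epsilon> / (2 * (B + 1)))" using i B(1) by (intro mult_mono) auto
    also have "\<dots> = \<epsilon> / 2" using B(1) by (simp add: field_simps)
    finally have half: "B * gnorm (\<lambda>x. v x - e i x) \<le> \<epsilon> / 2" .
    have "\<epsilon> / 2 > 0" using \<epsilon> by simp
    then obtain N where N: "\<And>n. n \<ge> N \<Longrightarrow> norm (1 / real (Suc n) - 0) < \<epsilon> / 2" using LIMSEQ_D[OF lim0] by blast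
    have "norm (A (wn n) v - 0) < \<epsilon>" if n: "n \<ge> max N (Suc i)" for n
    proof -
      have "A (wn n) (\<lambda>x. v x - e i x) = A (wn n) v - A (wn n) (e i)" by (rule functional_diff[OF A_Wm1[OF wn(1)] v eX])
      moreover have "\<bar>A (wn n) (\<lambda>x. v x - e i x)\<bar> \<le> \<epsilon> / 2" using B(2)[OF W01p_diff[OF v eX]] half order_trans by blast
      moreover have "\<bar>A (wn n) (e i)\<bar> < \<epsilon> / 2" using wn(4)[of i n] N[of n] n by auto
      ultimately show ?thesis unfolding real_norm_def by linarith
    qed
    then show "\<exists>N. \<forall>n\<ge>N. norm (A (wn n) v - 0) < \<epsilon>" by blast
  qed
  then show ?thesis using that wn(1,2) self by blast
qed

theorem strong_generalized_solution:
  "\<exists>w\<in>X. \<exists>wn. (\<forall>n. wn n \<in> X) \<and> weakly_converges X (W01p_norm \<Omega> p) wn w \<and>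
     weakly_converges (Wm1 \<Omega> p) (Wm1_norm \<Omega> p) (\<lambda>n. A (wn n)) (\<lambda>v. 0) \<and>
     (\<lambda>n. neg_div \<Omega> (\<lambda>x. flux p (G (wn n) x) - flux q (G (wn n) x)) (\<lambda>x. wn n x - w x)) \<longlonglongrightarrow> 0"
proof -
  obtain un :: "nat \<Rightarrow> 'a \<Rightarrow> real" and R0 where un: "\<And>n. un n \<in> X" "\<And>n. gnorm (un n) \<le> R0"
    "(\<lambda>n. A (un n) (un n)) \<longlonglongrightarrow> 0" "\<And>v. v \<in> X \<Longrightarrow> (\<lambda>n. A (un n) v) \<longlonglongrightarrow> 0"
    using almost_solutions by blast
  obtain \<rho> :: "nat \<Rightarrow> nat" and w where \<rho>: "strict_mono \<rho>" and w: "w \<in> X"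
    and lim: "\<And>l. l \<in> Wm1 \<Omega> p \<Longrightarrow> (\<lambda>n. l (un (\<rho> n))) \<longlonglongrightarrow> l w"
    using weak_compactness[of un, OF un(1,2)] by blast
  define wn where "wn n = un (\<rho> n)" for n
  have wn: "wn n \<in> X" "gnorm (wn n) \<le> R0" for n by (simp_all add: wn_def un)
  have As: "(\<lambda>n. A (wn n) (wn n)) \<longlonglongrightarrow> 0" using LIMSEQ_subseq_LIMSEQ[OF un(3) \<rho>] by (simp add: o_def wn_def)
  have Av: "(\<lambda>n. A (wn n) v) \<longlonglongrightarrow> 0" if "v \<in> X" for v
    using LIMSEQ_subseq_LIMSEQ[OF un(4)[OF that] \<rho>] by (simp add: o_def wn_def)
  have a: "weakly_converges X (W01p_norm \<Omega> p) wn w"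
    unfolding weakly_converges_def using wn(1) w lim by (simp add: wn_def)
  have b: "weakly_converges (Wm1 \<Omega> p) (Wm1_norm \<Omega> p) (\<lambda>n. A (wn n)) (\<lambda>v. 0)"
    unfolding weakly_converges_def
  proof (intro conjI allI ballI)
    show "A (wn n) \<in> Wm1 \<Omega> p" for n by (rule A_Wm1[OF wn(1)])
    show z: "(\<lambda>v. 0) \<in> Wm1 \<Omega> p" unfolding dual_space_def by (auto intro: exI[of _ 0])
    fix g assume "g \<in> dual_space (Wm1 \<Omega> p) (Wm1_norm \<Omega> p)"
    \<comment> \<open>An element of the bidual is evaluation at some v, so weak convergence in the
      dual is convergence at each v.\<close>
    then obtain v where v: "v \<in> X" "\<And>l. l \<in> Wm1 \<Omega> p \<Longrightarrow> g l = l v" using W01p_reflexive by blast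
    show "(\<lambda>n. g (A (wn n))) \<longlonglongrightarrow> g (\<lambda>v. 0)"
      using Av[OF v(1)] v(2)[OF A_Wm1[OF wn(1)]] v(2)[OF z] by simp
  qed
  define v where "v n = (\<lambda>x. wn n x - w x)" for n
  have v: "v n \<in> X" for n unfolding v_def by (rule W01p_diff[OF wn(1) w])
  have gv: "gnorm (v n) \<le> (2 powr p * (R0 powr p + gnorm w powr p)) powr (1/p)" for n
  proof -
    have "pint \<mu> p (D (wn n)) \<le> R0 powr p" unfolding gnorm_powr[symmetric] using wn(2) p_gt_1 by (intro powr_mono2) auto
    then have "2 powr p * (pint \<mu> p (D (wn n)) + pint \<mu> p (D w)) \<le> 2 powr p * (R0 powr p + gnorm w powr p)"
      by (intro mult_left_mono add_mono) (auto simp: gnorm_powr)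
    then have "pint \<mu> p (\<lambda>x. D (wn n) x - D w x) \<le> 2 powr p * (R0 powr p + gnorm w powr p)"
      by (rule order_trans[OF Lfun_diff(2)[OF D_Lfun[OF wn(1)] D_Lfun[OF w] p_gt_0]])
    then show ?thesis unfolding v_def gnorm_diff[OF wn(1) w] using p_gt_1 by (intro powr_mono2) auto
  qed
  have lv: "(\<lambda>n. l (v n)) \<longlonglongrightarrow> 0" if l: "l \<in> Wm1 \<Omega> p" for l
    using LIM_zero[OF lim[OF l]] by (simp add: v_def functional_diff[OF l wn(1) w] wn_def[symmetric])
  have rel: "(\<lambda>n. pint \<mu> t (v n)) \<longlonglongrightarrow> 0" by (rule rellich[of v, OF v gv lv less_imp_le[OF t(1)] t(2)])
  obtain Bh where Bh: "\<And>n. pint \<mu> tc (h (wn n)) \<le> Bh" using h_bounded[of R0] wn by blast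
  have hv: "(\<lambda>n. fun_functional \<Omega> (h (wn n)) (v n)) \<longlonglongrightarrow> 0"
  proof (rule Lim_null_comparison)
    have "(\<lambda>n. Bh powr (1/tc) * pint \<mu> t (v n) powr (1/t)) \<longlonglongrightarrow> Bh powr (1/tc) * 0 powr (1/t)"
      by (intro tendsto_mult_left tendsto_powr2 rel) (use t in auto)
    then show "(\<lambda>n. Bh powr (1/tc) * pint \<mu> t (v n) powr (1/t)) \<longlonglongrightarrow> 0" by simp
    have "norm (fun_functional \<Omega> (h (wn n)) (v n)) \<le> Bh powr (1/tc) * pint \<mu> t (v n) powr (1/t)" for n
    proof -
      have "\<bar>fun_functional \<Omega> (h (wn n)) (v n)\<bar> \<le> pint \<mu> tc (h (wn n)) powr (1/tc) * pint \<mu> t (v n) powr (1/t)"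
        using holder_inner(2)[OF t(3) t(5) h_Lfun(1)[OF wn(1)] embedding_Lfun(1)[OF v less_imp_le[OF t(1)] tle(1)]]
        by (simp add: fun_functional_def)
      also have "\<dots> \<le> Bh powr (1/tc) * pint \<mu> t (v n) powr (1/t)"
        using Bh t by (intro mult_right_mono powr_mono2) auto
      finally show ?thesis by simp
    qed
    then show "eventually (\<lambda>n. norm (fun_functional \<Omega> (h (wn n)) (v n)) \<le> Bh powr (1/tc) * pint \<mu> t (v n) powr (1/t)) sequentially" by simp
  qed
  \<comment> \<open>The functional is split over wn - w, so that the limits at wn and at the fixed
    w, both given by the Galerkin construction, apply separately.\<close>
  have "neg_div \<Omega> (\<lambda>x. flux p (G (wn n) x) - flux q (G (wn n) x)) (v n) =
      (A (wn n) (wn n) - A (wn n) w) + fun_functional \<Omega> (h (wn n)) (v n)" for n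
  proof -
    note fl = flux_G_Lfun[OF wn(1)[of n]]
    have "neg_div \<Omega> (\<lambda>x. flux p (G (wn n) x) - flux q (G (wn n) x)) (v n) =
        neg_div \<Omega> (\<lambda>x. flux p (G (wn n) x)) (v n) - neg_div \<Omega> (\<lambda>x. flux q (G (wn n) x)) (v n)"
      using neg_div_bound(1)[OF fl(1) v[of n]] neg_div_bound(1)[OF fl(3) v[of n]] by (simp add: neg_div_def inner_diff_left)
    also have "\<dots> = A (wn n) (v n) + fun_functional \<Omega> (h (wn n)) (v n)" by (simp add: A_def)
    also have "A (wn n) (v n) = A (wn n) (wn n) - A (wn n) w"
      unfolding v_def by (rule functional_diff[OF A_Wm1[OF wn(1)] wn(1) w])
    finally show ?thesis .
  qed
  moreover have "(\<lambda>n. (A (wn n) (wn n) - A (wn n) w) + fun_functional \<Omega> (h (wn n)) (v n)) \<longlonglongrightarrow> (0 - 0) + 0"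
    by (intro tendsto_intros As Av[OF w] hv)
  ultimately have c: "(\<lambda>n. neg_div \<Omega> (\<lambda>x. flux p (G (wn n) x) - flux q (G (wn n) x)) (\<lambda>x. wn n x - w x)) \<longlonglongrightarrow> 0"
    by (simp add: v_def)
  show ?thesis using w wn(1) a b c by blast
qed

end

theorem corollary1:
  fixes \<Omega> :: "(real ^ 'n) set"
    and p q pstar a1 a2 \<alpha> \<beta> r K1 K2 K3 :: real
    and S :: "real \<Rightarrow> real"
    and T :: "(real ^ 'n \<Rightarrow> real) \<Rightarrow> (real ^ 'n \<Rightarrow> real)"
    and f :: "real ^ 'n \<Rightarrow> real \<Rightarrow> real ^ 'n \<Rightarrow> real"
    and u0 \<sigma> :: "real ^ 'n \<Rightarrow> real"
  assumes dom: "bounded_lipschitz_domain \<Omega>"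
    and exps: "1 < q" "q < p" "p < real CARD('n)"
    and pstar: "pstar = real CARD('n) * p / (real CARD('n) - p)"
    and sobolev: "\<And>t. 1 \<le> t \<Longrightarrow> t \<le> pstar \<Longrightarrow>
          0 < S t \<and> (\<forall>u\<in>W01p \<Omega> p. eLp_norm \<Omega> t u \<le> ennreal (S t * Lp_norm \<Omega> p (weak_grad \<Omega> u)))"
    and T: "continuous_map_nrm (W01p \<Omega> p) (W01p_norm \<Omega> p) (W1p \<Omega> p) (W1p_norm \<Omega> p) T"
    and f: "caratheodory \<Omega> f"
    and u0: "u0 \<in> W1p \<Omega> p"
    and a: "0 \<le> a1" "0 \<le> a2"
    and \<alpha>: "0 < \<alpha>" "\<alpha> < pstar - 1"
    and \<beta>: "0 < \<beta>" "\<beta> < p / conj_exp pstar"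
    and r: "1 \<le> r" "r < pstar"
    and \<sigma>: "if r = 1 then \<sigma> \<in> Linf \<Omega> else \<sigma> \<in> Lp \<Omega> (conj_exp r)"
    and growth: "AE x in lebesgue_on \<Omega>. \<forall>s \<xi>.
          \<bar>f x s \<xi>\<bar> \<le> \<sigma> x + a1 * \<bar>s\<bar> powr \<alpha> + a2 * norm \<xi> powr \<beta>"
    and K: "0 \<le> K1" "0 \<le> K2" "0 \<le> K3"
    and small: "a1 * K1 * S (pstar / (pstar - \<alpha>)) + a2 * K2 * S (p / (p - \<beta>)) < 1"
    and T_bound: "\<And>u. u \<in> W01p \<Omega> p \<Longrightarrow>
          enn_powr (eLp_norm \<Omega> pstar (T u)) \<alpha>
            \<le> ennreal (K1 * Lp_norm \<Omega> p (weak_grad \<Omega> u) powr (p - 1) + K3)"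
    and grad_T_bound: "\<And>u. u \<in> W01p \<Omega> p \<Longrightarrow>
          Lp_norm \<Omega> p (weak_grad \<Omega> (T u)) powr \<beta>
            \<le> K2 * Lp_norm \<Omega> p (weak_grad \<Omega> u) powr (p - 1) + K3"
  shows "\<exists>w\<in>W01p \<Omega> p. \<exists>wn :: nat \<Rightarrow> real ^ 'n \<Rightarrow> real.
      (\<forall>n. wn n \<in> W01p \<Omega> p) \<and>
      weakly_converges (W01p \<Omega> p) (W01p_norm \<Omega> p) wn w \<and>
      weakly_converges (Wm1 \<Omega> p) (Wm1_norm \<Omega> p)
        (\<lambda>n v. neg_div \<Omega> (\<lambda>x. flux p (weak_grad \<Omega> (\<lambda>y. wn n y + u0 y) x)) v
             - neg_div \<Omega> (\<lambda>x. flux q (weak_grad \<Omega> (\<lambda>y. wn n y + u0 y) x)) v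
             - fun_functional \<Omega> (\<lambda>x. f x (T (wn n) x) (weak_grad \<Omega> (T (wn n)) x)) v)
        (\<lambda>v. 0) \<and>
      (\<lambda>n. neg_div \<Omega> (\<lambda>x. flux p (weak_grad \<Omega> (\<lambda>y. wn n y + u0 y) x)
                        - flux q (weak_grad \<Omega> (\<lambda>y. wn n y + u0 y) x))
             (\<lambda>x. wn n x - w x)) \<longlonglongrightarrow> 0"
proof -
  have o: "open \<Omega>" and b: "bounded \<Omega>" using dom by (simp_all add: bounded_lipschitz_domain_def)
  have p1: "1 < p" using exps by simp
  have "p * (real CARD('n) - p) < real CARD('n) * p" using p1 by (simp add: algebra_simps)
  then have ps: "p < pstar" unfolding pstar using exps by (simp add: pos_less_divide_eq)
  interpret Q: quasilinear_problem \<Omega> p pstar S q a1 a2 \<alpha> \<beta> r K1 K2 K3 T f u0 \<sigma>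
    by unfold_locales (fact o b p1 ps assms)+
  show ?thesis
    using Q.strong_generalized_solution unfolding Q.A_def[abs_def] Q.G_def Q.h_def[abs_def] .
qed

end
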